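(* Let $d\in\{-4,8\}$ and $d_0=d/4$. Let $r_1,r_2\in\{1,9\}$ and, in case $d=8$, suppose $r_1r_2\equiv 1\pmod{16}$. Let $s_1,s_2\in\{\pm1\}$ with $s_1s_2=1$. For primes $p,q\equiv1\pmod 8$ let $\varepsilon(p,q)$ and $\chi_2$ be as in the context. Then, as $X\to\infty$, $$\#\Big\{(p,q):\ p<q \text{ primes},\ pq\le X,\ p\equiv r_1,\ q\equiv r_2 \ (\mathrm{mod}\ 16),\ \chi_2(p)=s_1,\ \chi_2(q)=s_2,\ p\equiv\square \ (\mathrm{mod}\ q),\ \varepsilon(p,q)=1\Big\}\sim \frac{1}{1024}\,\frac{X\log\log X}{\log X}.$$
   Context: Let $R=\mathbb{Z}[\sqrt{d_0}]$ (a principal ideal domain) with conjugation $a\mapsto\bar a$ and norm $\mathrm{N}$. For a prime ideal $\mathfrak p\nmid 2$ of $R$ and $a\in R$, $\left(\frac{a}{\mathfrak p}\right)$ is $0$ if $a\in\mathfrak p$, else $\pm1$ according as $a$ is or is not a square mod $\mathfrak p$; for an ideal $\mathfrak a$ coprime to $2$, $\left(\frac{a}{\mathfrak a}\right)=\prod\left(\frac{a}{\mathfrak p}\right)$ over the prime factors of $\mathfrak a$ with multiplicity. Let $t=1+i$ if $d=-4$ and $t=\sqrt2$ if $d=8$, and for a prime $p\equiv 1\pmod 8$ let $\chi_2(p)=\left(\frac{t}{\mathfrak p}\right)$ where $\mathfrak p$ is any prime ideal of $R$ above $p$ (this does not depend on the choice). For primes $p,q\equiv1\pmod 8$, fix prime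 elements $w,z\in R$ with $\mathrm{N}(w)=p$, $\mathrm{N}(z)=q$, each congruent to a square modulo $4R$, set $\alpha=wz$ and $\varepsilon(p,q)=\left(\frac{\bar\alpha}{(w)}\right)$. "$p\equiv\square \pmod q$" means $p$ is a quadratic residue modulo $q$. *)

theory Defs
  imports
    "HOL-Number_Theory.Number_Theory"
    "HOL-Algebra.Ring_Divisibility"
    "HOL-Algebra.Ideal_Product"
    "HOL-Library.Landau_Symbols"
    Complex_Main
begin

hide_const (open) Divisibility.prime

text \<open>\<open>QInt a b\<close> stands for $a + b\sqrt{d_0}$; the value of $d_0$ enters only through the
  multiplication of the ring \<open>zsqrt d0\<close>. The lemmas \<open>quad_embed_ring_hom\<close> and
  \<open>inj_quad_embed\<close> below identify this ring with the subring of the complex numbers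
  generated by $\sqrt{d_0}$.\<close>

datatype quad_int = QInt (rat_part: int) (irr_part: int)

definition zsqrt :: "int \<Rightarrow> quad_int ring" where
  "zsqrt d0 =
    \<lparr> carrier = UNIV,
      mult = (\<lambda>x y. QInt (rat_part x * rat_part y + d0 * irr_part x * irr_part y)
                         (rat_part x * irr_part y + irr_part x * rat_part y)),
      one = QInt 1 0,
      zero = QInt 0 0,
      add = (\<lambda>x y. QInt (rat_part x + rat_part y) (irr_part x + irr_part y)) \<rparr>"

definition quad_conj :: "quad_int \<Rightarrow> quad_int" where
  "quad_conj x = QInt (rat_part x) (- irr_part x)"

definition quad_norm :: "int \<Rightarrow> quad_int \<Rightarrow> int" where
  "quad_norm d0 x = (rat_part x)\<^sup>2 - d0 * (irr_part x)\<^sup>2"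

definition quad_embed :: "int \<Rightarrow> quad_int \<Rightarrow> complex" where
  "quad_embed d0 x = of_int (rat_part x) + of_int (irr_part x) * csqrt (of_int d0)"

definition square_mod_ideal :: "('a, 'b) ring_scheme \<Rightarrow> 'a set \<Rightarrow> 'a \<Rightarrow> bool" where
  "square_mod_ideal R I a \<longleftrightarrow> (\<exists>s \<in> carrier R. a \<ominus>\<^bsub>R\<^esub> (s \<otimes>\<^bsub>R\<^esub> s) \<in> I)"

text \<open>The two symbols are meant for ideals coprime to \<open>2\<close> only.\<close>

definition prime_ideal_symbol :: "('a, 'b) ring_scheme \<Rightarrow> 'a \<Rightarrow> 'a set \<Rightarrow> int" where
  "prime_ideal_symbol R a P =
     (if a \<in> P then 0 else if square_mod_ideal R P a then 1 else - 1)"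

text \<open>The list \<open>Ps\<close> is a factorization of \<open>I\<close> into prime ideals; it is unique up to order
  for nonzero ideals of a principal ideal domain.\<close>

definition ideal_symbol :: "('a, 'b) ring_scheme \<Rightarrow> 'a \<Rightarrow> 'a set \<Rightarrow> int" where
  "ideal_symbol R a I =
     prod_list (map (prime_ideal_symbol R a)
       (SOME Ps. (\<forall>P \<in> set Ps. primeideal P R) \<and>
                 foldr (ideal_prod R) Ps (carrier R) = I))"

definition lies_above :: "int \<Rightarrow> quad_int set \<Rightarrow> nat \<Rightarrow> bool" where
  "lies_above d0 P p \<longleftrightarrow> primeideal P (zsqrt d0) \<and> {n. QInt n 0 \<in> P} = {n. int p dvd n}"

text \<open>The element $t$: $1 + i$ for $d = -4$, and $\sqrt{2}$ for $d = 8$.\<close>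

definition t_elem :: "int \<Rightarrow> quad_int" where
  "t_elem d = (if d = - 4 then QInt 1 1 else QInt 0 1)"

definition chi2 :: "int \<Rightarrow> nat \<Rightarrow> int" where
  "chi2 d p =
     prime_ideal_symbol (zsqrt (d div 4)) (t_elem d) (SOME P. lies_above (d div 4) P p)"

definition primary_prime_elem :: "int \<Rightarrow> nat \<Rightarrow> quad_int \<Rightarrow> bool" where
  "primary_prime_elem d0 p w \<longleftrightarrow>
     w \<in> carrier (zsqrt d0) \<and> ring_prime\<^bsub>zsqrt d0\<^esub> w \<and> quad_norm d0 w = int p \<and>
     square_mod_ideal (zsqrt d0) (PIdl\<^bsub>zsqrt d0\<^esub> (QInt 4 0)) w"

definition eps_symbol :: "int \<Rightarrow> quad_int \<Rightarrow> quad_int \<Rightarrow> int" where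
  "eps_symbol d0 w z =
     (let \<alpha> = w \<otimes>\<^bsub>zsqrt d0\<^esub> z
      in ideal_symbol (zsqrt d0) (quad_conj \<alpha>) (PIdl\<^bsub>zsqrt d0\<^esub> w))"

lemma zsqrt_cring: "cring (zsqrt d0)"
proof (rule cringI)
  show "abelian_group (zsqrt d0)"
  proof (rule abelian_groupI)
    fix x assume "x \<in> carrier (zsqrt d0)"
    show "\<exists>y\<in>carrier (zsqrt d0). y \<oplus>\<^bsub>zsqrt d0\<^esub> x = \<zero>\<^bsub>zsqrt d0\<^esub>"
      by (rule bexI[of _ "QInt (- rat_part x) (- irr_part x)"]) (simp_all add: zsqrt_def)
  qed (simp_all add: zsqrt_def)
  show "Group.comm_monoid (zsqrt d0)"
    by (rule comm_monoidI) (simp_all add: zsqrt_def algebra_simps)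
qed (simp_all add: zsqrt_def algebra_simps)

lemma quad_embed_ring_hom:
  "quad_embed d0 (x \<oplus>\<^bsub>zsqrt d0\<^esub> y) = quad_embed d0 x + quad_embed d0 y"
  "quad_embed d0 (x \<otimes>\<^bsub>zsqrt d0\<^esub> y) = quad_embed d0 x * quad_embed d0 y"
  "quad_embed d0 (\<one>\<^bsub>zsqrt d0\<^esub>) = 1"
proof -
  have s: "csqrt (of_int d0) * csqrt (of_int d0) = of_int d0"
    by (metis power2_csqrt power2_eq_square)
  have "(a + b * c) * (a' + b' * c) = (a * a' + c * c * b * b') + (a * b' + b * a') * c"
    for a b c a' b' :: complex
    by (simp add: algebra_simps)
  from this[where c = "csqrt (of_int d0)"]
  show "quad_embed d0 (x \<otimes>\<^bsub>zsqrt d0\<^esub> y) = quad_embed d0 x * quad_embed d0 y"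
    by (simp add: quad_embed_def zsqrt_def s)
qed (simp_all add: quad_embed_def zsqrt_def algebra_simps)

lemma inj_quad_embed:
  assumes "\<not> (\<exists>k. d0 = k\<^sup>2)"
  shows "inj (quad_embed d0)"
proof (rule injI)
  fix x y assume eq: "quad_embed d0 x = quad_embed d0 y"
  define a where "a = rat_part x - rat_part y"
  define b where "b = irr_part y - irr_part x"
  have "of_int a = of_int b * csqrt (of_int d0)"
    using eq by (simp add: quad_embed_def a_def b_def algebra_simps)
  then have "(of_int a)\<^sup>2 = (of_int b)\<^sup>2 * (of_int d0 :: complex)"
    by (simp add: power_mult_distrib)
  then have "(of_int (a\<^sup>2) :: complex) = of_int (b\<^sup>2 * d0)"
    by simp
  then have ab: "a\<^sup>2 = b\<^sup>2 * d0"
    by (simp only: of_int_eq_iff)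
  have "b = 0"
  proof (rule ccontr)
    assume "b \<noteq> 0"
    from ab have "b\<^sup>2 dvd a\<^sup>2" by simp
    then have "b dvd a" by simp
    then obtain k where "a = b * k" ..
    with ab \<open>b \<noteq> 0\<close> have "d0 = k\<^sup>2" by (simp add: power_mult_distrib)
    with assms show False by blast
  qed
  with ab have "a = 0" by simp
  with \<open>b = 0\<close> show "x = y"
    by (simp add: a_def b_def quad_int.expand)
qed

end

theory Submission
  imports
    Defs
    "HOL-Complex_Analysis.Complex_Analysis"
    "HOL-Real_Asymp.Real_Asymp"
begin

text \<open>Fix $p$ and a root $r$ of $r^2 \equiv d_0$ modulo $p$, and write $q = c^2 - d_0 e^2$. If $q$ is a square modulo $p$,
  then $\varepsilon(p,q) = \kappa_p \left(\frac{c + er}{p}\right)$ with a sign $\kappa_p$ depending on $p$ only. As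
  $\left(\frac{c + er}{p}\right)\left(\frac{c - er}{p}\right) = \left(\frac{q}{p}\right)$, the last two conditions on $(p,q)$
  have the indicator function
  $\frac14\left(1 + \left(\frac{q}{p}\right) + \kappa_p\left(\frac{c + er}{p}\right) + \kappa_p\left(\frac{c - er}{p}\right)\right)$.
  For $(\log X)^4 < p \le \exp(\log X / \log\log X)$ the three nonconstant terms cancel: by the Cauchy--Schwarz inequality the sum
  over prime norms $q$ is bounded by one over all lattice points $(c, e)$, where products of symbols to distinct
  moduli $p$, $p'$ have mean zero. All other $p$ contribute a smaller order of magnitude.

  The conditions on $p$ modulo $16$ and on $\chi_2(p)$ say that the Gaussian primes above $p$ lie in prescribed classes
  of a ray class group of order eight. Nonvanishing of its eight $L$-functions on $\mathrm{Re}\, s = 1$ and the Wiener--Ikehara theorem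
  give these $p$ the density $\frac1{16}$ among the integers weighted by $\log p$, and likewise for $q$. Hence the count is asymptotic to
  $\frac14 \cdot \frac1{16} \sum_p \frac{X}{p \log X} \sim \frac14 \cdot \frac1{16^2} \cdot \frac{X \log\log X}{\log X}$.\<close>

section \<open>Dirichlet series\<close>

text \<open>For a single p, counting primes q by conditions modulo p would require prime number
  theorems uniform in p. Averaging over p avoids this: after Cauchy--Schwarz the primality of q is
  dropped by positivity, and what remains are sums over c of symbols to two moduli, bounded by one
  period pp'. The price is a term with the factor y^4 sqrt X, harmless since y is smaller than every
  power of X, and a diagonal of size X^2 (ln y)/L, which a power of ln X in L defeats. To have all
  symbols to the modulus p, reciprocity turns "p is a square modulo q" into a condition on q modulo
  p.

  The form c^2 - 2 e^2 is indefinite, so its points of bounded norm are infinitely many. Each q gets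
  a reduced representative with e^2 <= q, reached through squares of units, which no symbol sees.

  For d = 8 the symbol of sqrt 2 is rewritten through 1 + i and p modulo 16. Hence eight characters
  of the Gaussian integers supply all densities, for both values of d, and no L-function whose
  conductor depends on p occurs.\<close>

definition dpow :: "complex \<Rightarrow> nat \<Rightarrow> complex" where
  "dpow s n = exp (- (s * of_real (ln (real n))))"

text \<open>The power x^{-s} at a real argument, so that neighbouring integers can be compared
  through the points between them.\<close>

definition rpw :: "complex \<Rightarrow> real \<Rightarrow> complex" where
  "rpw s x = exp (- (s * of_real (ln x)))"

lemma dpow_rpw: "dpow s n = rpw s (real n)"
  by (simp add: dpow_def rpw_def)

lemma norm_rpw: "x > 0 \<Longrightarrow> norm (rpw s x) = x powr (- Re s)"
  by (simp add: rpw_def powr_def)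

lemma norm_dpow: "n > 0 \<Longrightarrow> norm (dpow s n) = real n powr (- Re s)"
  by (simp add: dpow_rpw norm_rpw)

lemma dpow_1 [simp]: "dpow s (Suc 0) = 1"
  by (simp add: dpow_def)

lemma dpow_mult: "m > 0 \<Longrightarrow> n > 0 \<Longrightarrow> dpow s (m * n) = dpow s m * dpow s n"
  by (simp add: dpow_def ln_mult ring_distribs exp_add[symmetric])

lemma dpow_add: "dpow (s + t) n = dpow s n * dpow t n"
  by (simp add: dpow_def ring_distribs exp_add[symmetric])

lemma has_field_derivative_dpow [derivative_intros]:
  "((\<lambda>s. dpow s n) has_field_derivative (- of_real (ln (real n)) * dpow s n)) (at s within S)"
  unfolding dpow_def by (auto intro!: derivative_eq_intros)

lemma holomorphic_dpow [holomorphic_intros]: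
  "f holomorphic_on S \<Longrightarrow> (\<lambda>s. dpow (f s) n) holomorphic_on S"
  unfolding dpow_def by (intro holomorphic_intros)

text \<open>In the variable ln x the power is an exponential, whose derivative on the segment from
  ln x to ln y has norm at most |s| x^{-Re s}; the mean value inequality gives the bound.\<close>

lemma rpw_diff_bound:
  assumes "0 < x" "x \<le> y" "Re s \<ge> 0"
  shows "norm (rpw s x - rpw s y) \<le> norm s * x powr (- Re s) * (ln y - ln x)"
proof -
  define S where "S = closed_segment (complex_of_real (ln x)) (complex_of_real (ln y))"
  have xy: "ln x \<le> ln y" using assms by simp
  have inS: "\<exists>u. z = of_real u \<and> ln x \<le> u \<and> u \<le> ln y" if zS: "z \<in> S" for z
  proof -
    from zS obtain u where "z = of_real u" "u \<in> closed_segment (ln x) (ln y)"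
      unfolding S_def closed_segment_of_real by auto
    thus ?thesis using xy by (auto simp: closed_segment_eq_real_ivl)
  qed
  have "norm ((\<lambda>z. exp (- (s * z))) (of_real (ln x)) - (\<lambda>z. exp (- (s * z))) (of_real (ln y)))
        \<le> (norm s * x powr (- Re s)) * norm (complex_of_real (ln x) - of_real (ln y))"
  proof (rule field_differentiable_bound[where S = S and f' = "\<lambda>z. - s * exp (- (s * z))"])
    show "convex S" by (simp add: S_def)
    show "((\<lambda>z. exp (- (s * z))) has_field_derivative - s * exp (- (s * z))) (at z within S)" for z
      by (auto intro!: derivative_eq_intros)
    show "norm (- s * exp (- (s * z))) \<le> norm s * x powr (- Re s)" if "z \<in> S" for z
    proof -
      from inS[OF that] obtain u where u: "z = of_real u" "ln x \<le> u" by auto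
      have "norm (exp (- (s * z))) = exp (- (Re s * u))" using u by simp
      also have "... \<le> exp (- (Re s * ln x))" using u(2) assms(3) by (simp add: mult_left_mono)
      also have "... = x powr (- Re s)" using assms(1) by (simp add: powr_def)
      finally show ?thesis by (simp add: norm_mult mult_left_mono)
    qed
  qed (auto simp: S_def)
  also have "norm (complex_of_real (ln x) - of_real (ln y)) = ln y - ln x"
    using xy by (simp flip: of_real_diff)
  finally show ?thesis by (simp add: rpw_def)
qed

lemma ln_Suc_diff_le:
  assumes "n > 0"
  shows "ln (real (Suc n)) - ln (real n) \<le> 1 / real n"
proof -
  have "ln (real (Suc n)) - ln (real n) = ln (1 + 1 / real n)"
    using assms by (subst ln_divide_pos[symmetric]) (auto simp: add_divide_distrib add.commute)
  also have "... \<le> 1 / real n" by (rule ln_add_one_self_le_self) simp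
  finally show ?thesis .
qed

lemma dpow_diff_bound:
  assumes "n > 0" "Re s \<ge> 0"
  shows "norm (dpow s n - dpow s (Suc n)) \<le> norm s * real n powr (- Re s - 1)"
proof -
  have "norm (dpow s n - dpow s (Suc n))
      \<le> norm s * real n powr (- Re s) * (ln (real (Suc n)) - ln (real n))"
    unfolding dpow_rpw using assms by (intro rpw_diff_bound) auto
  also have "... \<le> norm s * real n powr (- Re s) * (1 / real n)"
    using assms by (intro mult_left_mono ln_Suc_diff_le) auto
  also have "... = norm s * real n powr (- Re s - 1)"
    using assms by (simp add: powr_diff)
  finally show ?thesis .
qed

text \<open>Euler--Maclaurin remainders: their sum over \<open>n\<close> is $(s - 1)\zeta(s) - 1$.\<close>

definition zterm :: "complex \<Rightarrow> nat \<Rightarrow> complex" where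
  "zterm s n = (if n = 0 then 0 else (s - 1) * dpow s n - dpow (s - 1) n + dpow (s - 1) (Suc n))"

text \<open>The term is the increment over [n, n+1] of h(z) = (s-1) n^{-s} z + z^{1-s}. Its
  derivative (s-1)(n^{-s} - z^{-s}) is small by \<open>rpw_diff_bound\<close>, because ln z - ln n
  is at most 1/n.\<close>

lemma zterm_bound:
  assumes "n > 0" "Re s \<ge> 0"
  shows "norm (zterm s n) \<le> norm (s - 1) * norm s * real n powr (- Re s - 1)"
proof -
  define S where "S = closed_segment (complex_of_real (real n)) (complex_of_real (real (Suc n)))"
  have inS: "\<exists>u. z = of_real u \<and> real n \<le> u \<and> u \<le> real (Suc n)" if zS: "z \<in> S" for z
  proof -
    from zS obtain u where "z = of_real u" "u \<in> closed_segment (real n) (real (Suc n))"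
      unfolding S_def closed_segment_of_real by auto
    thus ?thesis by (auto simp: closed_segment_eq_real_ivl split: if_splits)
  qed
  let ?h = "\<lambda>z. (s - 1) * dpow s n * z + exp (- ((s - 1) * Ln z))"
  let ?h' = "\<lambda>z. (s - 1) * dpow s n - (s - 1) * exp (- ((s - 1) * Ln z)) / z"
  have "norm (?h (of_real (real (Suc n))) - ?h (of_real (real n)))
        \<le> (norm (s - 1) * norm s * real n powr (- Re s - 1)) * norm (complex_of_real (real (Suc n)) - of_real (real n))"
  proof (rule field_differentiable_bound[where S = S and f' = ?h'])
    show "convex S" by (simp add: S_def)
    show "(?h has_field_derivative ?h' z) (at z within S)" if "z \<in> S" for z
    proof -
      from inS[OF that] assms obtain u where u: "z = of_real u" "u > 0" by force
      have "z \<notin> \<real>\<^sub>\<le>\<^sub>0" using u by (simp add: complex_nonpos_Reals_iff)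
      thus ?thesis by (auto intro!: derivative_eq_intros simp: field_simps diff_divide_distrib)
    qed
    show "norm (?h' z) \<le> norm (s - 1) * norm s * real n powr (- Re s - 1)" if "z \<in> S" for z
    proof -
      from inS[OF that] assms obtain u where u: "z = of_real u" "u \<ge> real n" "u \<le> real (Suc n)" "u > 0" by force
      have e: "exp (- ((s - 1) * Ln z)) / z = rpw s u"
      proof -
        have "exp (- ((s - 1) * Ln z)) = exp (- (s * Ln z) + Ln z)" by (simp add: algebra_simps)
        also have "... = exp (- (s * Ln z)) * z" using u unfolding exp_add by (simp add: exp_Ln)
        finally show ?thesis using u by (simp add: rpw_def Ln_of_real)
      qed
      have "?h' z = (s - 1) * (rpw s (real n) - rpw s u)"
        unfolding e[symmetric] dpow_rpw by (simp add: right_diff_distrib)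
      hence "norm (?h' z) \<le> norm (s - 1) * (norm s * real n powr (- Re s) * (ln u - ln (real n)))"
        using rpw_diff_bound[of "real n" u s] assms u by (simp add: norm_mult mult_left_mono)
      also have "ln u - ln (real n) \<le> ln (real (Suc n)) - ln (real n)" using u by simp
      also have "... \<le> 1 / real n" using assms by (intro ln_Suc_diff_le)
      finally show ?thesis using assms by (simp add: powr_diff mult_left_mono mult.assoc)
    qed
  qed (auto simp: S_def)
  also have "norm (complex_of_real (real (Suc n)) - of_real (real n)) = 1" by simp
  also have "?h (of_real (real (Suc n))) - ?h (of_real (real n)) = zterm s n"
  proof -
    have e: "exp (- ((s - 1) * Ln (of_real (real m)))) = dpow (s - 1) m" if "m > 0" for m
      using that by (simp add: dpow_def Ln_of_real del: of_real_of_nat_eq)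
    show ?thesis unfolding e[OF assms(1)] e[of "Suc n", OF zero_less_Suc] zterm_def
      using assms(1) by (simp add: algebra_simps)
  qed
  finally show ?thesis by simp
qed

section \<open>Holomorphy of locally dominated series\<close>

lemma holomorphic_suminf:
  fixes f :: "nat \<Rightarrow> complex \<Rightarrow> complex"
  assumes S: "open S" and hol: "\<And>n. f n holomorphic_on S"
    and bd: "\<And>x. x \<in> S \<Longrightarrow> \<exists>d M. d > 0 \<and> summable M \<and> (\<forall>n. \<forall>y\<in>ball x d \<inter> S. norm (f n y) \<le> M n)"
  shows "(\<lambda>x. \<Sum>n. f n x) holomorphic_on S"
proof -
  have 1: "f n field_differentiable (at x)" if "x \<in> S" for n x
    using hol[of n] S that by (simp add: holomorphic_on_open field_differentiable_def)
  have 2: "\<exists>d h. 0 < d \<and> summable h \<and> range h \<subseteq> \<real>\<^sub>\<ge>\<^sub>0 \<and> (\<forall>\<^sub>F n in sequentially. \<forall>y\<in>ball x d \<inter> S. cmod(f n y) \<le> cmod (h n))"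
    if "x \<in> S" for x
  proof -
    from bd[OF that] obtain d M where dM: "d > 0" "summable M" "\<And>n y. y \<in> ball x d \<inter> S \<Longrightarrow> norm (f n y) \<le> M n"
      by blast
    have "M n \<ge> 0" for n using order_trans[OF norm_ge_zero dM(3)[of x n]] that dM(1) by simp
    thus ?thesis using dM
      by (intro exI[of _ d] exI[of _ "\<lambda>n. of_real (M n)"]) (auto simp: summable_of_real)
  qed
  obtain g where g: "\<forall>x \<in> S. ((\<lambda>n. f n x) sums g x) \<and> g field_differentiable (at x)"
    using series_differentiable_comparison_complex[OF S 1 2] by blast
  have "g holomorphic_on S"
    using g S by (simp add: holomorphic_on_open field_differentiable_def)
  thus ?thesis
    by (rule holomorphic_transform) (use g in \<open>auto simp: sums_iff\<close>)
qed

lemma open_Re_gt: "open {s. Re s > c}"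
  by (simp add: open_halfspace_Re_gt)

lemma Re_ball_bounds:
  assumes "Re x > c" "y \<in> ball x ((Re x - c) / 2)"
  shows "Re y > (Re x + c) / 2" "norm y \<le> norm x + (Re x - c) / 2"
proof -
  have d: "norm (x - y) < (Re x - c) / 2" using assms(2) by (simp add: dist_norm)
  have "Re x - Re y \<le> norm (x - y)" using complex_Re_le_cmod[of "x - y"] by simp
  thus "Re y > (Re x + c) / 2" using d by (simp add: field_simps)
  have "norm y \<le> norm x + norm (x - y)" by (metis norm_minus_commute norm_triangle_sub)
  thus "norm y \<le> norm x + (Re x - c) / 2" using d by linarith
qed

text \<open>Polynomial growth in s is harmless locally: on the ball around x whose radius is half
  the distance to the line Re s = c, the exponent of n stays below a constant less than -1, so a
  majorant independent of s exists. Abel summation and the Euler--Maclaurin terms both produce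
  bounds of this shape.\<close>

lemma holomorphic_suminf_poly_bound:
  fixes f :: "nat \<Rightarrow> complex \<Rightarrow> complex"
  assumes hol: "\<And>n. f n holomorphic_on {s. Re s > c}"
    and bd: "\<And>n s. Re s > c \<Longrightarrow> norm (f n s) \<le> K * (1 + norm s) ^ 2 * real n powr (c - 1 - Re s)"
    and K: "K \<ge> 0"
  shows "(\<lambda>s. \<Sum>n. f n s) holomorphic_on {s. Re s > c}"
    and "Re s > c \<Longrightarrow> summable (\<lambda>n. norm (f n s))"
proof -
  show "(\<lambda>s. \<Sum>n. f n s) holomorphic_on {s. Re s > c}"
  proof (rule holomorphic_suminf[OF open_Re_gt hol])
    fix x assume "x \<in> {s. Re s > c}"
    hence x: "Re x > c" by simp
    define d where "d = (Re x - c) / 2"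
    define M where "M = (\<lambda>n. K * (1 + norm x + d) ^ 2 * real n powr (c - 1 - (Re x + c) / 2))"
    have "c - 1 - (Re x + c) / 2 < -1" using x by (simp add: field_simps)
    hence "summable (\<lambda>n. real n powr (c - 1 - (Re x + c) / 2))" by (simp add: summable_real_powr_iff)
    hence "summable M" unfolding M_def by (rule summable_mult)
    moreover have "norm (f n y) \<le> M n" if y: "y \<in> ball x d \<inter> {s. Re s > c}" for n y
    proof -
      have b: "Re y > (Re x + c) / 2" "norm y \<le> norm x + d"
        using Re_ball_bounds[OF x, of y] y by (auto simp: d_def)
      have "norm (f n y) \<le> K * (1 + norm y) ^ 2 * real n powr (c - 1 - Re y)" using bd y by auto
      also have "... \<le> M n" unfolding M_def
      proof (intro mult_mono power_mono)
        show "real n powr (c - 1 - Re y) \<le> real n powr (c - 1 - (Re x + c) / 2)"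
          using b(1) by (cases "n = 0") (auto intro!: powr_mono simp: )
      qed (use b K in auto)
      finally show ?thesis .
    qed
    moreover have "d > 0" using x by (simp add: d_def)
    ultimately show "\<exists>d M. d > 0 \<and> summable M \<and> (\<forall>n. \<forall>y\<in>ball x d \<inter> {s. Re s > c}. norm (f n y) \<le> M n)"
      by blast
  qed
  show "summable (\<lambda>n. norm (f n s))" if "Re s > c"
  proof (rule summable_comparison_test')
    show "summable (\<lambda>n. K * (1 + norm s) ^ 2 * real n powr (c - 1 - Re s))"
      using that by (intro summable_mult) (simp add: summable_real_powr_iff)
    show "norm (norm (f n s)) \<le> K * (1 + norm s) ^ 2 * real n powr (c - 1 - Re s)" for n
      using bd[OF that] by simp
  qed
qed

section \<open>Summation by parts and continuation across Re s = 1\<close>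

lemma abel_sum_nat:
  fixes a u :: "nat \<Rightarrow> 'a::comm_ring"
  shows "(\<Sum>n\<le>N. a n * u n) = (\<Sum>k\<le>N. a k) * u (Suc N) + (\<Sum>n\<le>N. (\<Sum>k\<le>n. a k) * (u n - u (Suc n)))"
  by (induction N) (simp_all add: algebra_simps)

lemma abel_term_bound:
  assumes "\<And>n. norm (A n) \<le> K * real n powr \<theta>" "A 0 = 0" "K \<ge> 0" "Re s \<ge> 0"
  shows "norm (A n * (dpow s n - dpow s (Suc n))) \<le> K * (1 + norm s) ^ 2 * real n powr (\<theta> - 1 - Re s)"
proof (cases "n = 0")
  case False
  have "norm (A n * (dpow s n - dpow s (Suc n))) \<le> (K * real n powr \<theta>) * (norm s * real n powr (- Re s - 1))"
    unfolding norm_mult using assms False by (intro mult_mono dpow_diff_bound) auto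
  also have "... = K * norm s * real n powr (\<theta> - 1 - Re s)"
    using False by (simp add: powr_add[symmetric] algebra_simps)
  also have "... \<le> K * (1 + norm s) ^ 2 * real n powr (\<theta> - 1 - Re s)"
    using assms by (intro mult_right_mono mult_left_mono) (auto simp: power2_eq_square algebra_simps)
  finally show ?thesis .
qed (use assms in simp)

text \<open>Partial sums of order n leave a boundary term of order N^{1 - Re s}, which vanishes in
  the limit, and a series with terms of order n^{-Re s}.\<close>

lemma dirichlet_abel:
  fixes a :: "nat \<Rightarrow> complex"
  assumes A: "\<And>n. norm (\<Sum>k\<le>n. a k) \<le> K * real n" and "Re s > 1"
  shows "(\<lambda>n. a n * dpow s n) sums (\<Sum>n. (\<Sum>k\<le>n. a k) * (dpow s n - dpow s (Suc n)))"
    and "summable (\<lambda>n. (\<Sum>k\<le>n. a k) * (dpow s n - dpow s (Suc n)))"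
proof -
  have K: "K \<ge> 0" using order_trans[OF norm_ge_zero A[of 1]] by simp
  let ?A = "\<lambda>n. \<Sum>k\<le>n. a k"
  have A0: "?A 0 = 0" using A[of 0] by simp
  have bd: "norm (?A n * (dpow s n - dpow s (Suc n))) \<le> K * (1 + norm s) ^ 2 * real n powr (1 - 1 - Re s)" for n
    by (rule abel_term_bound) (use A A0 K assms(2) in auto)
  show sm: "summable (\<lambda>n. ?A n * (dpow s n - dpow s (Suc n)))"
  proof (rule summable_comparison_test'[OF _ bd])
    show "summable (\<lambda>n. K * (1 + norm s) ^ 2 * real n powr (1 - 1 - Re s))"
      using assms(2) by (intro summable_mult) (simp add: summable_real_powr_iff)
  qed
  have lim0: "(\<lambda>N. ?A N * dpow s (Suc N)) \<longlonglongrightarrow> 0"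
  proof (rule Lim_null_comparison)
    show "\<forall>\<^sub>F N in sequentially. norm (?A N * dpow s (Suc N)) \<le> K * real (Suc N) powr (1 - Re s)"
    proof (rule always_eventually, rule allI)
      fix N
      have "norm (?A N * dpow s (Suc N)) \<le> (K * real (Suc N)) * real (Suc N) powr (- Re s)"
        unfolding norm_mult
      proof (intro mult_mono)
        show "norm (?A N) \<le> K * real (Suc N)" using A[of N] K by (smt (verit) mult_left_mono of_nat_mono le_SucI order_refl)
      qed (use K in \<open>auto simp: norm_dpow\<close>)
      also have "... = K * real (Suc N) powr (1 - Re s)" by (simp add: powr_diff powr_minus divide_inverse)
      finally show "norm (?A N * dpow s (Suc N)) \<le> K * real (Suc N) powr (1 - Re s)" .
    qed
    have "(\<lambda>N. real (Suc N) powr (1 - Re s)) \<longlonglongrightarrow> 0"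
      using assms(2) by real_asymp
    thus "(\<lambda>N. K * real (Suc N) powr (1 - Re s)) \<longlonglongrightarrow> 0"
      by (rule tendsto_mult_right_zero)
  qed
  have eq: "(\<lambda>N. \<Sum>n\<le>N. a n * dpow s n) =
      (\<lambda>N. ?A N * dpow s (Suc N) + (\<Sum>n\<le>N. ?A n * (dpow s n - dpow s (Suc n))))"
    by (rule ext) (rule abel_sum_nat)
  have "(\<lambda>N. \<Sum>n\<le>N. a n * dpow s n) \<longlonglongrightarrow> 0 + (\<Sum>n. ?A n * (dpow s n - dpow s (Suc n)))"
    unfolding eq by (intro tendsto_add lim0 summable_LIMSEQ'[OF sm])
  thus "(\<lambda>n. a n * dpow s n) sums (\<Sum>n. ?A n * (dpow s n - dpow s (Suc n)))"
    by (simp add: sums_def_le)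
qed

text \<open>At the real point Re s the terms of the majorant series are nonnegative, so the
  convergence supplied by \<open>dirichlet_abel\<close> is absolute there, and it dominates the
  given series.\<close>

lemma dirichlet_abs_summable:
  fixes a :: "nat \<Rightarrow> complex" and a0 :: "nat \<Rightarrow> real"
  assumes "\<And>n. norm (a n) \<le> a0 n" "\<And>n. (\<Sum>k\<le>n. a0 k) \<le> K * real n" and s: "Re s > 1"
  shows "summable (\<lambda>n. norm (a n * dpow s n))"
proof -
  have a0: "a0 n \<ge> 0" for n using assms(1)[of n] norm_ge_zero order_trans by blast
  have a00: "a0 0 = 0" using assms(2)[of 0] a0[of 0] by simp
  have "(\<lambda>n. complex_of_real (a0 n) * dpow (of_real (Re s)) n) sums
      (\<Sum>n. (\<Sum>k\<le>n. complex_of_real (a0 k)) * (dpow (of_real (Re s)) n - dpow (of_real (Re s)) (Suc n)))"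
  proof (rule dirichlet_abel(1)[where K = K])
    show "norm (\<Sum>k\<le>n. complex_of_real (a0 k)) \<le> K * real n" for n
      using assms(2)[of n] a0 by (simp flip: of_real_sum add: sum_nonneg)
  qed (use s in simp)
  hence "summable (\<lambda>n. complex_of_real (a0 n) * dpow (of_real (Re s)) n)" by (simp add: sums_iff)
  hence "summable (\<lambda>n. Re (complex_of_real (a0 n) * dpow (of_real (Re s)) n))" by (rule summable_Re)
  also have "(\<lambda>n. Re (complex_of_real (a0 n) * dpow (of_real (Re s)) n)) = (\<lambda>n. a0 n * real n powr (- Re s))"
  proof
    show "Re (complex_of_real (a0 n) * dpow (of_real (Re s)) n) = a0 n * real n powr (- Re s)" for n
    using a00 by (cases "n = 0") (auto simp: dpow_def powr_def Re_exp simp flip: of_real_mult of_real_minus)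
  qed
  finally show ?thesis
  proof (rule summable_comparison_test'[where N = 0])
    show "norm (norm (a n * dpow s n)) \<le> a0 n * real n powr (- Re s)" for n
    proof (cases "n = 0")
      case True
      have "a 0 = 0" using assms(1)[of 0] a00 by simp
      thus ?thesis using True by simp
    qed (use assms(1) in \<open>simp add: norm_mult norm_dpow mult_right_mono\<close>)
  qed
qed

lemma zterm_bound':
  assumes "Re s > 0"
  shows "norm (zterm s n) \<le> 1 * (1 + norm s) ^ 2 * real n powr (0 - 1 - Re s)"
proof (cases "n = 0")
  case False
  hence "norm (zterm s n) \<le> norm (s - 1) * norm s * real n powr (- Re s - 1)"
    using zterm_bound[of n s] assms by simp
  also have "norm (s - 1) * norm s \<le> (1 + norm s) * (1 + norm s)"
    by (intro mult_mono) (auto intro: order_trans[OF norm_triangle_ineq4])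
  also have "- Re s - 1 = 0 - 1 - Re s" by simp
  finally show ?thesis by (simp add: power2_eq_square mult_right_mono)
qed (simp add: zterm_def)

definition zeta_ext :: "complex \<Rightarrow> complex" where
  "zeta_ext s = 1 + (\<Sum>n. zterm s n)"

lemma holomorphic_zeta_ext: "zeta_ext holomorphic_on {s. Re s > 0}"
  and summable_zterm: "Re s > 0 \<Longrightarrow> summable (zterm s)"
proof -
  have hol: "(\<lambda>s. zterm s n) holomorphic_on A" for n A
    unfolding zterm_def by (cases "n = 0") (auto intro!: holomorphic_intros)
  note * = holomorphic_suminf_poly_bound[where f = "\<lambda>n s. zterm s n" and K = 1 and c = 0, OF hol zterm_bound']
  show "zeta_ext holomorphic_on {s. Re s > 0}"
    unfolding zeta_ext_def using *(1) by (intro holomorphic_intros) auto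
  show "Re s > 0 \<Longrightarrow> summable (zterm s)"
    using *(2)[of s] by (auto intro: summable_norm_cancel)
qed

lemma zeta_ext_1 [simp]: "zeta_ext 1 = 1"
proof -
  have "zterm 1 n = 0" for n by (auto simp: zterm_def dpow_def)
  thus ?thesis by (simp add: zeta_ext_def)
qed

text \<open>In the sum of \<open>zterm\<close> up to N the powers with exponent s - 1 telescope to
  (N+1)^{1-s} - 1; the rest is s - 1 times the partial sum of the zeta series.\<close>

lemma zeta_sums:
  assumes "Re s > 1"
  shows "(\<lambda>n. (if n = 0 then 0 else dpow s n)) sums (zeta_ext s / (s - 1))"
proof -
  have s1: "s \<noteq> 1" using assms by auto
  have part: "(\<Sum>n\<le>N. zterm s n) = (s - 1) * (\<Sum>n\<le>N. if n = 0 then 0 else dpow s n) - 1 + dpow (s - 1) (Suc N)" for N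
    by (induction N) (simp_all add: zterm_def algebra_simps)
  have l0: "(\<lambda>N. dpow (s - 1) (Suc N)) \<longlonglongrightarrow> 0"
  proof (rule tendsto_norm_zero_cancel)
    have "(\<lambda>N. real (Suc N) powr (- (Re s - 1))) \<longlonglongrightarrow> 0"
      using assms by real_asymp
    thus "(\<lambda>N. norm (dpow (s - 1) (Suc N))) \<longlonglongrightarrow> 0" by (simp add: norm_dpow)
  qed
  have "(\<lambda>N. \<Sum>n\<le>N. zterm s n) \<longlonglongrightarrow> (\<Sum>n. zterm s n)"
    using summable_zterm[of s] assms by (intro summable_LIMSEQ') auto
  hence "(\<lambda>N. ((\<Sum>n\<le>N. zterm s n) + 1 - dpow (s - 1) (Suc N)) / (s - 1)) \<longlonglongrightarrow> ((\<Sum>n. zterm s n) + 1 - 0) / (s - 1)"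
    using s1 by (intro tendsto_intros l0) auto
  also have "(\<lambda>N. ((\<Sum>n\<le>N. zterm s n) + 1 - dpow (s - 1) (Suc N)) / (s - 1)) = (\<lambda>N. \<Sum>n\<le>N. if n = 0 then 0 else dpow s n)"
    using s1 by (auto simp: part fun_eq_iff)
  finally show ?thesis by (simp add: sums_def_le zeta_ext_def add.commute)
qed

text \<open>Subtracting c times the zeta series leaves coefficients with partial sums of order sqrt
  n, whose Abel-summed series converges for Re s > 1/2. The possible pole is thus isolated in an
  explicit term.\<close>

lemma dirichlet_continuation:
  fixes a :: "nat \<Rightarrow> complex" and c :: complex
  assumes E: "\<And>n. norm ((\<Sum>k\<le>n. a k) - c * of_nat n) \<le> K * sqrt (real n)"
  obtains H where "H holomorphic_on {s. Re s > 1/2}"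
    "\<And>s. Re s > 1 \<Longrightarrow> (\<lambda>n. a n * dpow s n) sums (H s + c * zeta_ext s / (s - 1))"
proof -
  have K: "K \<ge> 0" using order_trans[OF norm_ge_zero E[of 1]] by simp
  define E' where "E' = (\<lambda>n. (\<Sum>k\<le>n. a k) - c * of_nat n)"
  define H where "H = (\<lambda>s. \<Sum>n. E' n * (dpow s n - dpow s (Suc n)))"
  have E0: "E' 0 = 0" using E[of 0] by (simp add: E'_def)
  have bd: "norm (E' n * (dpow s n - dpow s (Suc n))) \<le> K * (1 + norm s) ^ 2 * real n powr (1/2 - 1 - Re s)"
    if "Re s > 1/2" for n s
    by (rule abel_term_bound) (use E E0 K that in \<open>auto simp: E'_def powr_half_sqrt\<close>)
  have hol: "(\<lambda>s. E' n * (dpow s n - dpow s (Suc n))) holomorphic_on A" for n A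
    by (intro holomorphic_intros)
  note hh = holomorphic_suminf_poly_bound[where f = "\<lambda>n s. E' n * (dpow s n - dpow s (Suc n))" and K = K and c = "1/2", OF hol bd K]
  show ?thesis
  proof (rule that[of H])
    show "H holomorphic_on {s. Re s > 1/2}" unfolding H_def by (rule hh(1))
    fix s :: complex assume s: "Re s > 1"
    \<comment> \<open>The coefficients of zeta itself, with value 0 at n = 0: the same Abel
      summation is applied to them, so that the two series can be combined term by term.\<close>
    define e where "e = (\<lambda>n::nat. if n = 0 then 0 else (1::complex))"
    have se: "(\<Sum>k\<le>n. e k) = of_nat n" for n
      by (induction n) (auto simp: e_def)
    have "(\<lambda>n. e n * dpow s n) sums (\<Sum>n. (\<Sum>k\<le>n. e k) * (dpow s n - dpow s (Suc n)))"
      and sme: "summable (\<lambda>n. (\<Sum>k\<le>n. e k) * (dpow s n - dpow s (Suc n)))"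
      using dirichlet_abel[of e 1 s] s by (auto simp: se)
    moreover have "(\<lambda>n. e n * dpow s n) sums (zeta_ext s / (s - 1))"
      using zeta_sums[OF s] by (simp add: e_def if_distrib if_distribR cong: if_cong)
    ultimately have ez: "(\<Sum>n. (\<Sum>k\<le>n. e k) * (dpow s n - dpow s (Suc n))) = zeta_ext s / (s - 1)"
      by (simp add: sums_iff)
    have A: "norm (\<Sum>k\<le>n. a k) \<le> (K + norm c) * real n" for n
    proof -
      have "norm (\<Sum>k\<le>n. a k) \<le> norm ((\<Sum>k\<le>n. a k) - c * of_nat n) + norm (c * of_nat n)"
        by (metis norm_triangle_sub add.commute)
      also have "... \<le> K * sqrt (real n) + norm c * real n" using E[of n] by (simp add: norm_mult)
      also have "K * sqrt (real n) \<le> K * real n"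
      proof (intro mult_left_mono K)
        show "sqrt (real n) \<le> real n" using real_sqrt_le_mono[of "real n" "real n * real n"]
          by (cases "n = 0") (auto simp: )
      qed
      finally show ?thesis by (simp add: algebra_simps)
    qed
    have "(\<lambda>n. a n * dpow s n) sums (\<Sum>n. (\<Sum>k\<le>n. a k) * (dpow s n - dpow s (Suc n)))"
      by (rule dirichlet_abel(1)[OF A s])
    also have "(\<lambda>n. (\<Sum>k\<le>n. a k) * (dpow s n - dpow s (Suc n)))
       = (\<lambda>n. E' n * (dpow s n - dpow s (Suc n)) + c * ((\<Sum>k\<le>n. e k) * (dpow s n - dpow s (Suc n))))"
      by (auto simp: E'_def se algebra_simps fun_eq_iff)
    also have "(\<Sum>n. E' n * (dpow s n - dpow s (Suc n)) + c * ((\<Sum>k\<le>n. e k) * (dpow s n - dpow s (Suc n))))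
       = H s + c * (zeta_ext s / (s - 1))"
      unfolding H_def ez[symmetric]
      using hh(2)[of s] s sme
      by (subst suminf_add[symmetric]) (auto intro: summable_norm_cancel summable_mult simp: suminf_mult)
    finally show "(\<lambda>n. a n * dpow s n) sums (H s + c * zeta_ext s / (s - 1))" by simp
  qed
qed

section \<open>A Tauberian theorem\<close>

text \<open>The Fejer kernel, the cosine transform of the triangle of half-width l. It is
  nonnegative, of order l for |u| <= 1/l, and at most 4/(l u^2) elsewhere.\<close>

definition fejer :: "real \<Rightarrow> real \<Rightarrow> real" where
  "fejer l u = (if u = 0 then l else 2 * (1 - cos (l * u)) / (l * u\<^sup>2))"

lemma has_integral_fejer:
  assumes "l > 0"
  shows "((\<lambda>y. 2 * (1 - y / l) * cos (y * u)) has_integral fejer l u) {0..l}"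
proof (cases "u = 0")
  case True
  have "((\<lambda>y. 2 * (1 - y / l)) has_integral ((\<lambda>y. 2 * y - y\<^sup>2 / l) l - (\<lambda>y. 2 * y - y\<^sup>2 / l) 0)) {0..l}"
    by (rule fundamental_theorem_of_calculus)
       (use assms in \<open>auto intro!: derivative_eq_intros simp flip: has_real_derivative_iff_has_vector_derivative simp: field_simps\<close>)
  moreover have "2 * l - l\<^sup>2 / l = l" using assms by (simp add: power2_eq_square)
  ultimately show ?thesis using True by (simp add: fejer_def)
next
  case False
  let ?F = "\<lambda>y. 2 * ((1 - y / l) * sin (y * u) / u - cos (y * u) / (l * u\<^sup>2))"
  have "((\<lambda>y. 2 * (1 - y / l) * cos (y * u)) has_integral (?F l - ?F 0)) {0..l}"
    by (rule fundamental_theorem_of_calculus)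
       (use assms False in \<open>auto intro!: derivative_eq_intros simp flip: has_real_derivative_iff_has_vector_derivative simp: field_simps power2_eq_square\<close>)
  moreover have "?F l - ?F 0 = fejer l u" using assms False by (simp add: fejer_def field_simps)
  ultimately show ?thesis by simp
qed

lemma fejer_nonneg: "l > 0 \<Longrightarrow> fejer l u \<ge> 0"
  by (simp add: fejer_def)

lemma fejer_le:
  assumes "l > 0" "u \<noteq> 0"
  shows "fejer l u \<le> 4 / (l * u\<^sup>2)"
proof -
  have "2 * (1 - cos (l * u)) \<le> 4" by (smt (verit) cos_ge_minus_one)
  thus ?thesis using assms by (simp add: fejer_def divide_right_mono)
qed

text \<open>From cos >= 1/2 on [0, 1], two integrations give sin t >= t/2 and the claim; evenness
  covers negative x.\<close>

lemma one_minus_cos_ge: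
  fixes x :: real
  assumes "\<bar>x\<bar> \<le> 1"
  shows "1 - cos x \<ge> x\<^sup>2 / 4"
proof -
  have pi3: "1 < pi / 3" using pi_gt3 by simp
  have c: "cos t \<ge> 1 / 2" if "0 \<le> t" "t \<le> 1" for t :: real
  proof -
    have "cos t \<ge> cos (pi / 3)" using that pi3 by (intro cos_monotone_0_pi_le) auto
    thus ?thesis by (simp add: cos_60)
  qed
  have s: "sin t \<ge> t / 2" if "0 \<le> t" "t \<le> 1" for t :: real
  proof -
    have "(\<lambda>t. sin t - t / 2) 0 \<le> (\<lambda>t. sin t - t / 2) t"
      by (rule DERIV_nonneg_imp_nondecreasing[OF that(1)])
         (use c that in \<open>auto intro!: derivative_eq_intros exI\<close>)
    thus ?thesis by simp
  qed
  have "(\<lambda>t. - cos t - t\<^sup>2 / 4) 0 \<le> (\<lambda>t. - cos t - t\<^sup>2 / 4) \<bar>x\<bar>"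
  proof (rule DERIV_nonneg_imp_nondecreasing[where f = "\<lambda>t. - cos t - t\<^sup>2 / 4" and a = 0 and b = "\<bar>x\<bar>"])
    fix t assume t: "0 \<le> t" "t \<le> \<bar>x\<bar>"
    have "((\<lambda>t. - cos t - t\<^sup>2 / 4) has_real_derivative sin t - t / 2) (at t)"
      by (auto intro!: derivative_eq_intros)
    moreover have "sin t - t / 2 \<ge> 0" using s[of t] t assms by simp
    ultimately show "\<exists>y. ((\<lambda>t. - cos t - t\<^sup>2 / 4) has_real_derivative y) (at t) \<and> 0 \<le> y" by blast
  qed simp
  thus ?thesis by simp
qed

lemma fejer_ge:
  assumes "l > 0" "\<bar>u\<bar> \<le> 1 / l"
  shows "fejer l u \<ge> l / 2"
proof (cases "u = 0")
  case False
  have "\<bar>l * u\<bar> \<le> 1" using assms by (simp add: abs_mult field_simps)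
  hence "1 - cos (l * u) \<ge> (l * u)\<^sup>2 / 4" by (rule one_minus_cos_ge)
  hence "2 * (1 - cos (l * u)) / (l * u\<^sup>2) \<ge> 2 * ((l * u)\<^sup>2 / 4) / (l * u\<^sup>2)"
    using assms by (intro divide_right_mono) auto
  also have "2 * ((l * u)\<^sup>2 / 4) / (l * u\<^sup>2) = l / 2" using assms False by (simp add: power2_eq_square)
  finally show ?thesis using False by (simp add: fejer_def)
qed (use assms in \<open>simp add: fejer_def\<close>)

text \<open>The telescoping sum of arctangents bounds the mass of $1/(n(1+(T-\ln n)^2))$ uniformly in \<open>T\<close>.\<close>

lemma arctan_telescope:
  assumes "n > 0"
  shows "1 / (real n * (1 + (T - ln (real n))\<^sup>2)) \<le> 6 * (arctan (ln (real (Suc n)) - T) - arctan (ln (real n) - T))"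
proof -
  define x y where "x = ln (real n) - T" and "y = ln (real (Suc n)) - T"
  have xy: "x < y" using assms by (simp add: x_def y_def)
  have yx: "y - x \<le> 1" using ln_Suc_diff_le[OF assms] assms
    unfolding x_def y_def by (auto intro!: order_trans[OF ln_Suc_diff_le[OF assms]] simp del: of_nat_Suc)
  have "ln (real n / real (Suc n)) \<le> real n / real (Suc n) - 1" using assms by (intro ln_le_minus_one) auto
  hence "y - x \<ge> 1 - real n / real (Suc n)" using assms by (simp add: x_def y_def ln_div)
  moreover have "1 - real n / real (Suc n) \<ge> 1 / (2 * real n)" using assms by (simp add: field_simps)
  ultimately have yx2: "y - x \<ge> 1 / (2 * real n)" by linarith
  obtain z where z: "x < z" "z < y" "arctan y - arctan x = (y - x) * (inverse (1 + z\<^sup>2))"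
    using MVT2[OF xy, of arctan "\<lambda>z. inverse (1 + z\<^sup>2)"] DERIV_arctan by blast
  have "\<bar>z\<bar> \<le> \<bar>x\<bar> + 1" using z yx by linarith
  hence "z\<^sup>2 \<le> (\<bar>x\<bar> + 1)\<^sup>2" by (metis abs_ge_zero power2_abs power_mono)
  also have "(\<bar>x\<bar> + 1)\<^sup>2 \<le> 2 * x\<^sup>2 + 2"
    using sum_squares_ge_zero[of "\<bar>x\<bar> - 1" 0] by (simp add: power2_eq_square algebra_simps)
  finally have "1 + z\<^sup>2 \<le> 3 * (1 + x\<^sup>2)" by (smt (verit) zero_le_power2)
  hence "1 / (3 * (1 + x\<^sup>2)) \<le> inverse (1 + z\<^sup>2)"
    by (simp add: divide_inverse add_pos_nonneg le_imp_inverse_le flip: inverse_mult_distrib)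
  hence "(1 / (2 * real n)) * (1 / (3 * (1 + x\<^sup>2))) \<le> (y - x) * inverse (1 + z\<^sup>2)"
    using yx2 xy by (intro mult_mono) auto
  hence "6 * ((1 / (2 * real n)) * (1 / (3 * (1 + x\<^sup>2)))) \<le> 6 * (arctan y - arctan x)" unfolding z(3) by (rule mult_left_mono) simp
  also have "6 * ((1 / (2 * real n)) * (1 / (3 * (1 + x\<^sup>2)))) = 1 / (real n * (1 + x\<^sup>2))"
  proof -
    have "6 * ((1 / (2 * a)) * (1 / (3 * b))) = 1 / (a * b)" for a b :: real by simp
    thus ?thesis .
  qed
  also have "x\<^sup>2 = (T - ln (real n))\<^sup>2" by (simp add: x_def power2_commute)
  finally show ?thesis by (simp add: x_def y_def)
qed

lemma sum_arctan_bound: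
  "(\<Sum>n=1..N. 1 / (real n * (1 + (T - ln (real n))\<^sup>2))) \<le> 6 * pi"
proof -
  have "(\<Sum>n=1..N. 1 / (real n * (1 + (T - ln (real n))\<^sup>2)))
      \<le> (\<Sum>n=1..N. 6 * (arctan (ln (real (Suc n)) - T) - arctan (ln (real n) - T)))"
    by (intro sum_mono arctan_telescope) auto
  also have "... = 6 * (arctan (ln (real (Suc N)) - T) - arctan (ln (real 1) - T))"
    unfolding sum_distrib_left[symmetric] by (subst sum_Suc_diff) auto
  also have "... \<le> 6 * pi"
    using arctan_bounded[of "ln (real (Suc N)) - T"] arctan_bounded[of "ln (real 1) - T"] by simp
  finally show ?thesis .
qed

text \<open>A quantitative Riemann--Lebesgue argument. On the line Re s = \<sigma> the series is
  multiplied by the triangle times e^{iyT} and integrated over 0 <= y <= l; termwise, twice the real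
  part yields the Fejer kernel. On the side of G one integration by parts gains 1/T. The constant is
  uniform in \<sigma> because G and its derivative are bounded on the compact rectangle with 1 <= Re
  s <= 2 and 0 <= Im s <= l, which lies inside U.\<close>

lemma fejer_series_bound:
  fixes f :: "nat \<Rightarrow> real" and G :: "complex \<Rightarrow> complex"
  assumes U: "open U" "{s. Re s \<ge> 1} \<subseteq> U" and G: "G holomorphic_on U"
    and f: "\<And>n. \<bar>f n\<bar> \<le> M" "f 0 = 0"
    and sums: "\<And>s. Re s > 1 \<Longrightarrow> (\<lambda>n. of_real (f n) * dpow s n) sums G s"
    and l: "l > 0"
  shows "\<exists>C. \<forall>T \<sigma>. T > 0 \<longrightarrow> 1 < \<sigma> \<longrightarrow> \<sigma> \<le> 2 \<longrightarrow>
      summable (\<lambda>n. f n * real n powr (-\<sigma>) * fejer l (T - ln (real n))) \<and>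
      \<bar>\<Sum>n. f n * real n powr (-\<sigma>) * fejer l (T - ln (real n))\<bar> \<le> C / T"
proof -
  define B where "B = cbox (Complex 1 0) (Complex 2 l)"
  have BU: "B \<subseteq> U" using U(2) by (auto simp: B_def in_cbox_complex_iff)
  have dG: "deriv G holomorphic_on U" using G U(1) by (rule holomorphic_deriv)
  have "compact (G ` B)" "compact (deriv G ` B)"
    using G dG BU by (auto intro!: compact_continuous_image holomorphic_on_imp_continuous_on intro: holomorphic_on_subset simp: B_def)
  then obtain C1 C2 where C1: "\<And>s. s \<in> B \<Longrightarrow> norm (G s) \<le> C1" and C2: "\<And>s. s \<in> B \<Longrightarrow> norm (deriv G s) \<le> C2"
    by (metis bounded_iff compact_imp_bounded image_eqI)
  have inB: "of_real \<sigma> + \<i> * of_real y \<in> B" if "1 \<le> \<sigma>" "\<sigma> \<le> 2" "0 \<le> y" "y \<le> l" for \<sigma> y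
    using that by (auto simp: B_def in_cbox_complex_iff)
  have C1pos: "C1 \<ge> 0" using order_trans[OF norm_ge_zero C1[OF inB[of 1 0]]] l by simp
  have C2pos: "C2 \<ge> 0" using order_trans[OF norm_ge_zero C2[OF inB[of 1 0]]] l by simp
  define C where "C = 2 * (C1 + (C1 / l + C2) * l)"
  show ?thesis
  proof (rule exI[of _ C], intro allI impI)
    fix T \<sigma> :: real assume T: "T > 0" and sg: "1 < \<sigma>" "\<sigma> \<le> 2"
    define g where "g = (\<lambda>y. G (of_real \<sigma> + \<i> * of_real y))"
    define g' where "g' = (\<lambda>y. \<i> * deriv G (of_real \<sigma> + \<i> * of_real y))"
    have inU: "of_real \<sigma> + \<i> * of_real y \<in> U" for y using U(2) sg by auto
    have gd: "(g has_vector_derivative g' y) (at y within S)" for y S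
    proof -
      have "(G has_field_derivative deriv G (of_real \<sigma> + \<i> * of_real y)) (at (of_real \<sigma> + \<i> * of_real y))"
        using G U(1) inU by (rule holomorphic_derivI)
      moreover have "((\<lambda>y. of_real \<sigma> + \<i> * of_real y) has_vector_derivative \<i>) (at y within S)"
        by (auto intro!: derivative_eq_intros simp: has_vector_derivative_def scaleR_conv_of_real mult.commute)
      ultimately show ?thesis unfolding g_def g'_def
        using field_vector_diff_chain_within[of "\<lambda>y. of_real \<sigma> + \<i> * of_real y" \<i> y S G]
        by (simp add: o_def has_field_derivative_at_within)
    qed
    define H where "H = (\<lambda>y. (1 - of_real (y / l)) * g y)"
    define H' where "H' = (\<lambda>y. - of_real (1 / l) * g y + (1 - of_real (y / l)) * g' y)"
    have Hd: "(H has_vector_derivative H' y) (at y within S)" for y S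
      unfolding H_def H'_def using l
      by (auto intro!: derivative_eq_intros gd simp: divide_inverse)
    define e where "e = (\<lambda>y. exp (\<i> * of_real (y * T)))"
    have ed: "(e has_vector_derivative \<i> * of_real T * e y) (at y within S)" for y S
    proof -
      have "((\<lambda>z. exp (\<i> * (z * of_real T))) has_field_derivative \<i> * of_real T * e y) (at (of_real y))"
        unfolding e_def by (auto intro!: derivative_eq_intros)
      thus ?thesis unfolding e_def of_real_mult by (rule has_vector_derivative_real_field)
    qed
    \<comment> \<open>The antiderivative for integration by parts. The triangle makes
      \<open>H\<close> vanish at l, so only the boundary value at 0 survives.\<close>
    let ?E = "\<lambda>y. e y * H y / (\<i> * of_real T)"
    have int0: "((\<lambda>y. e y * H y + e y * H' y / (\<i> * of_real T)) has_integral (?E l - ?E 0)) {0..l}"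
      using l T
      by (intro fundamental_theorem_of_calculus)
         (auto intro!: derivative_eq_intros ed Hd simp: field_simps)
    have cg: "continuous_on {0..l} g" using gd by (meson continuous_on_vector_derivative)
    have cg': "continuous_on {0..l} g'"
      unfolding g'_def using dG inU 
      by (intro continuous_intros continuous_on_compose2[OF holomorphic_on_imp_continuous_on[OF dG]]) auto
    define I1 where "I1 = integral {0..l} (\<lambda>y. e y * H' y / (\<i> * of_real T))"
    have int1: "((\<lambda>y. e y * H' y / (\<i> * of_real T)) has_integral I1) {0..l}"
      unfolding I1_def e_def H'_def using T l by (intro integrable_integral integrable_continuous_real continuous_intros cg cg') auto
    define J where "J = ?E l - ?E 0 - I1"
    have intJ: "((\<lambda>y. e y * H y) has_integral J) {0..l}"
      using has_integral_diff[OF int0 int1] by (simp add: J_def)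
    have ne: "norm (e y) = 1" for y by (simp add: e_def)
    have nfac: "norm (1 - complex_of_real (y / l)) \<le> 1" if "0 \<le> y" "y \<le> l" for y
    proof -
      have "norm (1 - complex_of_real (y / l)) = \<bar>1 - y / l\<bar>" by (metis norm_of_real of_real_1 of_real_diff)
      also have "... \<le> 1" using that l by (simp add: field_simps abs_le_iff)
      finally show ?thesis .
    qed
    have nH': "norm (H' y) \<le> C1 / l + C2" if y: "0 \<le> y" "y \<le> l" for y
    proof -
      have "norm (H' y) \<le> norm (- of_real (1 / l) * g y) + norm ((1 - of_real (y / l)) * g' y)"
        unfolding H'_def by (rule norm_triangle_ineq)
      also have "norm (- of_real (1 / l) * g y) \<le> (1 / l) * C1"
        unfolding norm_mult using C1[OF inB[of \<sigma> y]] y sg l by (intro mult_mono) (auto simp: g_def norm_divide)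
      also have "norm ((1 - of_real (y / l)) * g' y) \<le> 1 * C2"
        unfolding norm_mult using C2[OF inB[of \<sigma> y]] y sg l by (intro mult_mono nfac) (auto simp: g'_def norm_mult)
      finally show ?thesis by simp
    qed
    have nI1: "norm I1 \<le> (C1 / l + C2) / T * l"
    proof -
      have "norm I1 \<le> (C1 / l + C2) / T * measure lborel (cbox 0 l)"
      proof (rule has_integral_bound)
        show "((\<lambda>y. e y * H' y / (\<i> * of_real T)) has_integral I1) (cbox 0 l)" using int1 by simp
        show "norm (e x * H' x / (\<i> * of_real T)) \<le> (C1 / l + C2) / T" if "x \<in> cbox 0 l" for x
          using nH'[of x] that T by (simp add: norm_mult norm_divide ne divide_right_mono)
      qed (use C1pos C2pos l T in auto)
      thus ?thesis using l by simp
    qed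
    have "norm J \<le> norm (?E l - ?E 0) + norm I1" unfolding J_def by (rule norm_triangle_ineq4)
    also have "norm (?E l - ?E 0) = norm (H 0) / T"
      using l T by (simp add: H_def norm_mult norm_divide ne)
    also have "norm (H 0) \<le> C1" using C1[OF inB[of \<sigma> 0]] sg l by (simp add: H_def g_def)
    finally have nJ: "norm J \<le> C1 / T + (C1 / l + C2) / T * l"
      using nI1 T by (simp add: divide_right_mono)
    have CT: "2 * norm J \<le> C / T"
    proof -
      have "2 * norm J \<le> 2 * (C1 / T + (C1 / l + C2) / T * l)" using nJ by simp
      also have "... = C / T" unfolding C_def using T by (simp add: field_simps)
      finally show ?thesis .
    qed
    define h where "h = (\<lambda>n y. f n * real n powr (-\<sigma>) * (2 * (1 - y / l) * cos (y * (T - ln (real n)))))"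
    have hs: "(\<lambda>n. h n y) sums (2 * Re (e y * H y))" for y
    proof -
      have "(\<lambda>n. of_real (f n) * dpow (of_real \<sigma> + \<i> * of_real y) n) sums g y"
        unfolding g_def using sums sg by auto
      hence "(\<lambda>n. (2 * (1 - of_real (y / l)) * e y) * (of_real (f n) * dpow (of_real \<sigma> + \<i> * of_real y) n)) sums
         ((2 * (1 - of_real (y / l)) * e y) * g y)" by (rule sums_mult)
      hence "(\<lambda>n. Re ((2 * (1 - of_real (y / l)) * e y) * (of_real (f n) * dpow (of_real \<sigma> + \<i> * of_real y) n))) sums
         (Re ((2 * (1 - of_real (y / l)) * e y) * g y))" by (rule sums_Re)
      also have "(\<lambda>n. Re ((2 * (1 - of_real (y / l)) * e y) * (of_real (f n) * dpow (of_real \<sigma> + \<i> * of_real y) n))) = (\<lambda>n. h n y)"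
      proof
        fix n
        show "Re ((2 * (1 - of_real (y / l)) * e y) * (of_real (f n) * dpow (of_real \<sigma> + \<i> * of_real y) n)) = h n y"
        proof (cases "n = 0")
          case False
          have "e y * dpow (of_real \<sigma> + \<i> * of_real y) n = exp (of_real (- \<sigma> * ln (real n)) + \<i> * of_real (y * (T - ln (real n))))"
            unfolding e_def dpow_def exp_add[symmetric] by (simp add: algebra_simps)
          hence "Re (e y * dpow (of_real \<sigma> + \<i> * of_real y) n) = real n powr (-\<sigma>) * cos (y * (T - ln (real n)))"
            using False by (simp add: Re_exp powr_def)
          moreover have "(2 * (1 - of_real (y / l)) * e y) * (of_real (f n) * dpow (of_real \<sigma> + \<i> * of_real y) n)
             = of_real (2 * (1 - y / l) * f n) * (e y * dpow (of_real \<sigma> + \<i> * of_real y) n)" by simp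
          moreover have "Re (of_real x * w) = x * Re w" for x w by simp
          ultimately show ?thesis by (simp only: h_def) (simp add: mult_ac)
        qed (use f(2) in \<open>simp add: h_def\<close>)
      qed
      also have "Re ((2 * (1 - of_real (y / l)) * e y) * g y) = 2 * Re (e y * H y)"
        by (simp add: H_def algebra_simps)
      finally show ?thesis .
    qed
    have hb: "norm (h n y) \<le> M * real n powr (-\<sigma>) * 2" if "y \<in> {0..l}" for n y
    proof -
      have "\<bar>1 - y / l\<bar> \<le> 1" using that l by (simp add: field_simps abs_le_iff)
      hence "\<bar>1 - y / l\<bar> * \<bar>cos (y * (T - ln (real n)))\<bar> \<le> 1 * 1" by (intro mult_mono) auto
      hence *: "\<bar>1 - y / l\<bar> * \<bar>cos (y * (T - ln (real n)))\<bar> \<le> 1" by simp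
      have "\<bar>f n\<bar> * real n powr (-\<sigma>) * (2 * (\<bar>1 - y / l\<bar> * \<bar>cos (y * (T - ln (real n)))\<bar>)) \<le> M * real n powr (-\<sigma>) * 2"
        using order_trans[OF abs_ge_zero f(1)[of 0]] f(1)[of n] * by (intro mult_mono) auto
      also have "\<bar>f n\<bar> * real n powr (-\<sigma>) * (2 * (\<bar>1 - y / l\<bar> * \<bar>cos (y * (T - ln (real n)))\<bar>)) = norm (h n y)"
        by (simp only: h_def real_norm_def abs_mult) simp
      finally show ?thesis .
    qed
    have "uniform_limit {0..l} (\<lambda>N y. \<Sum>n<N. h n y) (\<lambda>y. \<Sum>n. h n y) sequentially"
    proof (rule Weierstrass_m_test[OF hb])
      show "summable (\<lambda>n. M * real n powr (-\<sigma>) * 2)"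
        using sg by (intro summable_mult summable_mult2) (simp add: summable_real_powr_iff)
    qed
    hence ul: "uniform_limit {0..l} (\<lambda>N y. \<Sum>n<N. h n y) (\<lambda>y. 2 * Re (e y * H y)) sequentially"
      using hs by (simp add: sums_iff)
    obtain I J' where I: "\<And>N. ((\<lambda>y. \<Sum>n<N. h n y) has_integral I N) {0..l}"
      and J': "((\<lambda>y. 2 * Re (e y * H y)) has_integral J') {0..l}" and lim: "I \<longlonglongrightarrow> J'"
    proof (rule uniform_limit_integral[OF ul])
      show "continuous_on {0..l} (\<lambda>y. \<Sum>n<N. h n y)" for N
        unfolding h_def using l by (intro continuous_intros) auto
    qed auto
    have "((\<lambda>y. \<Sum>n<N. h n y) has_integral (\<Sum>n<N. f n * real n powr (-\<sigma>) * fejer l (T - ln (real n)))) {0..l}" for N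
      unfolding h_def by (intro has_integral_sum has_integral_mult_right has_integral_fejer l) auto
    hence Ieq: "I N = (\<Sum>n<N. f n * real n powr (-\<sigma>) * fejer l (T - ln (real n)))" for N
      using I has_integral_unique by blast
    have "((\<lambda>y. 2 * Re (e y * H y)) has_integral 2 * Re J) {0..l}"
      using has_integral_Re[OF intJ] by (intro has_integral_mult_right)
    hence "J' = 2 * Re J" using J' has_integral_unique by blast
    hence sms: "(\<lambda>n. f n * real n powr (-\<sigma>) * fejer l (T - ln (real n))) sums (2 * Re J)"
      using lim by (simp add: sums_def Ieq[abs_def] fun_eq_iff)
    have "\<bar>2 * Re J\<bar> \<le> 2 * norm J" using abs_Re_le_cmod[of J] by simp
    thus "summable (\<lambda>n. f n * real n powr (-\<sigma>) * fejer l (T - ln (real n))) \<and>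
      \<bar>\<Sum>n. f n * real n powr (-\<sigma>) * fejer l (T - ln (real n))\<bar> \<le> C / T"
      using sms CT by (simp add: sums_iff)
  qed
qed

text \<open>Fixes for how long, on the logarithmic scale, a deviation \<eta> of S(N)/N from \<rho>
  persists as one of \<eta>/2 when S is merely monotone: an excess is diluted by exp (-h), a deficit
  by exp h.\<close>

lemma exists_window:
  fixes \<rho> \<eta> :: real
  assumes "\<rho> \<ge> 0" "\<eta> > 0"
  obtains h where "0 < h" "h \<le> 1" "(\<rho> + \<eta>) * exp (-h) \<ge> \<rho> + \<eta> / 2" "(\<rho> - \<eta>) * exp h \<le> \<rho> - \<eta> / 2"
proof -
  have "((\<lambda>h. (\<rho> + \<eta>) * exp (-h)) \<longlongrightarrow> (\<rho> + \<eta>) * exp (-0)) (at_right 0)"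
    "((\<lambda>h. (\<rho> - \<eta>) * exp h) \<longlongrightarrow> (\<rho> - \<eta>) * exp 0) (at_right 0)"
    by (intro tendsto_intros)+
  hence "eventually (\<lambda>h. (\<rho> + \<eta>) * exp (-h) > \<rho> + \<eta> / 2) (at_right 0)"
    "eventually (\<lambda>h. (\<rho> - \<eta>) * exp h < \<rho> - \<eta> / 2) (at_right 0)"
    using assms by (auto elim!: order_tendstoD)
  moreover have "eventually (\<lambda>h::real. 0 < h \<and> h < 1) (at_right 0)"
    using eventually_at_right_real[of 0 1] by (simp add: eventually_mono)
  ultimately have "eventually (\<lambda>h. (0 < h \<and> h < 1) \<and> (\<rho> + \<eta>) * exp (-h) > \<rho> + \<eta> / 2 \<and> (\<rho> - \<eta>) * exp h < \<rho> - \<eta> / 2) (at_right 0)"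
    by (simp add: eventually_conj_iff)
  then obtain h where "(0 < h \<and> h < 1) \<and> (\<rho> + \<eta>) * exp (-h) > \<rho> + \<eta> / 2 \<and> (\<rho> - \<eta>) * exp h < \<rho> - \<eta> / 2"
    using eventually_happens'[OF trivial_limit_at_right_real] by blast
  thus ?thesis using that[of h] by auto
qed

text \<open>A logarithmic interval of length 1/l carries reciprocals with sum about 1/l. Rounding
  its left end up to an integer costs at most exp (-T), hence the assumption on T.\<close>

lemma sum_inverse_window:
  assumes l: "l > 0" and T: "exp (-T) \<le> 1 / (2 * l)"
  obtains W where "finite W" "\<And>n. n \<in> W \<Longrightarrow> n > 0 \<and> T \<le> ln (real n) \<and> ln (real n) \<le> T + 1 / l"
    "(\<Sum>n\<in>W. 1 / real n) \<ge> 1 / (2 * l)"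
proof -
  define a b where "a = nat \<lceil>exp T\<rceil>" and "b = nat \<lfloor>exp (T + 1 / l)\<rfloor>"
  have a: "real a \<ge> exp T" "real a \<le> exp T + 1" unfolding a_def using exp_gt_zero[of T] by linarith+
  have b: "real b \<le> exp (T + 1 / l)" "real b + 1 \<ge> exp (T + 1 / l)" unfolding b_def using exp_gt_zero[of "T + 1 / l"] by linarith+
  have apos: "a > 0" using a(1) exp_gt_zero[of T] by (metis not_gr_zero of_nat_0 not_less)
  have "ln (real (Suc b)) - ln (real a) \<le> (\<Sum>n=a..b. 1 / real n)"
  proof (cases "a \<le> Suc b")
    case True
    have "ln (real (Suc b)) - ln (real a) = (\<Sum>n=a..b. ln (real (Suc n)) - ln (real n))"
      using sum_Suc_diff[of a b "\<lambda>n. ln (real n)"] True by simp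
    also have "... \<le> (\<Sum>n=a..b. 1 / real n)" using apos by (intro sum_mono ln_Suc_diff_le) auto
    finally show ?thesis .
  next
    case False
    hence "ln (real (Suc b)) \<le> ln (real a)" by simp
    moreover have "0 \<le> (\<Sum>n=a..b. 1 / real n)" by (intro sum_nonneg) auto
    ultimately show ?thesis by linarith
  qed
  moreover have "ln (real (Suc b)) \<ge> T + 1 / l"
    using b(2) by (subst ln_ge_iff) (auto simp: add.commute)
  moreover have "ln (real a) \<le> T + 1 / (2 * l)"
  proof -
    have "ln (real a) \<le> ln (exp T * (1 + exp (-T)))"
      using a apos by (subst ln_le_cancel_iff) (auto simp: algebra_simps exp_minus add_pos_pos)
    also have "... = T + ln (1 + exp (-T))" by (subst ln_mult_pos) (auto intro: add_pos_pos)
    also have "ln (1 + exp (-T)) \<le> exp (-T)" by (rule ln_add_one_self_le_self) simp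
    finally show ?thesis using T by linarith
  qed
  moreover have "1 / l = 1 / (2 * l) + 1 / (2 * l)" using l by simp
  ultimately have S: "(\<Sum>n\<in>{a..b}. 1 / real n) \<ge> 1 / (2 * l)" by linarith
  show ?thesis
  proof (rule that[OF _ _ S])
    fix n assume n: "n \<in> {a..b}"
    hence "real n \<ge> exp T" "real n \<le> exp (T + 1 / l)" using a b by (auto intro: order_trans simp: le_trans)
    moreover from this have "real n > 0" using exp_gt_zero[of T] by linarith
    ultimately show "n > 0 \<and> T \<le> ln (real n) \<and> ln (real n) \<le> T + 1 / l"
      by (auto simp: ln_ge_iff) (metis exp_le_cancel_iff exp_ln of_nat_0_less_iff)
  qed auto
qed

text \<open>By contradiction: a large value of |f| spreads over a window around T where c f >=
  \<eta>/2. The Fejer average at T then gains at least \<eta>/24 near the centre and loses at most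
  D/l outside the window, yet it is at most C/T in absolute value. The constant D does not depend on
  l, so l can be fixed before T is sent to infinity.\<close>

lemma fejer_tauber:
  fixes f :: "nat \<Rightarrow> real" and G :: "complex \<Rightarrow> complex"
  assumes U: "open U" "{s. Re s \<ge> 1} \<subseteq> U" and G: "G holomorphic_on U"
    and f: "\<And>n. \<bar>f n\<bar> \<le> M" "f 0 = 0"
    and sums: "\<And>s. Re s > 1 \<Longrightarrow> (\<lambda>n. of_real (f n) * dpow s n) sums G s"
    and slow: "\<And>\<eta>. \<eta> > 0 \<Longrightarrow> \<exists>h>0. h \<le> 1 \<and> (\<forall>N>0. \<bar>f N\<bar> \<ge> \<eta> \<longrightarrow>
        (\<exists>c T. \<bar>c\<bar> = 1 \<and> T \<ge> ln (real N) - 1 \<and> (\<forall>n>0. \<bar>ln (real n) - T\<bar> \<le> h \<longrightarrow> c * f n \<ge> \<eta> / 2)))"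
  shows "f \<longlonglongrightarrow> 0"
proof (rule LIMSEQ_I, rule ccontr)
  fix \<eta> :: real assume eta: "\<eta> > 0" and "\<not> (\<exists>no. \<forall>n\<ge>no. norm (f n - 0) < \<eta>)"
  hence inf: "\<exists>n\<ge>no. \<bar>f n\<bar> \<ge> \<eta>" for no by (auto simp: not_less)
  from slow[OF eta] obtain h where h: "h > 0" "h \<le> 1" and hw: "\<And>N. N > 0 \<Longrightarrow> \<bar>f N\<bar> \<ge> \<eta> \<Longrightarrow>
        (\<exists>c T. \<bar>c\<bar> = 1 \<and> T \<ge> ln (real N) - 1 \<and> (\<forall>n>0. \<bar>ln (real n) - T\<bar> \<le> h \<longrightarrow> c * f n \<ge> \<eta> / 2))"
    by blast
  have M: "M \<ge> 0" using order_trans[OF abs_ge_zero f(1)[of 0]] .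
  \<comment> \<open>Outside the window the kernel is at most (4/l)(2/h^2)/(1 + u^2); with |f| <= M
    and the bound 6 pi of \<open>sum_arctan_bound\<close> the loss is D/l.\<close>
  define D where "D = 8 * M * 6 * pi / h\<^sup>2"
  have D: "D \<ge> 0" using M by (simp add: D_def)
  \<comment> \<open>The entry 1/h puts the central peak |u| <= 1/l of the kernel inside the window;
    the other entry makes the loss D/l at most \<eta>/48, half of the gain.\<close>
  define l where "l = max (1 / h) (48 * D / \<eta> + 1)"
  have l: "l > 0" "1 / l \<le> h" "D / l \<le> \<eta> / 48"
  proof -
    have lh: "1 / h \<le> l" by (simp add: l_def)
    moreover have "0 < 1 / h" using h by simp
    ultimately show l0: "l > 0" by linarith
    show "1 / l \<le> h" using lh l0 h by (simp add: field_simps)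
    have "48 * D / \<eta> \<le> l" by (simp add: l_def)
    thus "D / l \<le> \<eta> / 48" using l0 eta by (simp add: field_simps)
  qed
  obtain C where C: "\<And>T \<sigma>. T > 0 \<Longrightarrow> 1 < \<sigma> \<Longrightarrow> \<sigma> \<le> 2 \<Longrightarrow>
      summable (\<lambda>n. f n * real n powr (-\<sigma>) * fejer l (T - ln (real n))) \<and>
      \<bar>\<Sum>n. f n * real n powr (-\<sigma>) * fejer l (T - ln (real n))\<bar> \<le> C / T"
    using fejer_series_bound[OF U G f sums l(1)] by blast
  \<comment> \<open>The entry \<open>ln (2 * l)\<close> serves \<open>sum_inverse_window\<close>;
    the last one forces |C|/T below \<eta>/48.\<close>
  define T0 where "T0 = max (max 1 (ln (2 * l))) (96 * \<bar>C\<bar> / \<eta> + 1)"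
  obtain N where N: "N \<ge> nat \<lceil>exp (T0 + 1)\<rceil>" "\<bar>f N\<bar> \<ge> \<eta>" using inf by blast
  have Ne: "real N \<ge> exp (T0 + 1)" using N(1) by linarith
  hence Npos: "N > 0" using exp_gt_zero[of "T0 + 1"] by (metis not_gr_zero of_nat_0 not_less)
  have lnN: "ln (real N) \<ge> T0 + 1" using Ne Npos by (simp add: ln_ge_iff)
  from hw[OF Npos N(2)] obtain c T where c: "\<bar>c\<bar> = 1" and TN: "T \<ge> ln (real N) - 1"
    and cf: "\<And>n. n > 0 \<Longrightarrow> \<bar>ln (real n) - T\<bar> \<le> h \<Longrightarrow> c * f n \<ge> \<eta> / 2" by blast
  have T: "T \<ge> T0" using TN lnN by linarith
  have T1: "T \<ge> 1" "T \<ge> ln (2 * l)" "T \<ge> 96 * \<bar>C\<bar> / \<eta> + 1" using T by (auto simp: T0_def)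
  have "exp (-T) \<le> exp (- ln (2 * l))" using T1 by simp
  also have "... = 1 / (2 * l)" using l by (simp add: exp_minus inverse_eq_divide)
  finally have eT: "exp (-T) \<le> 1 / (2 * l)" .
  obtain W where W: "finite W" "\<And>n. n \<in> W \<Longrightarrow> n > 0 \<and> T \<le> ln (real n) \<and> ln (real n) \<le> T + 1 / l"
    "(\<Sum>n\<in>W. 1 / real n) \<ge> 1 / (2 * l)" using sum_inverse_window[OF l(1) eT] by blast
  \<comment> \<open>\<sigma> is tied to T: for ln n <= T + 2 the factor n^{1-\<sigma>} is then at
    least 1/e, so no limit \<sigma> -> 1 has to be interchanged with the sum.\<close>
  define \<sigma> where "\<sigma> = 1 + 1 / (T + 2)"
  have sg: "1 < \<sigma>" "\<sigma> \<le> 2" using T1 by (auto simp: \<sigma>_def field_simps)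
  define t where "t = (\<lambda>n. f n * real n powr (-\<sigma>) * fejer l (T - ln (real n)))"
  have tsum: "summable t" and tC: "\<bar>suminf t\<bar> \<le> C / T" using C[of T \<sigma>] T1 sg by (auto simp: t_def)
  have F0: "fejer l u \<ge> 0" for u by (rule fejer_nonneg[OF l(1)])
  have low: "c * t n \<ge> - (4 * M / l * (2 / h\<^sup>2)) * (1 / (real n * (1 + (T - ln (real n))\<^sup>2)))" if "n > 0" for n
  proof (cases "\<bar>ln (real n) - T\<bar> \<le> h")
    case True
    have "c * f n \<ge> 0" using cf[OF that True] eta by linarith
    hence "(c * f n) * (real n powr (-\<sigma>) * fejer l (T - ln (real n))) \<ge> 0" using F0 by simp
    hence "c * t n \<ge> 0" by (simp add: t_def mult_ac)
    moreover have "- (4 * M / l * (2 / h\<^sup>2)) * (1 / (real n * (1 + (T - ln (real n))\<^sup>2))) \<le> 0"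
      using M l by (simp add: add_nonneg_nonneg)
    ultimately show ?thesis by linarith
  next
    case False
    define u where "u = T - ln (real n)"
    have u: "\<bar>u\<bar> > h" using False by (simp add: u_def abs_minus_commute)
    have u0: "u \<noteq> 0" using u h by auto
    have h1: "h\<^sup>2 \<le> u\<^sup>2" using u h by (metis abs_le_square_iff abs_of_pos less_imp_le)
    have h2: "h\<^sup>2 \<le> 1" using h by (simp add: power_le_one)
    have "h\<^sup>2 * u\<^sup>2 \<le> 1 * u\<^sup>2" using h2 by (intro mult_right_mono) auto
    hence "h\<^sup>2 * (1 + u\<^sup>2) \<le> u\<^sup>2 + 1 * u\<^sup>2" using h1 by (simp add: distrib_left)
    hence u2: "1 / u\<^sup>2 \<le> (2 / h\<^sup>2) * (1 / (1 + u\<^sup>2))" using u0 h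
      by (simp add: field_simps add_pos_nonneg)
    have "fejer l u \<le> 4 / l * (1 / u\<^sup>2)" using fejer_le[OF l(1) u0] by simp
    also have "... \<le> 4 / l * ((2 / h\<^sup>2) * (1 / (1 + u\<^sup>2)))"
      by (rule mult_left_mono[OF u2]) (use l(1) in simp)
    finally have F1: "fejer l u \<le> 4 / l * ((2 / h\<^sup>2) * (1 / (1 + u\<^sup>2)))" .
    have pw: "real n powr (-\<sigma>) \<le> 1 / real n"
      using powr_mono[of "-\<sigma>" "-1" "real n"] that sg by (simp add: powr_minus divide_inverse)
    have "\<bar>c * t n\<bar> = \<bar>f n\<bar> * (real n powr (-\<sigma>) * fejer l u)" using c F0 by (simp add: t_def u_def abs_mult)
    also have "... \<le> M * ((1 / real n) * (4 / l * ((2 / h\<^sup>2) * (1 / (1 + u\<^sup>2)))))"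
      using f M F0 F1 pw l by (intro mult_mono) auto
    also have "... = (4 * M / l * (2 / h\<^sup>2)) * (1 / (real n * (1 + u\<^sup>2)))" by (simp add: mult_ac)
    finally show ?thesis unfolding u_def mult_minus_left by linarith
  qed
  have inW: "c * t n \<ge> (\<eta> * l / 12) * (1 / real n)" if n: "n \<in> W" for n
  proof -
    have n0: "n > 0" and T1n: "T \<le> ln (real n)" "ln (real n) \<le> T + 1 / l" using W(2)[OF n] by auto
    have "\<bar>ln (real n) - T\<bar> \<le> h" using T1n l by linarith
    hence 1: "c * f n \<ge> \<eta> / 2" using cf n0 by blast
    have 2: "fejer l (T - ln (real n)) \<ge> l / 2" using T1n by (intro fejer_ge l) auto
    have "1 / l \<le> 1" using l h by linarith
    hence "ln (real n) / (T + 2) \<le> 1" using T1n T1 by (simp add: field_simps)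
    hence "exp (-1) \<le> exp (- (ln (real n) / (T + 2)))" by simp
    moreover have "(1/3::real) \<le> exp (-1)" using exp_le by (simp add: exp_minus field_simps)
    moreover have "real n powr (-\<sigma>) = exp (- (ln (real n) / (T + 2))) * (1 / real n)"
    proof -
      have "real n powr (-\<sigma>) = real n powr (- (1 / (T + 2)) + (-1))" by (simp add: \<sigma>_def algebra_simps)
      also have "... = real n powr (- (1 / (T + 2))) * real n powr (-1)" by (rule powr_add)
      also have "real n powr (- (1 / (T + 2))) = exp (- (ln (real n) / (T + 2)))" using n0 by (simp add: powr_def)
      also have "real n powr (-1) = 1 / real n" using n0 by (simp add: powr_minus_divide)
      finally show ?thesis .
    qed
    moreover have "x * (1 / real n) \<le> y * (1 / real n)" if "x \<le> y" for x y
      using that by (intro mult_right_mono) auto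
    ultimately have 3: "real n powr (-\<sigma>) \<ge> (1/3) * (1 / real n)" by (metis order_trans)
    have "(\<eta> / 2) * ((1/3) * (1 / real n) * (l / 2)) \<le> (c * f n) * (real n powr (-\<sigma>) * fejer l (T - ln (real n)))"
      using 1 2 3 eta l F0 by (intro mult_mono) auto
    thus ?thesis by (simp add: t_def mult_ac)
  qed
  have part: "(\<Sum>n<K. c * t n) \<ge> \<eta> / 24 - D / l" if K: "W \<subseteq> {..<K}" for K
  proof -
    define V where "V = {1..<K} - W"
    have W0: "W \<subseteq> {1..<K}" using K W(2) by fastforce
    have "(\<Sum>n<K. c * t n) = (\<Sum>n\<in>{1..<K}. c * t n)"
      by (rule sum.mono_neutral_right) (auto simp: t_def f(2) not_le Suc_le_eq)
    also have "... = (\<Sum>n\<in>V. c * t n) + (\<Sum>n\<in>W. c * t n)"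
      unfolding V_def using W0 by (subst sum.subset_diff[of W]) auto
    finally have eq: "(\<Sum>n<K. c * t n) = (\<Sum>n\<in>V. c * t n) + (\<Sum>n\<in>W. c * t n)" .
    have "\<eta> / 24 = (\<eta> * l / 12) * (1 / (2 * l))" using l by simp
    also have "... \<le> (\<eta> * l / 12) * (\<Sum>n\<in>W. 1 / real n)"
      using W(3) eta l by (intro mult_left_mono) auto
    also have "... \<le> (\<Sum>n\<in>W. c * t n)"
      unfolding sum_distrib_left by (intro sum_mono inW)
    finally have BW: "(\<Sum>n\<in>W. c * t n) \<ge> \<eta> / 24" .
    have "(\<Sum>n\<in>V. 1 / (real n * (1 + (T - ln (real n))\<^sup>2))) \<le> (\<Sum>n=1..K. 1 / (real n * (1 + (T - ln (real n))\<^sup>2)))"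
      by (intro sum_mono2) (auto simp: V_def add_nonneg_nonneg)
    also have "... \<le> 6 * pi" by (rule sum_arctan_bound)
    finally have "(4 * M / l * (2 / h\<^sup>2)) * (\<Sum>n\<in>V. 1 / (real n * (1 + (T - ln (real n))\<^sup>2))) \<le> (4 * M / l * (2 / h\<^sup>2)) * (6 * pi)"
      using M l by (intro mult_left_mono) auto
    also have "(4 * M / l * (2 / h\<^sup>2)) * (6 * pi) = D / l" by (simp add: D_def mult_ac)
    finally have "- (D / l) \<le> (\<Sum>n\<in>V. - (4 * M / l * (2 / h\<^sup>2)) * (1 / (real n * (1 + (T - ln (real n))\<^sup>2))))"
      unfolding sum_distrib_left[symmetric] mult_minus_left sum_negf by linarith
    also have "... \<le> (\<Sum>n\<in>V. c * t n)"
      by (intro sum_mono low) (auto simp: V_def)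
    finally show ?thesis using eq BW by linarith
  qed
  obtain K0 where K0: "W \<subseteq> {..<K0}" using W(1) by (meson finite_nat_iff_bounded)
  have "(\<lambda>K. \<Sum>n<K. c * t n) \<longlonglongrightarrow> c * suminf t"
    using summable_mult[OF tsum, of c] suminf_mult[OF tsum, of c] by (metis summable_LIMSEQ)
  hence "c * suminf t \<ge> \<eta> / 24 - D / l"
  proof (rule tendsto_lowerbound)
    show "\<forall>\<^sub>F K in sequentially. \<eta> / 24 - D / l \<le> (\<Sum>n<K. c * t n)"
      using eventually_ge_at_top[of K0] by eventually_elim (intro part, use K0 in auto)
  qed simp
  hence "\<eta> / 48 \<le> c * suminf t" using l(3) by linarith
  also have "... \<le> \<bar>c\<bar> * \<bar>suminf t\<bar>" by (metis abs_ge_self abs_mult)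
  also have "... \<le> C / T" using c tC by simp
  also have "... \<le> \<bar>C\<bar> / T" using T1 by (intro divide_right_mono) auto
  finally have "\<eta> / 48 * T \<le> \<bar>C\<bar>" using T1 by (simp add: field_simps)
  moreover have "\<eta> / 48 * (96 * \<bar>C\<bar> / \<eta> + 1) \<le> \<eta> / 48 * T" using T1(3) eta by (intro mult_left_mono) auto
  moreover have "\<eta> / 48 * (96 * \<bar>C\<bar> / \<eta> + 1) = 2 * \<bar>C\<bar> + \<eta> / 48" using eta by (simp add: field_simps)
  ultimately show False using eta abs_ge_zero[of C] by linarith
qed

text \<open>\<open>fejer_tauber\<close> is applied to f(n) = S(n)/n - \<rho>, with S the summatory
  function. Its Dirichlet series comes from Abel summation: n^{-s} - (n+1)^{-s} equals s n^{-s-1}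
  minus \<open>zterm (s + 1) n\<close>, and as S grows at most linearly the correction R is
  holomorphic for Re s > 0. Dividing by s and subtracting \<rho> zeta(s) removes the pole at
  1.\<close>

theorem wiener_ikehara:
  fixes b :: "nat \<Rightarrow> real" and \<Phi> :: "complex \<Rightarrow> complex"
  assumes b: "\<And>n. b n \<ge> 0" and K: "\<And>n. (\<Sum>k\<le>n. b k) \<le> K * real n"
    and U: "open U" "{s. Re s \<ge> 1} \<subseteq> U" and \<Phi>: "\<Phi> holomorphic_on U" and \<rho>: "\<rho> \<ge> 0"
    and sums: "\<And>s. Re s > 1 \<Longrightarrow> (\<lambda>n. of_real (b n) * dpow s n) sums (of_real \<rho> / (s - 1) + \<Phi> s)"
  shows "(\<lambda>n. (\<Sum>k\<le>n. b k) / real n) \<longlonglongrightarrow> \<rho>"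
proof -
  define S where "S = (\<lambda>n. \<Sum>k\<le>n. b k)"
  have S0: "S n \<ge> 0" for n unfolding S_def by (intro sum_nonneg b)
  have Smono: "S m \<le> S n" if "m \<le> n" for m n unfolding S_def using that b by (intro sum_mono2) auto
  have SK: "S n \<le> K * real n" for n using K by (simp add: S_def)
  have Kpos: "K \<ge> 0" using order_trans[OF S0 SK[of 1]] by simp
  have SZ: "S 0 = 0" using SK[of 0] S0[of 0] by simp
  define f where "f = (\<lambda>n. if n = 0 then 0 else S n / real n - \<rho>)"
  define R where "R = (\<lambda>s. \<Sum>n. of_real (S n) * zterm (s + 1) n)"
  have bd: "norm (of_real (S n) * zterm (s + 1) n) \<le> K * (1 + norm s) ^ 2 * real n powr (0 - 1 - Re s)"
    if "Re s > 0" for n s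
  proof (cases "n = 0")
    case False
    have "norm (of_real (S n) * zterm (s + 1) n) \<le> (K * real n) * (norm s * norm (s + 1) * real n powr (- Re (s + 1) - 1))"
      unfolding norm_mult using zterm_bound[of n "s + 1"] that False S0 SK Kpos by (intro mult_mono) auto
    also have "norm s * norm (s + 1) \<le> (1 + norm s) * (1 + norm s)"
      using norm_triangle_ineq[of s 1] by (intro mult_mono) auto
    also have "(K * real n) * ((1 + norm s) * (1 + norm s) * real n powr (- Re (s + 1) - 1))
       = K * (1 + norm s) ^ 2 * (real n * real n powr (- Re (s + 1) - 1))" by (simp add: power2_eq_square)
    also have "real n * real n powr (- Re (s + 1) - 1) = real n powr (0 - 1 - Re s)"
      using False by (simp add: powr_mult_base algebra_simps)
    finally show ?thesis using Kpos by (simp add: mult_left_mono mult_right_mono)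
  qed (simp add: zterm_def)
  have hol: "(\<lambda>s. of_real (S n) * zterm (s + 1) n) holomorphic_on A" for n A
    unfolding zterm_def by (cases "n = 0") (auto intro!: holomorphic_intros)
  note RR = holomorphic_suminf_poly_bound[where f = "\<lambda>n s. of_real (S n) * zterm (s + 1) n" and K = K and c = 0, OF hol bd Kpos]
  have holR: "R holomorphic_on {s. Re s > 0}" unfolding R_def by (rule RR(1))
  \<comment> \<open>This is zeta(s) - 1/(s-1), with its removable singularity filled in.\<close>
  define Wf where "Wf = (\<lambda>s. if s = 1 then deriv zeta_ext 1 else (zeta_ext s - zeta_ext 1) / (s - 1))"
  have holW: "Wf holomorphic_on {s. Re s > 0}"
    unfolding Wf_def by (rule pole_lemma_open[OF holomorphic_zeta_ext open_Re_gt])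
  define V where "V = U \<inter> {s. Re s > 0}"
  \<comment> \<open>The summand - \<rho> in the numerator comes from 1/(s(s-1)) = 1/(s-1) -
    1/s.\<close>
  define G where "G = (\<lambda>s. (\<Phi> s + R s - of_real \<rho>) / s - of_real \<rho> * Wf s)"
  have V: "open V" "{s. Re s \<ge> 1} \<subseteq> V" using U open_Re_gt by (auto simp: V_def)
  have "s \<noteq> 0" if "s \<in> V" for s using that by (auto simp: V_def)
  hence holG: "G holomorphic_on V" unfolding G_def
    by (intro holomorphic_intros holomorphic_on_subset[OF \<Phi>] holomorphic_on_subset[OF holR] holomorphic_on_subset[OF holW])
       (auto simp: V_def)
  have fs: "(\<lambda>n. of_real (f n) * dpow s n) sums G s" if s: "Re s > 1" for s
  proof -
    have s0: "s \<noteq> 0" "s \<noteq> 1" using s by auto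
    have nK: "norm (\<Sum>k\<le>n. complex_of_real (b k)) \<le> K * real n" for n
      using SK[of n] S0[of n] by (simp add: S_def flip: of_real_sum)
    have "(\<lambda>n. of_real (b n) * dpow s n) sums (\<Sum>n. (\<Sum>k\<le>n. of_real (b k)) * (dpow s n - dpow s (Suc n)))"
      and sm: "summable (\<lambda>n. (\<Sum>k\<le>n. of_real (b k)) * (dpow s n - dpow s (Suc n)))"
      using dirichlet_abel[OF nK s] by auto
    hence "(\<Sum>n. (\<Sum>k\<le>n. of_real (b k)) * (dpow s n - dpow s (Suc n))) = of_real \<rho> / (s - 1) + \<Phi> s"
      using sums[OF s] by (metis sums_unique2)
    hence 1: "(\<lambda>n. of_real (S n) * (dpow s n - dpow s (Suc n))) sums (of_real \<rho> / (s - 1) + \<Phi> s)"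
      using sm by (simp add: sums_iff S_def)
    have 2: "(\<lambda>n. of_real (S n) * zterm (s + 1) n) sums R s"
      unfolding R_def by (rule summable_sums, rule summable_norm_cancel, rule RR(2)) (use s in linarith)+
    have 3: "(\<lambda>n. of_real \<rho> * (if n = 0 then 0 else dpow s n)) sums (of_real \<rho> * (zeta_ext s / (s - 1)))"
      by (intro sums_mult zeta_sums s)
    have "(\<lambda>n. (of_real (S n) * (dpow s n - dpow s (Suc n)) + of_real (S n) * zterm (s + 1) n) / s
        - of_real \<rho> * (if n = 0 then 0 else dpow s n)) sums
        ((of_real \<rho> / (s - 1) + \<Phi> s + R s) / s - of_real \<rho> * (zeta_ext s / (s - 1)))"
      by (intro sums_diff sums_divide sums_add 1 2 3)
    also have "(\<lambda>n. (of_real (S n) * (dpow s n - dpow s (Suc n)) + of_real (S n) * zterm (s + 1) n) / s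
        - of_real \<rho> * (if n = 0 then 0 else dpow s n)) = (\<lambda>n. of_real (f n) * dpow s n)"
    proof
      fix n
      show "(of_real (S n) * (dpow s n - dpow s (Suc n)) + of_real (S n) * zterm (s + 1) n) / s
        - of_real \<rho> * (if n = 0 then 0 else dpow s n) = of_real (f n) * dpow s n"
      proof (cases "n = 0")
        case False
        have "dpow 1 n = exp (of_real (- ln (real n)))" by (simp add: dpow_def)
        also have "... = of_real (exp (- ln (real n)))" by (rule exp_of_real)
        also have "... = 1 / of_nat n" using False by (simp add: exp_minus inverse_eq_divide)
        finally have "dpow (s + 1) n = dpow s n / of_nat n" by (simp add: dpow_add)
        hence d: "dpow (1 + s) n = dpow s n / of_nat n" by (simp add: add.commute)
        have "of_real (S n) * (dpow s n - dpow s (Suc n)) + of_real (S n) * zterm (s + 1) n = s * (of_real (S n) * dpow s n / of_nat n)"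
          using False by (simp add: zterm_def d algebra_simps)
        thus ?thesis using False s0 by (simp add: f_def algebra_simps)
      qed (simp add: f_def SZ)
    qed
    also have "(of_real \<rho> / (s - 1) + \<Phi> s + R s) / s - of_real \<rho> * (zeta_ext s / (s - 1)) = G s"
    proof -
      have "of_real \<rho> / (s - 1) / s = of_real \<rho> / (s - 1) - of_real \<rho> / s" using s0 by (simp add: field_simps)
      thus ?thesis using s0 by (simp add: G_def Wf_def add_divide_distrib diff_divide_distrib algebra_simps)
    qed
    finally show ?thesis .
  qed
  have fM: "\<bar>f n\<bar> \<le> K + \<rho>" for n
  proof (cases "n = 0")
    case False
    have "S n / real n \<le> K" using SK[of n] False by (simp add: field_simps)
    moreover have "S n / real n \<ge> 0" using S0 by simp
    ultimately show ?thesis using False \<rho> Kpos by (simp add: f_def abs_le_iff)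
  qed (use \<rho> Kpos in \<open>simp add: f_def\<close>)
  have "f \<longlonglongrightarrow> 0"
  proof (rule fejer_tauber[OF V holG fM _ fs])
    fix \<eta> :: real assume eta: "\<eta> > 0"
    obtain h where h: "0 < h" "h \<le> 1" "(\<rho> + \<eta>) * exp (-h) \<ge> \<rho> + \<eta> / 2" "(\<rho> - \<eta>) * exp h \<le> \<rho> - \<eta> / 2"
      by (rule exists_window[OF \<rho> eta])
    show "\<exists>h>0. h \<le> 1 \<and> (\<forall>N>0. \<bar>f N\<bar> \<ge> \<eta> \<longrightarrow>
        (\<exists>c T. \<bar>c\<bar> = 1 \<and> T \<ge> ln (real N) - 1 \<and> (\<forall>n>0. \<bar>ln (real n) - T\<bar> \<le> h \<longrightarrow> c * f n \<ge> \<eta> / 2)))"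
    proof (rule exI[of _ "h / 2"], intro conjI allI impI)
      fix N :: nat assume N: "N > 0" and fN: "\<bar>f N\<bar> \<ge> \<eta>"
      show "\<exists>c T. \<bar>c\<bar> = 1 \<and> T \<ge> ln (real N) - 1 \<and> (\<forall>n>0. \<bar>ln (real n) - T\<bar> \<le> h / 2 \<longrightarrow> c * f n \<ge> \<eta> / 2)"
      \<comment> \<open>Monotonicity of S spreads an excess to the right of N and a deficit to the
        left; the window of radius h/2 is centred accordingly.\<close>
      proof (cases "f N \<ge> 0")
        case True
        hence SN: "S N / real N \<ge> \<rho> + \<eta>" using fN N by (simp add: f_def)
        have "f n \<ge> \<eta> / 2" if n: "n > 0" "\<bar>ln (real n) - (ln (real N) + h / 2)\<bar> \<le> h / 2" for n
        proof -
          have l1: "ln (real N) \<le> ln (real n)" "ln (real n) \<le> ln (real N) + h" using n(2) by linarith+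
          have Nn: "N \<le> n" using l1(1) n N by simp
          have "real n = exp (ln (real n))" using n by simp
          also have "... \<le> exp (ln (real N) + h)" using l1 by simp
          also have "... = real N * exp h" using N by (simp add: exp_add)
          finally have "exp (-h) \<le> real N / real n" using n N by (simp add: exp_minus field_simps)
          hence "(\<rho> + \<eta>) * exp (-h) \<le> (S N / real N) * (real N / real n)"
            using SN eta \<rho> by (intro mult_mono) auto
          also have "... = S N / real n" using N by simp
          also have "... \<le> S n / real n" using Smono[OF Nn] by (simp add: divide_right_mono)
          finally have "\<rho> + \<eta> / 2 \<le> S n / real n" using h(3) by linarith
          moreover have "f n = S n / real n - \<rho>" using n(1) by (simp add: f_def)
          ultimately show ?thesis by linarith
        qed
        hence "\<forall>n>0. \<bar>ln (real n) - (ln (real N) + h / 2)\<bar> \<le> h / 2 \<longrightarrow> 1 * f n \<ge> \<eta> / 2" by simp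
        moreover have "ln (real N) + h / 2 \<ge> ln (real N) - 1" "\<bar>1::real\<bar> = 1" using h by auto
        ultimately show ?thesis by blast
      next
        case False
        hence SN: "S N / real N \<le> \<rho> - \<eta>" using fN N by (simp add: f_def)
        have neg: "f n \<le> - (\<eta> / 2)" if n: "n > 0" "\<bar>ln (real n) - (ln (real N) - h / 2)\<bar> \<le> h / 2" for n
        proof -
          have l1: "ln (real n) \<le> ln (real N)" "ln (real n) \<ge> ln (real N) - h" using n(2) by linarith+
          have Nn: "n \<le> N" using l1(1) n N by simp
          have "real N = exp (ln (real N))" using N by simp
          also have "... \<le> exp (ln (real n) + h)" using l1 by simp
          also have "... = real n * exp h" using n by (simp add: exp_add)
          finally have e: "real N / real n \<le> exp h" using n N by (simp add: field_simps)
          have "S n / real n \<le> S N / real n" using Smono[OF Nn] by (simp add: divide_right_mono)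
          also have "... = (S N / real N) * (real N / real n)" using N by simp
          also have "... \<le> (\<rho> - \<eta>) * exp h"
          proof (intro mult_mono SN e)
            have "0 \<le> S N / real N" using S0[of N] by simp
            thus "0 \<le> \<rho> - \<eta>" using SN by linarith
          qed auto
          finally have "S n / real n \<le> \<rho> - \<eta> / 2" using h(4) by linarith
          moreover have "f n = S n / real n - \<rho>" using n(1) by (simp add: f_def)
          ultimately show ?thesis by linarith
        qed
        have "\<forall>n>0. \<bar>ln (real n) - (ln (real N) - h / 2)\<bar> \<le> h / 2 \<longrightarrow> (-1) * f n \<ge> \<eta> / 2"
        proof (intro allI impI)
          fix n :: nat assume "0 < n" "\<bar>ln (real n) - (ln (real N) - h / 2)\<bar> \<le> h / 2"
          from neg[OF this] show "(-1) * f n \<ge> \<eta> / 2" by linarith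
        qed
        moreover have "ln (real N) - h / 2 \<ge> ln (real N) - 1" "\<bar>-1::real\<bar> = 1" using h by auto
        ultimately show ?thesis by blast
      qed
    qed (use h in auto)
  qed (simp add: f_def)
  hence "(\<lambda>n. f n + \<rho>) \<longlonglongrightarrow> 0 + \<rho>" by (intro tendsto_intros)
  moreover have "eventually (\<lambda>n. f n + \<rho> = S n / real n) sequentially"
    using eventually_gt_at_top[of 0] by eventually_elim (simp add: f_def)
  ultimately show ?thesis by (simp add: S_def tendsto_cong)
qed

section \<open>Logarithmic derivatives and convolution of Dirichlet series\<close>

lemma logderiv_order:
  fixes M :: "complex \<Rightarrow> complex"
  assumes hol: "M holomorphic_on S" and S: "open S" "connected S" and s0: "s0 \<in> S" and nz: "z \<in> S" "M z \<noteq> 0"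
  obtains m :: nat where "((\<lambda>\<sigma>. of_real \<sigma> * (deriv M (s0 + of_real \<sigma>) / M (s0 + of_real \<sigma>))) \<longlongrightarrow> of_nat m) (at_right (0::real))"
    "m = 0 \<longleftrightarrow> M s0 \<noteq> 0" "eventually (\<lambda>\<sigma>. M (s0 + of_real \<sigma>) \<noteq> 0) (at_right (0::real))"
proof -
  \<comment> \<open>The exact power of w - s0 is split off. The exponent n is the order of vanishing
    at s0, and n = 0 covers a nonzero value.\<close>
  obtain g r n where r: "r > 0" "ball s0 r \<subseteq> S" and g: "g holomorphic_on ball s0 r"
     and M: "\<And>w. w \<in> ball s0 r \<Longrightarrow> M w = (w - s0) ^ n * g w" and gnz: "\<And>w. w \<in> ball s0 r \<Longrightarrow> g w \<noteq> 0"
  proof (cases "M s0 = 0")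
    case True
    have "\<not> M constant_on S" using True nz s0 unfolding constant_on_def by metis
    from holomorphic_factor_zero_nonconstant[OF hol S s0 True this] show ?thesis using that by metis
  next
    case False
    have "continuous_on S M" using hol by (rule holomorphic_on_imp_continuous_on)
    hence "open (M -` (- {0}) \<inter> S)" using S by (simp add: continuous_on_open_vimage open_Compl)
    then obtain r where r: "r > 0" "ball s0 r \<subseteq> M -` (- {0}) \<inter> S" using False s0
      by (metis IntI open_contains_ball vimageI ComplI singletonD)
    show ?thesis
    proof (rule that[of r M 0])
      show "M holomorphic_on ball s0 r" using hol r(2) by (auto intro: holomorphic_on_subset)
    qed (use r in auto)
  qed
  have ev: "eventually (\<lambda>\<sigma>::real. 0 < \<sigma> \<and> \<sigma> < r) (at_right 0)"
    using eventually_at_right_real[OF r(1)] by simp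
  have b: "s0 + of_real \<sigma> \<in> ball s0 r" if "0 < \<sigma> \<and> \<sigma> < r" for \<sigma> using that by (simp add: dist_norm)
  have ev3: "eventually (\<lambda>\<sigma>. M (s0 + of_real \<sigma>) \<noteq> 0) (at_right (0::real))"
    using ev by eventually_elim (use M b gnz in auto)
  have gd: "(g has_field_derivative deriv g w) (at w)" if "w \<in> ball s0 r" for w
    using g that by (intro holomorphic_derivI) auto
  have "((\<lambda>\<sigma>. of_nat n + of_real \<sigma> * (deriv g (s0 + of_real \<sigma>) / g (s0 + of_real \<sigma>))) \<longlongrightarrow>
      of_nat n + of_real 0 * (deriv g (s0 + of_real 0) / g (s0 + of_real 0))) (at_right (0::real))"
  proof -
    have cg: "isCont g s0" "isCont (deriv g) s0"
      using g holomorphic_deriv[OF g] r by (auto intro!: holomorphic_on_imp_continuous_on intro: continuous_on_interior[of "ball s0 r"])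
    have t: "((\<lambda>\<sigma>. s0 + complex_of_real \<sigma>) \<longlongrightarrow> s0) (at_right 0)" by (auto intro!: tendsto_eq_intros)
    have "((\<lambda>\<sigma>. of_nat n + of_real \<sigma> * (deriv g (s0 + of_real \<sigma>) / g (s0 + of_real \<sigma>))) \<longlongrightarrow>
      of_nat n + of_real 0 * (deriv g s0 / g s0)) (at_right (0::real))"
      using gnz[of s0] r(1)
      by (intro tendsto_intros isCont_tendsto_compose[OF cg(1) t] isCont_tendsto_compose[OF cg(2) t]) auto
    thus ?thesis by simp
  qed
  moreover have "eventually (\<lambda>\<sigma>. of_nat n + of_real \<sigma> * (deriv g (s0 + of_real \<sigma>) / g (s0 + of_real \<sigma>))
      = of_real \<sigma> * (deriv M (s0 + of_real \<sigma>) / M (s0 + of_real \<sigma>))) (at_right (0::real))"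
    using ev
  proof eventually_elim
    case (elim \<sigma>)
    define w where "w = s0 + complex_of_real \<sigma>"
    have w: "w \<in> ball s0 r" using b elim by (simp add: w_def)
    have "((\<lambda>w. (w - s0) ^ n * g w) has_field_derivative (of_nat n * (w - s0) ^ (n - 1) * g w + (w - s0) ^ n * deriv g w)) (at w)"
      by (rule derivative_eq_intros refl gd w | simp)+
    hence "(M has_field_derivative (of_nat n * (w - s0) ^ (n - 1) * g w + (w - s0) ^ n * deriv g w)) (at w)"
      by (rule has_field_derivative_transform_within_open[where S = "ball s0 r"]) (use w M in auto)
    hence "deriv M w = of_nat n * (w - s0) ^ (n - 1) * g w + (w - s0) ^ n * deriv g w" by (rule DERIV_imp_deriv)
    moreover have "M w = (w - s0) ^ n * g w" using M w by blast
    moreover have "w - s0 = of_real \<sigma>" "complex_of_real \<sigma> \<noteq> 0" using elim by (auto simp: w_def)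
    moreover have "g w \<noteq> 0" using gnz w by blast
    ultimately have "of_real \<sigma> * (deriv M w / M w) = of_nat n + of_real \<sigma> * (deriv g w / g w)"
      by (cases n) (auto simp: field_simps)
    thus ?case by (simp add: w_def)
  qed
  ultimately have "((\<lambda>\<sigma>. of_real \<sigma> * (deriv M (s0 + of_real \<sigma>) / M (s0 + of_real \<sigma>))) \<longlongrightarrow> of_nat n) (at_right (0::real))"
    by (simp add: tendsto_cong)
  moreover have "n = 0 \<longleftrightarrow> M s0 \<noteq> 0" using M[of s0] gnz[of s0] r(1) by (cases n) auto
  ultimately show ?thesis using that ev3 by blast
qed

text \<open>Ordered factorizations of n. The set is infinite for n = 0, so the convolution
  identities are stated for n > 0.\<close>

definition mulpairs :: "nat \<Rightarrow> (nat \<times> nat) set" where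
  "mulpairs n = {(i, j). i * j = n}"

lemma finite_mulpairs: "n > 0 \<Longrightarrow> finite (mulpairs n)"
  by (rule finite_subset[of _ "{..n} \<times> {..n}"]) (auto simp: mulpairs_def)

text \<open>The double series over (i, j) converges absolutely and may be summed along the fibres ij
  = n. The fibre over 0 is infinite but contributes 0, as both sequences vanish at 0.\<close>

lemma dirichlet_product:
  fixes a b :: "nat \<Rightarrow> complex"
  assumes a: "summable (\<lambda>n. norm (a n * dpow s n))" "a 0 = 0" and b: "summable (\<lambda>n. norm (b n * dpow s n))" "b 0 = 0"
    and c: "\<And>n. n > 0 \<Longrightarrow> c n = (\<Sum>(i, j)\<in>mulpairs n. a i * b j)" "c 0 = 0"
  shows "(\<lambda>n. c n * dpow s n) sums ((\<Sum>n. a n * dpow s n) * (\<Sum>n. b n * dpow s n))"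
proof -
  let ?A = "\<lambda>n. a n * dpow s n" and ?B = "\<lambda>n. b n * dpow s n"
  have hA: "(?A has_sum suminf ?A) UNIV" and hB: "(?B has_sum suminf ?B) UNIV"
    using a b by (auto intro!: norm_summable_imp_has_sum summable_sums summable_norm_cancel)
  have nA: "((\<lambda>n. norm (?A n)) has_sum (\<Sum>n. norm (?A n))) UNIV" and nB: "((\<lambda>n. norm (?B n)) has_sum (\<Sum>n. norm (?B n))) UNIV"
    using a b by (auto intro!: norm_summable_imp_has_sum summable_sums)
  have "(\<lambda>ij. norm (?A (fst ij)) * norm (?B (snd ij))) summable_on (UNIV \<times> UNIV)"
  proof (rule summable_on_SigmaI)
    show "((\<lambda>j. norm (?A (fst (i, j))) * norm (?B (snd (i, j)))) has_sum norm (?A i) * (\<Sum>n. norm (?B n))) UNIV" for i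
      unfolding fst_conv snd_conv by (intro has_sum_cmult_right nB)
    show "(\<lambda>i. norm (?A i) * (\<Sum>n. norm (?B n))) summable_on UNIV"
      using has_sum_cmult_left[OF nA] by (auto simp: summable_on_def)
  qed auto
  hence "(\<lambda>ij. norm (?A (fst ij) * ?B (snd ij))) summable_on (UNIV \<times> UNIV)" by (simp only: norm_mult)
  hence prods: "(\<lambda>ij. ?A (fst ij) * ?B (snd ij)) summable_on (UNIV \<times> UNIV)"
    by (rule Infinite_Sum.abs_summable_summable)
  have "((\<lambda>ij. ?A (fst ij) * ?B (snd ij)) has_sum (suminf ?A * suminf ?B)) (UNIV \<times> UNIV)"
  proof (rule has_sum_SigmaI[OF _ _ prods])
    show "((\<lambda>j. ?A (fst (i, j)) * ?B (snd (i, j))) has_sum ?A i * suminf ?B) UNIV" for i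
      unfolding fst_conv snd_conv by (intro has_sum_cmult_right hB)
    show "((\<lambda>i. ?A i * suminf ?B) has_sum (suminf ?A * suminf ?B)) UNIV" by (intro has_sum_cmult_left hA)
  qed
  hence hs: "((\<lambda>(i, j). ?A i * ?B j) has_sum (suminf ?A * suminf ?B)) (UNIV \<times> UNIV)"
    by (simp add: case_prod_unfold)
  have "((\<lambda>(n, (i, j)). ?A i * ?B j) has_sum (suminf ?A * suminf ?B)) (Sigma UNIV mulpairs)"
  proof (subst has_sum_reindex_bij_witness[where i = "\<lambda>(i, j). (i * j, (i, j))" and j = "\<lambda>(n, ij). ij" and T = "UNIV \<times> UNIV" and h = "\<lambda>(i, j). ?A i * ?B j"])
    show "((\<lambda>(i, j). ?A i * ?B j) has_sum (suminf ?A * suminf ?B)) (UNIV \<times> UNIV)" by (rule hs)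
  qed (auto simp: mulpairs_def)
  hence "((\<lambda>n. c n * dpow s n) has_sum (suminf ?A * suminf ?B)) UNIV"
  proof (rule has_sum_SigmaD)
    fix n :: nat
    show "((\<lambda>ij. case (n, ij) of (n, (i, j)) \<Rightarrow> ?A i * ?B j) has_sum c n * dpow s n) (mulpairs n)"
    proof (cases "n = 0")
      case True
      show ?thesis unfolding True c(2) mult_zero_left
        by (rule has_sum_0) (auto simp: mulpairs_def a(2) b(2))
    next
      case False
      have "(\<Sum>(i, j)\<in>mulpairs n. ?A i * ?B j) = (\<Sum>(i, j)\<in>mulpairs n. a i * b j * dpow s n)"
        using False by (intro sum.cong) (auto simp: mulpairs_def dpow_mult)
      also have "... = c n * dpow s n" using False c(1) by (simp add: sum_distrib_right case_prod_unfold)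
      finally have "c n * dpow s n = (\<Sum>ij\<in>mulpairs n. case (n, ij) of (n, (i, j)) \<Rightarrow> ?A i * ?B j)" by simp
      thus ?thesis using False finite_mulpairs[of n] by (simp add: has_sum_finite)
    qed
  qed
  thus ?thesis by (rule has_sum_imp_sums)
qed

text \<open>Termwise differentiation; the local majorant near x is the absolute series at the
  midpoint between 1 and Re x.\<close>

lemma dirichlet_deriv:
  fixes a :: "nat \<Rightarrow> complex" and a0 :: "nat \<Rightarrow> real"
  assumes a0: "\<And>n. norm (a n) \<le> a0 n" "\<And>n. (\<Sum>k\<le>n. a0 k) \<le> K * real n" and s: "Re s > 1"
  shows "((\<lambda>s. \<Sum>n. a n * dpow s n) has_field_derivative - (\<Sum>n. a n * of_real (ln (real n)) * dpow s n)) (at s)"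
proof -
  define S where "S = {s. Re s > 1}"
  have az: "a 0 = 0" using a0(1)[of 0] a0(2)[of 0] using order_trans[of "norm (a 0)" "a0 0" 0] by simp
  have "\<exists>g g'. \<forall>x \<in> S. ((\<lambda>n. a n * dpow x n) sums g x) \<and> ((\<lambda>n. a n * (- of_real (ln (real n)) * dpow x n)) sums g' x) \<and> (g has_field_derivative g' x) (at x)"
  proof (rule series_and_derivative_comparison_complex)
    show "open S" by (simp add: S_def open_Re_gt)
    show "((\<lambda>x. a n * dpow x n) has_field_derivative a n * (- of_real (ln (real n)) * dpow x n)) (at x)" for n x
      by (auto intro!: derivative_eq_intros)
    fix x assume "x \<in> S"
    hence x: "Re x > 1" by (simp add: S_def)
    define y where "y = complex_of_real ((Re x + 1) / 2)"
    have y: "Re y > 1" using x by (simp add: y_def)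
    have "summable (\<lambda>n. norm (a n * dpow y n))" by (rule dirichlet_abs_summable[OF a0 y])
    hence sm: "summable (\<lambda>n. complex_of_real (norm (a n * dpow y n)))" by (rule summable_of_real)
    have "norm (a n * dpow z n) \<le> norm (complex_of_real (norm (a n * dpow y n)))" if z: "z \<in> ball x ((Re x - 1) / 2) \<inter> S" for n z
    proof (cases "n = 0")
      case False
      have "Re z > (Re x + 1) / 2" using Re_ball_bounds[OF x, of z] z by auto
      hence "real n powr (- Re z) \<le> real n powr (- Re y)" using False by (intro powr_mono) (auto simp: y_def)
      thus ?thesis using False by (simp add: norm_mult norm_dpow mult_left_mono)
    qed (simp add: az)
    thus "\<exists>d h. 0 < d \<and> summable h \<and> range h \<subseteq> \<real>\<^sub>\<ge>\<^sub>0 \<and> (\<forall>\<^sub>F n in sequentially. \<forall>z\<in>ball x d \<inter> S. cmod(a n * dpow z n) \<le> cmod (h n))"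
      using sm x by (intro exI[of _ "(Re x - 1) / 2"] exI[of _ "\<lambda>n. complex_of_real (norm (a n * dpow y n))"]) auto
  qed
  then obtain g g' where g: "\<And>x. x \<in> S \<Longrightarrow> ((\<lambda>n. a n * dpow x n) sums g x)"
     "\<And>x. x \<in> S \<Longrightarrow> ((\<lambda>n. a n * (- of_real (ln (real n)) * dpow x n)) sums g' x)"
     "\<And>x. x \<in> S \<Longrightarrow> (g has_field_derivative g' x) (at x)" by blast
  have sS: "s \<in> S" using s by (simp add: S_def)
  have "(\<lambda>n. - (a n * of_real (ln (real n)) * dpow s n)) sums g' s" using g(2)[OF sS] by (simp add: mult_ac)
  hence "(\<lambda>n. - (- (a n * of_real (ln (real n)) * dpow s n))) sums (- g' s)" by (rule sums_minus)
  hence g': "g' s = - (\<Sum>n. a n * of_real (ln (real n)) * dpow s n)" by (simp add: sums_iff)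
  show ?thesis unfolding g'[symmetric]
    by (rule has_field_derivative_transform_within_open[OF g(3)[OF sS], where S = S])
       (use g(1) sS in \<open>auto simp: S_def open_Re_gt sums_iff\<close>)
qed

text \<open>The exponent \<open>e\<close> is the order of the pole of the Dirichlet series of \<open>a\<close> at \<open>s = 1\<close>.\<close>

lemma dirichlet_log_order:
  fixes a b :: "nat \<Rightarrow> complex" and a0 b0 :: "nat \<Rightarrow> real" and e :: nat
  assumes a0: "\<And>n. norm (a n) \<le> a0 n" "\<And>n. (\<Sum>k\<le>n. a0 k) \<le> K * real n" and a1: "a 1 = 1"
    and b0: "\<And>n. norm (b n) \<le> b0 n" "\<And>n. (\<Sum>k\<le>n. b0 k) \<le> K' * real n"
    and conv: "\<And>n. n > 0 \<Longrightarrow> a n * of_real (ln (real n)) = (\<Sum>(i, j)\<in>mulpairs n. a i * b j)"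
    and M: "M holomorphic_on {s. Re s > 1/2}" "\<And>s. Re s > 1 \<Longrightarrow> M s = (s - 1) ^ e * (\<Sum>n. a n * dpow s n)"
  shows "\<exists>z. Re z > 1 \<and> M z \<noteq> 0"
    and "Re s0 \<ge> 1 \<Longrightarrow> \<exists>m::nat. ((\<lambda>\<sigma>. of_real \<sigma> * (\<Sum>n. b n * dpow (s0 + of_real \<sigma>) n)) \<longlongrightarrow>
            (if s0 = 1 then of_nat e else 0) - of_nat m) (at_right (0::real)) \<and> (m = 0 \<longleftrightarrow> M s0 \<noteq> 0)"
    and "Re s > 1 \<Longrightarrow> M s \<noteq> 0"
    and "Re s > 1 \<Longrightarrow> (\<Sum>n. b n * dpow s n) = of_nat e / (s - 1) - deriv M s / M s"
proof -
  have az: "a 0 = 0" using a0(1)[of 0] a0(2)[of 0] using order_trans[of "norm (a 0)" "a0 0" 0] by simp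
  have bz: "b 0 = 0" using b0(1)[of 0] b0(2)[of 0] using order_trans[of "norm (b 0)" "b0 0" 0] by simp
  define L where "L = (\<lambda>s. \<Sum>n. a n * dpow s n)"
  define B where "B = (\<lambda>s. \<Sum>n. b n * dpow s n)"
  have dL: "(L has_field_derivative - (L s * B s)) (at s)" if "Re s > 1" for s
  proof -
    have "(\<lambda>n. a n * of_real (ln (real n)) * dpow s n) sums (L s * B s)"
      unfolding L_def B_def
      by (rule dirichlet_product) (use dirichlet_abs_summable[OF a0 that] dirichlet_abs_summable[OF b0 that] az bz conv in auto)
    thus ?thesis using dirichlet_deriv[OF a0 that] by (simp add: L_def sums_iff)
  qed
  have dM: "deriv M s = M s * (of_nat e / (s - 1) - B s)" if s: "Re s > 1" for s
  proof -
    have s1: "s \<noteq> 1" using s by auto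
    have "((\<lambda>s. (s - 1) ^ e * L s) has_field_derivative (of_nat e * (s - 1) ^ (e - 1) * L s + (s - 1) ^ e * (- (L s * B s)))) (at s)"
      by (rule derivative_eq_intros refl dL s | simp)+
    hence "(M has_field_derivative (of_nat e * (s - 1) ^ (e - 1) * L s + (s - 1) ^ e * (- (L s * B s)))) (at s)"
      by (rule has_field_derivative_transform_within_open[where S = "{s. Re s > 1}"]) (use s M(2) in \<open>auto simp: open_Re_gt L_def\<close>)
    hence "deriv M s = of_nat e * (s - 1) ^ (e - 1) * L s + (s - 1) ^ e * (- (L s * B s))" by (rule DERIV_imp_deriv)
    moreover have "M s = (s - 1) ^ e * L s" using M(2) s by (simp add: L_def)
    moreover have "of_nat e * x ^ (e - 1) * l + x ^ e * (- (l * c)) = x ^ e * l * (of_nat e / x - c)"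
      if "x \<noteq> 0" for x l c :: complex using that by (cases e) (auto simp: field_simps)
    ultimately show ?thesis using s1 by simp
  qed
  have contB: "isCont B s" if s: "Re s > 1" for s
    using dirichlet_deriv[OF b0 s] DERIV_isCont unfolding B_def by blast
  show ex: "\<exists>z. Re z > 1 \<and> M z \<noteq> 0"
  proof -
    define T where "T = (\<Sum>n. norm (a (n + 2) * dpow 2 (n + 2)))"
    have "summable (\<lambda>n. norm (a n * dpow 2 n))" by (rule dirichlet_abs_summable[OF a0]) simp
    hence sm22: "summable (\<lambda>n. norm (a (n + 2) * dpow 2 (n + 2)))" by (subst summable_iff_shift)
    have T0: "T \<ge> 0" unfolding T_def by (intro suminf_nonneg sm22) auto
    \<comment> \<open>Moving from 2 to 2 + k scales every term with n >= 2 by at most 2^{-k}; once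
      2^k exceeds the tail T, the leading coefficient 1 dominates.\<close>
    define k :: nat where "k = nat \<lceil>T\<rceil> + 1"
    have kT: "T < 2 ^ k"
    proof -
      have "T < real k" unfolding k_def using T0 by linarith
      also have "real k \<le> 2 ^ k" by (metis less_exp of_nat_le_iff of_nat_numeral of_nat_power less_imp_le)
      finally show ?thesis .
    qed
    define z where "z = 2 + complex_of_real (real k)"
    have z: "Re z > 1" by (simp add: z_def)
    have smz: "summable (\<lambda>n. a n * dpow z n)" by (rule summable_norm_cancel[OF dirichlet_abs_summable[OF a0 z]])
    have "L z = (\<Sum>n. a (n + 2) * dpow z (n + 2)) + (\<Sum>n<2. a n * dpow z n)"
      unfolding L_def by (rule suminf_split_initial_segment[OF smz])
    also have "(\<Sum>n<2. a n * dpow z n) = 1" using az a1 by (simp add: numeral_2_eq_2)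
    finally have Lz: "L z - 1 = (\<Sum>n. a (n + 2) * dpow z (n + 2))" by simp
    have bd: "norm (a (n + 2) * dpow z (n + 2)) \<le> norm (a (n + 2) * dpow 2 (n + 2)) * (1 / 2 ^ k)" for n
    proof -
      have "dpow z (n + 2) = dpow 2 (n + 2) * dpow (of_real (real k)) (n + 2)" unfolding z_def by (rule dpow_add)
      moreover have "norm (dpow (of_real (real k)) (n + 2)) \<le> 1 / 2 ^ k"
      proof -
        have "norm (dpow (of_real (real k)) (n + 2)) = 1 / real (n + 2) ^ k"
          by (subst norm_dpow) (auto simp: powr_minus_divide powr_realpow simp del: of_nat_add)
        also have "... \<le> 1 / 2 ^ k" by (intro divide_left_mono power_mono) auto
        finally show ?thesis .
      qed
      ultimately show ?thesis by (simp add: norm_mult mult_left_mono flip: mult.assoc) (metis mult_left_mono norm_ge_zero mult.assoc divide_inverse mult_1 norm_mult)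
    qed
    have "norm (L z - 1) \<le> (\<Sum>n. norm (a (n + 2) * dpow 2 (n + 2)) * (1 / 2 ^ k))"
      unfolding Lz by (rule norm_suminf_le) (use bd sm22 in \<open>auto intro: summable_mult2\<close>)
    also have "... = T * (1 / 2 ^ k)" unfolding T_def by (rule suminf_mult2[OF sm22, symmetric])
    also have "... < 1" using kT by simp
    finally have "L z \<noteq> 0" by auto
    hence "M z \<noteq> 0" using M(2)[OF z] z by (auto simp: L_def)
    thus ?thesis using z by blast
  qed
  have order: "\<exists>m::nat. ((\<lambda>\<sigma>. of_real \<sigma> * B (s0 + of_real \<sigma>)) \<longlongrightarrow>
            (if s0 = 1 then of_nat e else 0) - of_nat m) (at_right (0::real)) \<and> (m = 0 \<longleftrightarrow> M s0 \<noteq> 0)"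
    if s0: "Re s0 \<ge> 1" for s0
  proof -
    obtain z where z: "Re z > 1" "M z \<noteq> 0" using ex by blast
    have conn: "connected {s. Re s > 1/2}" by (intro convex_connected convex_halfspace_Re_gt)
    obtain m :: nat where m: "((\<lambda>\<sigma>. of_real \<sigma> * (deriv M (s0 + of_real \<sigma>) / M (s0 + of_real \<sigma>))) \<longlongrightarrow> of_nat m) (at_right (0::real))"
      "m = 0 \<longleftrightarrow> M s0 \<noteq> 0" "eventually (\<lambda>\<sigma>. M (s0 + of_real \<sigma>) \<noteq> 0) (at_right (0::real))"
      by (rule logderiv_order[OF M(1) open_Re_gt conn, of s0 z]) (use s0 z in auto)
    have pos: "eventually (\<lambda>\<sigma>::real. \<sigma> > 0) (at_right 0)" by (simp add: eventually_at_right_less)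
    have l1: "((\<lambda>\<sigma>. of_real \<sigma> * (of_nat e / (s0 + of_real \<sigma> - 1))) \<longlongrightarrow> (if s0 = 1 then of_nat e else 0)) (at_right (0::real))"
    proof (cases "s0 = 1")
      case True
      have "((\<lambda>\<sigma>::real. complex_of_nat e) \<longlongrightarrow> of_nat e) (at_right 0)" by simp
      moreover have "eventually (\<lambda>\<sigma>. complex_of_nat e = of_real \<sigma> * (of_nat e / (s0 + of_real \<sigma> - 1))) (at_right (0::real))"
        using pos by eventually_elim (simp add: True)
      ultimately show ?thesis unfolding if_P[OF True] by (rule Lim_transform_eventually)
    next
      case False
      have "((\<lambda>\<sigma>. of_real \<sigma> * (of_nat e / (s0 + of_real \<sigma> - 1))) \<longlongrightarrow> of_real 0 * (of_nat e / (s0 + of_real 0 - 1))) (at_right (0::real))"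
        using False by (intro tendsto_intros) auto
      thus ?thesis using False by simp
    qed
    have "((\<lambda>\<sigma>. of_real \<sigma> * (of_nat e / (s0 + of_real \<sigma> - 1)) - of_real \<sigma> * (deriv M (s0 + of_real \<sigma>) / M (s0 + of_real \<sigma>))) \<longlongrightarrow>
            (if s0 = 1 then of_nat e else 0) - of_nat m) (at_right (0::real))"
      by (intro tendsto_diff l1 m(1))
    moreover have "eventually (\<lambda>\<sigma>. of_real \<sigma> * (of_nat e / (s0 + of_real \<sigma> - 1)) - of_real \<sigma> * (deriv M (s0 + of_real \<sigma>) / M (s0 + of_real \<sigma>))
       = of_real \<sigma> * B (s0 + of_real \<sigma>)) (at_right (0::real))"
      using pos m(3)
    proof eventually_elim
      case (elim \<sigma>)
      have "Re (s0 + of_real \<sigma>) > 1" using s0 elim by simp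
      from dM[OF this] elim(2)
      have "deriv M (s0 + of_real \<sigma>) / M (s0 + of_real \<sigma>) = of_nat e / (s0 + of_real \<sigma> - 1) - B (s0 + of_real \<sigma>)" by simp
      thus ?case by (simp only: right_diff_distrib) simp
    qed
    ultimately have "((\<lambda>\<sigma>. of_real \<sigma> * B (s0 + of_real \<sigma>)) \<longlongrightarrow>
            (if s0 = 1 then of_nat e else 0) - of_nat m) (at_right (0::real))"
      by (rule Lim_transform_eventually)
    thus ?thesis using m(2) by blast
  qed
  thus "Re s0 \<ge> 1 \<Longrightarrow> \<exists>m::nat. ((\<lambda>\<sigma>. of_real \<sigma> * (\<Sum>n. b n * dpow (s0 + of_real \<sigma>) n)) \<longlongrightarrow>
            (if s0 = 1 then of_nat e else 0) - of_nat m) (at_right (0::real)) \<and> (m = 0 \<longleftrightarrow> M s0 \<noteq> 0)"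
    unfolding B_def by blast
  \<comment> \<open>Inside the half-plane B is continuous, so \<sigma> B(s + \<sigma>) tends to 0
    and the order of M at s is 0.\<close>
  show nz: "M s \<noteq> 0" if s: "Re s > 1" for s
  proof -
    obtain m :: nat where m: "((\<lambda>\<sigma>. of_real \<sigma> * B (s + of_real \<sigma>)) \<longlongrightarrow>
            (if s = 1 then of_nat e else 0) - of_nat m) (at_right (0::real))" "m = 0 \<longleftrightarrow> M s \<noteq> 0" using order[of s] s by auto
    have "((\<lambda>\<sigma>. s + complex_of_real \<sigma>) \<longlongrightarrow> s) (at_right 0)" by (auto intro!: tendsto_eq_intros)
    hence "((\<lambda>\<sigma>. of_real \<sigma> * B (s + of_real \<sigma>)) \<longlongrightarrow> of_real 0 * B s) (at_right (0::real))"
      by (intro tendsto_intros isCont_tendsto_compose[OF contB[OF s]])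
    hence "(if s = 1 then of_nat e else 0) - of_nat m = (0::complex)" using m(1) tendsto_unique trivial_limit_at_right_real by fastforce
    hence "m = 0" using s by (auto split: if_splits)
    thus ?thesis using m(2) by simp
  qed
  show "(\<Sum>n. b n * dpow s n) = of_nat e / (s - 1) - deriv M s / M s" if s: "Re s > 1"
    using dM[OF s] nz[OF s] by (simp add: B_def)
qed

section \<open>Gaussian integers\<close>

text \<open>A type of its own, next to the ring record \<open>zsqrt (- 1)\<close>, so that type
  class arithmetic, \<open>dvd\<close> and \<open>prime_elem\<close> apply. It supplies the prime
  densities for both values of d.\<close>

datatype gint = GInt (gre: int) (gim: int)

lemma gint_eq_iff: "x = y \<longleftrightarrow> gre x = gre y \<and> gim x = gim y"
  by (cases x; cases y) auto

instantiation gint :: comm_ring_1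
begin
definition "0 = GInt 0 0"
definition "1 = GInt 1 0"
definition "x + y = GInt (gre x + gre y) (gim x + gim y)"
definition "- x = GInt (- gre x) (- gim x)"
definition "x - y = GInt (gre x - gre y) (gim x - gim y)"
definition "x * y = GInt (gre x * gre y - gim x * gim y) (gre x * gim y + gim x * gre y)"

lemma gint_sel [simp]:
  "gre 0 = 0" "gim 0 = 0" "gre 1 = 1" "gim 1 = 0"
  "gre (x + y) = gre x + gre y" "gim (x + y) = gim x + gim y"
  "gre (x - y) = gre x - gre y" "gim (x - y) = gim x - gim y"
  "gre (- x) = - gre x" "gim (- x) = - gim x"
  "gre (x * y) = gre x * gre y - gim x * gim y" "gim (x * y) = gre x * gim y + gim x * gre y"
  by (simp_all add: zero_gint_def one_gint_def plus_gint_def uminus_gint_def minus_gint_def times_gint_def)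

instance
  by standard (simp_all only: gint_eq_iff gint_sel, simp_all add: algebra_simps)
end

section \<open>Norms, units and Euclidean division\<close>

definition gnorm :: "gint \<Rightarrow> nat" where
  "gnorm x = nat ((gre x)\<^sup>2 + (gim x)\<^sup>2)"

definition gconj :: "gint \<Rightarrow> gint" where
  "gconj x = GInt (gre x) (- gim x)"

lemma gconj_sel [simp]: "gre (gconj x) = gre x" "gim (gconj x) = - gim x"
  by (auto simp: gconj_def)

lemma gconj_gconj [simp]: "gconj (gconj x) = x"
  by (simp add: gint_eq_iff)

lemma gconj_mult: "gconj (x * y) = gconj x * gconj y"
  by (simp add: gint_eq_iff)

lemma gconj_1 [simp]: "gconj 1 = 1"
  by (simp add: gint_eq_iff)

lemma gconj_power: "gconj (x ^ n) = gconj x ^ n"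
  by (induction n) (auto simp: gconj_mult)

lemma int_gnorm: "int (gnorm x) = (gre x)\<^sup>2 + (gim x)\<^sup>2"
  by (simp add: gnorm_def)

lemma gnorm_mult: "gnorm (x * y) = gnorm x * gnorm y"
proof -
  have "int (gnorm (x * y)) = int (gnorm x * gnorm y)"
    unfolding of_nat_mult int_gnorm by (simp add: power2_eq_square algebra_simps)
  thus ?thesis by (simp only: of_nat_eq_iff)
qed

lemma gnorm_0_iff [simp]: "gnorm x = 0 \<longleftrightarrow> x = 0"
proof -
  have "gnorm x = 0 \<longleftrightarrow> int (gnorm x) = 0" by simp
  also have "... \<longleftrightarrow> x = 0" unfolding int_gnorm by (simp add: sum_power2_eq_zero_iff gint_eq_iff)
  finally show ?thesis .
qed

lemma gnorm_1 [simp]: "gnorm 1 = 1"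
  by (simp add: gnorm_def)

lemma gnorm_gconj [simp]: "gnorm (gconj x) = gnorm x"
  by (simp add: gnorm_def)

lemma gnorm_power: "gnorm (x ^ n) = gnorm x ^ n"
  by (induction n) (auto simp: gnorm_mult)

lemma mult_gconj: "x * gconj x = of_int (int (gnorm x))"
proof -
  have *: "gre (of_nat n) = int n \<and> gim (of_nat n) = 0" for n by (induction n) auto
  have "gre (x * gconj x) = int (gnorm x)" by (simp add: int_gnorm power2_eq_square)
  thus ?thesis using * by (simp add: gint_eq_iff)
qed

instance gint :: idom
proof
  fix x y :: gint assume "x \<noteq> 0" "y \<noteq> 0"
  hence "gnorm (x * y) \<noteq> 0" by (simp only: gnorm_mult) simp
  thus "x * y \<noteq> 0" by (metis gnorm_0_iff)
qed

lemma gre_of_nat [simp]: "gre (of_nat n) = int n" "gim (of_nat n) = 0"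
  by (induction n) auto

lemma gint_unit_iff: "x dvd 1 \<longleftrightarrow> gnorm x = 1"
proof
  assume "x dvd 1"
  then obtain y where "1 = x * y" by (elim dvdE)
  hence "gnorm x * gnorm y = 1" by (metis gnorm_1 gnorm_mult)
  thus "gnorm x = 1" by simp
next
  assume "gnorm x = 1"
  hence "x * gconj x = 1" by (simp add: mult_gconj)
  thus "x dvd 1" by (metis dvdI)
qed

lemma finite_gnorm_le: "finite {x. gnorm x \<le> n}"
proof (rule finite_subset)
  show "{x. gnorm x \<le> n} \<subseteq> (\<lambda>(a, b). GInt a b) ` ({- int n..int n} \<times> {- int n..int n})"
  proof
    fix x assume "x \<in> {x. gnorm x \<le> n}"
    hence n: "(gre x)\<^sup>2 + (gim x)\<^sup>2 \<le> int n" by (simp flip: int_gnorm)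
    have "\<bar>y\<bar> \<le> int n" if "y\<^sup>2 \<le> int n" for y :: int
    proof -
      have "\<bar>y\<bar> \<le> \<bar>y\<bar> * \<bar>y\<bar>"
      proof (cases "y = 0")
        case False
        have "\<bar>y\<bar> * 1 \<le> \<bar>y\<bar> * \<bar>y\<bar>" using False by (intro mult_left_mono) auto
        thus ?thesis by simp
      qed simp
      also have "... = y\<^sup>2" by (simp add: power2_eq_square flip: abs_mult)
      finally show ?thesis using that by linarith
    qed
    from this[of "gre x"] this[of "gim x"] n zero_le_power2[of "gre x"] zero_le_power2[of "gim x"]
    have "\<bar>gre x\<bar> \<le> int n" "\<bar>gim x\<bar> \<le> int n" by (smt (verit))+
    thus "x \<in> (\<lambda>(a, b). GInt a b) ` ({- int n..int n} \<times> {- int n..int n})"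
      by (intro image_eqI[of _ _ "(gre x, gim x)"]) (auto simp: abs_le_iff)
  qed
qed simp

text \<open>Both coordinates of x conj(y) / N(y) are rounded to a nearest integer. Each error is at
  most 1/2, so the remainder has norm at most N(y)/2.\<close>

lemma gint_division:
  fixes x y :: gint
  assumes "y \<noteq> 0"
  shows "\<exists>q. gnorm (x - q * y) < gnorm y"
proof -
  define n where "n = int (gnorm y)"
  have n: "n > 0" using assms by (simp add: n_def zero_less_iff_neq_zero)
  define u v where "u = gre (x * gconj y)" and "v = gim (x * gconj y)"
  define a b where "a = (2 * u + n) div (2 * n)" and "b = (2 * v + n) div (2 * n)"
  have rnd: "(2 * (w - ((2 * w + n) div (2 * n)) * n))\<^sup>2 \<le> n\<^sup>2" for w
  proof -
    define c where "c = (2 * w + n) div (2 * n)"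
    have "2 * w + n = c * (2 * n) + (2 * w + n) mod (2 * n)" unfolding c_def by (rule div_mult_mod_eq[symmetric])
    moreover have "0 \<le> (2 * w + n) mod (2 * n)" "(2 * w + n) mod (2 * n) < 2 * n" using n by auto
    ultimately have "\<bar>2 * (w - c * n)\<bar> \<le> \<bar>n\<bar>" by (simp add: algebra_simps abs_le_iff)
    thus ?thesis unfolding c_def by (metis abs_le_square_iff)
  qed
  define q where "q = GInt a b"
  define r where "r = x - q * y"
  have rc: "gre (r * gconj y) = u - a * n" "gim (r * gconj y) = v - b * n"
    by (simp_all add: r_def u_def v_def q_def n_def int_gnorm power2_eq_square algebra_simps)
  have "int (gnorm r) * n = (u - a * n)\<^sup>2 + (v - b * n)\<^sup>2"
    using int_gnorm[of "r * gconj y"] by (simp add: rc gnorm_mult n_def del: gint_sel)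
  hence "4 * (int (gnorm r) * n) = (2 * (u - a * n))\<^sup>2 + (2 * (v - b * n))\<^sup>2" unfolding power_mult_distrib by simp
  also have "... \<le> n\<^sup>2 + n\<^sup>2" unfolding a_def b_def by (intro add_mono rnd)
  finally have "n * (4 * int (gnorm r)) \<le> n * (2 * n)" by (simp add: power2_eq_square algebra_simps)
  hence "4 * int (gnorm r) \<le> 2 * n" using n by simp
  hence "gnorm r < gnorm y" using n by (simp add: n_def)
  thus ?thesis unfolding r_def by blast
qed

text \<open>If p does not divide a, an element d of least norm in the ideal generated by p and a
  divides both, by Euclidean division. Irreducibility makes d a unit, and the resulting Bezout
  relation shows that p divides b.\<close>

lemma gint_prime_elemI:
  fixes p :: gint
  assumes "p \<noteq> 0" "\<not> p dvd 1" and irr: "\<And>a b. p = a * b \<Longrightarrow> a dvd 1 \<or> b dvd 1"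
  shows "prime_elem p"
proof (rule prime_elemI)
  fix a b assume ab: "p dvd a * b"
  show "p dvd a \<or> p dvd b"
  proof (cases "p dvd a")
    case False
    define J where "J = {d. d \<noteq> 0 \<and> (\<exists>x y. d = x * p + y * a)}"
    have "p = 1 * p + 0 * a" by simp
    hence "p \<in> J" using assms(1) unfolding J_def by blast
    then obtain d where d: "d \<in> J" "\<And>e. e \<in> J \<Longrightarrow> gnorm d \<le> gnorm e"
      using ex_has_least_nat[of "\<lambda>d. d \<in> J" p gnorm] by blast
    then obtain x y where xy: "d = x * p + y * a" and d0: "d \<noteq> 0" by (auto simp: J_def)
    have dv: "d dvd e" if e: "e = x' * p + y' * a" for e x' y'
    proof -
      obtain q where q: "gnorm (e - q * d) < gnorm d" using gint_division[OF d0] by blast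
      have "e - q * d = (x' - q * x) * p + (y' - q * y) * a" by (simp add: e xy algebra_simps)
      hence "e - q * d = 0" using q d(2)[of "e - q * d"] by (auto simp: J_def not_le)
      thus ?thesis by (metis dvd_triv_right eq_iff_diff_eq_0)
    qed
    have "d dvd p" "d dvd a" using dv[of p 1 0] dv[of a 0 1] by auto
    then obtain e where e: "p = d * e" by (elim dvdE)
    have "d dvd 1"
    proof (rule ccontr)
      assume "\<not> d dvd 1"
      hence "e dvd 1" using irr[OF e] by blast
      then obtain e' where "1 = e * e'" by (elim dvdE)
      hence "d = p * e'" using e by (simp add: mult.assoc)
      hence "p dvd d" by simp
      thus False using \<open>d dvd a\<close> False dvd_trans by blast
    qed
    then obtain u where "1 = d * u" by (elim dvdE)
    hence "b = (x * p + y * a) * u * b" using xy by simp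
    also have "... = p * (x * u * b) + (a * b) * (y * u)" by (simp add: algebra_simps)
    finally show ?thesis using ab by (metis dvd_add dvd_mult2 dvd_triv_left)
  qed simp
qed (use assms in auto)

text \<open>Primary Gaussian integers represent the ideals prime to \<open>2\<close>; they are parametrised by
  $(m, n) \mapsto (1 + 2m + 4n) + 2mi$.\<close>

definition primary :: "gint \<Rightarrow> bool" where
  "primary x \<longleftrightarrow> even (gim x) \<and> 4 dvd (gre x + gim x - 1)"

definition pm :: "gint \<Rightarrow> int" where "pm x = gim x div 2"
definition pn :: "gint \<Rightarrow> int" where "pn x = (gre x - gim x - 1) div 4"
definition mkp :: "int \<Rightarrow> int \<Rightarrow> gint" where "mkp m n = GInt (1 + 2 * m + 4 * n) (2 * m)"

lemma primary_mkp [simp]: "primary (mkp m n)" "pm (mkp m n) = m" "pn (mkp m n) = n"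
  by (auto simp: primary_def mkp_def pm_def pn_def)

lemma primary_eq_mkp:
  assumes "primary x" shows "x = mkp (pm x) (pn x)"
proof -
  from assms obtain b c where "gim x = 2 * b" "gre x + gim x - 1 = 4 * c"
    by (auto simp: primary_def elim!: evenE dvdE)
  moreover from this have "gre x - gim x - 1 = 4 * (c - b)" by simp
  hence "(gre x - gim x - 1) div 4 = c - b" by simp
  ultimately show ?thesis by (simp only: gint_eq_iff mkp_def pm_def pn_def gint.sel) simp
qed

text \<open>Up to a unit 2 + 2i is (1 + i)^3. In this form closure under products and cancellation
  are immediate.\<close>

lemma primary_iff_dvd: "primary x \<longleftrightarrow> GInt 2 2 dvd (x - 1)"
proof
  assume "primary x"
  hence x: "x = mkp (pm x) (pn x)" by (rule primary_eq_mkp)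
  have "mkp m n - 1 = GInt 2 2 * GInt (m + n) (- n)" for m n
    by (simp add: gint_eq_iff mkp_def)
  thus "GInt 2 2 dvd (x - 1)" using x by (metis dvd_triv_left)
next
  assume "GInt 2 2 dvd (x - 1)"
  then obtain y where "x - 1 = GInt 2 2 * y" by (elim dvdE)
  hence "gre x - 1 = 2 * gre y - 2 * gim y" "gim x = 2 * gim y + 2 * gre y"
    unfolding gint_eq_iff by auto
  hence "gim x = 2 * (gim y + gre y)" "gre x + gim x - 1 = 4 * gre y" by auto
  thus "primary x" unfolding primary_def by (metis dvd_triv_left)
qed

lemma primary_1 [simp]: "primary 1"
  by (simp add: primary_def)

lemma primary_mult: "primary x \<Longrightarrow> primary y \<Longrightarrow> primary (x * y)"
proof -
  assume "primary x" "primary y"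
  hence "GInt 2 2 dvd (x - 1) * y + (y - 1)" by (auto simp: primary_iff_dvd)
  thus ?thesis by (simp add: primary_iff_dvd algebra_simps)
qed

lemma primary_cancel: "primary x \<Longrightarrow> primary (x * y) \<Longrightarrow> primary y"
proof -
  assume "primary x" "primary (x * y)"
  hence "GInt 2 2 dvd (x * y - 1) - (x - 1) * y"
    unfolding primary_iff_dvd by (metis dvd_diff dvd_mult2)
  thus ?thesis by (simp add: primary_iff_dvd algebra_simps)
qed

lemma primary_power: "primary x \<Longrightarrow> primary (x ^ k)"
  by (induction k) (auto intro: primary_mult)

lemma primary_gconj [simp]: "primary (gconj x) \<longleftrightarrow> primary x"
  unfolding primary_def by (auto elim!: evenE) presburger+

lemma primary_nz: "primary x \<Longrightarrow> x \<noteq> 0"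
  by (auto simp: primary_def)

lemma primary_gnorm_pos: "primary x \<Longrightarrow> gnorm x > 0"
  by (metis gnorm_0_iff gr0I primary_nz)

lemma primary_unit:
  assumes "primary x" "gnorm x = 1" shows "x = 1"
proof -
  have e: "(gre x)\<^sup>2 + (gim x)\<^sup>2 = 1" using assms(2) int_gnorm[of x] by simp
  have "gim x = 0"
  proof (rule ccontr)
    assume "gim x \<noteq> 0"
    moreover have "even (gim x)" using assms(1) by (simp add: primary_def)
    ultimately have "\<bar>gim x\<bar> \<ge> 2" by presburger
    hence "(gim x)\<^sup>2 \<ge> 2\<^sup>2" using abs_le_square_iff[of 2 "gim x"] by simp
    moreover have False if "u + v = 1" "v \<ge> 2\<^sup>2" "u \<ge> 0" for u v :: int using that by simp
    ultimately show False using e zero_le_power2 by blast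
  qed
  moreover have "gre x = 1 \<or> gre x = -1" using e calculation by (simp add: power2_eq_1_iff)
  moreover have "4 dvd (gre x + gim x - 1)" using assms(1) by (simp add: primary_def)
  ultimately show ?thesis by (auto simp: gint_eq_iff)
qed

lemma primary_assoc:
  assumes "primary x" "primary y" "x dvd y" "gnorm y \<le> gnorm x"
  shows "x = y"
proof -
  obtain u where u: "y = x * u" using assms(3) by (elim dvdE)
  have "primary u" using primary_cancel[OF assms(1)] assms(2) u by simp
  moreover have "gnorm u = 1"
  proof -
    have "gnorm x * gnorm u \<le> gnorm x * 1" using assms(4) u by (simp add: gnorm_mult)
    hence "gnorm u \<le> 1" using primary_gnorm_pos[OF assms(1)] by simp
    moreover have "gnorm u > 0" using primary_gnorm_pos calculation \<open>primary u\<close> by blast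
    ultimately show ?thesis by linarith
  qed
  ultimately show ?thesis using primary_unit u by simp
qed

text \<open>The units 1, -1, i, -i represent the four invertible classes modulo (1 + i)^3.\<close>

lemma odd_primary_assoc:
  assumes "odd (gnorm x)"
  obtains u where "gnorm u = 1" "primary (u * x)"
proof -
  have "odd ((gre x)\<^sup>2 + (gim x)\<^sup>2)" using assms by (simp flip: int_gnorm)
  hence "odd (gre x) \<noteq> odd (gim x)" by auto
  hence "primary (1 * x) \<or> primary (GInt (-1) 0 * x) \<or> primary (GInt 0 1 * x) \<or> primary (GInt 0 (-1) * x)"
    by (auto simp: primary_def) presburger+
  thus ?thesis using that[of 1] that[of "GInt (-1) 0"] that[of "GInt 0 1"] that[of "GInt 0 (-1)"]
    by (auto simp: gnorm_def)
qed

lemma primary_odd_gnorm: "primary x \<Longrightarrow> odd (gnorm x)"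
proof -
  assume x: "primary x"
  have "odd (gre x)" "even (gim x)" using x unfolding primary_def by presburger+
  hence "odd ((gre x)\<^sup>2 + (gim x)\<^sup>2)" by simp
  thus "odd (gnorm x)" by (simp flip: int_gnorm)
qed

text \<open>One generator for each prime ideal not dividing 2.\<close>

definition PP :: "gint set" where "PP = {p. primary p \<and> prime_elem p}"

lemma PP_gnorm: "p \<in> PP \<Longrightarrow> gnorm p \<ge> 2"
proof -
  assume p: "p \<in> PP"
  hence "\<not> p dvd 1" "p \<noteq> 0" by (auto simp: PP_def prime_elem_def)
  hence "gnorm p \<noteq> 1" "gnorm p \<noteq> 0" by (auto simp: gint_unit_iff)
  thus ?thesis by linarith
qed

text \<open>A divisor of least norm above 1 is irreducible, hence prime. A unit makes it primary,
  and cancellation makes the cofactor primary too.\<close>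

lemma primary_divisor:
  assumes "primary x" "x \<noteq> 1"
  obtains p y where "p \<in> PP" "primary y" "x = p * y" "gnorm y < gnorm x"
proof -
  define J where "J = {d. d dvd x \<and> gnorm d > 1}"
  have "gnorm x > 1" using primary_gnorm_pos[OF assms(1)] primary_unit[OF assms(1)] assms(2) by force
  hence "x \<in> J" by (simp add: J_def)
  then obtain d where d: "d \<in> J" "\<And>e. e \<in> J \<Longrightarrow> gnorm d \<le> gnorm e"
    using ex_has_least_nat[of "\<lambda>d. d \<in> J" x gnorm] by blast
  obtain y where y: "x = d * y" using d by (auto simp: J_def elim: dvdE)
  have "odd (gnorm d)" using primary_odd_gnorm[OF assms(1)] y by (simp add: gnorm_mult)
  then obtain u where u: "gnorm u = 1" "primary (u * d)" using odd_primary_assoc by blast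
  define p where "p = u * d"
  have gp: "gnorm p = gnorm d" by (simp add: p_def gnorm_mult u)
  have uc: "u * gconj u = 1" using u by (simp add: mult_gconj)
  have x: "x = p * (gconj u * y)"
    using uc unfolding p_def y by (metis mult.assoc mult.left_commute mult_1)
  have "prime_elem p"
  proof (rule gint_prime_elemI)
    show "p \<noteq> 0" unfolding p_def by (rule primary_nz[OF u(2)])
    show "\<not> p dvd 1" using gp d(1) by (auto simp: gint_unit_iff J_def)
    fix a b assume ab: "p = a * b"
    show "a dvd 1 \<or> b dvd 1"
    proof (rule ccontr)
      assume "\<not> (a dvd 1 \<or> b dvd 1)"
      hence ab1: "gnorm a \<noteq> 1" "gnorm b \<noteq> 1" by (auto simp: gint_unit_iff)
      have g: "gnorm a * gnorm b = gnorm d" using ab gp by (metis gnorm_mult)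
      hence "gnorm a > 1" "gnorm b > 1" using ab1 d(1) by (auto simp: J_def) (metis One_nat_def Suc_lessI mult_0 mult_0_right neq0_conv not_less_zero)+
      moreover have "a dvd x" using x ab by (metis dvd_mult2 dvd_triv_left)
      ultimately have "gnorm d \<le> gnorm a" using d(2)[of a] by (simp add: J_def)
      moreover have "gnorm a * 1 < gnorm a * gnorm b" using \<open>gnorm a > 1\<close> \<open>gnorm b > 1\<close> by (intro mult_strict_left_mono) auto
      ultimately show False using g by simp
    qed
  qed
  hence pP: "p \<in> PP" using u by (simp add: PP_def p_def)
  show ?thesis
  proof (rule that[OF pP _ x])
    show "primary (gconj u * y)" using primary_cancel[of p "gconj u * y"] x assms(1) u(2) by (simp add: p_def)
    have "gnorm x = gnorm p * gnorm (gconj u * y)" using x gnorm_mult by metis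
    moreover have "gnorm (gconj u * y) > 0" using \<open>primary (gconj u * y)\<close> by (rule primary_gnorm_pos)
    moreover have "gnorm p > 1" using PP_gnorm[OF pP] by simp
    ultimately show "gnorm (gconj u * y) < gnorm x" by simp
  qed
qed

section \<open>Prime power divisors of a primary element\<close>

lemma prime_elem_power_dvd_cancel:
  fixes r :: "'a::idom"
  assumes "prime_elem r" "\<not> r dvd p" "r ^ k dvd p * y"
  shows "r ^ k dvd y"
  using assms(3)
proof (induction k arbitrary: y)
  case (Suc k)
  have "r dvd p * y" using Suc.prems unfolding power_Suc by (rule dvd_mult_left)
  hence "r dvd y" using assms(1,2) by (auto simp: prime_elem_dvd_mult_iff)
  then obtain z where z: "y = r * z" by (elim dvdE)
  have r0: "r \<noteq> 0" using assms(1) by auto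
  have "r * r ^ k dvd r * (p * z)" using Suc.prems z by (simp add: mult_ac)
  hence "r ^ k dvd p * z" using r0 by simp
  hence "r ^ k dvd z" by (rule Suc.IH)
  thus ?case unfolding z power_Suc by (rule mult_dvd_mono[OF dvd_refl])
qed simp

text \<open>A prime of multiplicity v in x occurs in v pairs, so weighting each pair by ln N(p)
  plays the part of the von Mangoldt function.\<close>

definition ppdiv :: "gint \<Rightarrow> (gint \<times> nat) set" where
  "ppdiv x = {(p, k). p \<in> PP \<and> k \<ge> 1 \<and> p ^ k dvd x}"

lemma dvd_gnorm: "x dvd y \<Longrightarrow> gnorm x dvd gnorm y"
  by (metis dvd_def gnorm_mult)

lemma pp_bounds:
  assumes "p \<in> PP" "k \<ge> 1" "gnorm p ^ k \<le> n"
  shows "gnorm p \<le> n" "k \<le> n"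
proof -
  have g: "gnorm p \<ge> 2" using PP_gnorm assms by blast
  have "gnorm p ^ 1 \<le> gnorm p ^ k" using g assms(2) by (intro power_increasing) auto
  thus "gnorm p \<le> n" using assms(3) by simp
  have "k < 2 ^ k" by (rule less_exp)
  also have "(2::nat) ^ k \<le> gnorm p ^ k" using g by (intro power_mono) auto
  finally show "k \<le> n" using assms(3) by simp
qed

lemma finite_pp: "finite {(p, k). p \<in> PP \<and> k \<ge> 1 \<and> gnorm p ^ k \<le> n}"
proof (rule finite_subset)
  show "{(p, k). p \<in> PP \<and> k \<ge> 1 \<and> gnorm p ^ k \<le> n} \<subseteq> {p. gnorm p \<le> n} \<times> {..n}"
    using pp_bounds by blast
  show "finite ({p. gnorm p \<le> n} \<times> {..n})"
    by (intro finite_cartesian_product finite_gnorm_le finite_atMost)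
qed

lemma finite_ppdiv: assumes "primary x" shows "finite (ppdiv x)"
proof (rule finite_subset[OF _ finite_pp[of "gnorm x"]])
  show "ppdiv x \<subseteq> {(p, k). p \<in> PP \<and> k \<ge> 1 \<and> gnorm p ^ k \<le> gnorm x}"
  proof (clarsimp simp: ppdiv_def)
    fix p k assume "p ^ k dvd x"
    hence "gnorm (p ^ k) dvd gnorm x" by (rule dvd_gnorm)
    thus "gnorm p ^ k \<le> gnorm x" using primary_gnorm_pos[OF assms] by (simp add: gnorm_power dvd_imp_le)
  qed
qed

lemma PP_not_dvd:
  assumes "p \<in> PP" "r \<in> PP" "r \<noteq> p" shows "\<not> r dvd p"
proof
  assume rp: "r dvd p"
  then obtain u where u: "p = r * u" by (elim dvdE)
  have pr: "prime_elem p" "prime_elem r" "primary p" "primary r" using assms by (auto simp: PP_def)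
  have "p dvd r \<or> p dvd u" using pr(1) u by (metis dvd_refl prime_elem_dvd_multD)
  thus False
  proof
    assume "p dvd r"
    hence "gnorm p \<le> gnorm r" using dvd_gnorm primary_gnorm_pos[OF pr(4)] by (simp add: dvd_imp_le)
    thus False using primary_assoc[OF pr(4,3) rp] assms(3) by simp
  next
    assume "p dvd u"
    then obtain v where "u = p * v" by (elim dvdE)
    hence "p * 1 = p * (r * v)" using u by (simp add: mult_ac)
    moreover have "p \<noteq> 0" using primary_nz pr(3) by blast
    ultimately have "1 = r * v" using mult_left_cancel by blast
    hence "r dvd 1" by (metis dvd_triv_left)
    thus False using pr(2) by (simp add: prime_elem_def)
  qed
qed

text \<open>Induction by removing one primary prime p: the pairs of other primes stay, the pairs of
  p shift by one in the exponent, and (p, 1) is new, which accounts for the summand ln N(p).\<close>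

lemma sum_ppdiv:
  assumes "primary x"
  shows "(\<Sum>(p, k)\<in>ppdiv x. ln (real (gnorm p))) = ln (real (gnorm x))"
  using assms
proof (induction "gnorm x" arbitrary: x rule: less_induct)
  case less
  show ?case
  proof (cases "x = 1")
    case True
    have "ppdiv 1 = {}"
    proof -
      have False if "p \<in> PP" "k \<ge> 1" "p ^ k dvd 1" for p k
      proof -
        have "p dvd p ^ k" using that(2) by (cases k) auto
        hence "p dvd 1" using that(3) dvd_trans by blast
        thus False using that(1) by (simp add: PP_def prime_elem_def)
      qed
      thus ?thesis by (auto simp: ppdiv_def)
    qed
    thus ?thesis using True by simp
  next
    case False
    obtain p y where py: "p \<in> PP" "primary y" "x = p * y" "gnorm y < gnorm x"
      using primary_divisor[OF less.prems False] by blast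
    have p0: "p \<noteq> 0" using py(1) by (auto simp: PP_def primary_nz)
    define A where "A = {(r, k) \<in> ppdiv y. r \<noteq> p}"
    define B where "B = {(r, k) \<in> ppdiv y. r = p}"
    have yAB: "ppdiv y = A \<union> B" "A \<inter> B = {}" by (auto simp: A_def B_def)
    have fin: "finite A" "finite B" using finite_ppdiv[OF py(2)] by (auto simp: yAB(1))
    let ?s = "\<lambda>(r, k). (r, Suc k)"
    have "ppdiv x = A \<union> insert (p, 1) (?s ` B)"
    proof (intro equalityI subsetI)
      fix rk assume "rk \<in> ppdiv x"
      then obtain r k where rk: "rk = (r, k)" "r \<in> PP" "k \<ge> 1" "r ^ k dvd p * y" by (auto simp: ppdiv_def py(3))
      show "rk \<in> A \<union> insert (p, 1) (?s ` B)"
      proof (cases "r = p")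
        case True
        obtain k' where k': "k = Suc k'" using rk(3) by (cases k) auto
        have "p * p ^ k' dvd p * y" using rk(4) True k' by simp
        hence "p ^ k' dvd y" using p0 by simp
        hence "k' = 0 \<or> (p, k') \<in> B" using rk(2) True by (cases k') (auto simp: B_def ppdiv_def)
        thus ?thesis using rk(1) True k' by force
      next
        case False
        have "r ^ k dvd y" using prime_elem_power_dvd_cancel[of r p k y] PP_not_dvd[OF py(1) rk(2) False] rk(2,4) by (auto simp: PP_def)
        thus ?thesis using rk False by (auto simp: A_def ppdiv_def)
      qed
    next
      fix rk assume "rk \<in> A \<union> insert (p, 1) (?s ` B)"
      thus "rk \<in> ppdiv x" using py(1) by (auto simp: A_def B_def ppdiv_def py(3) intro: mult_dvd_mono)
    qed
    moreover have "A \<inter> insert (p, 1) (?s ` B) = {}" "(p, 1) \<notin> ?s ` B" by (auto simp: A_def B_def ppdiv_def)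
    ultimately have "(\<Sum>(p, k)\<in>ppdiv x. ln (real (gnorm p))) = (\<Sum>(p, k)\<in>A. ln (real (gnorm p))) + (ln (real (gnorm p)) + (\<Sum>(p, k)\<in>?s ` B. ln (real (gnorm p))))"
      using fin by (simp add: sum.union_disjoint)
    also have "(\<Sum>(p, k)\<in>?s ` B. ln (real (gnorm p))) = (\<Sum>(p, k)\<in>B. ln (real (gnorm p)))"
      by (subst sum.reindex) (auto simp: inj_on_def intro!: sum.cong)
    also have "(\<Sum>(p, k)\<in>A. ln (real (gnorm p))) + (ln (real (gnorm p)) + (\<Sum>(p, k)\<in>B. ln (real (gnorm p))))
       = (\<Sum>(p, k)\<in>ppdiv y. ln (real (gnorm p))) + ln (real (gnorm p))"
      unfolding yAB(1) using fin yAB(2) by (simp add: sum.union_disjoint)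
    also have "(\<Sum>(p, k)\<in>ppdiv y. ln (real (gnorm p))) = ln (real (gnorm y))" using less.hyps py by blast
    also have "ln (real (gnorm y)) + ln (real (gnorm p)) = ln (real (gnorm x))"
      using primary_gnorm_pos[OF py(2)] PP_gnorm[OF py(1)] unfolding py(3) gnorm_mult of_nat_mult
      by (subst ln_mult_pos) auto
    finally show ?thesis .
  qed
qed

text \<open>For $j < 4$, $k < 2$ these are the characters of the group of residues modulo $8$ of primary elements.\<close>

definition chi :: "nat \<Rightarrow> nat \<Rightarrow> gint \<Rightarrow> complex" where
  "chi j k x = \<i> powi (int j * pm x) * (-1) powi (int k * pn x)"

lemma ii_powi_4: "\<i> powi (4 * n) = 1"
  by (simp add: power_int_mult)

lemma minus_one_powi_2: "(-1 :: complex) powi (2 * n) = 1"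
  by (simp add: power_int_mult)

text \<open>In the coordinates of \<open>mkp\<close> a product has m-coordinate m + m' modulo 4 and
  n-coordinate n + n' modulo 2, which is all that powers of i and -1 detect.\<close>

lemma chi_mult:
  assumes "primary x" "primary y"
  shows "chi j k (x * y) = chi j k x * chi j k y"
proof -
  define m n m' n' where "m = pm x" "n = pn x" "m' = pm y" "n' = pn y"
  have xy: "x = mkp m n" "y = mkp m' n'" using primary_eq_mkp assms by (auto simp: m_n_m'_n'_def)
  have "x * y = mkp (m + m' + 4 * (m * m' + m * n' + m' * n)) (n + n' + 2 * (2 * n * n' - m * m'))"
    unfolding xy mkp_def gint_eq_iff by (simp add: algebra_simps)
  hence pp: "pm (x * y) = m + m' + 4 * (m * m' + m * n' + m' * n)"
    "pn (x * y) = n + n' + 2 * (2 * n * n' - m * m')" by simp_all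
  have "\<i> powi (int j * pm (x * y)) = \<i> powi (int j * m + int j * m' + 4 * (int j * (m * m' + m * n' + m' * n)))"
    unfolding pp by (simp add: algebra_simps)
  also have "... = \<i> powi (int j * m) * \<i> powi (int j * m')" by (simp add: power_int_add ii_powi_4)
  finally have 1: "\<i> powi (int j * pm (x * y)) = \<i> powi (int j * m) * \<i> powi (int j * m')" .
  have "(-1::complex) powi (int k * pn (x * y)) = (-1) powi (int k * n + int k * n' + 2 * (int k * (2 * n * n' - m * m')))"
    unfolding pp by (simp add: algebra_simps)
  also have "... = (-1) powi (int k * n) * (-1) powi (int k * n')" by (simp add: power_int_add minus_one_powi_2)
  finally show ?thesis using 1 by (simp add: chi_def m_n_m'_n'_def)
qed

lemma chi_1 [simp]: "chi j k 1 = 1"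
  by (simp add: chi_def pm_def pn_def)

lemma norm_chi [simp]: "norm (chi j k x) = 1"
  by (simp add: chi_def norm_mult norm_power_int)

definition In :: "nat \<Rightarrow> gint set" where "In n = {x. primary x \<and> gnorm x = n}"
definition Qn :: "nat \<Rightarrow> (gint \<times> nat) set" where "Qn n = {(p, k). p \<in> PP \<and> k \<ge> 1 \<and> gnorm p ^ k = n}"

lemma finite_In: "finite (In n)"
  by (rule finite_subset[OF _ finite_gnorm_le[of n]]) (auto simp: In_def)

lemma finite_Qn: "finite (Qn n)"
  by (rule finite_subset[OF _ finite_pp[of n]]) (auto simp: Qn_def)

text \<open>Coefficients of the L-function of the ray class character \<open>chi j k\<close>;
  \<open>bcoef\<close> gives those of -L'/L.\<close>

definition acoef :: "nat \<Rightarrow> nat \<Rightarrow> nat \<Rightarrow> complex" where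
  "acoef j k n = (\<Sum>x\<in>In n. chi j k x)"

definition bcoef :: "nat \<Rightarrow> nat \<Rightarrow> nat \<Rightarrow> complex" where
  "bcoef j k n = (\<Sum>(p, l)\<in>Qn n. chi j k (p ^ l) * of_real (ln (real (gnorm p))))"

text \<open>The coefficient form of -L' = L (-L'/L). The factor ln n is expanded over the prime
  powers p^l dividing each x of norm n, and writing x = y p^l separates the two coefficients by
  multiplicativity.\<close>

lemma acoef_ln_conv:
  assumes "n > 0"
  shows "acoef j k n * of_real (ln (real n)) = (\<Sum>(i, i')\<in>mulpairs n. acoef j k i * bcoef j k i')"
proof -
  define f where "f = (\<lambda>(x, (p, l::nat)). chi j k x * of_real (ln (real (gnorm p))))"
  have dest: "\<exists>x p l y. a = (x, (p, l)) \<and> primary x \<and> gnorm x = n \<and> p \<in> PP \<and> l \<ge> 1 \<and> x = y * p ^ l"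
    if aS: "a \<in> Sigma (In n) ppdiv" for a
  proof -
    obtain x pl where 1: "a = (x, pl)" "x \<in> In n" "pl \<in> ppdiv x" using aS by blast
    obtain p l where pl: "pl = (p, l)" by (cases pl)
    have a: "a = (x, (p, l))" "x \<in> In n" "(p, l) \<in> ppdiv x" using 1 pl by auto
    have "p ^ l dvd x" using a(3) by (simp add: ppdiv_def)
    then obtain y where "x = p ^ l * y" by (elim dvdE)
    hence "x = y * p ^ l" by (simp only: mult.commute)
    moreover have "primary x" "gnorm x = n" "p \<in> PP" "l \<ge> 1" using a(2,3) by (auto simp: In_def ppdiv_def)
    ultimately show ?thesis using a(1) by blast
  qed
  have "acoef j k n * of_real (ln (real n)) = (\<Sum>x\<in>In n. chi j k x * of_real (\<Sum>(p, l)\<in>ppdiv x. ln (real (gnorm p))))"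
    unfolding acoef_def sum_distrib_right
    by (intro sum.cong refl) (auto simp: In_def sum_ppdiv simp del: of_real_sum)
  also have "... = (\<Sum>x\<in>In n. \<Sum>pl\<in>ppdiv x. f (x, pl))"
    by (auto simp: f_def sum_distrib_left case_prod_unfold)
  also have "... = (\<Sum>xpl\<in>Sigma (In n) ppdiv. f xpl)"
    by (subst sum.Sigma, rule finite_In) (auto simp: In_def finite_ppdiv)
  also have "... = (\<Sum>(ii, (x, (p, l)))\<in>Sigma (mulpairs n) (\<lambda>(i, i'). In i \<times> Qn i'). f (x * p ^ l, (p, l)))"
  proof (rule sum.reindex_bij_witness[where j = "\<lambda>(x, (p, l)). ((gnorm x div gnorm p ^ l, gnorm p ^ l), ((THE y. x = y * p ^ l), (p, l)))"
        and i = "\<lambda>(ii, (y, (p, l))). (y * p ^ l, (p, l))"], goal_cases)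
    case (1 a)
    then obtain x p l y where a: "a = (x, (p, l))" "primary x" "gnorm x = n" "p \<in> PP" "l \<ge> 1" "x = y * p ^ l"
      using dest by blast
    have p0: "p \<noteq> 0" using a(4) by (auto simp: PP_def primary_nz)
    have "(THE y. x = y * p ^ l) = y" using a(6) p0 by (intro the_equality) auto
    thus ?case using a by simp
  next
    case (2 a)
    then obtain x p l y where a: "a = (x, (p, l))" "primary x" "gnorm x = n" "p \<in> PP" "l \<ge> 1" "x = y * p ^ l"
      using dest by blast
    have p0: "p \<noteq> 0" using a(4) by (auto simp: PP_def primary_nz)
    have y: "(THE y. x = y * p ^ l) = y" using a(6) p0 by (intro the_equality) auto
    have "primary y" using primary_cancel[of "p ^ l" y] a by (auto simp: PP_def primary_power mult.commute)
    moreover have "gnorm x = gnorm y * gnorm p ^ l" using a(6) by (simp add: gnorm_mult gnorm_power)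
    moreover have "gnorm p ^ l > 0" using p0 by (metis gnorm_0_iff gr0I zero_less_power)
    ultimately have d: "gnorm x div gnorm p ^ l = gnorm y" "gnorm y * gnorm p ^ l = n" "primary y" using a(3) by auto
    show ?case unfolding a(1) prod.case y d(1) using d(2,3) a(4,5) by (auto simp: mulpairs_def In_def Qn_def)
  next
    case (3 b)
    then obtain i i' y p l where b: "b = ((i, i'), (y, (p, l)))" "i * i' = n" "primary y" "gnorm y = i" "p \<in> PP" "l \<ge> 1" "gnorm p ^ l = i'"
      by (auto simp: mulpairs_def In_def Qn_def)
    have p0: "p \<noteq> 0" using b(5) by (auto simp: PP_def primary_nz)
    have "(THE y'. y * p ^ l = y' * p ^ l) = y" using p0 by (intro the_equality) auto
    moreover have "gnorm p ^ l > 0" using p0 by (metis gnorm_0_iff gr0I zero_less_power)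
    ultimately show ?case using b by (auto simp: gnorm_mult gnorm_power)
  next
    case (4 b)
    then obtain i i' y p l where b: "b = ((i, i'), (y, (p, l)))" "i * i' = n" "primary y" "gnorm y = i" "p \<in> PP" "l \<ge> 1" "gnorm p ^ l = i'"
      by (auto simp: mulpairs_def In_def Qn_def)
    thus ?case by (auto simp: In_def ppdiv_def gnorm_mult gnorm_power PP_def intro: primary_mult primary_power)
  next
    case (5 a)
    then obtain x p l y where a: "a = (x, (p, l))" "primary x" "gnorm x = n" "p \<in> PP" "l \<ge> 1" "x = y * p ^ l"
      using dest by blast
    have p0: "p \<noteq> 0" using a(4) by (auto simp: PP_def primary_nz)
    have "(THE y. x = y * p ^ l) = y" using a(6) p0 by (intro the_equality) auto
    thus ?case using a by simp
  qed
  also have "... = (\<Sum>ii\<in>mulpairs n. \<Sum>(x, (p, l))\<in>(case ii of (i, i') \<Rightarrow> In i \<times> Qn i'). f (x * p ^ l, (p, l)))"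
    by (subst sum.Sigma) (auto simp: finite_mulpairs assms finite_In finite_Qn)
  also have "... = (\<Sum>(i, i')\<in>mulpairs n. acoef j k i * bcoef j k i')"
  proof (intro sum.cong refl, clarify)
    fix i i'
    have "acoef j k i * bcoef j k i' = (\<Sum>x\<in>In i. \<Sum>pl\<in>Qn i'. chi j k x * (case pl of (p, l) \<Rightarrow> chi j k (p ^ l) * of_real (ln (real (gnorm p)))))"
      by (simp add: acoef_def bcoef_def sum_product)
    also have "... = (\<Sum>x\<in>In i. \<Sum>(p, l)\<in>Qn i'. f (x * p ^ l, (p, l)))"
      by (intro sum.cong refl) (auto simp: f_def In_def Qn_def chi_mult PP_def primary_power)
    also have "... = (\<Sum>(x, (p, l))\<in>In i \<times> Qn i'. f (x * p ^ l, (p, l)))"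
      by (subst sum.cartesian_product) simp
    finally show "(\<Sum>(x, (p, l))\<in>In i \<times> Qn i'. f (x * p ^ l, (p, l))) = acoef j k i * bcoef j k i'" ..
  qed
  finally show ?thesis .
qed

section \<open>Counting primary Gaussian integers\<close>

definition PB :: "nat \<Rightarrow> gint set" where "PB N = {x. primary x \<and> gnorm x \<le> N}"

lemma sum_In_PB:
  fixes f :: "gint \<Rightarrow> 'a::comm_monoid_add"
  shows "(\<Sum>n\<le>N. \<Sum>x\<in>In n. f x) = (\<Sum>x\<in>PB N. f x)"
proof -
  have "(\<Sum>n\<le>N. \<Sum>x\<in>In n. f x) = (\<Sum>x\<in>(\<Union>n\<in>{..N}. In n). f x)"
  proof (rule sum.UNION_disjoint[symmetric])
    show "\<forall>i\<in>{..N}. finite (In i)" by (simp add: finite_In)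
    show "\<forall>i\<in>{..N}. \<forall>j\<in>{..N}. i \<noteq> j \<longrightarrow> In i \<inter> In j = {}" by (auto simp: In_def)
  qed simp
  also have "(\<Union>n\<in>{..N}. In n) = PB N" by (auto simp: In_def PB_def)
  finally show ?thesis .
qed

lemma sum_acoef: "(\<Sum>n\<le>N. acoef j k n) = (\<Sum>x\<in>PB N. chi j k x)"
  unfolding acoef_def by (rule sum_In_PB)

lemma gnorm_mkp: "int (gnorm (mkp m n)) = (1 + 2 * m + 4 * n)\<^sup>2 + 4 * m\<^sup>2"
  by (simp add: int_gnorm mkp_def power_mult_distrib)

lemma abs_le_sqrt_iff: "x\<^sup>2 \<le> int N \<longleftrightarrow> \<bar>real_of_int x\<bar> \<le> sqrt (real N)"
proof -
  have "x\<^sup>2 \<le> int N \<longleftrightarrow> (real_of_int x)\<^sup>2 \<le> real N"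
    by (metis of_int_le_iff of_int_of_nat_eq of_int_power)
  also have "... \<longleftrightarrow> \<bar>real_of_int x\<bar> \<le> sqrt (real N)"
    using real_sqrt_le_iff[of "(real_of_int x)\<^sup>2" "real N"] by simp
  finally show ?thesis .
qed

lemma alternating_sum_interval: "norm (\<Sum>n\<in>{a..b::int}. (-1 :: complex) powi n) \<le> 1"
proof -
  have e: "(-1 :: complex) powi n = (if even n then 1 else -1)" for n by (simp add: power_int_minus_left)
  have "(\<Sum>n\<in>{a..<a + int l}. if even n then 1 else -1 :: complex) = (if even l then 0 else if even a then 1 else -1)" for l
  proof (induction l)
    case (Suc l)
    have "{a..<a + int (Suc l)} = insert (a + int l) {a..<a + int l}" by auto
    thus ?case using Suc.IH by (auto simp: )
  qed simp
  from this[of "nat (b + 1 - a)"] have "norm (\<Sum>n\<in>{a..<a + int (nat (b + 1 - a))}. if even n then 1 else -1 :: complex) \<le> 1"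
    by (simp split: if_splits)
  moreover have "{a..<a + int (nat (b + 1 - a))} = {a..b}" by auto
  ultimately show ?thesis by (simp only: e)
qed

text \<open>For odd k the character alternates in n. With m fixed, n runs through an interval and
  the sum over it has norm at most 1; only O(sqrt N) values of m occur.\<close>

lemma acoef_sum_odd:
  assumes "odd k"
  shows "norm (\<Sum>n\<le>N. acoef j k n) \<le> 3 * sqrt (real N)"
proof -
  define Ms where "Ms = {m::int. 4 * m\<^sup>2 \<le> int N}"
  define F where "F = (\<lambda>m::int. {n::int. (1 + 2 * m + 4 * n)\<^sup>2 + 4 * m\<^sup>2 \<le> int N})"
  have nn: "v \<le> w" if "u + v \<le> w" "0 \<le> u" for u v w :: int using that by linarith
  have Fint: "\<exists>a b. F m = {a..b}" for m
  proof -
    have eq: "F m = {n. \<bar>real_of_int (1 + 2 * m + 4 * n)\<bar> \<le> sqrt (real_of_int (int N - 4 * m\<^sup>2))}" if "4 * m\<^sup>2 \<le> int N"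
    proof -
      have "F m = {n. (1 + 2 * m + 4 * n)\<^sup>2 \<le> int (nat (int N - 4 * m\<^sup>2))}" using that by (auto simp: F_def)
      thus ?thesis using that unfolding abs_le_sqrt_iff by simp
    qed
    show ?thesis
    proof (cases "4 * m\<^sup>2 \<le> int N")
      case True
      define R where "R = sqrt (real_of_int (int N - 4 * m\<^sup>2))"
      have "F m = {\<lceil>(- R - 1 - 2 * real_of_int m) / 4\<rceil>..\<lfloor>(R - 1 - 2 * real_of_int m) / 4\<rfloor>}"
        unfolding eq[OF True] R_def[symmetric]
        by (auto simp: ceiling_le_iff le_floor_iff abs_le_iff field_simps)
      thus ?thesis by blast
    next
      case False
      have "F m = {}" unfolding F_def using False nn[OF _ zero_le_power2] by blast
      thus ?thesis by (intro exI[of _ 1] exI[of _ 0]) simp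
    qed
  qed
  have finF: "finite (F m)" for m using Fint[of m] by auto
  have MsI: "Ms \<subseteq> {- \<lfloor>sqrt (real N) / 2\<rfloor>..\<lfloor>sqrt (real N) / 2\<rfloor>}"
  proof
    fix m assume "m \<in> Ms"
    hence "(2 * m)\<^sup>2 \<le> int N" by (simp add: Ms_def power_mult_distrib)
    hence "\<bar>real_of_int (2 * m)\<bar> \<le> sqrt (real N)" by (simp only: abs_le_sqrt_iff)
    hence "real_of_int m \<le> sqrt (real N) / 2" "real_of_int (- m) \<le> sqrt (real N) / 2" by (auto simp: abs_le_iff)
    hence "m \<le> \<lfloor>sqrt (real N) / 2\<rfloor>" "- m \<le> \<lfloor>sqrt (real N) / 2\<rfloor>" unfolding le_floor_iff by auto
    thus "m \<in> {- \<lfloor>sqrt (real N) / 2\<rfloor>..\<lfloor>sqrt (real N) / 2\<rfloor>}" by auto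
  qed
  hence finM: "finite Ms" by (rule finite_subset) simp
  have cardM: "real (card Ms) \<le> sqrt (real N) + 1"
  proof -
    have "card Ms \<le> card {- \<lfloor>sqrt (real N) / 2\<rfloor>..\<lfloor>sqrt (real N) / 2\<rfloor>}" using MsI by (intro card_mono) auto
    also have "... = nat (2 * \<lfloor>sqrt (real N) / 2\<rfloor> + 1)" by simp
    finally have "real (card Ms) \<le> real_of_int (2 * \<lfloor>sqrt (real N) / 2\<rfloor> + 1)" by (simp add: le_nat_iff)
    thus ?thesis using of_int_floor_le[of "sqrt (real N) / 2"] by simp
  qed
  have bij: "PB N = (\<lambda>(m, n). mkp m n) ` Sigma Ms F"
  proof (intro equalityI subsetI)
    fix x assume x: "x \<in> PB N"
    hence xm: "x = mkp (pm x) (pn x)" using primary_eq_mkp by (simp add: PB_def)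
    have "int (gnorm (mkp (pm x) (pn x))) \<le> int N" using x xm by (simp add: PB_def)
    hence "pn x \<in> F (pm x)" unfolding gnorm_mkp by (simp add: F_def)
    moreover from this have "pm x \<in> Ms" unfolding F_def Ms_def mem_Collect_eq by (rule nn[OF _ zero_le_power2])
    ultimately show "x \<in> (\<lambda>(m, n). mkp m n) ` Sigma Ms F" using xm by (intro image_eqI[of _ _ "(pm x, pn x)"]) auto
  next
    fix x assume "x \<in> (\<lambda>(m, n). mkp m n) ` Sigma Ms F"
    then obtain m n where x: "x = mkp m n" "n \<in> F m" by auto
    have "int (gnorm x) \<le> int N" unfolding x(1) gnorm_mkp using x(2) by (simp add: F_def)
    thus "x \<in> PB N" using x(1) by (simp add: PB_def)
  qed
  have inj: "inj_on (\<lambda>(m, n). mkp m n) (Sigma Ms F)" by (auto simp: inj_on_def mkp_def)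
  have ck: "(-1 :: complex) powi (int k * n) = (-1) powi n" for n using assms by (simp add: power_int_minus_left)
  have "(\<Sum>n\<le>N. acoef j k n) = (\<Sum>(m, n)\<in>Sigma Ms F. \<i> powi (int j * m) * (-1) powi n)"
    unfolding sum_acoef bij by (subst sum.reindex[OF inj]) (auto simp: chi_def ck intro!: sum.cong)
  also have "... = (\<Sum>m\<in>Ms. \<Sum>n\<in>F m. \<i> powi (int j * m) * (-1) powi n)"
    by (rule sum.Sigma[symmetric]) (use finM finF in auto)
  also have "norm ... \<le> (\<Sum>m\<in>Ms. 1)"
  proof (rule sum_norm_le)
    fix m
    obtain a b where ab: "F m = {a..b}" using Fint by blast
    show "norm (\<Sum>n\<in>F m. \<i> powi (int j * m) * (-1) powi n) \<le> 1"
      unfolding sum_distrib_left[symmetric] ab using alternating_sum_interval[of a b] by (simp add: norm_mult norm_power_int)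
  qed
  also have "... = real (card Ms)" by simp
  finally have bd: "norm (\<Sum>n\<le>N. acoef j k n) \<le> sqrt (real N) + 1" using cardM by linarith
  show ?thesis
  proof (cases "N = 0")
    case True
    have "PB 0 = {}" by (auto simp: PB_def dest: primary_nz)
    thus ?thesis using True by (simp only: sum_acoef) simp
  next
    case False
    have "1 \<le> sqrt (real N)" using False by simp
    thus ?thesis using bd by linarith
  qed
qed

section \<open>Summation over the imaginary part for a fixed real part\<close>

definition oddset :: "nat \<Rightarrow> nat set" where "oddset N = {a. odd a \<and> a\<^sup>2 \<le> N}"

definition imag_range :: "nat \<Rightarrow> nat \<Rightarrow> int set" where "imag_range N a = {m::int. int (a\<^sup>2) + 4 * m\<^sup>2 \<le> int N}"

lemma finite_oddset: "finite (oddset N)"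
proof (rule finite_subset)
  show "oddset N \<subseteq> {..N}" by (auto simp: oddset_def power2_eq_square) (metis le_square order_trans)
qed simp

lemma imag_range_interval:
  assumes "a\<^sup>2 \<le> N"
  obtains M :: nat where "imag_range N a = {- int M..int M}" "2 * real M \<le> sqrt (real (N - a\<^sup>2))" "sqrt (real (N - a\<^sup>2)) < 2 * real M + 2"
proof -
  define R where "R = sqrt (real (N - a\<^sup>2))"
  define M where "M = nat \<lfloor>R / 2\<rfloor>"
  have R0: "R \<ge> 0" by (simp add: R_def)
  have M: "real M \<le> R / 2" "R / 2 < real M + 1" unfolding M_def using R0 by linarith+
  have "m \<in> imag_range N a \<longleftrightarrow> \<bar>m\<bar> \<le> int M" for m
  proof -
    have "m \<in> imag_range N a \<longleftrightarrow> (2 * m)\<^sup>2 \<le> int (N - a\<^sup>2)" using assms by (auto simp: imag_range_def power_mult_distrib of_nat_diff)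
    also have "... \<longleftrightarrow> \<bar>real_of_int (2 * m)\<bar> \<le> R" unfolding abs_le_sqrt_iff R_def ..
    also have "... \<longleftrightarrow> real_of_int \<bar>m\<bar> \<le> R / 2" by auto
    also have "... \<longleftrightarrow> \<bar>m\<bar> \<le> int M" using M by linarith
    finally show ?thesis .
  qed
  hence "imag_range N a = {m. \<bar>m\<bar> \<le> int M}" by blast
  also have "... = {- int M..int M}" by (auto simp: abs_le_iff)
  finally have "imag_range N a = {- int M..int M}" .
  thus ?thesis using that[of M] M by (simp add: R_def field_simps)
qed

text \<open>The absolute value a of the real part, which is odd, and half the imaginary part m
  determine a primary element: exactly one sign of the real part satisfies the condition modulo 4.
  For even k the character depends on m alone, which suits this order of summation.\<close>

lemma sum_PB_am_general:
  fixes f :: "nat \<Rightarrow> int \<Rightarrow> 'a::comm_monoid_add"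
  shows "(\<Sum>x\<in>PB N. f (nat \<bar>gre x\<bar>) (pm x)) = (\<Sum>a\<in>oddset N. \<Sum>m\<in>imag_range N a. f a m)"
proof -
  let ?i = "\<lambda>(a::nat, m::int). if 4 dvd int a + 2 * m - 1 then GInt (int a) (2 * m) else GInt (- int a) (2 * m)"
  have fin: "finite (imag_range N a)" if "a \<in> oddset N" for a
  proof -
    have "a\<^sup>2 \<le> N" using that by (simp add: oddset_def)
    then obtain M :: nat where "imag_range N a = {- int M..int M}" using imag_range_interval by blast
    thus ?thesis by simp
  qed
  have "(\<Sum>x\<in>PB N. f (nat \<bar>gre x\<bar>) (pm x)) = (\<Sum>(a, m)\<in>Sigma (oddset N) (imag_range N). f a m)"
  proof (rule sum.reindex_bij_witness[where j = "\<lambda>x. (nat \<bar>gre x\<bar>, pm x)" and i = ?i])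
    fix x assume x: "x \<in> PB N"
    hence pr: "primary x" "gnorm x \<le> N" by (auto simp: PB_def)
    then have ev: "even (gim x)" "4 dvd gre x + gim x - 1" by (auto simp: primary_def)
    have og: "odd (gre x)" using ev by presburger
    have g2: "gim x = 2 * pm x" using ev(1) by (simp add: pm_def)
    show "?i (nat \<bar>gre x\<bar>, pm x) = x"
    proof (cases "gre x \<ge> 0")
      case True thus ?thesis using ev(2) g2 by (simp add: gint_eq_iff)
    next
      case False
      have "\<not> 4 dvd - gre x + gim x - 1" using ev og by presburger
      thus ?thesis using False g2 by (simp add: gint_eq_iff)
    qed
    have "int (gnorm x) \<le> int N" using pr by simp
    hence n: "(gre x)\<^sup>2 + 4 * (pm x)\<^sup>2 \<le> int N" unfolding int_gnorm g2 by (simp add: power_mult_distrib)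
    have sq: "int ((nat \<bar>gre x\<bar>)\<^sup>2) = (gre x)\<^sup>2" by simp
    have "int ((nat \<bar>gre x\<bar>)\<^sup>2) \<le> int N" unfolding sq using n by (smt (verit) zero_le_power2)
    hence "(nat \<bar>gre x\<bar>)\<^sup>2 \<le> N" by (simp only: of_nat_le_iff)
    thus "(nat \<bar>gre x\<bar>, pm x) \<in> Sigma (oddset N) (imag_range N)" using og n sq by (simp add: oddset_def imag_range_def even_nat_iff)
    show "(case (nat \<bar>gre x\<bar>, pm x) of (a, m) \<Rightarrow> f a m) = f (nat \<bar>gre x\<bar>) (pm x)" by simp
  next
    fix am assume "am \<in> Sigma (oddset N) (imag_range N)"
    then obtain a m where am: "am = (a, m)" "odd a" "int (a\<^sup>2) + 4 * m\<^sup>2 \<le> int N" by (auto simp: oddset_def imag_range_def)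
    have "gre (?i (a, m)) = int a \<or> gre (?i (a, m)) = - int a" "gim (?i (a, m)) = 2 * m" by auto
    hence "int (gnorm (?i (a, m))) \<le> int N" unfolding int_gnorm using am(3) by (auto simp: power_mult_distrib)
    moreover have "primary (?i (a, m))" using am(2) by (auto simp: primary_def) presburger
    ultimately show "?i am \<in> PB N" using am(1) by (simp add: PB_def)
    show "(\<lambda>x. (nat \<bar>gre x\<bar>, pm x)) (?i am) = am" using am(1) by (auto simp: pm_def)
  qed
  also have "... = (\<Sum>a\<in>oddset N. \<Sum>m\<in>imag_range N a. f a m)"
    by (rule sum.Sigma[symmetric]) (use finite_oddset fin in auto)
  finally show ?thesis .
qed

lemma sum_PB_am:
  fixes f :: "int \<Rightarrow> 'a::comm_monoid_add"
  shows "(\<Sum>x\<in>PB N. f (pm x)) = (\<Sum>a\<in>oddset N. \<Sum>m\<in>imag_range N a. f m)"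
  by (rule sum_PB_am_general[of "\<lambda>_. f"])

lemma card_oddset: "real (card (oddset N)) \<le> sqrt (real N)"
proof -
  have "oddset N \<subseteq> {1..nat \<lfloor>sqrt (real N)\<rfloor>}"
  proof
    fix a assume a: "a \<in> oddset N"
    hence "(int a)\<^sup>2 \<le> int N" by (simp add: oddset_def flip: of_nat_power)
    hence "real a \<le> sqrt (real N)" unfolding abs_le_sqrt_iff by simp
    hence "a \<le> nat \<lfloor>sqrt (real N)\<rfloor>" by linarith
    moreover have "a \<ge> 1" using a by (auto simp: oddset_def intro: Suc_leI odd_pos)
    ultimately show "a \<in> {1..nat \<lfloor>sqrt (real N)\<rfloor>}" by simp
  qed
  hence "card (oddset N) \<le> card {1..nat \<lfloor>sqrt (real N)\<rfloor>}" by (intro card_mono) auto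
  hence "card (oddset N) \<le> nat \<lfloor>sqrt (real N)\<rfloor>" by simp
  thus ?thesis using real_sqrt_ge_zero[of "real N"] by linarith
qed

lemma chi_even: "even k \<Longrightarrow> chi j k x = \<i> powi (int j * pm x)"
  by (simp add: chi_def power_int_minus_left)

text \<open>Multiplication by u - 1 telescopes the sum to two terms of norm 1.\<close>

lemma geometric_powi_bound:
  fixes u :: complex
  assumes "norm u = 1" "norm (u - 1) \<ge> 1"
  shows "norm (\<Sum>m\<in>{- int M..int M}. u powi m) \<le> 2"
proof -
  have u0: "u \<noteq> 0" using assms(1) by auto
  have "(u - 1) * (\<Sum>m\<in>{- int M..int M}. u powi m) = u powi (int M + 1) - u powi (- int M)"
  proof (induction M)
    case (Suc M)
    have "{- int (Suc M)..int (Suc M)} = insert (int M + 1) (insert (- int M - 1) {- int M..int M})" by auto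
    hence "(\<Sum>m\<in>{- int (Suc M)..int (Suc M)}. u powi m) = u powi (int M + 1) + (u powi (- int M - 1) + (\<Sum>m\<in>{- int M..int M}. u powi m))" by simp
    hence "(u - 1) * (\<Sum>m\<in>{- int (Suc M)..int (Suc M)}. u powi m) = (u - 1) * u powi (int M + 1) + (u - 1) * u powi (- int M - 1) + (u powi (int M + 1) - u powi (- int M))"
      using Suc.IH by (simp add: distrib_left)
    also have "... = u powi (int M + 1 + 1) - u powi (- int M - 1)"
      using u0 power_int_add_1[of u "int M + 1"] power_int_add_1[of u "- int M - 1"] by (simp add: algebra_simps)
    also have "int M + 1 + 1 = int (Suc M) + 1" by simp
    also have "- int M - 1 = - int (Suc M)" by simp
    finally show ?case .
  qed (simp add: algebra_simps)
  hence "norm (u - 1) * norm (\<Sum>m\<in>{- int M..int M}. u powi m) = norm (u powi (int M + 1) - u powi (- int M))" by (metis norm_mult)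
  also have "... \<le> norm (u powi (int M + 1)) + norm (u powi (- int M))" by (rule norm_triangle_ineq4)
  also have "... = 2" using assms(1) by (simp add: norm_power_int)
  finally have "norm (u - 1) * norm (\<Sum>m\<in>{- int M..int M}. u powi m) \<le> 2" .
  moreover have "1 * norm (\<Sum>m\<in>{- int M..int M}. u powi m) \<le> norm (u - 1) * norm (\<Sum>m\<in>{- int M..int M}. u powi m)"
    using assms(2) by (intro mult_right_mono) auto
  ultimately show ?thesis by simp
qed

lemma ii_power_ne_1:
  assumes "\<not> 4 dvd j" shows "norm (\<i> ^ j - 1) \<ge> 1"
proof -
  have "j mod 4 \<noteq> 0" "j mod 4 < 4" using assms by (auto simp: dvd_eq_mod_eq_0)
  hence "j mod 4 = 1 \<or> j mod 4 = 2 \<or> j mod 4 = 3" by linarith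
  moreover have "\<i> ^ j = \<i> ^ (j mod 4)"
  proof -
    have "\<i> ^ j = \<i> ^ (4 * (j div 4) + j mod 4)" by simp
    also have "... = (\<i> ^ 4) ^ (j div 4) * \<i> ^ (j mod 4)" by (simp only: power_add power_mult)
    also have "\<i> ^ 4 = 1" by (simp add: numeral_eq_Suc)
    finally show ?thesis by simp
  qed
  ultimately show ?thesis
    using abs_Im_le_cmod[of "\<i> - 1"] abs_Re_le_cmod[of "-1 - 1"] abs_Im_le_cmod[of "- \<i> - 1"]
    by (elim disjE) (simp_all add: power3_eq_cube)
qed

text \<open>For each of at most sqrt N values of a the sum over m is geometric, with ratio i^j
  different from 1.\<close>

lemma acoef_sum_even:
  assumes "even k" "\<not> 4 dvd j"
  shows "norm (\<Sum>n\<le>N. acoef j k n) \<le> 3 * sqrt (real N)"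
proof -
  have "(\<Sum>n\<le>N. acoef j k n) = (\<Sum>x\<in>PB N. (\<i> ^ j) powi (pm x))"
    unfolding sum_acoef by (intro sum.cong refl) (simp add: chi_even assms power_int_mult)
  also have "... = (\<Sum>a\<in>oddset N. \<Sum>m\<in>imag_range N a. (\<i> ^ j) powi m)" by (rule sum_PB_am)
  also have "norm ... \<le> (\<Sum>a\<in>oddset N. 2)"
  proof (rule sum_norm_le)
    fix a assume "a \<in> oddset N"
    then obtain M :: nat where "imag_range N a = {- int M..int M}" using imag_range_interval[of a N] by (auto simp: oddset_def)
    thus "norm (\<Sum>m\<in>imag_range N a. (\<i> ^ j) powi m) \<le> 2"
      using geometric_powi_bound[of "\<i> ^ j" M] ii_power_ne_1[OF assms(2)] by (simp add: norm_power)
  qed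
  also have "... \<le> 2 * sqrt (real N)" using card_oddset[of N] by simp
  finally show ?thesis using real_sqrt_ge_zero[of "real N"] by linarith
qed

text \<open>The area under the circle of radius R between the abscissae 0 and t, an antiderivative
  of sqrt (R^2 - t^2).\<close>

definition circ :: "real \<Rightarrow> real \<Rightarrow> real" where
  "circ R t = (t * sqrt (R\<^sup>2 - t\<^sup>2) + R\<^sup>2 * arcsin (t / R)) / 2"

lemma circ_MVT:
  assumes R: "R > 0" and ab: "0 \<le> a" "a < b" "b \<le> R"
  shows "(b - a) * sqrt (R\<^sup>2 - b\<^sup>2) \<le> circ R b - circ R a" "circ R b - circ R a \<le> (b - a) * sqrt (R\<^sup>2 - a\<^sup>2)"
proof -
  have der: "(circ R has_real_derivative sqrt (R\<^sup>2 - x\<^sup>2)) (at x)" if x: "a < x" "x < b" for x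
  proof -
    have x2: "x\<^sup>2 < R\<^sup>2" using x ab by (intro power_strict_mono) auto
    define y where "y = sqrt (R\<^sup>2 - x\<^sup>2)"
    have y: "y > 0" "y\<^sup>2 = R\<^sup>2 - x\<^sup>2" using x2 by (auto simp: y_def)
    have s: "sqrt (1 - (x / R)\<^sup>2) = y / R"
    proof -
      have "1 - (x / R)\<^sup>2 = (R\<^sup>2 - x\<^sup>2) / R\<^sup>2" using R by (simp add: power_divide diff_divide_distrib)
      thus ?thesis using R by (simp add: y_def real_sqrt_divide)
    qed
    have xr: "-1 < x / R" "x / R < 1" using x ab R by (auto simp: field_simps)
    have d1: "((\<lambda>t. sqrt (R\<^sup>2 - t\<^sup>2)) has_real_derivative (- x / y)) (at x)"
      using x2 y by (auto intro!: derivative_eq_intros simp: y_def field_simps)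
    have d2: "((\<lambda>t. arcsin (t / R)) has_real_derivative (1 / y)) (at x)"
    proof -
      have "((\<lambda>t. t / R) has_real_derivative 1 / R) (at x)" using R by (auto intro!: derivative_eq_intros)
      from DERIV_chain2[where f = arcsin and g = "\<lambda>t. t / R", OF DERIV_arcsin[OF xr] this]
      show ?thesis using R y unfolding s by simp
    qed
    have "(circ R has_real_derivative ((1 * sqrt (R\<^sup>2 - x\<^sup>2) + (- x / y) * x) + R\<^sup>2 * (1 / y)) / 2) (at x)"
      unfolding circ_def by (intro DERIV_cdivide DERIV_add DERIV_mult d1 DERIV_cmult d2 DERIV_ident)
    also have "((1 * sqrt (R\<^sup>2 - x\<^sup>2) + (- x / y) * x) + R\<^sup>2 * (1 / y)) / 2 = y"
    proof -
      have "(- x / y) * x + R\<^sup>2 * (1 / y) = y\<^sup>2 / y" unfolding y(2) by (simp add: power2_eq_square diff_divide_distrib)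
      also have "... = y" using y(1) by (simp add: power2_eq_square)
      finally show ?thesis unfolding y_def[symmetric] by simp
    qed
    finally show ?thesis by (simp add: y_def)
  qed
  have cont: "continuous_on {a..b} (circ R)"
    unfolding circ_def using R ab by (intro continuous_intros) (auto simp: field_simps intro: order_trans)
  obtain z where z: "a < z" "z < b" "circ R b - circ R a = (b - a) * sqrt (R\<^sup>2 - z\<^sup>2)"
    using MVT[OF ab(2) cont] der by (metis DERIV_unique real_differentiable_def)
  have "z\<^sup>2 \<le> b\<^sup>2" "a\<^sup>2 \<le> z\<^sup>2" using z ab by (auto intro!: power_mono)
  thus "(b - a) * sqrt (R\<^sup>2 - b\<^sup>2) \<le> circ R b - circ R a" "circ R b - circ R a \<le> (b - a) * sqrt (R\<^sup>2 - a\<^sup>2)"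
    unfolding z(3) using ab by (auto intro!: mult_left_mono)
qed

lemma circ_ends: "R > 0 \<Longrightarrow> circ R R = pi / 4 * R\<^sup>2" "circ R 0 = 0"
  by (auto simp: circ_def)

text \<open>Since sqrt (N - a^2) decreases in a, twice its sum over odd a is squeezed between areas
  of vertical strips of width 2 in the quarter disc. Only the strips at the two ends are left over,
  an error of order sqrt N.\<close>

lemma sum_odd_circle:
  assumes N: "N > 0"
  shows "\<bar>2 * (\<Sum>a\<in>oddset N. sqrt (real (N - a\<^sup>2))) - pi / 4 * real N\<bar> \<le> 3 * sqrt (real N)"
proof -
  define R where "R = sqrt (real N)"
  have R: "R > 0" "R \<ge> 1" "R\<^sup>2 = real N" using N by (auto simp: R_def)
  \<comment> \<open>The number of odd integers up to R.\<close>
  define m where "m = nat \<lfloor>(R + 1) / 2\<rfloor>"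
  have "0 \<le> (R + 1) / 2" using R by simp
  hence "real m = of_int \<lfloor>(R + 1) / 2\<rfloor>" by (simp add: m_def)
  hence m: "real m \<le> (R + 1) / 2" "(R + 1) / 2 < real m + 1" using floor_correct[of "(R + 1) / 2"] by auto
  have "1 \<le> (R + 1) / 2" using R(2) by simp
  hence "1 < real m + 1" using m(2) by (rule le_less_trans)
  hence m1: "m \<ge> 1" by simp
  let ?g = "\<lambda>i::nat. sqrt (R\<^sup>2 - (2 * real i + 1)\<^sup>2)"
  have os: "oddset N = (\<lambda>i. 2 * i + 1) ` {..<m}"
  proof (intro equalityI subsetI)
    fix a assume a: "a \<in> oddset N"
    then obtain i where i: "a = 2 * i + 1" by (auto simp: oddset_def elim: oddE)
    have "(int a)\<^sup>2 \<le> int N" using a by (simp add: oddset_def flip: of_nat_power)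
    hence "real a \<le> R" unfolding abs_le_sqrt_iff R_def by simp
    hence "2 * real i + 1 \<le> R" using i by simp
    hence "real i + 1 \<le> (R + 1) / 2" by simp
    hence "real i + 1 < real m + 1" using m(2) by (rule le_less_trans)
    hence "i < m" by simp
    thus "a \<in> (\<lambda>i. 2 * i + 1) ` {..<m}" using i by blast
  next
    fix a assume "a \<in> (\<lambda>i. 2 * i + 1) ` {..<m}"
    then obtain i where i: "i < m" "a = 2 * i + 1" by blast
    have "real a = 2 * (real i + 1) - 1" using i by simp
    also have "... \<le> 2 * real m - 1" using i by simp
    also have "... \<le> R" using m(1) by (simp add: field_simps)
    finally have "real a \<le> R" .
    hence "(int a)\<^sup>2 \<le> int N" unfolding abs_le_sqrt_iff R_def by simp
    hence "a\<^sup>2 \<le> N" by (simp flip: of_nat_power)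
    thus "a \<in> oddset N" using i by (simp add: oddset_def)
  qed
  have S: "(\<Sum>a\<in>oddset N. sqrt (real (N - a\<^sup>2))) = (\<Sum>i<m. ?g i)"
  proof -
    have "(\<Sum>a\<in>oddset N. sqrt (real (N - a\<^sup>2))) = (\<Sum>i<m. sqrt (real (N - (2 * i + 1)\<^sup>2)))"
      unfolding os by (subst sum.reindex) (auto simp: inj_on_def)
    also have "... = (\<Sum>i<m. ?g i)"
    proof (intro sum.cong refl)
      fix i assume "i \<in> {..<m}"
      hence "2 * i + 1 \<in> oddset N" unfolding os by blast
      hence "(2 * i + 1)\<^sup>2 \<le> N" by (simp add: oddset_def)
      hence "real (N - (2 * i + 1)\<^sup>2) = real N - (2 * real i + 1)\<^sup>2" by (simp add: of_nat_diff)
      thus "sqrt (real (N - (2 * i + 1)\<^sup>2)) = ?g i" using R by simp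
    qed
    finally show ?thesis .
  qed
  have le: "2 * real i + 1 \<le> R" if "i < m" for i
  proof -
    have "2 * real i + 1 = 2 * (real i + 1) - 1" by simp
    also have "... \<le> 2 * real m - 1" using that by simp
    also have "... \<le> R" using m(1) by (simp add: field_simps)
    finally show ?thesis .
  qed
  define c where "c = (\<lambda>i::nat. circ R (2 * real i + 1))"
  obtain m' where m': "m = Suc m'" using m1 by (cases m) auto
  have up: "2 * ?g (Suc i) \<le> c (Suc i) - c i" and lo: "c (Suc i) - c i \<le> 2 * ?g i" if "i < m'" for i
    using circ_MVT[OF R(1), of "2 * real i + 1" "2 * real (Suc i) + 1"] le[of "Suc i"] that m' by (auto simp: c_def)
  have t: "(\<Sum>i<m'. c (Suc i) - c i) = c m' - c 0" by (rule sum_lessThan_telescope)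
  have g0: "?g i \<ge> 0" "?g i \<le> R" if "i < m" for i
  proof -
    have "(2 * real i + 1)\<^sup>2 \<le> R\<^sup>2" using le[OF that] by (intro power_mono) auto
    thus "?g i \<ge> 0" by simp
    have "?g i \<le> sqrt (R\<^sup>2)" by (intro real_sqrt_le_mono) simp
    thus "?g i \<le> R" using R(1) by simp
  qed
  have c0: "0 \<le> c 0" "c 0 \<le> R"
  proof -
    have cc: "c 0 = circ R 1 - circ R 0" by (simp add: c_def circ_ends(2))
    have "(1::real)\<^sup>2 \<le> R\<^sup>2" using R(2) by (intro power_mono) auto
    hence "0 \<le> (1 - 0) * sqrt (R\<^sup>2 - 1\<^sup>2)" by simp
    also have "... \<le> circ R 1 - circ R 0" by (rule circ_MVT(1)[OF R(1)]) (use R(2) in auto)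
    finally show "0 \<le> c 0" unfolding cc .
    have "circ R 1 - circ R 0 \<le> (1 - 0) * sqrt (R\<^sup>2 - 0\<^sup>2)" by (rule circ_MVT(2)[OF R(1)]) (use R(2) in auto)
    also have "... = R" using R(1) by simp
    finally show "c 0 \<le> R" unfolding cc .
  qed
  have cm: "0 \<le> circ R R - c m'" "circ R R - c m' \<le> 2 * R"
  proof -
    have l: "2 * real m' + 1 \<le> R" using le[of m'] m' by simp
    have R2: "R - (2 * real m' + 1) \<le> 2" using m m' by simp
    have "0 \<le> circ R R - c m' \<and> circ R R - c m' \<le> 2 * R"
    proof (cases "2 * real m' + 1 = R")
      case True thus ?thesis using R by (simp add: c_def)
    next
      case False
      hence l': "2 * real m' + 1 < R" using l by simp
      note mv = circ_MVT[OF R(1) _ l' order_refl]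
      have "0 \<le> circ R R - c m'" using mv(1) by (simp add: c_def)
      moreover have "circ R R - c m' \<le> (R - (2 * real m' + 1)) * ?g m'" using mv(2) by (simp add: c_def)
      moreover have "(R - (2 * real m' + 1)) * ?g m' \<le> 2 * R" using R2 g0[of m'] m' R l by (intro mult_mono) auto
      ultimately show ?thesis by linarith
    qed
    thus "0 \<le> circ R R - c m'" "circ R R - c m' \<le> 2 * R" by auto
  qed
  have "(\<Sum>i<m. ?g i) = ?g 0 + (\<Sum>i<m'. ?g (Suc i))" unfolding m' by (rule sum.lessThan_Suc_shift)
  moreover have "(\<Sum>i<m'. 2 * ?g (Suc i)) \<le> c m' - c 0" unfolding t[symmetric] by (intro sum_mono up) auto
  ultimately have U: "2 * (\<Sum>i<m. ?g i) \<le> 2 * R + c m' - c 0"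
    using g0(2)[of 0] m' by (simp add: sum_distrib_left[symmetric])
  have gm: "0 \<le> ?g m'" by (rule g0(1)) (simp add: m')
  have "c m' - c 0 \<le> (\<Sum>i<m'. 2 * ?g i)" unfolding t[symmetric] by (intro sum_mono lo) auto
  also have "... = 2 * (\<Sum>i<m'. ?g i)" by (simp only: sum_distrib_left)
  also have "... \<le> 2 * ((\<Sum>i<m'. ?g i) + ?g m')" using gm by (intro mult_left_mono) auto
  also have "(\<Sum>i<m'. ?g i) + ?g m' = (\<Sum>i<m. ?g i)" unfolding m' by simp
  finally have L: "c m' - c 0 \<le> 2 * (\<Sum>i<m. ?g i)" .
  have "circ R R = pi / 4 * real N" using circ_ends(1)[OF R(1)] R(3) by simp
  thus ?thesis unfolding S R_def[symmetric] using U L c0 cm by (simp add: abs_le_iff)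
qed

text \<open>For fixed a the number of m is 2M + 1 with 2M the largest even integer up to sqrt (N -
  a^2), hence within 1 of that root. The constant pi/8 is the density of the disc of area pi N
  divided by the norm 8 of 2 + 2i.\<close>

lemma card_PB: "\<bar>real (card (PB N)) - pi / 8 * real N\<bar> \<le> 3 * sqrt (real N)"
proof (cases "N = 0")
  case True
  have "PB 0 = {}" by (auto simp: PB_def dest: primary_nz)
  thus ?thesis using True by simp
next
  case False
  have "real (card (PB N)) = (\<Sum>x\<in>PB N. 1)" by simp
  also have "... = (\<Sum>a\<in>oddset N. \<Sum>m\<in>imag_range N a. 1)" by (rule sum_PB_am)
  also have "... = (\<Sum>a\<in>oddset N. real (card (imag_range N a)))" by simp
  finally have e: "real (card (PB N)) = (\<Sum>a\<in>oddset N. real (card (imag_range N a)))" .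
  have "\<bar>real (card (PB N)) - (\<Sum>a\<in>oddset N. sqrt (real (N - a\<^sup>2)))\<bar> = \<bar>\<Sum>a\<in>oddset N. real (card (imag_range N a)) - sqrt (real (N - a\<^sup>2))\<bar>"
    unfolding e by (simp add: sum_subtractf)
  also have "... \<le> (\<Sum>a\<in>oddset N. \<bar>real (card (imag_range N a)) - sqrt (real (N - a\<^sup>2))\<bar>)" by (rule sum_abs)
  also have "... \<le> (\<Sum>a\<in>oddset N. 1)"
  proof (intro sum_mono)
    fix a assume "a \<in> oddset N"
    then obtain M :: nat where M: "imag_range N a = {- int M..int M}" "2 * real M \<le> sqrt (real (N - a\<^sup>2))" "sqrt (real (N - a\<^sup>2)) < 2 * real M + 2"
      using imag_range_interval[of a N] by (auto simp: oddset_def)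
    have "card (imag_range N a) = 2 * M + 1" unfolding M(1) by (simp add: nat_add_distrib nat_mult_distrib)
    thus "\<bar>real (card (imag_range N a)) - sqrt (real (N - a\<^sup>2))\<bar> \<le> 1" using M(2,3) by (simp add: abs_le_iff)
  qed
  also have "... \<le> sqrt (real N)" using card_oddset[of N] by simp
  finally have 1: "\<bar>real (card (PB N)) - (\<Sum>a\<in>oddset N. sqrt (real (N - a\<^sup>2)))\<bar> \<le> sqrt (real N)" .
  have 2: "\<bar>2 * (\<Sum>a\<in>oddset N. sqrt (real (N - a\<^sup>2))) - pi / 4 * real N\<bar> \<le> 3 * sqrt (real N)"
    using sum_odd_circle False by simp
  show ?thesis using 1 2 by linarith
qed

lemma sum_card_In: "(\<Sum>n\<le>N. real (card (In n))) \<le> 4 * real N"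
proof -
  have "(\<Sum>n\<le>N. real (card (In n))) = (\<Sum>n\<le>N. \<Sum>x\<in>In n. 1)" by simp
  also have "... = real (card (PB N))" unfolding sum_In_PB by simp
  also have "... \<le> pi / 8 * real N + 3 * sqrt (real N)" using card_PB[of N] by linarith
  also have "pi / 8 * real N \<le> 1 * real N" using pi_less_4 by (intro mult_right_mono) auto
  also have "sqrt (real N) \<le> real N" 
    using real_sqrt_le_mono[of "real N" "real N * real N"] by (cases "N = 0") auto
  finally show ?thesis by simp
qed

lemma norm_acoef: "norm (acoef j k n) \<le> real (card (In n))"
  unfolding acoef_def by (rule order_trans[OF norm_sum]) simp

lemma acoef_sum_principal:
  assumes "even k" "4 dvd j"
  shows "norm ((\<Sum>n\<le>N. acoef j k n) - of_real (pi / 8) * of_nat N) \<le> 3 * sqrt (real N)"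
proof -
  have "chi j k x = 1" for x
  proof -
    obtain i where "j = 4 * i" using assms(2) by (elim dvdE)
    hence "int j * pm x = 4 * (int i * pm x)" by simp
    thus ?thesis using chi_even[OF assms(1)] ii_powi_4 by metis
  qed
  hence "(\<Sum>n\<le>N. acoef j k n) = of_nat (card (PB N))" unfolding sum_acoef by simp
  hence "(\<Sum>n\<le>N. acoef j k n) - of_real (pi / 8) * of_nat N = of_real (real (card (PB N)) - pi / 8 * real N)" by simp
  thus ?thesis using card_PB[of N] by (metis norm_of_real)
qed

section \<open>Prime powers of Gaussian primes\<close>

lemma prod_primes_dvd:
  fixes n :: nat
  assumes "finite S" "\<And>p. p \<in> S \<Longrightarrow> prime p \<and> p dvd n"
  shows "\<Prod>S dvd n"
  using assms
proof (induction rule: finite_induct)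
  case (insert p S)
  have "coprime p (\<Prod>S)"
  proof (rule prime_imp_coprime)
    show "prime p" using insert.prems by blast
    show "\<not> p dvd \<Prod>S"
    proof
      assume "p dvd \<Prod>S"
      then obtain q where "q \<in> S" "p dvd q" using prime_dvd_prod_iff[OF insert.hyps(1) \<open>prime p\<close>, of "\<lambda>x. x"] by auto
      thus False using insert.prems insert.hyps(2) primes_dvd_imp_eq[of p q] by blast
    qed
  qed
  moreover have "p dvd n" "\<Prod>S dvd n" using insert by auto
  ultimately show ?case using insert.hyps by (simp add: divides_mult)
qed simp

lemma central_binomial_le: "(2 * m + 1) choose m \<le> 4 ^ m"
proof -
  have "((2 * m + 1) choose m) + ((2 * m + 1) choose (m + 1)) = (\<Sum>k\<in>{m, m + 1}. (2 * m + 1) choose k)" by simp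
  also have "... \<le> (\<Sum>k\<le>2 * m + 1. (2 * m + 1) choose k)" by (intro sum_mono2) auto
  also have "... = 2 ^ (2 * m + 1)" by (rule choose_row_sum)
  also have "... = 2 * 4 ^ m" by (simp add: power_mult)
  finally have "((2 * m + 1) choose m) + ((2 * m + 1) choose (m + 1)) \<le> 2 * 4 ^ m" .
  moreover have "(2 * m + 1) choose (m + 1) = (2 * m + 1) choose m"
    using binomial_symmetric[of m "2 * m + 1"] by simp
  ultimately show ?thesis by linarith
qed

text \<open>The binomial argument of Erdos: for n = 2m + 1 all primes in (m + 1, n] divide the
  binomial coefficient of n over m, which is at most 4^m; an even n above 2 is not prime and reduces
  to n - 1.\<close>

lemma primorial_le: "\<Prod>{p. prime p \<and> p \<le> n} \<le> (4::nat) ^ n"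
proof (induction n rule: less_induct)
  case (less n)
  have fin: "finite {p. prime p \<and> p \<le> k}" for k :: nat by (rule finite_subset[of _ "{..k}"]) auto
  have "n \<le> 1 \<or> n = 2 \<or> (\<exists>m. n = 2 * m \<and> m \<ge> 2) \<or> (\<exists>m. n = 2 * m + 1 \<and> m \<ge> 1)" by presburger
  then consider "n \<le> 1" | "n = 2" | m where "n = 2 * m" "m \<ge> 2" | m where "n = 2 * m + 1" "m \<ge> 1" by blast
  thus ?case
  proof cases
    case 1
    hence e: "{p. prime p \<and> p \<le> n} = {}" by (auto dest: prime_ge_2_nat)
    show ?thesis unfolding e by simp
  next
    case 2
    hence e: "{p::nat. prime p \<and> p \<le> n} = {2}" by (auto dest: prime_ge_2_nat)
    show ?thesis unfolding e using 2 by simp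
  next
    case 3
    have "\<not> prime n"
    proof
      assume "prime n"
      moreover have "2 dvd n" using 3 by simp
      ultimately have "2 = n" using primes_dvd_imp_eq[OF two_is_prime_nat] by blast
      thus False using 3 by simp
    qed
    hence "p \<le> n \<longleftrightarrow> p \<le> n - 1" if "prime p" for p using that by (cases "p = n") auto
    hence "{p. prime p \<and> p \<le> n} = {p. prime p \<and> p \<le> n - 1}" by blast
    also have "\<Prod>... \<le> 4 ^ (n - 1)" using less.IH[of "n - 1"] 3 by simp
    also have "(4::nat) ^ (n - 1) \<le> 4 ^ n" by (intro power_increasing) auto
    finally show ?thesis .
  next
    case (4 m)
    define S where "S = {p. prime p \<and> m + 1 < p \<and> p \<le> n}"
    have "{p. prime p \<and> p \<le> n} = {p. prime p \<and> p \<le> m + 1} \<union> S" using 4 by (auto simp: S_def)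
    moreover have "finite S" unfolding S_def by (rule finite_subset[OF _ fin[of n]]) auto
    ultimately have "\<Prod>{p. prime p \<and> p \<le> n} = \<Prod>{p. prime p \<and> p \<le> m + 1} * \<Prod>S"
      using fin[of "m + 1"] by (simp add: prod.union_disjoint S_def) (subst prod.union_disjoint, auto)
    also have "\<Prod>S \<le> n choose m"
    proof (rule dvd_imp_le[OF prod_primes_dvd[OF \<open>finite S\<close>]])
      fix p assume p: "p \<in> S"
      hence pp: "prime p" "m + 1 < p" "p \<le> n" by (auto simp: S_def)
      have "fact m * fact (n - m) * (n choose m) = (fact n :: nat)" using 4 by (intro binomial_fact_lemma) simp
      hence "p dvd fact m * fact (n - m) * (n choose m)" using pp prime_dvd_fact_iff[of p n] by simp
      hence "p dvd fact m \<or> p dvd fact (n - m) \<or> p dvd (n choose m)" using pp(1) by (simp add: prime_dvd_mult_iff)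
      moreover have "n - m = m + 1" using 4 by simp
      hence "\<not> p dvd fact m" "\<not> p dvd fact (n - m)"
        using prime_dvd_fact_iff[OF pp(1), of m] prime_dvd_fact_iff[OF pp(1), of "m + 1"] pp(2) by (simp_all del: fact_Suc)
      ultimately show "prime p \<and> p dvd (n choose m)" using pp by blast
    qed (use 4 in simp)
    also have "n choose m \<le> 4 ^ m" using central_binomial_le[of m] 4 by simp
    also have "\<Prod>{p. prime p \<and> p \<le> m + 1} \<le> 4 ^ (m + 1)" using less.IH[of "m + 1"] 4 by simp
    finally have "\<Prod>{p. prime p \<and> p \<le> n} \<le> 4 ^ (m + 1) * 4 ^ m" by simp
    also have "... = 4 ^ n" using 4 by (simp add: power_add[symmetric])
    finally show ?thesis .
  qed
qed

lemma chebyshev_theta: "(\<Sum>p\<in>{p. prime p \<and> p \<le> n}. ln (real p)) \<le> real n * ln 4"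
proof -
  have fin: "finite {p::nat. prime p \<and> p \<le> n}" by (rule finite_subset[of _ "{..n}"]) auto
  have "(\<Sum>p\<in>{p. prime p \<and> p \<le> n}. ln (real p)) = ln (\<Prod>p\<in>{p. prime p \<and> p \<le> n}. real p)"
    by (subst ln_prod) (use fin in \<open>auto simp: prime_gt_0_nat\<close>)
  also have "(\<Prod>p\<in>{p. prime p \<and> p \<le> n}. real p) = real (\<Prod>{p. prime p \<and> p \<le> n})" by simp
  also have "ln (real (\<Prod>{p. prime p \<and> p \<le> n})) \<le> ln (real (4 ^ n))"
  proof (subst ln_le_cancel_iff)
    show "0 < real (\<Prod>{p. prime p \<and> p \<le> n})" by (auto simp: prod_pos prime_gt_0_nat simp del: of_nat_prod intro!: prod_pos)
    show "real (\<Prod>{p. prime p \<and> p \<le> n}) \<le> real (4 ^ n)" using primorial_le[of n] by (simp only: of_nat_le_iff)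
  qed simp
  also have "... = real n * ln 4" by (simp add: ln_realpow)
  finally show ?thesis .
qed

section \<open>Primary elements of prime norm\<close>

lemma gnorm_prime_imp_prime_elem:
  assumes "prime (gnorm x)" shows "prime_elem x"
proof (rule gint_prime_elemI)
  show "x \<noteq> 0" using assms by (metis gnorm_0_iff not_prime_0)
  show "\<not> x dvd 1" using assms by (metis gint_unit_iff not_prime_1)
  fix a b assume "x = a * b"
  hence "prime (gnorm a * gnorm b)" using assms by (simp add: gnorm_mult)
  hence "gnorm a = 1 \<or> gnorm b = 1" by (metis dvd_triv_left prime_nat_iff nat_mult_eq_cancel1 prime_gt_0_nat mult.right_neutral nat_0_less_mult_iff)
  thus "a dvd 1 \<or> b dvd 1" by (simp add: gint_unit_iff)
qed

text \<open>The prime element x divides y conj(y) = x conj(x), hence y or its conjugate, and between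
  primary elements of equal norm divisibility is equality.\<close>

lemma same_prime_gnorm:
  assumes "primary x" "primary y" "gnorm x = gnorm y" "prime (gnorm x)"
  shows "y = x \<or> y = gconj x"
proof -
  have "prime_elem x" by (rule gnorm_prime_imp_prime_elem[OF assms(4)])
  moreover have "x dvd y * gconj y" using mult_gconj[of x] mult_gconj[of y] assms(3) by (metis dvd_triv_left)
  ultimately have "x dvd y \<or> x dvd gconj y" by (rule prime_elem_dvd_multD)
  thus ?thesis
  proof
    assume "x dvd y"
    thus ?thesis using primary_assoc[OF assms(1,2)] assms(3) by simp
  next
    assume "x dvd gconj y"
    hence "x = gconj y" using primary_assoc[OF assms(1), of "gconj y"] assms(2,3) by simp
    thus ?thesis by simp
  qed
qed

lemma prime_elem_dvd_of_nat:
  fixes p :: gint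
  assumes "prime_elem p" "p dvd of_nat n" "n > 0"
  shows "\<exists>l. prime l \<and> p dvd of_nat l"
  using assms(2,3)
proof (induction n rule: less_induct)
  case (less n)
  show ?case
  proof (cases "n = 1")
    case True
    thus ?thesis using less.prems assms(1) by (auto simp: prime_elem_def)
  next
    case False
    then obtain l where l: "prime l" "l dvd n" using prime_factor_nat by blast
    then obtain k where k: "n = l * k" by (elim dvdE)
    have "p dvd of_nat l * of_nat k" using less.prems(1) k by simp
    hence "p dvd of_nat l \<or> p dvd of_nat k" by (rule prime_elem_dvd_multD[OF assms(1)])
    moreover have "0 < k" using less.prems(2) k by (cases k) auto
    moreover from this have "1 * k < l * k" using prime_gt_1_nat[OF l(1)] by (intro mult_strict_right_mono) auto
    hence "k < n" using k by simp
    ultimately show ?thesis using l(1) less.IH[of k] by blast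
  qed
qed

text \<open>Such a p divides a rational prime l and has norm l^2, so it is a unit times l; being
  primary excludes the units i and -i.\<close>

lemma PP_nonprime_norm:
  assumes p: "p \<in> PP" and np: "\<not> prime (gnorm p)"
  shows "gim p = 0"
proof -
  have pr: "primary p" "prime_elem p" using p by (auto simp: PP_def)
  have "p dvd of_nat (gnorm p)" using mult_gconj[of p] by (metis dvd_triv_left of_int_of_nat_eq)
  then obtain l where l: "prime l" "p dvd of_nat l"
    using prime_elem_dvd_of_nat[OF pr(2)] primary_gnorm_pos[OF pr(1)] by blast
  then obtain u where u: "of_nat l = p * u" by (elim dvdE)
  have "gnorm (of_nat l) = l * l" by (simp add: gnorm_def power2_eq_square nat_mult_distrib)
  hence g: "gnorm p * gnorm u = l * l" using u by (metis gnorm_mult)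
  hence "gnorm p dvd l ^ 2" by (metis dvd_triv_left power2_eq_square)
  then obtain i where i: "i \<le> 2" "gnorm p = l ^ i" using l(1) by (metis divides_primepow_nat)
  have "i \<noteq> 0" using i PP_gnorm[OF p] by (cases i) auto
  moreover have "i \<noteq> 1" using i np l(1) by auto
  ultimately have "i = 2" using i by linarith
  hence gp: "gnorm p = l * l" using i by (simp add: power2_eq_square)
  have "l > 0" using l(1) by (simp add: prime_gt_0_nat)
  hence gu: "gnorm u = 1" using g gp by simp
  have "p = of_nat l * gconj u"
  proof -
    have "of_nat l * gconj u = p * (u * gconj u)" using u by (simp add: mult.assoc)
    thus ?thesis using mult_gconj[of u] gu by simp
  qed
  hence im: "gim p = - int l * gim u" "gre p = int l * gre u" by simp_all
  have ol: "odd l" using primary_odd_gnorm[OF pr(1)] gp by simp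
  have "even (gim p)" using pr(1) by (simp add: primary_def)
  hence "even (gim u)" using im ol by simp
  moreover have "(gre u)\<^sup>2 + (gim u)\<^sup>2 = 1" using int_gnorm[of u] gu by simp
  hence "(gim u)\<^sup>2 \<le> 1" using zero_le_power2[of "gre u"] by linarith
  hence "\<bar>gim u\<bar> \<le> 1" by (simp add: abs_square_le_1)
  ultimately have "gim u = 0" by presburger
  thus ?thesis using im by simp
qed

lemma card_gnorm_le: "M > 0 \<Longrightarrow> card {x. gnorm x \<le> M} \<le> 9 * M"
proof -
  assume M: "M > 0"
  define s where "s = nat \<lfloor>sqrt (real M)\<rfloor>"
  have s: "real s \<le> sqrt (real M)" unfolding s_def by simp
  have s1: "s \<ge> 1" unfolding s_def using M by (simp add: le_nat_iff le_floor_iff)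
  have ss: "s * s \<le> M"
  proof -
    have "real s * real s \<le> sqrt (real M) * sqrt (real M)" using s by (intro mult_mono) auto
    hence "real (s * s) \<le> real M" by simp
    thus ?thesis by (simp only: of_nat_le_iff)
  qed
  have "{x. gnorm x \<le> M} \<subseteq> (\<lambda>(a, b). GInt a b) ` ({- int s..int s} \<times> {- int s..int s})"
  proof
    fix x assume "x \<in> {x. gnorm x \<le> M}"
    hence "int (gnorm x) \<le> int M" by simp
    hence n: "(gre x)\<^sup>2 + (gim x)\<^sup>2 \<le> int M" by (simp only: int_gnorm)
    have *: "y \<in> {- int s..int s}" if "y\<^sup>2 \<le> int M" for y :: int
    proof -
      have "(real_of_int y)\<^sup>2 \<le> real M" using that by (metis of_int_le_iff of_int_of_nat_eq of_int_power)
      hence "\<bar>real_of_int y\<bar> \<le> sqrt (real M)" using real_sqrt_le_mono by fastforce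
      hence "\<bar>y\<bar> \<le> int s" unfolding s_def by (simp add: le_floor_iff)
      thus ?thesis by auto
    qed
    have nn: "a \<le> c" "b \<le> c" if "a + b \<le> c" "0 \<le> a" "0 \<le> b" for a b c :: int using that by linarith+
    have "gre x \<in> {- int s..int s}" "gim x \<in> {- int s..int s}"
      using *[OF nn(1)[OF n zero_le_power2 zero_le_power2]] *[OF nn(2)[OF n zero_le_power2 zero_le_power2]] by auto
    thus "x \<in> (\<lambda>(a, b). GInt a b) ` ({- int s..int s} \<times> {- int s..int s})"
      by (intro image_eqI[of _ _ "(gre x, gim x)"]) auto
  qed
  hence "card {x. gnorm x \<le> M} \<le> card ({- int s..int s} \<times> {- int s..int s})"
    by (meson card_image_le card_mono finite_SigmaI finite_atLeastAtMost_int finite_imageI le_trans)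
  also have "... = (2 * s + 1) * (2 * s + 1)" by (simp add: card_cartesian_product nat_add_distrib nat_mult_distrib)
  also have "... \<le> (3 * s) * (3 * s)" using s1 by (intro mult_mono) auto
  also have "... = 9 * (s * s)" by simp
  also have "... \<le> 9 * M" using ss by simp
  finally show ?thesis .
qed

text \<open>These prime powers contribute only \<open>o(N)\<close>.\<close>

definition Tset :: "nat \<Rightarrow> (gint \<times> nat) set" where
  "Tset N = {(p, l). p \<in> PP \<and> l \<ge> 1 \<and> gnorm p ^ l \<le> N \<and> \<not> prime (gnorm p ^ l)}"

text \<open>Proper powers have at most 9 sqrt N bases, of norm up to sqrt N, and at most 2 ln N
  exponents. First powers of nonprime norm are real, which leaves at most 2 sqrt N + 1 of them.
  Every weight is at most ln N.\<close>

definition hT :: "nat \<Rightarrow> real" where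
  "hT N = (9 * sqrt (real N) * (2 * ln (real N)) + 2 * sqrt (real N) + 1) * ln (real N)"

lemma hT_o: "(\<lambda>N. hT N / real N) \<longlonglongrightarrow> 0"
  unfolding hT_def by real_asymp

lemma sum_Tset: "(\<Sum>(p, l)\<in>Tset N. ln (real (gnorm p))) \<le> hT N"
proof (cases "N \<ge> 2")
  case False
  have "Tset N = {}"
  proof -
    have False if "p \<in> PP" "l \<ge> 1" "gnorm p ^ l \<le> N" for p l
      using pp_bounds(1)[OF that] PP_gnorm[OF that(1)] False by linarith
    thus ?thesis by (auto simp: Tset_def)
  qed
  moreover have "N = 0 \<or> N = 1" using False by linarith
  hence "hT N \<ge> 0" by (auto simp: hT_def)
  ultimately show ?thesis by simp
next
  case True
  define L where "L = nat \<lfloor>2 * ln (real N)\<rfloor>"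
  define M where "M = nat \<lfloor>sqrt (real N)\<rfloor>"
  define R where "R = {- int M..int M}"
  have lnN: "ln (real N) > 0" using True by simp
  have Lr: "real L \<le> 2 * ln (real N)" unfolding L_def using lnN by simp
  have Mr: "real M \<le> sqrt (real N)" unfolding M_def by simp
  have M1: "M > 0" unfolding M_def using True by (simp add: le_floor_iff)
  have sqM: "n \<le> M" if "n * n \<le> N" for n
  proof -
    have "real n * real n \<le> real N" using that by (metis of_nat_le_iff of_nat_mult)
    hence "real n \<le> sqrt (real N)" by (simp add: real_le_rsqrt power2_eq_square)
    thus ?thesis unfolding M_def by (simp add: le_nat_iff le_floor_iff)
  qed
  define T1 where "T1 = {p. gnorm p \<le> M} \<times> {1..L}"
  define T2 where "T2 = (\<lambda>a. (GInt a 0, 1::nat)) ` R"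
  have sub: "Tset N \<subseteq> T1 \<union> T2"
  proof
    fix pl assume "pl \<in> Tset N"
    then obtain p l where pl: "pl = (p, l)" "p \<in> PP" "l \<ge> 1" "gnorm p ^ l \<le> N" "\<not> prime (gnorm p ^ l)" by (auto simp: Tset_def)
    have g2: "gnorm p \<ge> 2" by (rule PP_gnorm[OF pl(2)])
    show "pl \<in> T1 \<union> T2"
    proof (cases "l \<ge> 2")
      case True
      have "gnorm p * gnorm p = gnorm p ^ 2" by (simp add: power2_eq_square)
      also have "... \<le> gnorm p ^ l" using g2 True by (intro power_increasing) auto
      finally have "gnorm p \<le> M" using pl(4) sqM by simp
      moreover have "l \<le> L"
      proof -
        have "(2::nat) ^ l \<le> gnorm p ^ l" using g2 by (intro power_mono) auto
        hence "2 ^ l \<le> N" using pl(4) by linarith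
        hence "real (2 ^ l) \<le> real N" by (simp only: of_nat_le_iff)
        hence "ln (real (2 ^ l)) \<le> ln (real N)" by (subst ln_le_cancel_iff) (use \<open>N \<ge> 2\<close> in auto)
        hence "real l * ln 2 \<le> ln (real N)" by (simp add: ln_realpow)
        moreover have "(exp (1/2::real))\<^sup>2 \<le> 2\<^sup>2" using exp_le by (simp add: power2_eq_square flip: exp_add)
        hence "exp (1/2::real) \<le> 2" by (rule power2_le_imp_le) simp
        hence "ln 2 \<ge> (1/2::real)" by (subst ln_ge_iff) auto
        hence "real l * (1/2) \<le> real l * ln 2" by (intro mult_left_mono) auto
        ultimately have "real l \<le> 2 * ln (real N)" by linarith
        thus ?thesis unfolding L_def by (simp add: le_nat_iff le_floor_iff)
      qed
      ultimately show ?thesis using pl by (auto simp: T1_def)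
    next
      case False
      hence l1: "l = 1" using pl(3) by simp
      hence "\<not> prime (gnorm p)" using pl(5) by simp
      hence im: "gim p = 0" by (rule PP_nonprime_norm[OF pl(2)])
      have "int (gnorm p) = (gre p)\<^sup>2" using im by (simp add: int_gnorm)
      hence "nat \<bar>gre p\<bar> * nat \<bar>gre p\<bar> = gnorm p" by (simp add: power2_eq_square nat_mult_distrib[symmetric] abs_mult[symmetric])
      hence "nat \<bar>gre p\<bar> \<le> M" using sqM pl(4) l1 by simp
      hence "gre p \<in> R" by (auto simp: R_def)
      moreover have "p = GInt (gre p) 0" using im by (simp add: gint_eq_iff)
      ultimately show ?thesis using pl(1) l1 by (auto simp: T2_def)
    qed
  qed
  have finT: "finite T1" "finite T2" by (auto simp: T1_def T2_def R_def finite_gnorm_le)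
  have "card (Tset N) \<le> card T1 + card T2"
    by (rule order_trans[OF card_mono[OF _ sub] card_Un_le]) (use finT in simp)
  also have "card T1 \<le> 9 * M * L" unfolding T1_def card_cartesian_product using card_gnorm_le[OF M1] by simp
  also have "card T2 \<le> 2 * M + 1" unfolding T2_def by (rule order_trans[OF card_image_le]) (auto simp: R_def)
  finally have "real (card (Tset N)) \<le> real (9 * M * L + (2 * M + 1))" by (simp only: of_nat_le_iff)
  also have "... = 9 * real M * real L + 2 * real M + 1" by simp
  also have "... \<le> 9 * sqrt (real N) * (2 * ln (real N)) + 2 * sqrt (real N) + 1"
    using Lr Mr lnN by (intro add_mono mult_mono) auto
  finally have cT: "real (card (Tset N)) \<le> 9 * sqrt (real N) * (2 * ln (real N)) + 2 * sqrt (real N) + 1" .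
  have "(\<Sum>(p, l)\<in>Tset N. ln (real (gnorm p))) \<le> (\<Sum>(p, l)\<in>Tset N. ln (real N))"
  proof (intro sum_mono, clarify)
    fix p l assume "(p, l) \<in> Tset N"
    hence pl: "p \<in> PP" "l \<ge> 1" "gnorm p ^ l \<le> N" by (auto simp: Tset_def)
    show "ln (real (gnorm p)) \<le> ln (real N)" using pp_bounds(1)[OF pl] PP_gnorm[OF pl(1)] True by simp
  qed
  also have "... = real (card (Tset N)) * ln (real N)" by (simp add: case_prod_unfold)
  also have "... \<le> hT N" unfolding hT_def using cT lnN by (intro mult_right_mono) auto
  finally show ?thesis .
qed

definition PX :: "nat \<Rightarrow> gint set" where
  "PX N = {x. primary x \<and> prime (gnorm x) \<and> gnorm x \<le> N}"

lemma finite_PX: "finite (PX N)"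
  by (rule finite_subset[OF _ finite_gnorm_le[of N]]) (auto simp: PX_def)

lemma sum_Qn_split:
  fixes f :: "gint \<Rightarrow> nat \<Rightarrow> 'a::comm_monoid_add"
  shows "(\<Sum>n\<le>N. \<Sum>(p, l)\<in>Qn n. f p l) = (\<Sum>x\<in>PX N. f x 1) + (\<Sum>(p, l)\<in>Tset N. f p l)"
proof -
  define A where "A = {(p, l). p \<in> PP \<and> l \<ge> 1 \<and> gnorm p ^ l \<le> N}"
  have "(\<Sum>n\<le>N. \<Sum>(p, l)\<in>Qn n. f p l) = (\<Sum>pl\<in>(\<Union>n\<in>{..N}. Qn n). case pl of (p, l) \<Rightarrow> f p l)"
  proof (rule sum.UNION_disjoint[symmetric])
    show "\<forall>i\<in>{..N}. finite (Qn i)" by (simp add: finite_Qn)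
    show "\<forall>i\<in>{..N}. \<forall>j\<in>{..N}. i \<noteq> j \<longrightarrow> Qn i \<inter> Qn j = {}" by (auto simp: Qn_def)
  qed simp
  also have "(\<Union>n\<in>{..N}. Qn n) = (\<lambda>x. (x, 1)) ` PX N \<union> Tset N"
  proof (intro equalityI subsetI)
    fix pl assume "pl \<in> (\<Union>n\<in>{..N}. Qn n)"
    then obtain p l where pl: "pl = (p, l)" "p \<in> PP" "l \<ge> 1" "gnorm p ^ l \<le> N" by (auto simp: Qn_def)
    show "pl \<in> (\<lambda>x. (x, 1)) ` PX N \<union> Tset N"
    proof (cases "prime (gnorm p ^ l)")
      case True
      hence "l = 1" using pl(3) by (simp add: prime_power_iff)
      thus ?thesis using True pl by (auto simp: PX_def PP_def)
    next
      case False
      thus ?thesis using pl by (auto simp: Tset_def)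
    qed
  next
    fix pl assume "pl \<in> (\<lambda>x. (x, 1)) ` PX N \<union> Tset N"
    thus "pl \<in> (\<Union>n\<in>{..N}. Qn n)"
      using gnorm_prime_imp_prime_elem by (auto simp: PX_def Tset_def Qn_def PP_def)
  qed
  also have "(\<Sum>pl\<in>(\<lambda>x. (x, 1)) ` PX N \<union> Tset N. case pl of (p, l) \<Rightarrow> f p l)
     = (\<Sum>pl\<in>(\<lambda>x. (x, 1)) ` PX N. case pl of (p, l) \<Rightarrow> f p l) + (\<Sum>(p, l)\<in>Tset N. f p l)"
  proof (rule sum.union_disjoint)
    show "finite (Tset N)" by (rule finite_subset[OF _ finite_pp[of N]]) (auto simp: Tset_def)
    show "(\<lambda>x. (x, 1)) ` PX N \<inter> Tset N = {}" by (auto simp: PX_def Tset_def)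
  qed (simp add: finite_PX)
  also have "(\<Sum>pl\<in>(\<lambda>x. (x, 1)) ` PX N. case pl of (p, l) \<Rightarrow> f p l) = (\<Sum>x\<in>PX N. f x 1)"
    by (subst sum.reindex) (auto simp: inj_on_def)
  finally show ?thesis .
qed

text \<open>The majorant common to \<open>bcoef\<close> for all characters.\<close>

definition b0 :: "nat \<Rightarrow> real" where "b0 n = (\<Sum>(p, l)\<in>Qn n. ln (real (gnorm p)))"

lemma b0_nonneg: "b0 n \<ge> 0"
  unfolding b0_def
proof (rule sum_nonneg)
  fix pl assume "pl \<in> Qn n"
  then obtain p l where "pl = (p, l)" "p \<in> PP" by (auto simp: Qn_def)
  thus "0 \<le> (case pl of (p, l) \<Rightarrow> ln (real (gnorm p)))" using PP_gnorm[of p] by simp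
qed

lemma norm_bcoef: "norm (bcoef j k n) \<le> b0 n"
  unfolding bcoef_def b0_def
proof (rule sum_norm_le)
  fix pl assume "pl \<in> Qn n"
  then obtain p l where "pl = (p, l)" "p \<in> PP" by (auto simp: Qn_def)
  thus "norm (case pl of (p, l) \<Rightarrow> chi j k (p ^ l) * of_real (ln (real (gnorm p)))) \<le> (case pl of (p, l) \<Rightarrow> ln (real (gnorm p)))"
    using PP_gnorm[of p] by (simp add: norm_mult)
qed

text \<open>At most two primary elements have a given prime norm, so Chebyshev's bound controls the
  prime norms; the remaining prime powers are bounded by \<open>hT\<close>.\<close>

lemma sum_b0: "\<exists>K. \<forall>N. (\<Sum>n\<le>N. b0 n) \<le> K * real N"
proof -
  have PXs: "(\<Sum>x\<in>PX N. ln (real (gnorm x))) \<le> 2 * (real N * ln 4)" for N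
  proof -
    define A where "A = {q. prime q \<and> q \<le> N}"
    have finA: "finite A" unfolding A_def by (rule finite_subset[of _ "{..N}"]) auto
    have "(\<Sum>x\<in>PX N. ln (real (gnorm x))) = (\<Sum>q\<in>A. \<Sum>x\<in>{x\<in>PX N. gnorm x = q}. ln (real (gnorm x)))"
      by (rule sum.group[symmetric]) (use finA finite_PX in \<open>auto simp: PX_def A_def\<close>)
    also have "... \<le> (\<Sum>q\<in>A. 2 * ln (real q))"
    proof (rule sum_mono)
      fix q assume q: "q \<in> A"
      have "card {x\<in>PX N. gnorm x = q} \<le> 2"
      proof (cases "{x\<in>PX N. gnorm x = q} = {}")
        case False
        then obtain x where x: "x \<in> PX N" "gnorm x = q" by blast
        have "{x\<in>PX N. gnorm x = q} \<subseteq> {x, gconj x}"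
        proof
          fix y assume "y \<in> {x\<in>PX N. gnorm x = q}"
          thus "y \<in> {x, gconj x}" using x same_prime_gnorm[of x y] by (simp add: PX_def)
        qed
        hence "card {x\<in>PX N. gnorm x = q} \<le> card {x, gconj x}" by (intro card_mono) auto
        also have "... \<le> 2" by (simp add: card_insert_if)
        finally show ?thesis .
      qed (metis card.empty zero_le)
      moreover have "0 \<le> ln (real q)" using q prime_ge_2_nat[of q] by (simp add: A_def)
      ultimately have "real (card {x\<in>PX N. gnorm x = q}) * ln (real q) \<le> 2 * ln (real q)" by (intro mult_right_mono) auto
      thus "(\<Sum>x\<in>{x\<in>PX N. gnorm x = q}. ln (real (gnorm x))) \<le> 2 * ln (real q)" by simp
    qed
    also have "... \<le> 2 * (real N * ln 4)" unfolding sum_distrib_left[symmetric] A_def using chebyshev_theta[of N] by simp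
    finally show ?thesis .
  qed
  obtain C where C: "\<And>N. \<bar>hT N / real N\<bar> \<le> C"
    using convergent_imp_Bseq[OF convergentI[OF hT_o]] by (auto simp: Bseq_def)
  have "(\<Sum>n\<le>N. b0 n) \<le> (2 * ln 4 + C) * real N" for N
  proof -
    have "(\<Sum>n\<le>N. b0 n) = (\<Sum>x\<in>PX N. ln (real (gnorm x))) + (\<Sum>(p, l)\<in>Tset N. ln (real (gnorm p)))"
      unfolding b0_def by (rule sum_Qn_split)
    also have "... \<le> 2 * (real N * ln 4) + hT N" using PXs[of N] sum_Tset[of N] by linarith
    also have "hT N \<le> C * real N"
    proof (cases "N = 0")
      case False
      have "hT N / real N \<le> C" using C[of N] by linarith
      thus ?thesis using False by (simp add: field_simps)
    qed (simp add: hT_def)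
    finally show ?thesis by (simp add: algebra_simps)
  qed
  thus ?thesis by blast
qed

section \<open>Nonvanishing on the line of real part one\<close>

lemma cnj_powi: "cnj (x powi n) = cnj x powi n"
  by (simp add: power_int_def)

lemma chi_cnj: "cnj (chi j k x) = chi (3 * j) k x"
proof -
  have "cnj (\<i> powi (int j * pm x)) = (- \<i>) powi (int j * pm x)" by (simp add: cnj_powi)
  also have "- \<i> = \<i> ^ 3" by (simp add: power3_eq_cube)
  also have "(\<i> ^ 3) powi (int j * pm x) = \<i> powi (3 * (int j * pm x))" by (simp add: power_int_mult)
  finally have "cnj (\<i> powi (int j * pm x)) = \<i> powi (int (3 * j) * pm x)" by (simp add: mult.assoc)
  moreover have "cnj ((-1) powi (int k * pn x)) = (-1) powi (int k * pn x)" by (simp add: cnj_powi)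
  ultimately show ?thesis by (simp add: chi_def)
qed

text \<open>Conjugation sends (m, n) to (-m, n + m), which multiplies (-1)^n by (-1)^m = i^{2m}. It
  therefore exchanges two of the nontrivial characters.\<close>

lemma chi_gconj:
  assumes "primary x" shows "chi 0 1 (gconj x) = chi 2 1 x"
proof -
  define m n where "m = pm x" and "n = pn x"
  have x: "x = mkp m n" using primary_eq_mkp[OF assms] by (simp add: m_def n_def)
  have "gconj x = mkp (- m) (n + m)" unfolding x by (simp add: gint_eq_iff mkp_def)
  hence p: "pn (gconj x) = n + m" by simp
  have "\<i> powi (int 2 * m) = (\<i> ^ 2) powi m" by (simp only: power_int_mult power_int_of_nat)
  hence "\<i> powi (int 2 * m) = (-1) powi m" by simp
  thus ?thesis unfolding chi_def p by (simp add: power_int_add m_def n_def mult.commute)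
qed

lemma chi_sq: "chi j k x ^ 2 = chi (2 * j) 0 x"
proof -
  have "(\<i> powi (int j * pm x)) ^ 2 = \<i> powi (2 * (int j * pm x))"
    by (metis mult.commute power_int_mult power_int_numeral)
  moreover have "((-1::complex) powi (int k * pn x)) ^ 2 = 1" by (simp add: power_int_minus_left)
  ultimately show ?thesis by (simp add: chi_def power_mult_distrib mult.assoc)
qed

text \<open>The function -L'/L of the character \<open>chi j k\<close>, on Re s > 1.\<close>

definition Bser :: "nat \<Rightarrow> nat \<Rightarrow> complex \<Rightarrow> complex" where
  "Bser j k s = (\<Sum>n. bcoef j k n * dpow s n)"

text \<open>The order of the pole of the L-function at 1.\<close>

definition princ :: "nat \<Rightarrow> nat \<Rightarrow> nat" where "princ j k = (if 4 dvd j \<and> even k then 1 else 0)"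

lemma Lext_exists:
  "\<exists>M. M holomorphic_on {s. Re s > 1/2} \<and> (\<forall>s. Re s > 1 \<longrightarrow> M s = (s - 1) ^ princ j k * (\<Sum>n. acoef j k n * dpow s n))
     \<and> (princ j k = 1 \<longrightarrow> M 1 \<noteq> 0)"
proof (cases "princ j k = 1")
  case True
  hence jk: "even k" "4 dvd j" by (auto simp: princ_def split: if_splits)
  obtain H where H: "H holomorphic_on {s. Re s > 1/2}"
    "\<And>s. Re s > 1 \<Longrightarrow> (\<lambda>n. acoef j k n * dpow s n) sums (H s + of_real (pi / 8) * zeta_ext s / (s - 1))"
    using dirichlet_continuation[of "acoef j k" "of_real (pi / 8)" 3] acoef_sum_principal[OF jk] by blast
  define M where "M = (\<lambda>s. (s - 1) * H s + of_real (pi / 8) * zeta_ext s)"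
  have "M holomorphic_on {s. Re s > 1/2}" unfolding M_def
    by (intro holomorphic_intros H(1) holomorphic_on_subset[OF holomorphic_zeta_ext]) auto
  moreover have "M s = (s - 1) ^ princ j k * (\<Sum>n. acoef j k n * dpow s n)" if s: "Re s > 1" for s
  proof -
    have "s \<noteq> 1" using s by auto
    thus ?thesis using H(2)[OF s] True by (simp add: M_def sums_iff field_simps)
  qed
  moreover have "M 1 \<noteq> 0" by (simp add: M_def)
  ultimately show ?thesis by blast
next
  case False
  hence 0: "princ j k = 0" by (auto simp: princ_def split: if_splits)
  have "norm ((\<Sum>n\<le>N. acoef j k n) - 0 * of_nat N) \<le> 3 * sqrt (real N)" for N
    using acoef_sum_odd[of k j N] acoef_sum_even[of k j N] 0 by (cases "even k") (auto simp: princ_def split: if_splits)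
  then obtain H where H: "H holomorphic_on {s. Re s > 1/2}"
    "\<And>s. Re s > 1 \<Longrightarrow> (\<lambda>n. acoef j k n * dpow s n) sums (H s + 0 * zeta_ext s / (s - 1))"
    using dirichlet_continuation[of "acoef j k" 0 3] by blast
  thus ?thesis using 0 by (intro exI[of _ H]) (auto simp: sums_iff)
qed

text \<open>The continued L-function, multiplied by s - 1 for the trivial character so that it is
  holomorphic at 1. In that case nonvanishing at 1 is part of the choice, as the residue pi/8 is not
  0.\<close>

definition Lext :: "nat \<Rightarrow> nat \<Rightarrow> complex \<Rightarrow> complex" where
  "Lext j k = (SOME M. M holomorphic_on {s. Re s > 1/2} \<and> (\<forall>s. Re s > 1 \<longrightarrow> M s = (s - 1) ^ princ j k * (\<Sum>n. acoef j k n * dpow s n))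
     \<and> (princ j k = 1 \<longrightarrow> M 1 \<noteq> 0))"

lemma Lext:
  "Lext j k holomorphic_on {s. Re s > 1/2}"
  "Re s > 1 \<Longrightarrow> Lext j k s = (s - 1) ^ princ j k * (\<Sum>n. acoef j k n * dpow s n)"
  "princ j k = 1 \<Longrightarrow> Lext j k 1 \<noteq> 0"
  using someI_ex[OF Lext_exists[of j k]] unfolding Lext_def[symmetric] by blast+

lemma acoef_1: "acoef j k 1 = 1"
proof -
  have "In 1 = {1}" using primary_unit by (auto simp: In_def)
  thus ?thesis by (simp add: acoef_def)
qed

lemma Bser_order:
  assumes "Re s0 \<ge> 1"
  obtains m :: nat where "((\<lambda>\<sigma>. of_real \<sigma> * Bser j k (s0 + of_real \<sigma>)) \<longlongrightarrow> (if s0 = 1 then of_nat (princ j k) else 0) - of_nat m) (at_right (0::real))"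
    "m = 0 \<longleftrightarrow> Lext j k s0 \<noteq> 0"
proof -
  obtain K where K: "\<And>N. (\<Sum>n\<le>N. b0 n) \<le> K * real N" using sum_b0 by blast
  show ?thesis
    using dirichlet_log_order(2)[OF norm_acoef sum_card_In acoef_1 norm_bcoef K acoef_ln_conv Lext(1,2) assms] that
    unfolding Bser_def by blast
qed

lemma Bser_eq:
  assumes "Re s > 1"
  shows "Bser j k s = of_nat (princ j k) / (s - 1) - deriv (Lext j k) s / Lext j k s"
proof -
  obtain K where K: "\<And>N. (\<Sum>n\<le>N. b0 n) \<le> K * real N" using sum_b0 by blast
  show ?thesis
    using dirichlet_log_order(4)[OF norm_acoef sum_card_In acoef_1 norm_bcoef K acoef_ln_conv Lext(1,2) assms]
    unfolding Bser_def by blast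
qed

lemma summable_b0:
  assumes "Re s > 1"
  shows "summable (\<lambda>n. norm (bcoef j k n * dpow s n))" "summable (\<lambda>n. norm (of_real (b0 n) * dpow s n))"
proof -
  obtain K where K: "\<And>N. (\<Sum>n\<le>N. b0 n) \<le> K * real N" using sum_b0 by blast
  show "summable (\<lambda>n. norm (bcoef j k n * dpow s n))" by (rule dirichlet_abs_summable[OF norm_bcoef K assms])
  show "summable (\<lambda>n. norm (of_real (b0 n) * dpow s n))"
    by (rule dirichlet_abs_summable[OF _ K assms]) (simp add: b0_nonneg)
qed

lemma dpow_conj: "cnj (dpow s n) = dpow (cnj s) n"
  by (simp add: dpow_def exp_cnj)

lemma Re_sum_Qn_nonneg:
  assumes "\<And>p l. (p, l) \<in> Qn n \<Longrightarrow> Re (f p l) \<ge> 0"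
  shows "Re (\<Sum>(p, l)\<in>Qn n. f p l * of_real (ln (real (gnorm p)))) \<ge> 0"
  unfolding Re_sum
proof (rule sum_nonneg)
  fix pl assume pl: "pl \<in> Qn n"
  then obtain p l where e: "pl = (p, l)" "p \<in> PP" by (auto simp: Qn_def)
  show "0 \<le> Re (case pl of (p, l) \<Rightarrow> f p l * of_real (ln (real (gnorm p))))"
    using assms[of p l] pl e PP_gnorm[of p] by simp
qed

text \<open>On the unit circle the real part is 2 (1 + Re w)^2, the classical inequality behind
  nonvanishing on the line.\<close>

lemma three_four_one:
  fixes w :: complex assumes "norm w = 1"
  shows "Re (3 + 4 * w + w ^ 2) \<ge> 0"
proof -
  have "(Re w)\<^sup>2 + (Im w)\<^sup>2 = 1" using assms by (metis cmod_power2 one_power2)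
  hence "Im w * Im w = 1 - Re w * Re w" by (simp add: power2_eq_square)
  hence "Re (3 + 4 * w + w ^ 2) = 2 * (1 + Re w)\<^sup>2"
    by (simp add: power2_eq_square algebra_simps)
  thus ?thesis by simp
qed

text \<open>For the trivial character at 1, \<chi> at 1 + it and \<chi>^2 at 1 + 2it, the functions
  -L'/L with weights 3, 4, 1 have a combination of nonnegative real part just to the right of these
  points. Neither shifted point is 1, so only the first has a pole, and the orders of vanishing
  satisfy 0 <= 3 - 4 m1 - m2, which forces m1 = 0.\<close>

lemma Lext_nonzero_line:
  assumes "t \<noteq> 0"
  shows "Lext j k (1 + \<i> * of_real t) \<noteq> 0"
proof
  assume z: "Lext j k (1 + \<i> * of_real t) = 0"
  define s1 where "s1 = 1 + \<i> * complex_of_real t"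
  define s2 where "s2 = 1 + \<i> * complex_of_real (2 * t)"
  have ne: "s1 \<noteq> 1" "s2 \<noteq> 1" using assms by (auto simp: s1_def s2_def)
  let ?H = "\<lambda>\<sigma>::real. 3 * Bser 0 0 (1 + of_real \<sigma>) + 4 * Bser j k (s1 + of_real \<sigma>) + Bser (2 * j) 0 (s2 + of_real \<sigma>)"
  let ?K = "\<lambda>\<sigma>::real. 3 * (of_real \<sigma> * Bser 0 0 (1 + of_real \<sigma>)) + 4 * (of_real \<sigma> * Bser j k (s1 + of_real \<sigma>)) + of_real \<sigma> * Bser (2 * j) 0 (s2 + of_real \<sigma>)"
  obtain m0 :: nat where m0: "((\<lambda>\<sigma>. of_real \<sigma> * Bser 0 0 (1 + of_real \<sigma>)) \<longlongrightarrow> 1 - of_nat m0) (at_right (0::real))" "m0 = 0"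
    using Bser_order[of 1 0 0] Lext(3)[of 0 0] by (auto simp: princ_def)
  obtain m1 :: nat where m1: "((\<lambda>\<sigma>. of_real \<sigma> * Bser j k (s1 + of_real \<sigma>)) \<longlongrightarrow> 0 - of_nat m1) (at_right (0::real))" "m1 \<noteq> 0"
    using Bser_order[of s1 j k] z ne by (auto simp: s1_def)
  obtain m2 :: nat where m2: "((\<lambda>\<sigma>. of_real \<sigma> * Bser (2 * j) 0 (s2 + of_real \<sigma>)) \<longlongrightarrow> 0 - of_nat m2) (at_right (0::real))"
    using Bser_order[of s2 "2 * j" 0] ne by (auto simp: s2_def)
  have "((\<lambda>\<sigma>. Re (?K \<sigma>)) \<longlongrightarrow>
     Re (3 * (1 - of_nat m0) + 4 * (0 - of_nat m1) + (0 - of_nat m2))) (at_right (0::real))"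
    by (intro tendsto_intros m0(1) m1(1) m2(1))
  moreover have "eventually (\<lambda>\<sigma>::real. 0 \<le> Re (?K \<sigma>)) (at_right 0)"
  proof -
    have "0 \<le> Re (?H \<sigma>)" if sg: "\<sigma> > 0" for \<sigma> :: real
    proof -
      let ?t = "\<lambda>n. 3 * (bcoef 0 0 n * dpow (1 + of_real \<sigma>) n) + 4 * (bcoef j k n * dpow (s1 + of_real \<sigma>) n) + bcoef (2 * j) 0 n * dpow (s2 + of_real \<sigma>) n"
      have S: "(\<lambda>n. bcoef a b n * dpow s n) sums Bser a b s" if "Re s > 1" for a b s
        unfolding Bser_def by (rule summable_sums[OF summable_norm_cancel[OF summable_b0(1)[OF that]]])
      have "?t sums (?H \<sigma>)"
        by (intro sums_add sums_mult S) (use sg in \<open>auto simp: s1_def s2_def\<close>)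
      hence "(\<lambda>n. Re (?t n)) sums Re (?H \<sigma>)" by (rule sums_Re)
      moreover have "Re (?t n) \<ge> 0" for n
      proof (cases "n = 0")
        case True
        have "Qn 0 = {}" by (auto simp: Qn_def PP_def primary_nz)
        thus ?thesis using True by (simp add: bcoef_def)
      next
        case False
        \<comment> \<open>The factor u = n^{-it} enters through u \<chi>(p^l), a number of norm 1
          whose square belongs to the third series; the positive factor n^{-1-\<sigma>} is common to
          all three.\<close>
        define u where "u = dpow (\<i> * of_real t) n"
        have nu: "norm u = 1" using False by (simp add: u_def norm_dpow)
        define D where "D = dpow (1 + of_real \<sigma>) n"
        have Dr: "D = of_real (real n powr (- (1 + \<sigma>)))" using False
          by (simp add: D_def dpow_def powr_def exp_of_real[symmetric] algebra_simps)
        have d1: "dpow (s1 + of_real \<sigma>) n = D * u"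
          unfolding D_def u_def dpow_add[symmetric] by (simp add: s1_def algebra_simps)
        have d2: "dpow (s2 + of_real \<sigma>) n = D * u ^ 2"
          unfolding D_def u_def power2_eq_square dpow_add[symmetric] by (simp add: s2_def algebra_simps)
        have "?t n = D * (3 * bcoef 0 0 n + 4 * u * bcoef j k n + u ^ 2 * bcoef (2 * j) 0 n)"
          unfolding d1 d2 D_def[symmetric] by (simp add: algebra_simps)
        also have "3 * bcoef 0 0 n + 4 * u * bcoef j k n + u ^ 2 * bcoef (2 * j) 0 n
          = (\<Sum>(p, l)\<in>Qn n. (3 + 4 * (u * chi j k (p ^ l)) + (u * chi j k (p ^ l)) ^ 2) * of_real (ln (real (gnorm p))))"
          unfolding bcoef_def sum_distrib_left sum.distrib[symmetric]
          by (intro sum.cong refl) (auto simp: power_mult_distrib chi_sq algebra_simps, simp add: chi_def)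
        finally have "?t n = D * (\<Sum>(p, l)\<in>Qn n. (3 + 4 * (u * chi j k (p ^ l)) + (u * chi j k (p ^ l)) ^ 2) * of_real (ln (real (gnorm p))))" .
        moreover have "Re (\<Sum>(p, l)\<in>Qn n. (3 + 4 * (u * chi j k (p ^ l)) + (u * chi j k (p ^ l)) ^ 2) * of_real (ln (real (gnorm p)))) \<ge> 0"
          by (intro Re_sum_Qn_nonneg three_four_one) (simp add: norm_mult nu)
        ultimately show ?thesis unfolding Dr by (simp del: Re_sum)
      qed
      ultimately show ?thesis using sums_le[OF _ sums_zero] by (metis (no_types, lifting))
    qed
    hence "0 \<le> Re (of_real \<sigma> * (?H \<sigma>))" if "\<sigma> > 0" for \<sigma> :: real
      using that by simp
    hence "0 \<le> Re (?K \<sigma>)" if "\<sigma> > 0" for \<sigma> :: real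
      using that by (simp add: algebra_simps)
    thus ?thesis using eventually_at_right_less[of "0::real"] by (auto elim: eventually_mono)
  qed
  ultimately have "0 \<le> Re (3 * (1 - of_nat m0) + 4 * (0 - of_nat m1) + (0 - of_nat m2 :: complex))"
    by (intro tendsto_lowerbound) auto
  hence "4 * real m1 \<le> 3" using m0(2) by simp
  thus False using m1(2) by simp
qed

text \<open>Conjugation permutes the primary primes of given norm and exchanges the two
  characters.\<close>

lemma bcoef_gconj: "bcoef 0 1 n = bcoef 2 1 n"
proof -
  have PPc: "gconj p \<in> PP" if "p \<in> PP" for p
  proof -
    have pr: "primary p" "prime_elem p" using that by (auto simp: PP_def)
    have "prime_elem (gconj p)"
    proof (rule prime_elemI)
      show "gconj p \<noteq> 0" using pr(1) primary_nz primary_gconj by blast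
      show "\<not> gconj p dvd 1" using pr(2) by (simp add: gint_unit_iff prime_elem_def)
      fix a b assume "gconj p dvd a * b"
      then obtain c where "a * b = gconj p * c" by (elim dvdE)
      hence "gconj a * gconj b = p * gconj c" by (metis gconj_gconj gconj_mult)
      hence "p dvd gconj a * gconj b" by simp
      hence "p dvd gconj a \<or> p dvd gconj b" by (rule prime_elem_dvd_multD[OF pr(2)])
      thus "gconj p dvd a \<or> gconj p dvd b" by (metis dvd_def gconj_gconj gconj_mult)
    qed
    thus ?thesis using pr by (simp add: PP_def)
  qed
  have "bcoef 2 1 n = (\<Sum>(p, l)\<in>Qn n. chi 0 1 (gconj p ^ l) * of_real (ln (real (gnorm p))))"
    unfolding bcoef_def
  proof (intro sum.cong refl, clarify)
    fix p l assume "(p, l) \<in> Qn n"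
    hence "primary (p ^ l)" by (auto simp: Qn_def PP_def primary_power)
    from chi_gconj[OF this] show "chi 2 1 (p ^ l) * of_real (ln (real (gnorm p))) = chi 0 1 (gconj p ^ l) * of_real (ln (real (gnorm p)))"
      unfolding gconj_power by simp
  qed
  also have "... = bcoef 0 1 n" unfolding bcoef_def
    by (rule sum.reindex_bij_witness[where i = "\<lambda>(p, l). (gconj p, l)" and j = "\<lambda>(p, l). (gconj p, l)"])
       (use PPc in \<open>auto simp: Qn_def\<close>)
  finally show ?thesis ..
qed

lemma bcoef_cnj: "cnj (bcoef j k n) = bcoef (3 * j) k n"
  unfolding bcoef_def cnj_sum by (intro sum.cong refl) (auto simp: chi_cnj)

lemma Bser_cnj:
  assumes "s > 1" shows "cnj (Bser j k (of_real s)) = Bser (3 * j) k (of_real s)"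
proof -
  have "(\<lambda>n. bcoef j k n * dpow (of_real s) n) sums Bser j k (of_real s)"
    unfolding Bser_def by (rule summable_sums[OF summable_norm_cancel[OF summable_b0(1)]]) (use assms in simp)
  hence "(\<lambda>n. cnj (bcoef j k n * dpow (of_real s) n)) sums cnj (Bser j k (of_real s))" by (simp only: sums_cnj)
  hence "(\<lambda>n. bcoef (3 * j) k n * dpow (of_real s) n) sums cnj (Bser j k (of_real s))"
    by (simp add: bcoef_cnj dpow_conj)
  thus ?thesis unfolding Bser_def by (simp add: sums_iff)
qed

lemma Lext_nonzero_gt1: "Re s > 1 \<Longrightarrow> Lext j k s \<noteq> 0"
proof -
  assume s: "Re s > 1"
  obtain K where K: "\<And>N. (\<Sum>n\<le>N. b0 n) \<le> K * real N" using sum_b0 by blast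
  show ?thesis
    using dirichlet_log_order(3)[OF norm_acoef sum_card_In acoef_1 norm_bcoef K acoef_ln_conv Lext(1,2) s] .
qed

section \<open>A lower bound for the real quadratic L-function near 1\<close>

lemma alternating_decreasing_ge:
  fixes g :: "nat \<Rightarrow> real"
  assumes dec: "\<And>m. g (Suc m) \<le> g m" and nn: "\<And>m. g m \<ge> 0"
  shows "g 0 - 2 * g 1 \<le> g 0 + 2 * (\<Sum>m=1..M. (-1) ^ m * g m)"
proof -
  \<comment> \<open>Strengthened for the induction: after an even number of terms the last positive
    term is still in hand. The case M = 0 is split off since the sum is then empty.\<close>
  have "(\<Sum>m=1..M. (-1) ^ m * g m) \<ge> - g 1 + (if odd M then 0 else g (Suc M)) \<and> (M = 0 \<or> (\<Sum>m=1..M. (-1) ^ m * g m) \<ge> - g 1 + (if odd M then 0 else g M)) \<or> M = 0"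
  proof (induction M)
    case (Suc M)
    show ?case
    proof (cases "M = 0")
      case True thus ?thesis by simp
    next
      case False
      hence IH: "(\<Sum>m=1..M. (-1) ^ m * g m) \<ge> - g 1 + (if odd M then 0 else g M)" using Suc.IH by blast
      have "(\<Sum>m=1..Suc M. (-1) ^ m * g m) = (\<Sum>m=1..M. (-1) ^ m * g m) + (-1) ^ Suc M * g (Suc M)" by simp
      thus ?thesis using IH dec[of M] dec[of "Suc M"] nn[of "Suc M"] by (auto split: if_splits)
    qed
  qed simp
  hence "M = 0 \<or> (\<Sum>m=1..M. (-1) ^ m * g m) \<ge> - g 1" using nn[of M] nn[of "Suc M"] by (auto split: if_splits)
  thus ?thesis using nn[of 1] by auto
qed

lemma sum_symmetric_int:
  fixes g :: "int \<Rightarrow> real"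
  assumes "\<And>m. g (- m) = g m"
  shows "(\<Sum>m\<in>{- int M..int M}. g m) = g 0 + 2 * (\<Sum>m=1..M. g (int m))"
proof (induction M)
  case (Suc M)
  have "{- int (Suc M)..int (Suc M)} = insert (int (Suc M)) (insert (- int (Suc M)) {- int M..int M})" by auto
  hence "(\<Sum>m\<in>{- int (Suc M)..int (Suc M)}. g m) = g (int (Suc M)) + (g (- int (Suc M)) + (\<Sum>m\<in>{- int M..int M}. g m))" by simp
  thus ?case using Suc.IH assms[of "int (Suc M)"] by simp
qed simp

text \<open>The square (2i + 3)^2 exceeds 4(i + 1)(i + 2), and the reciprocals of the latter
  telescope to at most 1/4.\<close>

lemma sum_inverse_odd_squares: "(\<Sum>a\<in>oddset N - {1}. 1 / (real a)\<^sup>2) \<le> 1 / 4"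
proof -
  have sub: "oddset N - {1} \<subseteq> (\<lambda>i. 2 * i + 3) ` {..<N}"
  proof
    fix a assume a: "a \<in> oddset N - {1}"
    hence "odd a" "a \<noteq> 1" "a\<^sup>2 \<le> N" by (auto simp: oddset_def)
    then obtain i where i: "a = 2 * i + 1" by (elim oddE)
    have "i \<noteq> 0" using i \<open>a \<noteq> 1\<close> by auto
    then obtain i' where i': "i = Suc i'" by (cases i) auto
    have "a \<le> a\<^sup>2" by (simp add: power2_eq_square)
    hence "i' < N" using \<open>a\<^sup>2 \<le> N\<close> i i' by simp
    thus "a \<in> (\<lambda>i. 2 * i + 3) ` {..<N}" using i i' by (intro image_eqI[of _ _ i']) auto
  qed
  have "(\<Sum>a\<in>oddset N - {1}. 1 / (real a)\<^sup>2) \<le> (\<Sum>a\<in>(\<lambda>i. 2 * i + 3) ` {..<N}. 1 / (real a)\<^sup>2)"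
    by (rule sum_mono2) (use sub in auto)
  also have "... = (\<Sum>i<N. 1 / (2 * real i + 3)\<^sup>2)" by (subst sum.reindex) (auto simp: inj_on_def)
  also have "... \<le> (\<Sum>i<N. (1 / (4 * (real i + 1)) - 1 / (4 * (real (Suc i) + 1))))"
  proof (rule sum_mono)
    fix i
    have gen: "1 / (4 * x) - 1 / (4 * (x + 1)) = 1 / (4 * (x * (x + 1)))" if "x > 0" for x :: real
    proof -
      have "1 / (4 * x) - 1 / (4 * (x + 1)) = (4 * (x + 1) - 4 * x) / ((4 * x) * (4 * (x + 1)))" using that by (subst diff_frac_eq) auto
      also have "... = 4 / (4 * (4 * (x * (x + 1))))" by (simp add: algebra_simps)
      also have "... = 1 / (4 * (x * (x + 1)))" by simp
      finally show ?thesis .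
    qed
    have "1 / (4 * (real i + 1)) - 1 / (4 * (real (Suc i) + 1)) = 1 / (4 * ((real i + 1) * (real i + 2)))"
      using gen[of "real i + 1"] by (simp add: algebra_simps)
    moreover have "4 * ((real i + 1) * (real i + 2)) \<le> (2 * real i + 3)\<^sup>2" by (simp add: power2_eq_square algebra_simps)
    hence "1 / (2 * real i + 3)\<^sup>2 \<le> 1 / (4 * ((real i + 1) * (real i + 2)))" by (intro divide_left_mono) auto
    ultimately show "1 / (2 * real i + 3)\<^sup>2 \<le> 1 / (4 * (real i + 1)) - 1 / (4 * (real (Suc i) + 1))" by simp
  qed
  also have "... = 1 / (4 * (real 0 + 1)) - 1 / (4 * (real N + 1))" by (rule sum_lessThan_telescope')
  also have "... \<le> 1 / 4" by simp
  finally show ?thesis .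
qed

text \<open>For $\chi_{2,0}$ every partial sum of the Dirichlet series on the real axis is bounded below:
  for fixed real part $a$ the summands alternate and decrease in the imaginary part.\<close>

lemma partial_sum_chi20:
  assumes s: "s > 1" and N: "N > 0"
  shows "(\<Sum>x\<in>PB N. (-1) powi (pm x) * real (gnorm x) powr (- s)) \<ge> 7 / 20"
proof -
  define g where "g = (\<lambda>(a::nat) (m::int). real_of_int ((int a)\<^sup>2 + 4 * m\<^sup>2) powr (- s))"
  have "(\<Sum>x\<in>PB N. (-1) powi (pm x) * real (gnorm x) powr (- s)) = (\<Sum>x\<in>PB N. (\<lambda>a m. (-1) powi m * g a m) (nat \<bar>gre x\<bar>) (pm x))"
  proof (intro sum.cong refl)
    fix x assume "x \<in> PB N"
    hence "primary x" by (simp add: PB_def)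
    hence "gim x = 2 * pm x" by (auto simp: primary_def pm_def)
    hence "int (gnorm x) = (int (nat \<bar>gre x\<bar>))\<^sup>2 + 4 * (pm x)\<^sup>2" by (simp add: int_gnorm power_mult_distrib)
    hence "real (gnorm x) = real_of_int ((int (nat \<bar>gre x\<bar>))\<^sup>2 + 4 * (pm x)\<^sup>2)" by (metis of_int_of_nat_eq)
    thus "(-1) powi (pm x) * real (gnorm x) powr (- s) = (\<lambda>a m. (-1) powi m * g a m) (nat \<bar>gre x\<bar>) (pm x)" by (simp add: g_def)
  qed
  also have "... = (\<Sum>a\<in>oddset N. \<Sum>m\<in>imag_range N a. (-1) powi m * g a m)" by (rule sum_PB_am_general)
  finally have E0: "(\<Sum>x\<in>PB N. (-1) powi (pm x) * real (gnorm x) powr (- s)) = (\<Sum>a\<in>oddset N. \<Sum>m\<in>imag_range N a. (-1) powi m * g a m)" .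
  have E1: "(\<Sum>a\<in>oddset N. g a 0 - 2 * g a 1) \<le> (\<Sum>a\<in>oddset N. \<Sum>m\<in>imag_range N a. (-1) powi m * g a m)"
  proof (rule sum_mono)
    fix a assume a: "a \<in> oddset N"
    then obtain M :: nat where M: "imag_range N a = {- int M..int M}" using imag_range_interval[of a N] by (auto simp: oddset_def)
    have a0: "a > 0" using a by (auto simp: oddset_def odd_pos)
    have "(\<Sum>m\<in>imag_range N a. (-1) powi m * g a m) = (-1) powi 0 * g a 0 + 2 * (\<Sum>m=1..M. (-1) powi (int m) * g a (int m))"
      unfolding M by (rule sum_symmetric_int) (simp add: g_def power_int_minus_left)
    also have "... = g a (int 0) + 2 * (\<Sum>m=1..M. (-1) ^ m * g a (int m))" by simp
    finally have F0: "(\<Sum>m\<in>imag_range N a. (-1) powi m * g a m) = g a (int 0) + 2 * (\<Sum>m=1..M. (-1) ^ m * g a (int m))" .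
    have "g a (int 0) - 2 * g a (int 1) \<le> g a (int 0) + 2 * (\<Sum>m=1..M. (-1) ^ m * g a (int m))"
    proof (rule alternating_decreasing_ge)
      fix m :: nat
      have "(int a)\<^sup>2 + 4 * (int m)\<^sup>2 > 0" using a0 by (simp add: add_pos_nonneg)
      moreover have "(int a)\<^sup>2 + 4 * (int m)\<^sup>2 \<le> (int a)\<^sup>2 + 4 * (int (Suc m))\<^sup>2" by (simp add: power_mono)
      ultimately show "g a (int (Suc m)) \<le> g a (int m)" unfolding g_def using s
        by (intro powr_mono2') (auto simp only: of_int_le_iff of_int_0_less_iff)
    qed (simp add: g_def)
    thus "g a 0 - 2 * g a 1 \<le> (\<Sum>m\<in>imag_range N a. (-1) powi m * g a m)" unfolding F0 by simp
  qed
  \<comment> \<open>The term a = 1 gives at least 1 - 2/5 = 3/5. Every other a gives at least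
    -1/a^2, since the value at m = 1 does not exceed the one at m = 0. Altogether this is 3/5 - 1/4
    = 7/20.\<close>
  have E2: "(\<Sum>a\<in>oddset N. g a 0 - 2 * g a 1) = (g 1 0 - 2 * g 1 1) + (\<Sum>a\<in>oddset N - {1}. g a 0 - 2 * g a 1)"
    using N finite_oddset[of N] by (subst sum.remove[of _ 1]) (auto simp: oddset_def)
  have E3: "g 1 0 - 2 * g 1 1 \<ge> 3 / 5"
  proof -
    have "(5::real) powr (- s) \<le> 5 powr (-1)" using s by (intro powr_mono) auto
    hence "(5::real) powr (- s) \<le> 1 / 5" by (simp add: powr_minus_divide)
    thus ?thesis by (simp add: g_def)
  qed
  have E4: "(\<Sum>a\<in>oddset N - {1}. - (1 / (real a)\<^sup>2)) \<le> (\<Sum>a\<in>oddset N - {1}. g a 0 - 2 * g a 1)"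
  proof (rule sum_mono)
    fix a assume a: "a \<in> oddset N - {1}"
    hence a0: "a > 0" by (auto simp: oddset_def odd_pos)
    have g10: "g a 1 \<le> g a 0" unfolding g_def using s a0 by (intro powr_mono2') auto
    have "1 \<le> (real a)\<^sup>2" using a0 by (simp add: one_le_power)
    hence "(real a)\<^sup>2 powr (- s) \<le> (real a)\<^sup>2 powr (-1)" using s by (intro powr_mono) auto
    hence "g a 0 \<le> (real a)\<^sup>2 powr (-1)" by (simp add: g_def)
    also have "... = 1 / (real a)\<^sup>2" using a0 by (simp add: powr_minus_divide)
    finally show "- (1 / (real a)\<^sup>2) \<le> g a 0 - 2 * g a 1" using g10 by linarith
  qed
  have E5: "(\<Sum>a\<in>oddset N - {1}. - (1 / (real a)\<^sup>2)) \<ge> - (1 / 4)"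
    using sum_inverse_odd_squares[of N] by (simp add: sum_negf)
  show ?thesis unfolding E0 using E1 E2 E3 E4 E5 by linarith
qed

lemma dpow_real: "n > 0 \<Longrightarrow> dpow (of_real s) n = of_real (real n powr (- s))"
  by (simp add: dpow_def powr_def exp_of_real[symmetric])

text \<open>The lower bound 7/20 is uniform in real s > 1 and survives the limit s -> 1. This
  character requires an argument of its own because complex conjugation and conjugation of Gaussian
  integers both fix it.\<close>

lemma Lext_20_nonzero: "Lext 2 0 1 \<noteq> 0"
proof
  assume z: "Lext 2 0 1 = 0"
  have lb: "Re (Lext 2 0 (of_real s)) \<ge> 7 / 20" if s: "s > 1" for s :: real
  proof -
    have "summable (\<lambda>n. acoef 2 0 n * dpow (of_real s) n)"
      by (rule summable_norm_cancel, rule dirichlet_abs_summable[OF norm_acoef sum_card_In]) (use s in simp)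
    hence "(\<lambda>N. \<Sum>n\<le>N. acoef 2 0 n * dpow (of_real s) n) \<longlonglongrightarrow> (\<Sum>n. acoef 2 0 n * dpow (of_real s) n)"
      by (rule summable_LIMSEQ')
    hence lim: "(\<lambda>N. Re (\<Sum>n\<le>N. acoef 2 0 n * dpow (of_real s) n)) \<longlonglongrightarrow> Re (\<Sum>n. acoef 2 0 n * dpow (of_real s) n)"
      by (rule tendsto_Re)
    have ge: "7 / 20 \<le> Re (\<Sum>n\<le>N. acoef 2 0 n * dpow (of_real s) n)" if N: "N \<ge> 1" for N
    proof -
      have "(\<Sum>n\<le>N. acoef 2 0 n * dpow (of_real s) n) = (\<Sum>n\<le>N. \<Sum>x\<in>In n. chi 2 0 x * dpow (of_real s) (gnorm x))"
        unfolding acoef_def sum_distrib_right by (intro sum.cong refl) (simp add: In_def)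
      also have "... = (\<Sum>x\<in>PB N. chi 2 0 x * dpow (of_real s) (gnorm x))" by (rule sum_In_PB)
      also have "... = (\<Sum>x\<in>PB N. of_real ((-1) powi (pm x) * real (gnorm x) powr (- s)))"
      proof (intro sum.cong refl)
        fix x assume "x \<in> PB N"
        hence "gnorm x > 0" by (simp add: PB_def primary_gnorm_pos)
        moreover have "chi 2 0 x = of_real ((-1) powi (pm x))"
        proof -
          have "chi 2 0 x = \<i> powi (2 * pm x)" by (simp add: chi_def)
          also have "... = (\<i> powi 2) powi (pm x)" by (rule power_int_mult)
          also have "\<i> powi 2 = (-1 :: complex)" by simp
          finally show ?thesis by (simp add: of_real_power_int)
        qed
        ultimately show "chi 2 0 x * dpow (of_real s) (gnorm x) = of_real ((-1) powi (pm x) * real (gnorm x) powr (- s))"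
          by (simp add: dpow_real)
      qed
      finally have "Re (\<Sum>n\<le>N. acoef 2 0 n * dpow (of_real s) n) = (\<Sum>x\<in>PB N. (-1) powi (pm x) * real (gnorm x) powr (- s))"
        by (simp only: of_real_sum[symmetric] Re_complex_of_real)
      thus ?thesis using partial_sum_chi20[OF s, of N] N by simp
    qed
    have "7 / 20 \<le> Re (\<Sum>n. acoef 2 0 n * dpow (of_real s) n)"
      by (rule LIMSEQ_le_const[OF lim]) (use ge in blast)
    thus ?thesis using Lext(2)[of "of_real s" 2 0] s by (simp add: princ_def)
  qed
  have "isCont (Lext 2 0) 1"
    using holomorphic_on_imp_continuous_on[OF Lext(1)[of 2 0]] open_Re_gt[of "1/2"]
    by (auto simp: continuous_on_eq_continuous_at)
  hence c: "(Lext 2 0 \<longlongrightarrow> Lext 2 0 1) (at 1)" by (simp add: isCont_def)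
  have f: "filterlim (\<lambda>s::real. complex_of_real s) (at 1) (at_right 1)"
    unfolding filterlim_at
  proof
    show "\<forall>\<^sub>F x in at_right (1::real). complex_of_real x \<in> UNIV \<and> complex_of_real x \<noteq> 1"
      using eventually_at_right_less[of "1::real"] by (auto elim!: eventually_mono)
    have "((\<lambda>s::real. complex_of_real s) \<longlongrightarrow> of_real 1) (at_right 1)" by (intro tendsto_intros)
    thus "((\<lambda>s::real. complex_of_real s) \<longlongrightarrow> 1) (at_right 1)" by simp
  qed
  have "((\<lambda>s::real. Re (Lext 2 0 (of_real s))) \<longlongrightarrow> Re (Lext 2 0 1)) (at_right 1)"
    by (rule tendsto_Re[OF filterlim_compose[OF c f]])
  moreover have "eventually (\<lambda>s::real. 7 / 20 \<le> Re (Lext 2 0 (of_real s))) (at_right 1)"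
    using eventually_at_right_less[of "1::real"] by (rule eventually_mono) (use lb in auto)
  ultimately have "7 / 20 \<le> Re (Lext 2 0 1)" by (intro tendsto_lowerbound) auto
  thus False using z by simp
qed

section \<open>Primes in ray classes\<close>

text \<open>For primary x, congruence modulo 8 to \<open>mkp m0 n0\<close>.\<close>

definition cls :: "int \<Rightarrow> int \<Rightarrow> gint \<Rightarrow> bool" where
  "cls m0 n0 x \<longleftrightarrow> 4 dvd (pm x - m0) \<and> even (pn x - n0)"

text \<open>The complex conjugate of \<open>chi j k\<close> at \<open>mkp m0 n0\<close>, the
  coefficient in the orthogonality relation.\<close>

definition cchi :: "int \<Rightarrow> int \<Rightarrow> nat \<Rightarrow> nat \<Rightarrow> complex" where
  "cchi m0 n0 j k = (\<i> powi (- m0)) ^ j * ((-1) powi n0) ^ k"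

lemma ii_powi_mod: "\<i> powi d = \<i> ^ nat (d mod 4)"
proof -
  have "\<i> powi d = \<i> powi (4 * (d div 4) + d mod 4)" by simp
  also have "... = \<i> powi (4 * (d div 4)) * \<i> powi (d mod 4)" by (rule power_int_add) simp
  also have "... = \<i> powi (d mod 4)" by (simp only: ii_powi_4 mult_1)
  also have "... = \<i> ^ nat (d mod 4)" by (simp add: power_int_def)
  finally show ?thesis .
qed

lemma chi_orth: "(\<Sum>j<4. \<Sum>k<2. cchi m0 n0 j k * chi j k x) = (if cls m0 n0 x then 8 else 0)"
proof -
  define u where "u = \<i> powi (pm x - m0)"
  define v where "v = (-1::complex) powi (pn x + n0)"
  have t: "cchi m0 n0 j k * chi j k x = u ^ j * v ^ k" for j k
  proof -
    have "\<i> powi (int j * pm x) = (\<i> powi (pm x)) ^ j" using power_int_mult[of \<i> "pm x" "int j"] by (simp add: mult.commute)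
    moreover have "(-1::complex) powi (int k * pn x) = ((-1) powi (pn x)) ^ k" using power_int_mult[of "-1::complex" "pn x" "int k"] by (simp add: mult.commute)
    moreover have "u = \<i> powi (pm x) * \<i> powi (- m0)" unfolding u_def by (subst power_int_add[symmetric]) auto
    moreover have "v = (-1) powi (pn x) * (-1) powi n0" unfolding v_def by (rule power_int_add) auto
    ultimately show ?thesis by (simp add: chi_def cchi_def power_mult_distrib)
  qed
  have "(\<Sum>j<4. \<Sum>k<2. cchi m0 n0 j k * chi j k x) = (\<Sum>j<4. u ^ j) * (\<Sum>k<2. v ^ k)"
    unfolding t sum_product ..
  also have "(\<Sum>j<4. u ^ j) = 1 + u + u ^ 2 + u ^ 3" by (simp add: eval_nat_numeral)
  also have "(\<Sum>k<2. v ^ k) = 1 + v" by (simp add: eval_nat_numeral)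
  also have "1 + u + u ^ 2 + u ^ 3 = (if 4 dvd (pm x - m0) then 4 else 0)"
  proof -
    define e where "e = (pm x - m0) mod 4"
    have u: "u = \<i> ^ nat e" unfolding u_def e_def by (rule ii_powi_mod)
    have d: "4 dvd (pm x - m0) \<longleftrightarrow> e = 0" by (simp add: e_def dvd_eq_mod_eq_0)
    have "e = 0 \<or> e = 1 \<or> e = 2 \<or> e = 3" unfolding e_def by presburger
    moreover have "\<i> ^ 3 = - \<i>" by (simp add: power3_eq_cube)
    ultimately have "e = 0 \<and> u = 1 \<or> e \<noteq> 0 \<and> (u = \<i> \<or> u = -1 \<or> u = - \<i>)" unfolding u by auto
    thus ?thesis unfolding d by (auto simp: power3_eq_cube power2_eq_square)
  qed
  also have "1 + v = (if even (pn x - n0) then 2 else 0)"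
    by (cases "even (pn x + n0)") (auto simp: v_def power_int_minus_left)
  finally show ?thesis by (auto simp: cls_def)
qed

definition bC :: "int \<Rightarrow> int \<Rightarrow> nat \<Rightarrow> real" where
  "bC m0 n0 n = (\<Sum>(p, l)\<in>Qn n. if cls m0 n0 (p ^ l) then ln (real (gnorm p)) else 0)"

lemma ln_gnorm_Qn: "(p, l) \<in> Qn n \<Longrightarrow> ln (real (gnorm p)) \<ge> 0"
  using PP_gnorm[of p] by (auto simp: Qn_def intro!: ln_ge_zero)

lemma bC_nonneg: "bC m0 n0 n \<ge> 0"
  unfolding bC_def by (rule sum_nonneg) (auto dest: ln_gnorm_Qn)

lemma bC_le: "bC m0 n0 n \<le> b0 n"
  unfolding bC_def b0_def by (rule sum_mono) (auto dest: ln_gnorm_Qn)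

lemma bC_bcoef: "of_real (8 * bC m0 n0 n) = (\<Sum>j<4. \<Sum>k<2. cchi m0 n0 j k * bcoef j k n)"
proof -
  have "of_real (8 * bC m0 n0 n) = (\<Sum>(p, l)\<in>Qn n. (if cls m0 n0 (p ^ l) then 8 else 0) * complex_of_real (ln (real (gnorm p))))"
    unfolding bC_def sum_distrib_left of_real_sum by (intro sum.cong refl) auto
  also have "... = (\<Sum>a\<in>Qn n. \<Sum>j<4. \<Sum>k<2. cchi m0 n0 j k * (case a of (p, l) \<Rightarrow> chi j k (p ^ l) * complex_of_real (ln (real (gnorm p)))))"
    unfolding chi_orth[symmetric] by (intro sum.cong refl) (auto simp: sum_distrib_right mult.assoc)
  also have "... = (\<Sum>j<4. \<Sum>a\<in>Qn n. \<Sum>k<2. cchi m0 n0 j k * (case a of (p, l) \<Rightarrow> chi j k (p ^ l) * complex_of_real (ln (real (gnorm p)))))"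
    by (rule sum.swap)
  also have "... = (\<Sum>j<4. \<Sum>k<2. \<Sum>a\<in>Qn n. cchi m0 n0 j k * (case a of (p, l) \<Rightarrow> chi j k (p ^ l) * complex_of_real (ln (real (gnorm p)))))"
    by (intro sum.cong refl sum.swap)
  also have "... = (\<Sum>j<4. \<Sum>k<2. cchi m0 n0 j k * bcoef j k n)" unfolding bcoef_def sum_distrib_left ..
  finally show ?thesis .
qed

lemma bC_sums:
  assumes "Re s > 1"
  shows "(\<lambda>n. of_real (bC m0 n0 n) * dpow s n) sums ((\<Sum>j<4. \<Sum>k<2. cchi m0 n0 j k * Bser j k s) / 8)"
proof -
  have S: "(\<lambda>n. bcoef a b n * dpow s n) sums Bser a b s" for a b
    unfolding Bser_def by (rule summable_sums[OF summable_norm_cancel[OF summable_b0(1)[OF assms]]])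
  have "(\<lambda>n. (\<Sum>j<4. \<Sum>k<2. cchi m0 n0 j k * (bcoef j k n * dpow s n)) / 8) sums ((\<Sum>j<4. \<Sum>k<2. cchi m0 n0 j k * Bser j k s) / 8)"
    by (intro sums_divide sums_sum sums_mult S)
  moreover have "(\<Sum>j<4. \<Sum>k<2. cchi m0 n0 j k * (bcoef j k n * dpow s n)) / 8 = of_real (bC m0 n0 n) * dpow s n" for n
  proof -
    have "(\<Sum>j<4. \<Sum>k<2. cchi m0 n0 j k * (bcoef j k n * dpow s n)) = of_real (8 * bC m0 n0 n) * dpow s n"
      unfolding bC_bcoef sum_distrib_right mult.assoc ..
    thus ?thesis by simp
  qed
  ultimately show ?thesis by simp
qed

text \<open>The sum over all eight characters selects the class of 1 with nonnegative coefficients,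
  so the orders of vanishing at 1 add up to at most 1, the order of the pole. Complex conjugation
  pairs (1, k) with (3, k), and conjugation of Gaussian integers pairs (0, 1) with (2, 1); a zero
  within a pair would count twice. The character (2, 0) stands alone and is covered by
  \<open>Lext_20_nonzero\<close>.\<close>

lemma Lext_nonzero_1:
  assumes "j < 4" "k < 2"
  shows "Lext j k 1 \<noteq> 0"
proof -
  have "\<exists>m::nat. ((\<lambda>\<sigma>. of_real \<sigma> * Bser j k (1 + of_real \<sigma>)) \<longlongrightarrow> of_nat (princ j k) - of_nat m) (at_right (0::real)) \<and> (m = 0 \<longleftrightarrow> Lext j k 1 \<noteq> 0)" for j k
    using Bser_order[of 1 j k] by auto
  then obtain m :: "nat \<Rightarrow> nat \<Rightarrow> nat" where
    m: "\<And>j k. ((\<lambda>\<sigma>. of_real \<sigma> * Bser j k (1 + of_real \<sigma>)) \<longlongrightarrow> of_nat (princ j k) - of_nat (m j k)) (at_right (0::real))"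
    and m0: "\<And>j k. m j k = 0 \<longleftrightarrow> Lext j k 1 \<noteq> 0" by metis
  have m00: "m 0 0 = 0" using Lext(3)[of 0 0] m0 by (simp add: princ_def)
  have m20: "m 2 0 = 0" using Lext_20_nonzero m0 by simp
  have m01: "m 0 1 = m 2 1"
  proof -
    have "Bser 0 1 = Bser 2 1" by (rule ext) (simp only: Bser_def bcoef_gconj)
    hence "of_nat (princ 0 1) - of_nat (m 0 1) = (of_nat (princ 2 1) - of_nat (m 2 1) :: complex)"
      using tendsto_unique[OF _ m[of 0 1] m[of 2 1, folded \<open>Bser 0 1 = Bser 2 1\<close>]] by simp
    thus ?thesis by (simp add: princ_def)
  qed
  have m13: "m 1 k = m 3 k" if k: "k < 2" for k
  proof -
    have "((\<lambda>\<sigma>. cnj (of_real \<sigma> * Bser 1 k (1 + of_real \<sigma>))) \<longlongrightarrow> cnj (of_nat (princ 1 k) - of_nat (m 1 k))) (at_right (0::real))"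
      by (rule tendsto_cnj[OF m])
    moreover have "\<forall>\<^sub>F \<sigma> in at_right (0::real). cnj (of_real \<sigma> * Bser 1 k (1 + of_real \<sigma>)) = of_real \<sigma> * Bser 3 k (1 + of_real \<sigma>)"
      using eventually_at_right_less[of "0::real"]
    proof (rule eventually_mono)
      fix \<sigma> :: real assume "0 < \<sigma>"
      thus "cnj (of_real \<sigma> * Bser 1 k (1 + of_real \<sigma>)) = of_real \<sigma> * Bser 3 k (1 + of_real \<sigma>)"
        using Bser_cnj[of "1 + \<sigma>" 1 k] by simp
    qed
    ultimately have "((\<lambda>\<sigma>. of_real \<sigma> * Bser 3 k (1 + of_real \<sigma>)) \<longlongrightarrow> cnj (of_nat (princ 1 k) - of_nat (m 1 k))) (at_right (0::real))"
      by (rule Lim_transform_eventually)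
    hence "cnj (of_nat (princ 1 k) - of_nat (m 1 k)) = of_nat (princ 3 k) - of_nat (m 3 k)"
      using tendsto_unique[OF _ _ m[of 3 k]] by simp
    thus ?thesis by (simp add: princ_def)
  qed
  have c1: "cchi 0 0 j k = 1" for j k by (simp add: cchi_def)
  let ?K = "\<lambda>\<sigma>::real. \<Sum>j<4. \<Sum>k<2. of_real \<sigma> * Bser j k (1 + of_real \<sigma>)"
  have pos: "0 \<le> Re (?K \<sigma>)" if sg: "\<sigma> > 0" for \<sigma> :: real
  proof -
    have "(\<lambda>n. Re (of_real (bC 0 0 n) * dpow (1 + of_real \<sigma>) n)) sums Re ((\<Sum>j<4. \<Sum>k<2. Bser j k (1 + of_real \<sigma>)) / 8)"
      using sums_Re[OF bC_sums[of "1 + of_real \<sigma>" 0 0]] sg by (simp add: c1)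
    moreover have "0 \<le> Re (of_real (bC 0 0 n) * dpow (1 + of_real \<sigma>) n)" for n
    proof (cases "n = 0")
      case True
      have "Qn 0 = {}" by (auto simp: Qn_def PP_def primary_nz)
      thus ?thesis using True by (simp add: bC_def)
    next
      case False
      thus ?thesis using dpow_real[of n "1 + \<sigma>"] bC_nonneg[of 0 0 n] by simp
    qed
    ultimately have "0 \<le> Re ((\<Sum>j<4. \<Sum>k<2. Bser j k (1 + of_real \<sigma>)) / 8)"
      using sums_le[OF _ sums_zero] by (metis (no_types, lifting))
    hence "0 \<le> \<sigma> * Re (\<Sum>j<4. \<Sum>k<2. Bser j k (1 + of_real \<sigma>))" using sg by (simp del: Re_sum)
    also have "... = Re (of_real \<sigma> * (\<Sum>j<4. \<Sum>k<2. Bser j k (1 + of_real \<sigma>)))" by (simp del: Re_sum)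
    finally show ?thesis by (simp only: sum_distrib_left)
  qed
  have "((\<lambda>\<sigma>. Re (?K \<sigma>)) \<longlongrightarrow> Re (\<Sum>j<4. \<Sum>k<2. of_nat (princ j k) - of_nat (m j k))) (at_right (0::real))"
    by (intro tendsto_Re tendsto_sum m)
  moreover have "eventually (\<lambda>\<sigma>::real. 0 \<le> Re (?K \<sigma>)) (at_right 0)"
    using eventually_at_right_less[of "0::real"] by (rule eventually_mono) (use pos in auto)
  ultimately have "0 \<le> Re (\<Sum>j<4. \<Sum>k<2. of_nat (princ j k) - of_nat (m j k) :: complex)"
    by (intro tendsto_lowerbound) auto
  also have "(\<Sum>j<4. \<Sum>k<2. of_nat (princ j k) - of_nat (m j k) :: complex) = of_real (\<Sum>j<4. \<Sum>k<2. real (princ j k) - real (m j k))" by simp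
  also have "Re ... = (\<Sum>j<4. \<Sum>k<2. real (princ j k) - real (m j k))" by (rule Re_complex_of_real)
  also have "... = 1 - (real (m 0 0) + real (m 0 1) + real (m 1 0) + real (m 1 1) + real (m 2 0) + real (m 2 1) + real (m 3 0) + real (m 3 1))"
  proof -
    have "{..<4} = {0, 1, 2, 3::nat}" "{..<2} = {0, 1::nat}" by auto
    thus ?thesis by (simp add: princ_def)
  qed
  finally have "m 0 0 + m 0 1 + m 1 0 + m 1 1 + m 2 0 + m 2 1 + m 3 0 + m 3 1 \<le> 1" by linarith
  hence z: "m 0 0 = 0" "m 0 1 = 0" "m 1 0 = 0" "m 1 1 = 0" "m 2 0 = 0" "m 2 1 = 0" "m 3 0 = 0" "m 3 1 = 0"
    using m00 m20 m01 m13[of 0] m13[of 1] by auto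
  have "j \<in> {0,1,2,3}" "k \<in> {0,1}" using assms by auto
  hence "m j k = 0" using z by auto
  thus ?thesis using m0 by blast
qed

lemma Lext_nonzero:
  assumes "j < 4" "k < 2" "Re s \<ge> 1"
  shows "Lext j k s \<noteq> 0"
proof (cases "Re s > 1")
  case True thus ?thesis by (rule Lext_nonzero_gt1)
next
  case False
  hence s: "s = 1 + \<i> * of_real (Im s)" using assms(3) by (simp add: complex_eq_iff)
  show ?thesis
  proof (cases "Im s = 0")
    case True
    hence "s = 1" using s by simp
    thus ?thesis using Lext_nonzero_1 assms by simp
  next
    case False
    thus ?thesis using Lext_nonzero_line[of "Im s" j k] s by simp
  qed
qed

text \<open>Among the eight characters only the trivial one contributes to the pole, hence the
  density 1/8. The open set handed to \<open>wiener_ikehara\<close> is the half-plane Re s > 1/2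
  without the zeros of the eight functions.\<close>

lemma sum_bC_limit: "(\<lambda>N. (\<Sum>n\<le>N. bC m0 n0 n) / real N) \<longlonglongrightarrow> 1 / 8"
proof -
  obtain K where K: "\<And>N. (\<Sum>n\<le>N. b0 n) \<le> K * real N" using sum_b0 by blast
  define U where "U = {s. Re s > 1/2} \<inter> (\<Inter>j\<in>{..<4::nat}. \<Inter>k\<in>{..<2::nat}. {s \<in> {s. Re s > 1/2}. Lext j k s \<noteq> 0})"
  define \<Phi> where "\<Phi> = (\<lambda>s. - (\<Sum>j<4. \<Sum>k<2. cchi m0 n0 j k * (deriv (Lext j k) s / Lext j k s)) / 8)"
  have op: "open {s \<in> {s. Re s > 1/2}. Lext j k s \<noteq> 0}" for j k
  proof -
    have "open ({s. Re s > 1/2} \<inter> Lext j k -` (- {0}))"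
      by (rule continuous_open_preimage[OF holomorphic_on_imp_continuous_on[OF Lext(1)] open_Re_gt]) auto
    moreover have "{s. Re s > 1/2} \<inter> Lext j k -` (- {0}) = {s \<in> {s. Re s > 1/2}. Lext j k s \<noteq> 0}" by auto
    ultimately show ?thesis by simp
  qed
  have oU: "open U" unfolding U_def by (intro open_Int open_INT open_Re_gt op ballI) auto
  have sub: "{s. Re s \<ge> 1} \<subseteq> U" unfolding U_def using Lext_nonzero by auto
  have hol: "\<Phi> holomorphic_on U"
  proof -
    have d: "deriv (Lext j k) holomorphic_on U" for j k
      by (rule holomorphic_on_subset[OF holomorphic_deriv[OF Lext(1) open_Re_gt]]) (auto simp: U_def)
    have l: "Lext j k holomorphic_on U" for j k
      by (rule holomorphic_on_subset[OF Lext(1)]) (auto simp: U_def)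
    have nz: "Lext j k s \<noteq> 0" if "j \<in> {..<4}" "k \<in> {..<2}" "s \<in> U" for j k s using that by (auto simp: U_def)
    show ?thesis unfolding \<Phi>_def by (intro holomorphic_intros d l nz) auto
  qed
  show ?thesis
  proof (rule wiener_ikehara[OF bC_nonneg _ oU sub hol])
    fix n show "(\<Sum>k\<le>n. bC m0 n0 k) \<le> K * real n" using K[of n] sum_mono[of "{..n}" "bC m0 n0" b0] bC_le by (meson order_trans)
  next
    fix s :: complex assume s: "Re s > 1"
    have "(\<Sum>j<4. \<Sum>k<2. cchi m0 n0 j k * Bser j k s) = (\<Sum>j<4. \<Sum>k<2. cchi m0 n0 j k * (of_nat (princ j k) / (s - 1)) - cchi m0 n0 j k * (deriv (Lext j k) s / Lext j k s))"
      by (intro sum.cong refl) (simp only: Bser_eq[OF s] right_diff_distrib)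
    also have "... = (\<Sum>j<4. \<Sum>k<2. cchi m0 n0 j k * (of_nat (princ j k) / (s - 1))) + 8 * \<Phi> s"
      by (simp add: sum_subtractf \<Phi>_def)
    also have "(\<Sum>j<4. \<Sum>k<2. cchi m0 n0 j k * (of_nat (princ j k) / (s - 1))) = 1 / (s - 1)"
    proof -
      have "{..<4} = {0, 1, 2, 3::nat}" "{..<2} = {0, 1::nat}" by auto
      thus ?thesis by (simp add: princ_def cchi_def)
    qed
    finally have "(\<Sum>j<4. \<Sum>k<2. cchi m0 n0 j k * Bser j k s) / 8 = of_real (1/8) / (s - 1) + \<Phi> s"
      by (simp add: add_divide_distrib)
    thus "(\<lambda>n. of_real (bC m0 n0 n) * dpow s n) sums (of_real (1/8) / (s - 1) + \<Phi> s)" using bC_sums[OF s, of m0 n0] by (simp only:)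
  qed simp
qed

definition QC :: "int \<Rightarrow> int \<Rightarrow> nat set" where
  "QC m0 n0 = {q. prime q \<and> (\<exists>x. primary x \<and> gnorm x = q \<and> cls m0 n0 x)}"

text \<open>For even m the conjugate coordinates (-m, n + m) agree with (m, n) modulo 4 and 2, so
  the class is stable under conjugation.\<close>

lemma cls_gconj:
  assumes "primary x" "even m0" "cls m0 n0 x"
  shows "cls m0 n0 (gconj x)"
proof -
  have x: "x = mkp (pm x) (pn x)" by (rule primary_eq_mkp[OF assms(1)])
  have g: "gconj x = mkp (- pm x) (pn x + pm x)" by (subst x) (simp add: gconj_def mkp_def)
  have "pm (gconj x) = - pm x" "pn (gconj x) = pn x + pm x" unfolding g by simp_all
  moreover have "4 dvd - pm x - m0" "even (pn x + pm x - n0)"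
    using assms(2,3) unfolding cls_def by presburger+
  ultimately show ?thesis by (simp add: cls_def)
qed

text \<open>Each q is the norm of exactly two elements of the class, a conjugate pair, distinct
  because a real element would make q a square. This turns the density 1/8 into 1/16.\<close>

lemma sum_QC:
  assumes "even m0"
  shows "(\<Sum>x\<in>PX N. if cls m0 n0 x then ln (real (gnorm x)) else 0) = 2 * (\<Sum>q\<in>{q\<in>QC m0 n0. q \<le> N}. ln (real q))"
proof -
  define S where "S = {x \<in> PX N. cls m0 n0 x}"
  have fS: "finite S" using finite_PX by (simp add: S_def)
  have "(\<Sum>x\<in>PX N. if cls m0 n0 x then ln (real (gnorm x)) else 0) = (\<Sum>x\<in>S. ln (real (gnorm x)))"
    unfolding S_def by (rule sum.inter_filter[symmetric, OF finite_PX])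
  also have "... = (\<Sum>q\<in>gnorm ` S. \<Sum>x\<in>{x\<in>S. gnorm x = q}. ln (real (gnorm x)))" by (rule sum.image_gen[OF fS])
  also have "gnorm ` S = {q\<in>QC m0 n0. q \<le> N}" by (auto simp: S_def PX_def QC_def)
  also have "(\<Sum>q\<in>{q\<in>QC m0 n0. q \<le> N}. \<Sum>x\<in>{x\<in>S. gnorm x = q}. ln (real (gnorm x))) = (\<Sum>q\<in>{q\<in>QC m0 n0. q \<le> N}. 2 * ln (real q))"
  proof (intro sum.cong refl)
    fix q assume q: "q \<in> {q\<in>QC m0 n0. q \<le> N}"
    then obtain x where x: "primary x" "gnorm x = q" "cls m0 n0 x" "prime q" "q \<le> N" by (auto simp: QC_def)
    have "{x\<in>S. gnorm x = q} = {x, gconj x}"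
    proof (intro equalityI subsetI)
      fix y assume "y \<in> {x\<in>S. gnorm x = q}"
      hence "primary y" "gnorm y = q" by (auto simp: S_def PX_def)
      thus "y \<in> {x, gconj x}" using same_prime_gnorm[of x y] x by auto
    next
      fix y assume "y \<in> {x, gconj x}"
      thus "y \<in> {x\<in>S. gnorm x = q}" using x cls_gconj[OF x(1) assms x(3)] by (auto simp: S_def PX_def)
    qed
    moreover have "gconj x \<noteq> x"
    proof
      assume "gconj x = x"
      hence "- gim x = gim x" using gconj_sel(2)[of x] by simp
      hence "int q = (gre x)\<^sup>2" using int_gnorm[of x] x(2) by simp
      hence "int q = int ((nat \<bar>gre x\<bar>)\<^sup>2)" by simp
      hence "q = (nat \<bar>gre x\<bar>)\<^sup>2" by (simp only: of_nat_eq_iff)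
      thus False using x(4) by (simp add: prime_power_iff)
    qed
    ultimately have "{x\<in>S. gnorm x = q} = {x, gconj x}" "x \<noteq> gconj x" by auto
    thus "(\<Sum>x\<in>{x\<in>S. gnorm x = q}. ln (real (gnorm x))) = 2 * ln (real q)" using x(2) by simp
  qed
  finally show ?thesis by (simp add: sum_distrib_left)
qed

theorem theta_QC:
  assumes "even m0"
  shows "(\<lambda>N. (\<Sum>q\<in>{q\<in>QC m0 n0. q \<le> N}. ln (real q)) / real N) \<longlonglongrightarrow> 1 / 16"
proof -
  define A where "A = (\<lambda>N. (\<Sum>x\<in>PX N. if cls m0 n0 x then ln (real (gnorm x)) else 0))"
  define T where "T = (\<lambda>N. (\<Sum>(p, l)\<in>Tset N. if cls m0 n0 (p ^ l) then ln (real (gnorm p)) else 0))"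
  have dec: "(\<Sum>n\<le>N. bC m0 n0 n) = A N + T N" for N
    unfolding bC_def sum_Qn_split A_def T_def by simp
  have ln0: "ln (real (gnorm p)) \<ge> 0" if "(p, l) \<in> Tset N" for p l N
    using that PP_gnorm[of p] by (auto simp: Tset_def intro!: ln_ge_zero)
  have T0: "T N \<ge> 0" for N unfolding T_def by (rule sum_nonneg) (auto dest: ln0)
  have "T N \<le> (\<Sum>(p, l)\<in>Tset N. ln (real (gnorm p)))" for N
    unfolding T_def by (rule sum_mono) (auto dest: ln0)
  hence T1: "T N \<le> hT N" for N using sum_Tset[of N] order_trans by blast
  have "(\<lambda>N. T N / real N) \<longlonglongrightarrow> 0"
    by (rule tendsto_sandwich[OF _ _ tendsto_const hT_o]) (use T0 T1 in \<open>auto intro!: always_eventually divide_right_mono\<close>)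
  hence "(\<lambda>N. (\<Sum>n\<le>N. bC m0 n0 n) / real N - T N / real N) \<longlonglongrightarrow> 1 / 8 - 0"
    by (intro tendsto_diff sum_bC_limit)
  hence "(\<lambda>N. (((\<Sum>n\<le>N. bC m0 n0 n) / real N - T N / real N)) / 2) \<longlonglongrightarrow> (1 / 8 - 0) / 2"
    by (intro tendsto_divide) auto
  moreover have "(((\<Sum>n\<le>N. bC m0 n0 n) / real N - T N / real N)) / 2 = (\<Sum>q\<in>{q\<in>QC m0 n0. q \<le> N}. ln (real q)) / real N" for N
  proof -
    have "(\<Sum>n\<le>N. bC m0 n0 n) / real N - T N / real N = A N / real N" unfolding dec by (simp add: add_divide_distrib)
    also have "A N = 2 * (\<Sum>q\<in>{q\<in>QC m0 n0. q \<le> N}. ln (real q))" unfolding A_def by (rule sum_QC[OF assms])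
    finally show ?thesis by simp
  qed
  ultimately show ?thesis by simp
qed

section \<open>Legendre symbols\<close>

lemmas cong_mod_def = unique_euclidean_semiring_class.cong_def

lemma Legendre_eq_if: "Legendre a p = (if [a = 0] (mod p) then 0 else if QuadRes p a then 1 else -1)"
  by (simp add: Legendre_def)

lemma Legendre_values: "Legendre a p \<in> {-1, 0, 1}"
  by (simp add: Legendre_def)

lemma Legendre_cong: "[a = b] (mod p) \<Longrightarrow> Legendre a p = Legendre b p"
proof -
  assume ab: "[a = b] (mod p)"
  have "[a = 0] (mod p) \<longleftrightarrow> [b = 0] (mod p)" using ab by (meson cong_sym cong_trans)
  moreover have "QuadRes p a \<longleftrightarrow> QuadRes p b" using ab unfolding QuadRes_def by (meson cong_sym cong_trans)
  ultimately show ?thesis by (simp add: Legendre_def)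
qed

text \<open>Euler's criterion gives the congruence modulo p; both sides lie between -1 and 1, so
  their difference is smaller than p.\<close>

lemma Legendre_mult:
  assumes "prime p" "p > 2"
  shows "Legendre (a * b) (int p) = Legendre a (int p) * Legendre b (int p)"
proof -
  have e: "[Legendre x (int p) = x ^ ((p - 1) div 2)] (mod int p)" for x
    using euler_criterion[OF assms] by simp
  have "[Legendre a (int p) * Legendre b (int p) = (a * b) ^ ((p - 1) div 2)] (mod int p)"
    unfolding power_mult_distrib by (intro cong_mult e)
  hence "[Legendre (a * b) (int p) = Legendre a (int p) * Legendre b (int p)] (mod int p)"
    using e[of "a * b"] by (meson cong_sym cong_trans)
  hence d: "int p dvd Legendre (a * b) (int p) - Legendre a (int p) * Legendre b (int p)"
    by (simp add: cong_iff_dvd_diff)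
  define l where "l = Legendre (a * b) (int p) - Legendre a (int p) * Legendre b (int p)"
  have "\<bar>l\<bar> \<le> 2" unfolding l_def
    using Legendre_values[of "a * b" "int p"] Legendre_values[of a "int p"] Legendre_values[of b "int p"] by auto
  moreover have "int p dvd l" using d by (simp add: l_def)
  ultimately have "l = 0" using assms(2) by (metis dvd_imp_le_int not_less of_nat_less_iff of_nat_numeral order_trans abs_of_nat less_le_trans)
  thus ?thesis by (simp add: l_def)
qed

lemma Legendre_square:
  assumes "prime p" "\<not> int p dvd a" shows "Legendre (a\<^sup>2) (int p) = 1"
proof -
  have "\<not> [a\<^sup>2 = 0] (mod int p)" using assms by (simp add: cong_0_iff prime_dvd_power_iff)
  moreover have "QuadRes (int p) (a\<^sup>2)" unfolding QuadRes_def by (intro exI[of _ a]) simp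
  ultimately show ?thesis by (simp add: Legendre_def)
qed

lemma Legendre_eq_0_iff: "Legendre a (int p) = 0 \<longleftrightarrow> int p dvd a"
  by (simp add: Legendre_def cong_0_iff)

lemma Legendre_pm1: "\<not> int p dvd a \<Longrightarrow> Legendre a (int p) = 1 \<or> Legendre a (int p) = -1"
  by (simp add: Legendre_def cong_0_iff)

lemma Legendre_pow_sign:
  assumes "prime p" "p > 2" "[x ^ ((p - 1) div 2) = e] (mod int p)" "e \<in> {1, -1}"
  shows "Legendre x (int p) = e"
proof -
  have "[Legendre x (int p) = e] (mod int p)"
    using euler_criterion[OF assms(1,2), of x] assms(3) by (meson cong_trans)
  hence d: "int p dvd Legendre x (int p) - e" by (simp add: cong_iff_dvd_diff)
  have "\<bar>Legendre x (int p) - e\<bar> \<le> 2" using Legendre_values[of x "int p"] assms(4) by auto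
  hence "Legendre x (int p) - e = 0" using d assms(2)
    by (metis dvd_imp_le_int not_less of_nat_less_iff of_nat_numeral order_trans abs_of_nat less_le_trans)
  thus ?thesis by simp
qed

lemma Legendre_minus1:
  assumes "prime p" "[p = 1] (mod 8)" shows "Legendre (-1) (int p) = 1"
proof (rule Legendre_pow_sign[OF assms(1)])
  have m: "p mod 8 = 1" using assms(2) by (simp add: cong_mod_def)
  show "p > 2" using m prime_ge_2_nat[OF assms(1)] by (cases "p = 2") auto
  have "even ((p - 1) div 2)" using m by presburger
  thus "[(-1) ^ ((p - 1) div 2) = 1] (mod int p)" by simp
qed simp

text \<open>The root \<open>z\<close> is a primitive eighth root of unity, whence $\sqrt2 = z^{-1}(1 + z^2)$ with $z^2 = \sqrt{-1}$.\<close>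

lemma prime_1_mod_8_root:
  assumes "prime p" "[p = 1] (mod 8)"
  obtains z :: int where "[z ^ 4 = -1] (mod int p)" "Legendre z (int p) = (if [p = 1] (mod 16) then 1 else -1)"
proof -
  have m: "p mod 8 = 1" using assms(2) by (simp add: cong_mod_def)
  have p2: "p > 2" using m prime_ge_2_nat[OF assms(1)] by (cases "p = 2") auto
  obtain g where g: "residue_primroot p g" using prime_primitive_root_exists[of p] assms(1) prime_gt_1_nat[of p] by auto
  have ordg: "ord p g = p - 1" and cop: "coprime p g" using g assms(1) by (auto simp: residue_primroot_def totient_prime)
  define a where "a = int g"
  have a1: "\<not> int p dvd a" using cop assms(1) p2 unfolding a_def
    by (metis coprime_common_divisor_nat dvd_refl int_dvd_int_iff nat_neq_iff one_less_numeral_iff less_trans semiring_norm(76))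
  have a2: "\<not> QuadRes (int p) a"
  proof
    assume "QuadRes (int p) a"
    hence "Legendre a (int p) = 1" using a1 by (simp add: Legendre_def cong_0_iff)
    hence "[a ^ ((p - 1) div 2) = 1] (mod int p)" using euler_criterion[OF assms(1) p2, of a] by (metis cong_sym)
    hence "[int (g ^ ((p - 1) div 2)) = int 1] (mod int p)" by (simp add: a_def)
    hence "[g ^ ((p - 1) div 2) = 1] (mod p)" by (simp only: cong_int_iff)
    hence "p - 1 dvd (p - 1) div 2" unfolding ord_divides ordg .
    moreover have "0 < (p - 1) div 2" "(p - 1) div 2 < p - 1" using p2 by auto
    ultimately show False by (meson nat_dvd_not_less)
  qed
  note a = a1 a2
  hence La: "Legendre a (int p) = -1" by (simp add: Legendre_def cong_0_iff)
  define k where "k = p div 8"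
  have p8: "p = 8 * k + 1" using m unfolding k_def by (metis div_mult_mod_eq mult.commute)
  have pk: "(p - 1) div 2 = 4 * k" unfolding p8 by simp
  \<comment> \<open>With a primitive root a and p = 8k + 1, z^4 is a^{(p-1)/2} = -1 modulo p, and
    the symbol of z is (-1)^k; k is even exactly when p = 1 modulo 16.\<close>
  define z where "z = a ^ k"
  have "[a ^ (4 * k) = -1] (mod int p)"
    using euler_criterion[OF assms(1) p2, of a] unfolding La pk by (rule cong_sym)
  hence z4: "[z ^ 4 = -1] (mod int p)" by (simp add: z_def power_mult[symmetric] mult.commute)
  have "[z ^ ((p - 1) div 2) = (if [p = 1] (mod 16) then 1 else -1)] (mod int p)"
  proof -
    have "z ^ ((p - 1) div 2) = (z ^ 4) ^ k" unfolding pk by (rule power_mult)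
    also have "[... = (-1) ^ k] (mod int p)" by (rule cong_pow[OF z4])
    also have "(-1 :: int) ^ k = (if [p = 1] (mod 16) then 1 else -1)"
    proof -
      have "even k \<longleftrightarrow> p mod 16 = 1"
      proof (cases "even k")
        case True
        then obtain j where "k = 2 * j" by (elim evenE)
        hence "p = 1 + 16 * j" using p8 by simp
        thus ?thesis using True by simp
      next
        case False
        then obtain j where "k = 2 * j + 1" by (elim oddE)
        hence "p = 9 + 16 * j" using p8 by simp
        thus ?thesis using False by simp
      qed
      thus ?thesis by (simp add: cong_mod_def)
    qed
    finally show ?thesis .
  qed
  hence "Legendre z (int p) = (if [p = 1] (mod 16) then 1 else -1)"
    by (intro Legendre_pow_sign[OF assms(1) p2]) auto
  thus ?thesis using that z4 by blast
qed

lemma dvd_power_pos: "x dvd y \<Longrightarrow> n > 0 \<Longrightarrow> x dvd (y::int) ^ n"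
  by (cases n) auto

lemma Legendre_mult_eq_1:
  assumes "prime p" "p > 2" "[x\<^sup>2 = y] (mod int p)" "\<not> int p dvd x"
  shows "Legendre y (int p) = 1"
  using Legendre_cong[OF assms(3)] Legendre_square[OF assms(1,4)] by simp

lemma prime_1_mod_8_gt_2: "prime p \<Longrightarrow> [p = 1] (mod 8) \<Longrightarrow> (p::nat) > 2"
  using prime_ge_2_nat[of p] by (cases "p = 2") (auto simp: cong_mod_def)

text \<open>If z^4 = -1 modulo p, then (z (1 + z^2))^2 is congruent to 2 z^4, and z^4 is a
  square.\<close>

lemma Legendre_2:
  assumes "prime p" "[p = 1] (mod 8)" shows "Legendre 2 (int p) = 1"
proof -
  obtain z :: int where z: "[z ^ 4 = -1] (mod int p)" using prime_1_mod_8_root[OF assms] by blast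
  have p2: "p > 2" by (rule prime_1_mod_8_gt_2[OF assms])
  have d4: "int p dvd z ^ 4 + 1" using z by (simp add: cong_iff_dvd_diff)
  have nz: "\<not> int p dvd z"
  proof
    assume "int p dvd z"
    hence "int p dvd z ^ 4" by (simp add: dvd_power_pos)
    hence "int p dvd 1" using d4 by (metis dvd_add_right_iff)
    thus False using p2 by simp
  qed
  have sq: "(z * (1 + z\<^sup>2))\<^sup>2 - 2 * z ^ 4 = z\<^sup>2 * (z ^ 4 + 1)" by (simp add: algebra_simps power2_eq_square power4_eq_xxxx)
  have e1: "[(z * (1 + z\<^sup>2))\<^sup>2 = 2 * z ^ 4] (mod int p)" using d4 by (simp add: cong_iff_dvd_diff sq)
  have pr: "prime (int p)" using assms(1) by simp
  have nz2: "\<not> int p dvd 2 * z ^ 4"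
  proof
    assume "int p dvd 2 * z ^ 4"
    hence "int p dvd 2 \<or> int p dvd z" using pr by (meson prime_dvd_mult_iff prime_dvd_power)
    thus False using nz p2 by (auto dest: zdvd_imp_le)
  qed
  have "\<not> int p dvd z * (1 + z\<^sup>2)"
  proof
    assume "int p dvd z * (1 + z\<^sup>2)"
    hence "int p dvd (z * (1 + z\<^sup>2))\<^sup>2" by (simp add: dvd_power_pos)
    thus False using e1 nz2 by (simp add: cong_dvd_iff)
  qed
  hence "Legendre (2 * z ^ 4) (int p) = 1" using Legendre_mult_eq_1[OF assms(1) p2 e1] by blast
  moreover have "Legendre (z ^ 4) (int p) = 1"
  proof -
    have "\<not> int p dvd z\<^sup>2" using nz pr by (meson prime_dvd_power)
    hence "Legendre ((z\<^sup>2)\<^sup>2) (int p) = 1" by (rule Legendre_square[OF assms(1)])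
    thus ?thesis by (simp flip: power_mult)
  qed
  ultimately show ?thesis using Legendre_mult[OF assms(1) p2, of 2 "z ^ 4"] by simp
qed

text \<open>On odd positive n this is the Jacobi symbol (2/n); it is even in n.\<close>

definition two8 :: "int \<Rightarrow> int" where "two8 n = (if n mod 8 = 1 \<or> n mod 8 = 7 then 1 else -1)"

text \<open>In the lemma of Gauss the exponent counts the y up to (p-1)/2 whose double exceeds
  (p-1)/2, the upper half of that range.\<close>

lemma Legendre_2_two8:
  assumes "prime p" "p > 2"
  shows "Legendre 2 (int p) = two8 (int p)"
proof -
  interpret GAUSS p 2
    by standard (use assms in \<open>auto simp: cong_mod_def dest: zdvd_imp_le\<close>)
  define h where "h = (int p - 1) div 2"
  have ph: "int p = 2 * h + 1" using p_eq2 by (simp add: h_def)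
  have h0: "h > 0" using assms(2) ph by linarith
  have "E = (\<lambda>y. 2 * y) ` {h div 2 <.. h}"
  proof (intro equalityI subsetI)
    fix x assume "x \<in> E"
    then obtain y where y: "0 < y" "y \<le> h" "x = (y * 2) mod int p" "h < x"
      by (auto simp: E_def C_def B_def A_def h_def)
    have "(y * 2) mod int p = y * 2" using y ph by (intro mod_pos_pos_trivial) auto
    hence x: "x = 2 * y" using y by simp
    hence "h div 2 < y" using y by linarith
    thus "x \<in> (\<lambda>y. 2 * y) ` {h div 2 <.. h}" using x y by auto
  next
    fix x assume "x \<in> (\<lambda>y. 2 * y) ` {h div 2 <.. h}"
    then obtain y where y: "h div 2 < y" "y \<le> h" "x = 2 * y" by auto
    have y0: "0 < y" using y h0 by linarith
    have "(y * 2) mod int p = y * 2" using y y0 ph by (intro mod_pos_pos_trivial) auto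
    hence "x = (y * 2) mod int p" using y by simp
    moreover have "x > h" using y by linarith
    moreover have "y \<in> A" using y y0 by (simp add: A_def h_def)
    hence "y * 2 \<in> B" by (auto simp: B_def)
    hence "(y * 2) mod int p \<in> C" by (auto simp: C_def)
    ultimately show "x \<in> E" by (simp add: E_def h_def)
  qed
  moreover have "card ((\<lambda>y. 2 * y) ` {h div 2 <.. h}) = nat (h - h div 2)"
    by (subst card_image) (auto simp: inj_on_def)
  ultimately have "Legendre 2 (int p) = (-1) ^ nat (h - h div 2)" using gauss_lemma by simp
  also have "... = two8 (int p)"
  proof -
    have "0 \<le> h - h div 2" using h0 by linarith
    hence "even (nat (h - h div 2)) \<longleftrightarrow> even (h - h div 2)" by (rule even_nat_iff)
    also have "... \<longleftrightarrow> (2 * h + 1) mod 8 = 1 \<or> (2 * h + 1) mod 8 = 7" by presburger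
    finally show ?thesis by (auto simp: two8_def ph)
  qed
  finally show ?thesis .
qed

lemma two8_mult:
  assumes "odd m" "odd n" shows "two8 (m * n) = two8 m * two8 n"
proof -
  have m: "m mod 8 \<in> {1, 3, 5, 7}" "n mod 8 \<in> {1, 3, 5, 7}" using assms by (simp_all, presburger+)
  have *: "(m * n) mod 8 = ((m mod 8) * (n mod 8)) mod 8" by (rule mod_mult_eq[symmetric])
  have gen: "((x * y) mod 8 = 1 \<or> (x * y) mod 8 = 7) \<longleftrightarrow> ((x = 1 \<or> x = 7) \<longleftrightarrow> (y = 1 \<or> y = 7))"
    if "x \<in> {1, 3, 5, 7}" "y \<in> {1, 3, 5, 7}" for x y :: int using that by auto
  show ?thesis unfolding two8_def * gen[OF m] by auto
qed

text \<open>Induction over prime factors. Multiplicativity of F is asked for on divisors of n only,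
  so that F may be \<open>two8\<close> when n is odd.\<close>

lemma Legendre_composite:
  fixes F :: "int \<Rightarrow> int" and n :: nat
  assumes p: "prime p" "p > 2" and F1: "F 1 = 1"
    and Fm: "\<And>l m. prime l \<Longrightarrow> l dvd n \<Longrightarrow> m dvd n \<Longrightarrow> F (int l * int m) = F (int l) * F (int m)"
    and L: "\<And>l. prime l \<Longrightarrow> l dvd n \<Longrightarrow> Legendre (int l) (int p) = F (int l)"
    and n: "n > 0"
  shows "Legendre (int n) (int p) = F (int n)"
proof -
  have "m dvd n \<Longrightarrow> Legendre (int m) (int p) = F (int m)" for m
  proof (induction m rule: less_induct)
    case (less m)
    show ?case
    proof (cases "m = 1")
      case True
      have "Legendre (1\<^sup>2) (int p) = 1" using p by (intro Legendre_square) auto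
      thus ?thesis using True F1 by simp
    next
      case False
      then obtain l where l: "prime l" "l dvd m" using prime_factor_nat by blast
      then obtain k where k: "m = l * k" by (elim dvdE)
      have "m > 0" using less.prems n by (rule_tac Nat.gr0I) auto
      hence "k > 0" using k by (rule_tac Nat.gr0I) auto
      hence "1 * k < l * k" using prime_gt_1_nat[OF l(1)] by (intro mult_strict_right_mono) auto
      hence "k < m" using k by simp
      hence "Legendre (int k) (int p) = F (int k)" using less k by (metis dvd_mult_right)
      thus ?thesis using L[OF l(1)] Fm[OF l(1), of k] less.prems k Legendre_mult[OF p, of "int l" "int k"]
        by (metis dvd_mult_left dvd_mult_right of_nat_mult)
    qed
  qed
  thus ?thesis by simp
qed

lemma Legendre_recip:
  assumes "prime p" "[p = 1] (mod 8)" "prime l" "l > 2" "l \<noteq> p"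
  shows "Legendre (int l) (int p) = Legendre (int p) (int l)"
proof -
  have p2: "p > 2" by (rule prime_1_mod_8_gt_2[OF assms(1,2)])
  have "even ((p - 1) div 2)" using assms(2) p2 by (simp add: cong_mod_def) presburger
  hence "Legendre (int p) (int l) * Legendre (int l) (int p) = 1"
    using Quadratic_Reciprocity[OF assms(1) p2 assms(3,4)] assms(5) by simp
  thus ?thesis using Legendre_values[of "int p" "int l"] Legendre_values[of "int l" "int p"] by auto
qed

text \<open>An odd prime \<open>l\<close> dividing \<open>b\<close> sees $p \equiv a^2$, and one dividing $a - b$ sees $2p \equiv (a+b)^2$.\<close>

lemma Legendre_one_plus_i:
  fixes a b r :: int
  assumes p: "prime p" "[p = 1] (mod 8)" and ab: "int p = a\<^sup>2 + b\<^sup>2" "even b" and r: "[r\<^sup>2 = -1] (mod int p)"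
  shows "Legendre (1 + r) (int p) = two8 (a - b)"
proof -
  have p2: "p > 2" by (rule prime_1_mod_8_gt_2[OF p])
  have pr: "prime (int p)" using p by simp
  have oa: "odd a" using ab p p2 by (metis even_add even_power int_eq_iff_numeral odd_two_times_div_two_nat of_nat_eq_iff prime_odd_nat even_of_nat pos2)
  have a0: "a \<noteq> 0" using oa by auto
  have nsq: "int p \<noteq> c\<^sup>2" for c
  proof
    assume c: "int p = c\<^sup>2"
    hence "int p dvd c" using pr by (metis dvd_refl prime_dvd_power)
    hence "(int p)\<^sup>2 dvd c\<^sup>2" by (rule dvd_power_same)
    hence "int p * int p dvd int p" using c by (simp add: power2_eq_square)
    thus False using p2 by (simp add: zdvd_mult_cancel1)
  qed
  have b0: "b \<noteq> 0" using nsq[of a] ab by auto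
  have small: "\<not> int p dvd c" if "c \<noteq> 0" "c\<^sup>2 < int p" for c :: int
  proof
    assume "int p dvd c"
    hence "int p \<le> \<bar>c\<bar>" using that(1) by (metis dvd_imp_le_int abs_of_nat)
    hence "(int p)\<^sup>2 \<le> c\<^sup>2" by (metis abs_of_nat abs_le_square_iff)
    moreover have "int p * 1 < int p * int p" using p2 by (intro mult_strict_left_mono) auto
    ultimately show False using that(2) by (simp add: power2_eq_square)
  qed
  have pa: "\<not> int p dvd a" by (rule small[OF a0]) (use ab b0 in simp)
  have pb: "\<not> int p dvd b" by (rule small[OF b0]) (use ab a0 in simp)
  have ldvd: "\<not> (int l dvd a \<and> int l dvd b)" if l: "prime l" for l
  proof
    assume d: "int l dvd a \<and> int l dvd b"
    then obtain a' b' where "a = int l * a'" "b = int l * b'" by (auto elim!: dvdE)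
    hence "int p = int l * (int l * (a'\<^sup>2 + b'\<^sup>2))" using ab by (simp add: power2_eq_square algebra_simps)
    hence "int (l * l) dvd int p" by (metis dvd_triv_left mult.assoc of_nat_mult)
    hence "l * l dvd p" by (simp only: int_dvd_int_iff)
    hence "l dvd p" by (rule dvd_mult_left)
    hence "l = p" using l p(1) by (simp add: primes_dvd_imp_eq)
    hence "int p dvd a" using d by simp
    thus False using pa by simp
  qed
  have Lb: "Legendre b (int p) = 1"
  proof -
    have "Legendre (int (nat \<bar>b\<bar>)) (int p) = (\<lambda>_. 1) (int (nat \<bar>b\<bar>))"
    proof (rule Legendre_composite[OF p(1) p2])
      fix l assume l: "prime l" "l dvd nat \<bar>b\<bar>"
      hence lb: "int l dvd b" by (metis dvd_abs_iff int_dvd_int_iff nat_0_le abs_ge_zero)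
      show "Legendre (int l) (int p) = 1"
      proof (cases "l = 2")
        case True thus ?thesis using Legendre_2[OF p] by simp
      next
        case False
        hence l2: "l > 2" using prime_ge_2_nat[OF l(1)] by linarith
        have lp: "l \<noteq> p" using lb pb by auto
        have la: "\<not> int l dvd a" using ldvd[OF l(1)] lb by blast
        have "int l dvd int p - a\<^sup>2" using lb ab by (simp add: power2_eq_square)
        hence "[a\<^sup>2 = int p] (mod int l)" by (simp add: cong_iff_dvd_diff) (metis dvd_minus_iff minus_diff_eq)
        hence "Legendre (int p) (int l) = 1" using Legendre_mult_eq_1[OF l(1) l2 _ la] by blast
        thus ?thesis using Legendre_recip[OF p l(1) l2 lp] by simp
      qed
    qed (use b0 in auto)
    hence h: "Legendre \<bar>b\<bar> (int p) = 1" by simp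
    show ?thesis
    proof (cases "b \<ge> 0")
      case False
      have "Legendre (- b) (int p) = 1" using h False by simp
      thus ?thesis using Legendre_mult[OF p(1) p2, of "-1" "- b"] Legendre_minus1[OF p] by simp
    qed (use h in simp)
  qed
  have oab: "odd (a - b)" using oa ab(2) by simp
  have ab0: "a - b \<noteq> 0" using oab by auto
  have pab: "\<not> int p dvd a - b"
  proof
    assume d: "int p dvd a - b"
    have "(a - b) * (a + b) + int p = 2 * a\<^sup>2" using ab by (simp add: power2_eq_square algebra_simps)
    hence "int p dvd 2 * a\<^sup>2" using d by (metis dvd_add dvd_mult2 dvd_refl)
    hence "int p dvd 2 \<or> int p dvd a" using pr by (meson prime_dvd_mult_iff prime_dvd_power)
    thus False using pa p2 by (auto dest: zdvd_imp_le)
  qed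
  have Lab: "Legendre (b - a) (int p) = two8 (a - b)"
  proof -
    have "Legendre (int (nat \<bar>a - b\<bar>)) (int p) = two8 (int (nat \<bar>a - b\<bar>))"
    proof (rule Legendre_composite[OF p(1) p2])
      show "two8 1 = 1" by (simp add: two8_def)
      show "two8 (int l * int m) = two8 (int l) * two8 (int m)" if "l dvd nat \<bar>a - b\<bar>" "m dvd nat \<bar>a - b\<bar>" for l m
      proof (rule two8_mult)
        have "odd (nat \<bar>a - b\<bar>)" using oab by (simp add: even_nat_iff)
        hence "odd l'" if "l' dvd nat \<bar>a - b\<bar>" for l' using that by (meson dvd_trans)
        thus "odd (int l)" "odd (int m)" using that unfolding even_of_nat by blast+
      qed
      fix l assume l: "prime l" "l dvd nat \<bar>a - b\<bar>"
      hence lb: "int l dvd a - b" by (metis dvd_abs_iff int_dvd_int_iff nat_0_le abs_ge_zero)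
      have "l \<noteq> 2" using lb oab by auto
      hence l2: "l > 2" using prime_ge_2_nat[OF l(1)] by linarith
      have lp: "l \<noteq> p" using lb pab by auto
      have prl: "prime (int l)" using l by simp
      have la: "\<not> int l dvd a + b"
      proof
        assume "int l dvd a + b"
        moreover have "2 * a = (a + b) + (a - b)" "2 * b = (a + b) - (a - b)" by simp_all
        ultimately have "int l dvd 2 * a" "int l dvd 2 * b" using lb by (metis dvd_add, metis dvd_diff)
        hence "int l dvd a" "int l dvd b" using prl l2 by (auto simp: prime_dvd_mult_iff dest: zdvd_imp_le)
        thus False using ldvd[OF l(1)] by blast
      qed
      have "(a + b)\<^sup>2 - 2 * int p = - ((a - b) * (a - b))" using ab by (simp add: power2_eq_square algebra_simps)
      hence "[(a + b)\<^sup>2 = 2 * int p] (mod int l)" using lb by (simp add: cong_iff_dvd_diff)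
      hence "Legendre (2 * int p) (int l) = 1" using Legendre_mult_eq_1[OF l(1) l2 _ la] by blast
      hence "Legendre 2 (int l) * Legendre (int p) (int l) = 1" using Legendre_mult[OF l(1) l2] by simp
      hence "Legendre (int p) (int l) = Legendre 2 (int l)"
        using Legendre_values[of "int p" "int l"] Legendre_values[of 2 "int l"] by auto
      thus "Legendre (int l) (int p) = two8 (int l)" using Legendre_recip[OF p l(1) l2 lp] Legendre_2_two8[OF l(1) l2] by simp
    qed (use ab0 in auto)
    hence h: "Legendre \<bar>a - b\<bar> (int p) = two8 \<bar>a - b\<bar>" by simp
    have neg: "two8 (- x) = two8 x" for x unfolding two8_def by presburger
    have "two8 \<bar>x\<bar> = two8 x" for x by (cases "x < 0") (auto simp: neg)
    hence t: "two8 \<bar>a - b\<bar> = two8 (a - b)" .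
    have "Legendre (- x) (int p) = Legendre x (int p)" for x
      using Legendre_mult[OF p(1) p2, of "-1" x] Legendre_minus1[OF p] by simp
    hence "Legendre (b - a) (int p) = Legendre \<bar>a - b\<bar> (int p)" by (metis abs_if minus_diff_eq)
    thus ?thesis using h t by simp
  qed
  \<comment> \<open>For the root s with a + bs = 0 modulo p, the product b (1 + s) is congruent to b
    - a, and b is a square modulo p.\<close>
  have key: "Legendre (1 + s) (int p) = two8 (a - b)" if s: "int p dvd a + b * s" for s
  proof -
    have "b * (1 + s) - (b - a) = a + b * s" by (simp add: algebra_simps)
    hence "[b * (1 + s) = b - a] (mod int p)" unfolding cong_iff_dvd_diff using s by metis
    hence "Legendre (b * (1 + s)) (int p) = two8 (a - b)" using Legendre_cong Lab by metis
    thus ?thesis using Legendre_mult[OF p(1) p2, of b "1 + s"] Lb by simp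
  qed
  have "int p dvd (a + b * r) * (a - b * r)"
  proof -
    have "(a + b * r) * (a - b * r) = int p - b\<^sup>2 * (r\<^sup>2 - (-1))" using ab by (simp add: power2_eq_square algebra_simps)
    moreover have "int p dvd r\<^sup>2 - (-1)" using r by (simp only: cong_iff_dvd_diff)
    ultimately show ?thesis by (metis dvd_diff dvd_mult dvd_refl)
  qed
  hence "int p dvd a + b * r \<or> int p dvd a + b * (- r)" using pr by (simp add: prime_dvd_mult_iff)
  thus ?thesis
  proof
    \<comment> \<open>The opposite root gives the same symbol, as (1 + r)(1 - r) is congruent to 2,
      a square modulo p.\<close>
    assume "int p dvd a + b * (- r)"
    hence 1: "Legendre (1 - r) (int p) = two8 (a - b)" using key[of "- r"] by simp
    have "[(1 + r) * (1 - r) = 2] (mod int p)"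
    proof -
      have "(1 + r) * (1 - r) - 2 = - (r\<^sup>2 - (-1))" by (simp add: power2_eq_square algebra_simps)
      thus ?thesis using r by (simp only: cong_iff_dvd_diff dvd_minus_iff)
    qed
    hence "Legendre (1 + r) (int p) * Legendre (1 - r) (int p) = 1"
      using Legendre_cong Legendre_2[OF p] Legendre_mult[OF p(1) p2] by metis
    thus ?thesis using 1 by (auto simp: two8_def split: if_splits)
  qed (rule key)
qed

text \<open>For the eighth root z, the product zt is 1 + z^2 up to sign modulo p. The symbol of sqrt
  2 is thus expressed through p modulo 16 and the symbol of 1 + i, and classes of Gaussian primes
  also serve d = 8.\<close>

lemma Legendre_sqrt2:
  fixes t r :: int
  assumes p: "prime p" "[p = 1] (mod 8)" and t: "[t\<^sup>2 = 2] (mod int p)" and r: "[r\<^sup>2 = -1] (mod int p)"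
    and ab: "int p = a\<^sup>2 + b\<^sup>2" "even b"
  shows "Legendre t (int p) = (if [p = 1] (mod 16) then 1 else -1) * Legendre (1 + r) (int p)"
proof -
  have p2: "p > 2" by (rule prime_1_mod_8_gt_2[OF p])
  have pr: "prime (int p)" using p by simp
  obtain z :: int where z: "[z ^ 4 = -1] (mod int p)" "Legendre z (int p) = (if [p = 1] (mod 16) then 1 else -1)"
    using prime_1_mod_8_root[OF p] by blast
  have d: "int p dvd z ^ 4 + 1" "int p dvd t\<^sup>2 - 2" using z(1) t by (auto simp: cong_iff_dvd_diff)
  have "(z * t - (1 + z\<^sup>2)) * (z * t + (1 + z\<^sup>2)) = z\<^sup>2 * (t\<^sup>2 - 2) - (z ^ 4 + 1)"
    by (simp add: algebra_simps power2_eq_square power4_eq_xxxx)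
  hence "int p dvd (z * t - (1 + z\<^sup>2)) * (z * t + (1 + z\<^sup>2))" using d by (metis dvd_diff dvd_mult)
  hence "int p dvd z * t - (1 + z\<^sup>2) \<or> int p dvd z * t - (- (1 + z\<^sup>2))"
    unfolding diff_minus_eq_add using pr by (simp only: prime_dvd_mult_iff)
  hence "[z * t = 1 + z\<^sup>2] (mod int p) \<or> [z * t = - (1 + z\<^sup>2)] (mod int p)" by (simp only: cong_iff_dvd_diff)
  moreover have "Legendre (- x) (int p) = Legendre x (int p)" for x
    using Legendre_mult[OF p(1) p2, of "-1" x] Legendre_minus1[OF p] by simp
  ultimately have "Legendre (z * t) (int p) = Legendre (1 + z\<^sup>2) (int p)" using Legendre_cong by metis
  moreover have "[(z\<^sup>2)\<^sup>2 = -1] (mod int p)" using z(1) by (simp add: power2_eq_square power4_eq_xxxx mult.assoc)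
  hence "Legendre (1 + z\<^sup>2) (int p) = Legendre (1 + r) (int p)"
    using Legendre_one_plus_i[OF p ab] r by simp
  ultimately have "Legendre z (int p) * Legendre t (int p) = Legendre (1 + r) (int p)"
    using Legendre_mult[OF p(1) p2] by simp
  thus ?thesis unfolding z(2) by (auto split: if_splits)
qed

section \<open>Residue symbols in quadratic orders\<close>

lemma zsqrt_simps [simp]:
  "carrier (zsqrt d0) = UNIV"
  "x \<otimes>\<^bsub>zsqrt d0\<^esub> y = QInt (rat_part x * rat_part y + d0 * irr_part x * irr_part y) (rat_part x * irr_part y + irr_part x * rat_part y)"
  "x \<oplus>\<^bsub>zsqrt d0\<^esub> y = QInt (rat_part x + rat_part y) (irr_part x + irr_part y)"
  "\<one>\<^bsub>zsqrt d0\<^esub> = QInt 1 0" "\<zero>\<^bsub>zsqrt d0\<^esub> = QInt 0 0"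
  by (simp_all add: zsqrt_def)

lemma zsqrt_a_inv: "\<ominus>\<^bsub>zsqrt d0\<^esub> x = QInt (- rat_part x) (- irr_part x)"
proof -
  interpret cring "zsqrt d0" by (rule zsqrt_cring)
  show ?thesis by (rule minus_equality) auto
qed

lemma zsqrt_minus [simp]: "x \<ominus>\<^bsub>zsqrt d0\<^esub> y = QInt (rat_part x - rat_part y) (irr_part x - irr_part y)"
  by (simp add: a_minus_def zsqrt_a_inv)

text \<open>Reduction $c + e\sqrt{d_0} \mapsto c + er$ modulo the prime ideal on which $\sqrt{d_0} \equiv r$.\<close>

definition redu :: "int \<Rightarrow> quad_int \<Rightarrow> int" where
  "redu r x = rat_part x + irr_part x * r"

lemma redu_mult:
  assumes "[r\<^sup>2 = d0] (mod int p)"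
  shows "[redu r (x \<otimes>\<^bsub>zsqrt d0\<^esub> y) = redu r x * redu r y] (mod int p)"
proof -
  have "redu r x * redu r y - redu r (x \<otimes>\<^bsub>zsqrt d0\<^esub> y) = irr_part x * irr_part y * (r\<^sup>2 - d0)"
    by (simp add: redu_def algebra_simps power2_eq_square)
  hence "int p dvd redu r x * redu r y - redu r (x \<otimes>\<^bsub>zsqrt d0\<^esub> y)" using assms by (simp add: cong_iff_dvd_diff)
  thus ?thesis by (simp add: cong_iff_dvd_diff dvd_diff_commute)
qed

text \<open>For w = a + b sqrt d0 of norm p, p cannot divide b, since p^2 would then divide the
  norm. The root is r = -a/b modulo p, the value of sqrt d0 modulo (w).\<close>

lemma norm_prime_root:
  assumes p: "prime p" and n: "quad_norm d0 w = int p"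
  obtains r where "int p dvd redu r w" "[r\<^sup>2 = d0] (mod int p)" "\<not> int p dvd irr_part w"
proof -
  have pr: "prime (int p)" using p by simp
  define a b where "a = rat_part w" and "b = irr_part w"
  have ab: "a\<^sup>2 - d0 * b\<^sup>2 = int p" using n by (simp add: quad_norm_def a_def b_def)
  have pb: "\<not> int p dvd b"
  proof
    assume d: "int p dvd b"
    hence "int p dvd a\<^sup>2" using ab by (metis diff_add_cancel dvd_add dvd_mult dvd_refl power2_eq_square)
    hence "int p dvd a" using pr prime_dvd_power by blast
    then obtain a' b' where "a = int p * a'" "b = int p * b'" using d by (auto elim!: dvdE)
    hence "int p * (int p * (a'\<^sup>2 - d0 * b'\<^sup>2)) = int p * 1" using ab by (simp add: power2_eq_square algebra_simps)
    hence "int p * (a'\<^sup>2 - d0 * b'\<^sup>2) = 1" using p by (metis mult_left_cancel of_nat_0_eq_iff not_prime_0)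
    hence "int p dvd 1" by (metis dvd_triv_left)
    thus False using pr by (simp add: not_prime_unit)
  qed
  hence "coprime b (int p)" using pr by (metis coprime_commute prime_imp_coprime)
  then obtain c where c: "[b * c = 1] (mod int p)" using cong_solve_coprime_int by blast
  define r where "r = - a * c"
  have d: "int p dvd b * c - 1" using c by (simp add: cong_iff_dvd_diff)
  have "a + b * r = - (a * (b * c - 1))" by (simp add: r_def algebra_simps)
  hence 1: "int p dvd a + b * r" using d by simp
  have "b\<^sup>2 * (r\<^sup>2 - d0) = (b * r - a) * (a + b * r) + int p" using ab by (simp add: power2_eq_square algebra_simps)
  hence "int p dvd b\<^sup>2 * (r\<^sup>2 - d0)" using 1 by (metis dvd_add dvd_mult dvd_refl)
  hence "int p dvd r\<^sup>2 - d0" using pb pr by (metis prime_dvd_mult_iff prime_dvd_power)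
  thus ?thesis using that[of r] 1 pb by (simp add: redu_def a_def b_def cong_iff_dvd_diff)
qed

text \<open>An element x lies in (w) iff x conj(w) / p is integral. Both coordinates of x conj(w)
  vanish modulo p once the reduction of x does, because w itself reduces to 0; g and h are the
  coordinates of the quotient.\<close>

lemma PIdl_norm_prime:
  assumes p: "prime p" and n: "quad_norm d0 w = int p"
    and r: "int p dvd redu r w" "[r\<^sup>2 = d0] (mod int p)"
  shows "PIdl\<^bsub>zsqrt d0\<^esub> w = {x. int p dvd redu r x}"
proof (intro equalityI subsetI)
  fix x assume "x \<in> PIdl\<^bsub>zsqrt d0\<^esub> w"
  then obtain y where x: "x = y \<otimes>\<^bsub>zsqrt d0\<^esub> w" by (auto simp: cgenideal_def simp del: zsqrt_simps(2))
  have "[redu r x = redu r y * redu r w] (mod int p)" unfolding x by (rule redu_mult[OF r(2)])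
  thus "x \<in> {x. int p dvd redu r x}" using r(1) by (simp add: cong_dvd_iff)
next
  fix x assume "x \<in> {x. int p dvd redu r x}"
  hence x: "int p dvd redu r x" by simp
  define a b c e where "a = rat_part w" and "b = irr_part w" and "c = rat_part x" and "e = irr_part x"
  have ab: "a\<^sup>2 - d0 * b\<^sup>2 = int p" using n by (simp add: quad_norm_def a_def b_def)
  have w: "int p dvd a + b * r" and cx: "int p dvd c + e * r" and rr: "int p dvd r\<^sup>2 - d0"
    using r x by (auto simp: redu_def a_def b_def c_def e_def cong_iff_dvd_diff)
  have "e * a - c * b = e * (a + b * r) - b * (c + e * r)" by (simp add: algebra_simps)
  hence "int p dvd e * a - c * b" using w cx by (metis dvd_diff dvd_mult)
  then obtain h where h: "e * a - c * b = int p * h" by (elim dvdE)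
  have "c * a - d0 * b * e = c * (a + b * r) - b * r * (c + e * r) + b * e * (r\<^sup>2 - d0)" by (simp add: algebra_simps power2_eq_square)
  hence "int p dvd c * a - d0 * b * e" using w cx rr by (metis dvd_add dvd_diff dvd_mult)
  then obtain g where g: "c * a - d0 * b * e = int p * g" by (elim dvdE)
  have p0: "int p \<noteq> 0" using p by (metis not_prime_0 of_nat_0_eq_iff)
  have "int p * (g * a + d0 * h * b) = (int p * g) * a + d0 * (int p * h) * b" by (simp add: algebra_simps)
  also have "... = (c * a - d0 * b * e) * a + d0 * (e * a - c * b) * b" by (simp only: g h)
  also have "... = c * (a\<^sup>2 - d0 * b\<^sup>2)" by (simp add: power2_eq_square algebra_simps)
  also have "... = int p * c" using ab by simp
  finally have 1: "g * a + d0 * h * b = c" using p0 by simp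
  have "int p * (g * b + h * a) = (int p * g) * b + (int p * h) * a" by (simp add: algebra_simps)
  also have "... = (c * a - d0 * b * e) * b + (e * a - c * b) * a" by (simp only: g h)
  also have "... = e * (a\<^sup>2 - d0 * b\<^sup>2)" by (simp add: power2_eq_square algebra_simps)
  also have "... = int p * e" using ab by simp
  finally have 2: "g * b + h * a = e" using p0 by simp
  have "x = QInt g h \<otimes>\<^bsub>zsqrt d0\<^esub> w"
    using 1 2 by (simp add: a_def b_def c_def e_def quad_int.expand algebra_simps)
  thus "x \<in> PIdl\<^bsub>zsqrt d0\<^esub> w" unfolding cgenideal_def by (auto simp del: zsqrt_simps(2))
qed

lemma primeideal_norm_prime:
  assumes p: "prime p" and n: "quad_norm d0 w = int p"
  shows "primeideal (PIdl\<^bsub>zsqrt d0\<^esub> w) (zsqrt d0)"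
proof -
  interpret cring "zsqrt d0" by (rule zsqrt_cring)
  obtain r where r: "int p dvd redu r w" "[r\<^sup>2 = d0] (mod int p)" using norm_prime_root[OF p n] by blast
  note I = PIdl_norm_prime[OF p n r]
  have pr: "prime (int p)" using p by simp
  show ?thesis
  proof (rule primeidealI)
    show "ideal (PIdl\<^bsub>zsqrt d0\<^esub> w) (zsqrt d0)" by (rule cgenideal_ideal) simp
    show "cring (zsqrt d0)" by (rule zsqrt_cring)
    have "redu r (QInt 1 0) = 1" by (simp add: redu_def)
    hence "QInt 1 0 \<notin> PIdl\<^bsub>zsqrt d0\<^esub> w" unfolding I using prime_gt_1_nat[OF p] by simp
    thus "carrier (zsqrt d0) \<noteq> PIdl\<^bsub>zsqrt d0\<^esub> w" by auto
    fix x y assume "x \<otimes>\<^bsub>zsqrt d0\<^esub> y \<in> PIdl\<^bsub>zsqrt d0\<^esub> w"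
    hence "int p dvd redu r (x \<otimes>\<^bsub>zsqrt d0\<^esub> y)" unfolding I by blast
    hence "int p dvd redu r x * redu r y" using redu_mult[OF r(2), of x y] by (simp only: cong_dvd_iff)
    hence "int p dvd redu r x \<or> int p dvd redu r y" using pr by (simp add: prime_dvd_mult_iff)
    thus "x \<in> PIdl\<^bsub>zsqrt d0\<^esub> w \<or> y \<in> PIdl\<^bsub>zsqrt d0\<^esub> w" unfolding I by simp
  qed
qed

text \<open>Reduction identifies the residue field with the integers modulo p, and every residue has
  a rational representative, so squares modulo (w) are squares modulo p.\<close>

lemma prime_ideal_symbol_Legendre:
  assumes p: "prime p" and n: "quad_norm d0 w = int p"
    and r: "int p dvd redu r w" "[r\<^sup>2 = d0] (mod int p)"
  shows "prime_ideal_symbol (zsqrt d0) x (PIdl\<^bsub>zsqrt d0\<^esub> w) = Legendre (redu r x) (int p)"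
proof -
  note I = PIdl_norm_prime[OF p n r]
  have "square_mod_ideal (zsqrt d0) (PIdl\<^bsub>zsqrt d0\<^esub> w) x \<longleftrightarrow> QuadRes (int p) (redu r x)"
  proof
    assume "square_mod_ideal (zsqrt d0) (PIdl\<^bsub>zsqrt d0\<^esub> w) x"
    then obtain s where "x \<ominus>\<^bsub>zsqrt d0\<^esub> (s \<otimes>\<^bsub>zsqrt d0\<^esub> s) \<in> PIdl\<^bsub>zsqrt d0\<^esub> w" unfolding square_mod_ideal_def by blast
    hence "int p dvd redu r (x \<ominus>\<^bsub>zsqrt d0\<^esub> (s \<otimes>\<^bsub>zsqrt d0\<^esub> s))" unfolding I by blast
    moreover have "redu r (x \<ominus>\<^bsub>zsqrt d0\<^esub> y) = redu r x - redu r y" for y by (simp add: redu_def algebra_simps)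
    ultimately have "[redu r x = redu r (s \<otimes>\<^bsub>zsqrt d0\<^esub> s)] (mod int p)" by (simp only: cong_iff_dvd_diff)
    hence "[(redu r s)\<^sup>2 = redu r x] (mod int p)" using redu_mult[OF r(2), of s s] by (metis cong_sym cong_trans power2_eq_square)
    thus "QuadRes (int p) (redu r x)" unfolding QuadRes_def by blast
  next
    assume "QuadRes (int p) (redu r x)"
    then obtain y where y: "[y\<^sup>2 = redu r x] (mod int p)" unfolding QuadRes_def by blast
    have "redu r (x \<ominus>\<^bsub>zsqrt d0\<^esub> (QInt y 0 \<otimes>\<^bsub>zsqrt d0\<^esub> QInt y 0)) = redu r x - y\<^sup>2"
      by (simp add: redu_def power2_eq_square)
    hence "x \<ominus>\<^bsub>zsqrt d0\<^esub> (QInt y 0 \<otimes>\<^bsub>zsqrt d0\<^esub> QInt y 0) \<in> PIdl\<^bsub>zsqrt d0\<^esub> w"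
      unfolding I mem_Collect_eq using y by (simp only: cong_iff_dvd_diff dvd_diff_commute)
    thus "square_mod_ideal (zsqrt d0) (PIdl\<^bsub>zsqrt d0\<^esub> w) x" unfolding square_mod_ideal_def
      by (intro bexI[of _ "QInt y 0"]) (auto simp del: zsqrt_simps(2) zsqrt_minus)
  qed
  moreover have "x \<in> PIdl\<^bsub>zsqrt d0\<^esub> w \<longleftrightarrow> [redu r x = 0] (mod int p)" unfolding I by (simp add: cong_0_iff)
  ultimately show ?thesis by (simp add: prime_ideal_symbol_def Legendre_def)
qed

section \<open>Uniqueness of the factorization of a principal prime ideal\<close>

lemma (in cring) ideal_prod_PIdl:
  assumes J: "ideal J R" and w: "w \<in> carrier R" and x: "x \<in> ideal_prod R (PIdl w) J"
  shows "\<exists>j\<in>J. x = w \<otimes> j"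
  using x
proof (induction rule: ideal_prod.induct)
  case (prod i j)
  interpret J: ideal J R by (rule J)
  from prod obtain y where y: "y \<in> carrier R" "i = y \<otimes> w" by (auto simp: cgenideal_def)
  have jc: "j \<in> carrier R" using prod J.Icarr by blast
  have "i \<otimes> j = w \<otimes> (y \<otimes> j)" using y jc w by (simp add: m_ac)
  moreover have "y \<otimes> j \<in> J" using y prod J.I_l_closed by blast
  ultimately show ?case by blast
next
  case (sum s1 s2)
  interpret J: ideal J R by (rule J)
  from sum obtain j1 j2 where j: "j1 \<in> J" "s1 = w \<otimes> j1" "j2 \<in> J" "s2 = w \<otimes> j2" by blast
  have "s1 \<oplus> s2 = w \<otimes> (j1 \<oplus> j2)" using j w J.Icarr by (simp add: r_distr)
  moreover have "j1 \<oplus> j2 \<in> J" using j by (simp add: J.a_closed)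
  ultimately show ?case by blast
qed

text \<open>\<open>ideal_symbol\<close> picks some factorization; for a prime ideal (w) it must be
  the singleton. Primality puts the head or the product of the rest inside (w), both contain (w),
  and cancelling w shows that the complementary factor contains 1.\<close>

lemma (in cring) prime_ideal_factorization_prime:
  assumes P: "primeideal (PIdl w) R" and w: "w \<in> carrier R" "\<And>x. x \<in> carrier R \<Longrightarrow> w \<otimes> x = w \<Longrightarrow> x = \<one>"
    and Ps: "\<forall>Q\<in>set Ps. primeideal Q R" "foldr (ideal_prod R) Ps (carrier R) = PIdl w"
  shows "Ps = [PIdl w]"
proof -
  have fid: "ideal (foldr (ideal_prod R) Qs (carrier R)) R" if "\<forall>Q\<in>set Qs. primeideal Q R" for Qs
    using that by (induction Qs) (auto intro!: ideal_prod_is_ideal oneideal dest: primeideal.axioms(1))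
  interpret P: primeideal "PIdl w" R by (rule P)
  have wP: "w \<in> PIdl w" by (rule cgenideal_self[OF w(1)])
  have proper: "\<one> \<notin> Q" if "primeideal Q R" for Q
  proof
    interpret Q: primeideal Q R by (rule that)
    assume "\<one> \<in> Q"
    hence "Q = carrier R" by (rule Q.one_imp_carrier)
    thus False using Q.I_notcarr by simp
  qed
  have sub: "ideal_prod R I J \<subseteq> I" "ideal_prod R I J \<subseteq> J" if "ideal I R" "ideal J R" for I J
    using ideal_prod_inter[OF that] by blast+
  show ?thesis
  proof (cases Ps)
    case Nil
    hence "PIdl w = carrier R" using Ps(2) by simp
    thus ?thesis using P.I_notcarr by simp
  next
    case (Cons Q Qs)
    define J where "J = foldr (ideal_prod R) Qs (carrier R)"
    have J: "ideal J R" unfolding J_def using fid Ps(1) Cons by simp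
    have Q: "primeideal Q R" using Ps(1) Cons by simp
    have Qi: "ideal Q R" using Q by (rule primeideal.axioms(1))
    have eq: "ideal_prod R Q J = PIdl w" using Ps(2) Cons by (simp add: J_def)
    have "Q \<subseteq> PIdl w \<or> J \<subseteq> PIdl w"
    proof (rule ccontr)
      assume "\<not> (Q \<subseteq> PIdl w \<or> J \<subseteq> PIdl w)"
      then obtain q j where qj: "q \<in> Q" "q \<notin> PIdl w" "j \<in> J" "j \<notin> PIdl w" by blast
      have "q \<otimes> j \<in> PIdl w" unfolding eq[symmetric] using qj by (intro ideal_prod.prod)
      moreover have "q \<in> carrier R" "j \<in> carrier R" using qj Qi J by (meson additive_subgroup.a_Hcarr ideal.axioms(1))+
      ultimately show False using P.I_prime qj by blast
    qed
    thus ?thesis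
    proof
      assume "Q \<subseteq> PIdl w"
      hence QP: "Q = PIdl w" using sub(1)[OF Qi J] eq by blast
      have "w \<in> ideal_prod R (PIdl w) J" using eq QP wP by simp
      then obtain j where j: "j \<in> J" "w = w \<otimes> j" using ideal_prod_PIdl[OF J w(1)] by blast
      have "j \<in> carrier R" using j(1) J by (meson additive_subgroup.a_Hcarr ideal.axioms(1))
      hence "\<one> \<in> J" using w(2)[of j] j by simp
      have "Qs = []"
      proof (cases Qs)
        case (Cons Q' Qs')
        have "ideal Q' R" "ideal (foldr (ideal_prod R) Qs' (carrier R)) R"
          using Ps(1) \<open>Ps = Q # Qs\<close> Cons fid by (auto intro: primeideal.axioms(1))
        from sub(1)[OF this] have "J \<subseteq> Q'" unfolding J_def Cons by simp
        hence "\<one> \<in> Q'" using \<open>\<one> \<in> J\<close> by blast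
        moreover have "primeideal Q' R" using Ps(1) \<open>Ps = Q # Qs\<close> Cons by simp
        ultimately show ?thesis using proper by blast
      qed
      thus ?thesis using \<open>Ps = Q # Qs\<close> QP by simp
    next
      assume "J \<subseteq> PIdl w"
      hence JP: "J = PIdl w" using sub(2)[OF Qi J] eq by blast
      have "w \<in> ideal_prod R (PIdl w) Q" using eq JP wP ideal_prod_commute[OF Qi J] by simp
      then obtain j where j: "j \<in> Q" "w = w \<otimes> j" using ideal_prod_PIdl[OF Qi w(1)] by blast
      have "j \<in> carrier R" using j(1) Qi by (meson additive_subgroup.a_Hcarr ideal.axioms(1))
      hence "\<one> \<in> Q" using w(2)[of j] j by simp
      thus ?thesis using proper Q by blast
    qed
  qed
qed

lemma ideal_symbol_Legendre:
  assumes p: "prime p" and n: "quad_norm d0 w = int p"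
    and r: "int p dvd redu r w" "[r\<^sup>2 = d0] (mod int p)"
  shows "ideal_symbol (zsqrt d0) x (PIdl\<^bsub>zsqrt d0\<^esub> w) = Legendre (redu r x) (int p)"
proof -
  interpret cring "zsqrt d0" by (rule zsqrt_cring)
  let ?P = "PIdl\<^bsub>zsqrt d0\<^esub> w"
  have prim: "primeideal ?P (zsqrt d0)" by (rule primeideal_norm_prime[OF p n])
  \<comment> \<open>Multiplication by conj(w) turns w y = w into p y = p.\<close>
  have canc: "y = \<one>\<^bsub>zsqrt d0\<^esub>" if "w \<otimes>\<^bsub>zsqrt d0\<^esub> y = w" for y
  proof -
    define a b c e where "a = rat_part w" and "b = irr_part w" and "c = rat_part y" and "e = irr_part y"
    have 1: "a * c + d0 * b * e = a" "a * e + b * c = b"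
      using arg_cong[OF that, of rat_part] arg_cong[OF that, of irr_part] by (simp_all add: a_def b_def c_def e_def)
    have ab: "a\<^sup>2 - d0 * b\<^sup>2 = int p" using n by (simp add: quad_norm_def a_def b_def)
    have "int p * e = a * (a * e + b * c) - b * (a * c + d0 * b * e)" unfolding ab[symmetric] by (simp add: power2_eq_square algebra_simps)
    also have "... = 0" unfolding 1 by simp
    finally have "e = 0" using p by (metis mult_eq_0_iff not_prime_0 of_nat_0_eq_iff)
    moreover have "int p * c = a * (a * c + d0 * b * e) - d0 * b * (a * e + b * c)" unfolding ab[symmetric] by (simp add: power2_eq_square algebra_simps)
    hence "int p * c = int p * 1" unfolding 1 ab[symmetric] by (simp add: power2_eq_square)
    hence "c = 1" using p by (metis mult_left_cancel not_prime_0 of_nat_0_eq_iff)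
    ultimately show ?thesis by (simp add: c_def e_def quad_int.expand)
  qed
  define Q where "Q = (\<lambda>Ps. (\<forall>P \<in> set Ps. primeideal P (zsqrt d0)) \<and> foldr (ideal_prod (zsqrt d0)) Ps (carrier (zsqrt d0)) = ?P)"
  have "Q [?P]" unfolding Q_def using prim ideal_prod_one[OF primeideal.axioms(1)[OF prim]] by simp
  hence "Q (SOME Ps. Q Ps)" by (rule someI)
  hence "(SOME Ps. Q Ps) = [?P]"
    using prime_ideal_factorization_prime[OF prim, of "SOME Ps. Q Ps"] canc unfolding Q_def by simp
  thus ?thesis unfolding ideal_symbol_def Q_def[symmetric] using prime_ideal_symbol_Legendre[OF p n r] by simp
qed

section \<open>Prime ideals above p, units, and independence of choices\<close>

lemma quad_norm_conj [simp]: "quad_norm d0 (quad_conj w) = quad_norm d0 w"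
  by (simp add: quad_norm_def quad_conj_def)

lemma redu_conj: "redu r (quad_conj w) = redu (- r) w"
  by (simp add: redu_def quad_conj_def)

lemma lies_above_norm_prime:
  assumes p: "prime p" and n: "quad_norm d0 w = int p"
  shows "lies_above d0 (PIdl\<^bsub>zsqrt d0\<^esub> w) p"
proof -
  obtain r where r: "int p dvd redu r w" "[r\<^sup>2 = d0] (mod int p)" using norm_prime_root[OF p n] by blast
  show ?thesis unfolding lies_above_def PIdl_norm_prime[OF p n r, symmetric]
    using primeideal_norm_prime[OF p n] PIdl_norm_prime[OF p n r] by (simp add: redu_def)
qed

text \<open>P contains p = w conj(w), hence v = w or v = conj(w). Modulo (v) every x is congruent to
  the rational integer c + er, which lies in P only if p divides it, so P = (v).\<close>

lemma lies_above_cases: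
  assumes p: "prime p" and n: "quad_norm d0 w = int p" and P: "lies_above d0 P p"
  shows "P = PIdl\<^bsub>zsqrt d0\<^esub> w \<or> P = PIdl\<^bsub>zsqrt d0\<^esub> (quad_conj w)"
proof -
  have prim: "primeideal P (zsqrt d0)" and above: "\<And>m. QInt m 0 \<in> P \<longleftrightarrow> int p dvd m"
    using P by (auto simp: lies_above_def)
  interpret P: primeideal P "zsqrt d0" by (rule prim)
  have *: "P = PIdl\<^bsub>zsqrt d0\<^esub> v" if v: "v \<in> P" "quad_norm d0 v = int p" for v
  proof
    show sub: "PIdl\<^bsub>zsqrt d0\<^esub> v \<subseteq> P"
      using v(1) P.I_l_closed unfolding cgenideal_def by (auto simp del: zsqrt_simps(2))
    obtain r where r: "int p dvd redu r v" "[r\<^sup>2 = d0] (mod int p)" using norm_prime_root[OF p v(2)] by blast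
    show "P \<subseteq> PIdl\<^bsub>zsqrt d0\<^esub> v"
    proof
      fix x assume x: "x \<in> P"
      have "QInt (redu r x - rat_part x) (- irr_part x) \<in> PIdl\<^bsub>zsqrt d0\<^esub> v"
        unfolding PIdl_norm_prime[OF p v(2) r] by (simp add: redu_def)
      hence "QInt (redu r x - rat_part x) (- irr_part x) \<in> P" using sub by blast
      hence "QInt (redu r x - rat_part x) (- irr_part x) \<oplus>\<^bsub>zsqrt d0\<^esub> x \<in> P" using x by (rule additive_subgroup.a_closed[OF ideal.axioms(1)[OF primeideal.axioms(1)[OF prim]]])
      hence "int p dvd redu r x" using above[of "redu r x"] by simp
      thus "x \<in> PIdl\<^bsub>zsqrt d0\<^esub> v" unfolding PIdl_norm_prime[OF p v(2) r] by simp
    qed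
  qed
  have "w \<otimes>\<^bsub>zsqrt d0\<^esub> quad_conj w = QInt (int p) 0"
    using n by (simp add: quad_conj_def quad_norm_def power2_eq_square algebra_simps)
  moreover have "QInt (int p) 0 \<in> P" using above by simp
  ultimately have "w \<in> P \<or> quad_conj w \<in> P" using P.I_prime[of w "quad_conj w"] by simp
  thus ?thesis using *[of w] *[of "quad_conj w"] n by auto
qed

text \<open>The ideal chosen in \<open>chi2\<close> is (w) or its conjugate, so r is an unspecified
  one of two roots; the evaluations of the symbol hold for either.\<close>

lemma chi2_Legendre:
  assumes p: "prime p" and n: "quad_norm (d div 4) w = int p"
  obtains r where "[r\<^sup>2 = d div 4] (mod int p)" "chi2 d p = Legendre (redu r (t_elem d)) (int p)"
proof -
  define P where "P = (SOME P. lies_above (d div 4) P p)"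
  have "lies_above (d div 4) P p" unfolding P_def by (rule someI[of "\<lambda>P. lies_above (d div 4) P p", OF lies_above_norm_prime[OF p n]])
  hence "P = PIdl\<^bsub>zsqrt (d div 4)\<^esub> w \<or> P = PIdl\<^bsub>zsqrt (d div 4)\<^esub> (quad_conj w)" by (rule lies_above_cases[OF p n])
  then obtain v where v: "P = PIdl\<^bsub>zsqrt (d div 4)\<^esub> v" "quad_norm (d div 4) v = int p" using n by auto
  obtain r where r: "int p dvd redu r v" "[r\<^sup>2 = d div 4] (mod int p)" using norm_prime_root[OF p v(2)] by blast
  have "chi2 d p = Legendre (redu r (t_elem d)) (int p)"
    unfolding chi2_def P_def[symmetric] v(1) by (rule prime_ideal_symbol_Legendre[OF p v(2) r])
  thus ?thesis using that r by blast
qed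

text \<open>Multiplying by $(1 \mp \sqrt2)^2 = 3 \mp 2\sqrt2$ changes no quadratic symbol and shrinks the coefficient of $\sqrt2$.\<close>

lemma sqrt2_reduction:
  fixes c e :: int
  assumes "c\<^sup>2 - 2 * e\<^sup>2 = n" "n > 0"
  shows "\<exists>c' e'. c'\<^sup>2 - 2 * e'\<^sup>2 = n \<and> 2 * e'\<^sup>2 \<le> n \<and>
     (\<forall>p r. prime p \<longrightarrow> [p = 1] (mod 8) \<longrightarrow> [r\<^sup>2 = 2] (mod int p) \<longrightarrow> Legendre (c' + e' * r) (int p) = Legendre (c + e * r) (int p))"
  using assms(1)
proof (induction "nat \<bar>e\<bar>" arbitrary: c e rule: less_induct)
  case less
  show ?case
  proof (cases "2 * e\<^sup>2 \<le> n")
    case True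
    thus ?thesis using less.prems by blast
  next
    case False
    \<comment> \<open>The sign of ce decides which of (1 - sqrt 2)^2 and (1 + sqrt 2)^2 shrinks |e|.
      The new element c' + e' sqrt 2 is (c + e sqrt 2)(3 - 2s sqrt 2).\<close>
    define s where "s = (if c * e > 0 then 1 else -1 :: int)"
    have ss: "s * s = 1" by (simp add: s_def)
    have e0: "e \<noteq> 0" using False assms(2) by auto
    have c2: "e\<^sup>2 < c\<^sup>2" "c\<^sup>2 < (2 * e)\<^sup>2" using less.prems False assms(2) zero_less_power2[of e] e0 by (auto simp: power_mult_distrib)
    have "\<bar>e\<bar>\<^sup>2 < \<bar>c\<bar>\<^sup>2" "\<bar>c\<bar>\<^sup>2 < (2 * \<bar>e\<bar>)\<^sup>2" using c2 by (simp_all add: power_mult_distrib)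
    hence ce: "\<bar>e\<bar> < \<bar>c\<bar>" "\<bar>c\<bar> < 2 * \<bar>e\<bar>" by (auto intro: power2_less_imp_less)
    define c' e' where "c' = 3 * c - 4 * s * e" and "e' = 3 * e - 2 * s * c"
    have n': "c'\<^sup>2 - 2 * e'\<^sup>2 = n"
    proof -
      have "c'\<^sup>2 - 2 * e'\<^sup>2 = 9 * c\<^sup>2 - 18 * e\<^sup>2 + (s * s) * (16 * e\<^sup>2 - 8 * c\<^sup>2)"
        by (simp add: c'_def e'_def power2_eq_square algebra_simps)
      thus ?thesis using less.prems ss by simp
    qed
    have "\<bar>e'\<bar> < \<bar>e\<bar>"
    proof -
      have "s * c = sgn e * \<bar>c\<bar>" 
      proof -
        have c0: "c \<noteq> 0" using ce(1) e0 by auto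
        show ?thesis using c0 e0 by (auto simp: s_def abs_if sgn_if zero_less_mult_iff)
      qed
      moreover have "e = sgn e * \<bar>e\<bar>" by (simp add: sgn_mult_abs)
      ultimately have "e' = sgn e * (3 * \<bar>e\<bar> - 2 * \<bar>c\<bar>)" unfolding e'_def by (simp add: algebra_simps)
      hence "\<bar>e'\<bar> = \<bar>3 * \<bar>e\<bar> - 2 * \<bar>c\<bar>\<bar>" using e0 by (simp add: abs_mult sgn_if)
      thus ?thesis using ce by linarith
    qed
    hence "nat \<bar>e'\<bar> < nat \<bar>e\<bar>" by simp
    from less.hyps[OF this n'] obtain c'' e'' where IH: "c''\<^sup>2 - 2 * e''\<^sup>2 = n" "2 * e''\<^sup>2 \<le> n"
      "\<And>p r. prime p \<Longrightarrow> [p = 1] (mod 8) \<Longrightarrow> [r\<^sup>2 = 2] (mod int p) \<Longrightarrow> Legendre (c'' + e'' * r) (int p) = Legendre (c' + e' * r) (int p)"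
      by blast
    have "Legendre (c' + e' * r) (int p) = Legendre (c + e * r) (int p)" if p: "prime p" "[p = 1] (mod 8)" and r: "[r\<^sup>2 = 2] (mod int p)" for p r
    proof -
      have p2: "p > 2" by (rule prime_1_mod_8_gt_2[OF p])
      have d: "int p dvd r\<^sup>2 - 2" using r by (simp add: cong_iff_dvd_diff)
      have "(c + e * r) * (1 - s * r)\<^sup>2 - (c' + e' * r) = (r\<^sup>2 - 2) * (s * s * (c + e * r) - 2 * s * e) + (s * s - 1) * (2 * c + 2 * e * r)"
        by (simp add: c'_def e'_def power2_eq_square algebra_simps)
      hence "int p dvd (c + e * r) * (1 - s * r)\<^sup>2 - (c' + e' * r)" using d ss by simp
      hence "[(c + e * r) * (1 - s * r)\<^sup>2 = c' + e' * r] (mod int p)" by (simp add: cong_iff_dvd_diff)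
      hence "Legendre (c' + e' * r) (int p) = Legendre (c + e * r) (int p) * Legendre ((1 - s * r)\<^sup>2) (int p)"
        using Legendre_cong Legendre_mult[OF p(1) p2] by metis
      moreover have "\<not> int p dvd 1 - s * r"
      proof
        assume "int p dvd 1 - s * r"
        moreover have "(1 - s * r) * (1 + s * r) = 1 - (s * s) * r\<^sup>2" by (simp add: power2_eq_square algebra_simps)
        ultimately have "int p dvd 1 - r\<^sup>2" using ss by (metis dvd_mult2 mult_1)
        hence "int p dvd (1 - r\<^sup>2) + (r\<^sup>2 - 2)" using d by (rule dvd_add)
        thus False using p2 by simp
      qed
      ultimately show ?thesis using Legendre_square[OF p(1)] by simp
    qed
    thus ?thesis using IH by metis
  qed
qed

text \<open>For d0 = 2 reduction brings a unit of norm 1 to 1 or -1 without changing symbols. For d0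
  = -1 the units are the powers of i, and i is a square modulo p because p = 1 modulo 8.\<close>

lemma Legendre_unit:
  fixes g h d0 r :: int
  assumes d0: "d0 = -1 \<or> d0 = 2" and u: "g\<^sup>2 - d0 * h\<^sup>2 = 1"
    and p: "prime p" "[p = 1] (mod 8)" and r: "[r\<^sup>2 = d0] (mod int p)"
  shows "Legendre (g + h * r) (int p) = 1"
proof -
  have p2: "p > 2" by (rule prime_1_mod_8_gt_2[OF p])
  have L1: "Legendre 1 (int p) = 1" using Legendre_square[OF p(1), of 1] p2 by simp
  have neg: "Legendre (- x) (int p) = Legendre x (int p)" for x
    using Legendre_mult[OF p(1) p2, of "-1" x] Legendre_minus1[OF p] by simp
  from d0 show ?thesis
  proof
    assume d: "d0 = 2"
    obtain c' e' where ce: "c'\<^sup>2 - 2 * e'\<^sup>2 = 1" "2 * e'\<^sup>2 \<le> 1" "Legendre (c' + e' * r) (int p) = Legendre (g + h * r) (int p)"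
    proof -
      have u': "g\<^sup>2 - 2 * h\<^sup>2 = 1" and r2: "[r\<^sup>2 = 2] (mod int p)" using u r d by simp_all
      show ?thesis using sqrt2_reduction[OF u' zero_less_one] p r2 that by blast
    qed
    have "e'\<^sup>2 = 0" using ce(2) zero_le_power2[of e'] by linarith
    hence "e' = 0" "c' = 1 \<or> c' = -1" using ce(1) by (auto simp: power2_eq_1_iff)
    thus ?thesis using ce(3) L1 neg[of 1] by auto
  next
    assume d: "d0 = -1"
    hence gh: "g\<^sup>2 + h\<^sup>2 = 1" using u by simp
    have "g = 0 \<and> (h = 1 \<or> h = -1) \<or> h = 0 \<and> (g = 1 \<or> g = -1)"
    proof -
      have "g\<^sup>2 = 0 \<or> h\<^sup>2 = 0" using gh zero_le_power2[of g] zero_le_power2[of h] by (smt (verit))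
      thus ?thesis using gh by (auto simp: power2_eq_1_iff)
    qed
    moreover have "Legendre r (int p) = 1"
    proof (rule Legendre_pow_sign[OF p(1) p2])
      have m: "p mod 8 = 1" using p(2) by (simp add: cong_mod_def)
      define k where "k = p div 8"
      have p8: "p = 8 * k + 1" using m unfolding k_def by (metis div_mult_mod_eq mult.commute)
      have "r ^ ((p - 1) div 2) = (r\<^sup>2) ^ (2 * k)" unfolding p8 by (simp flip: power_mult)
      also have "[... = (-1) ^ (2 * k)] (mod int p)" using r d by (intro cong_pow) simp
      finally show "[r ^ ((p - 1) div 2) = 1] (mod int p)" by simp
    qed simp
    ultimately show ?thesis using L1 neg[of 1] neg[of r] by auto
  qed
qed

text \<open>The prime q divides (ce' - c'e)(ce' + c'e). According to the factor it divides, the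
  quotient of the second element by the first or by the conjugate of the first is integral, a unit g
  + h sqrt d0 of norm 1.\<close>

lemma same_prime_norm:
  fixes c e c' e' d0 :: int
  assumes q: "prime q" and n: "c\<^sup>2 - d0 * e\<^sup>2 = int q" "c'\<^sup>2 - d0 * e'\<^sup>2 = int q"
  shows "\<exists>g h. g\<^sup>2 - d0 * h\<^sup>2 = 1 \<and> ((c' = c * g + d0 * e * h \<and> e' = c * h + e * g) \<or> (c' = c * g - d0 * e * h \<and> e' = c * h - e * g))"
proof -
  have pr: "prime (int q)" using q by simp
  have q0: "int q \<noteq> 0" using q by (metis not_prime_0 of_nat_0_eq_iff)
  have main: "\<exists>g h. g\<^sup>2 - d0 * h\<^sup>2 = 1 \<and> c' = c * g + d0 * e * h \<and> e' = c * h + e * g"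
    if n: "c\<^sup>2 - d0 * e\<^sup>2 = int q" and dv: "int q dvd c * e' - c' * e" for c e
  proof -
    obtain h where h: "c * e' - c' * e = int q * h" using dv by (elim dvdE)
    have id: "(c * c' - d0 * e * e')\<^sup>2 - d0 * (c * e' - c' * e)\<^sup>2 = (c\<^sup>2 - d0 * e\<^sup>2) * (c'\<^sup>2 - d0 * e'\<^sup>2)"
      by (simp add: power2_eq_square algebra_simps)
    hence id': "(c * c' - d0 * e * e')\<^sup>2 - d0 * (int q * h)\<^sup>2 = int q * int q" unfolding h n assms(3) .
    hence "(c * c' - d0 * e * e')\<^sup>2 = int q * int q + d0 * (int q * h)\<^sup>2" by linarith
    also have "... = int q * (int q + d0 * (int q * h\<^sup>2))" by (simp add: power2_eq_square algebra_simps)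
    finally have "(c * c' - d0 * e * e')\<^sup>2 = int q * (int q + d0 * (int q * h\<^sup>2))" .
    hence "int q dvd (c * c' - d0 * e * e')\<^sup>2" by simp
    hence "int q dvd c * c' - d0 * e * e'" using pr prime_dvd_power by blast
    then obtain g where g: "c * c' - d0 * e * e' = int q * g" by (elim dvdE)
    have "(int q)\<^sup>2 * (g\<^sup>2 - d0 * h\<^sup>2) = (int q)\<^sup>2 * 1" using id' unfolding g by (simp add: power2_eq_square algebra_simps)
    hence gh: "g\<^sup>2 - d0 * h\<^sup>2 = 1" using q0 by (metis mult_left_cancel power_not_zero)
    have "int q * (c * g + d0 * e * h) = c * (int q * g) + d0 * e * (int q * h)" by (simp add: algebra_simps)
    also have "... = c' * (c\<^sup>2 - d0 * e\<^sup>2)" unfolding g[symmetric] h[symmetric] by (simp add: power2_eq_square algebra_simps)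
    finally have 1: "c' = c * g + d0 * e * h" using n q0 by (simp add: mult.commute)
    have "int q * (c * h + e * g) = c * (int q * h) + e * (int q * g)" by (simp add: algebra_simps)
    also have "... = e' * (c\<^sup>2 - d0 * e\<^sup>2)" unfolding g[symmetric] h[symmetric] by (simp add: power2_eq_square algebra_simps)
    finally have 2: "e' = c * h + e * g" using n q0 by (simp add: mult.commute)
    show ?thesis using gh 1 2 by blast
  qed
  have "(c * e' - c' * e) * (c * e' + c' * e) = (c\<^sup>2 - d0 * e\<^sup>2) * e'\<^sup>2 - (c'\<^sup>2 - d0 * e'\<^sup>2) * e\<^sup>2" by (simp add: power2_eq_square algebra_simps)
  hence "(c * e' - c' * e) * (c * e' + c' * e) = int q * (e'\<^sup>2 - e\<^sup>2)" unfolding n by (simp add: algebra_simps)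
  hence "int q dvd (c * e' - c' * e) * (c * e' + c' * e)" by simp
  hence "int q dvd c * e' - c' * e \<or> int q dvd c * e' - c' * (- e)" using pr by (simp add: prime_dvd_mult_iff)
  thus ?thesis
  proof
    assume "int q dvd c * e' - c' * e"
    thus ?thesis using main[OF n(1)] by blast
  next
    assume "int q dvd c * e' - c' * (- e)"
    hence "\<exists>g h. g\<^sup>2 - d0 * h\<^sup>2 = 1 \<and> c' = c * g + d0 * (- e) * h \<and> e' = c * h + (- e) * g" using main[of c "- e"] n(1) by simp
    thus ?thesis by auto
  qed
qed

text \<open>Units of norm 1 have symbol 1, so only the possible conjugation matters, and it amounts
  to replacing the root r by -r.\<close>

lemma Legendre_same_norm:
  fixes c e c' e' d0 r :: int
  assumes d0: "d0 = -1 \<or> d0 = 2" and q: "prime q" and n: "c\<^sup>2 - d0 * e\<^sup>2 = int q" "c'\<^sup>2 - d0 * e'\<^sup>2 = int q"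
    and p: "prime p" "[p = 1] (mod 8)" and r: "[r\<^sup>2 = d0] (mod int p)"
  shows "Legendre (c' + e' * r) (int p) = Legendre (c + e * r) (int p) \<or> Legendre (c' + e' * r) (int p) = Legendre (c + e * (- r)) (int p)"
proof -
  have p2: "p > 2" by (rule prime_1_mod_8_gt_2[OF p])
  obtain g h where gh: "g\<^sup>2 - d0 * h\<^sup>2 = 1" "(c' = c * g + d0 * e * h \<and> e' = c * h + e * g) \<or> (c' = c * g - d0 * e * h \<and> e' = c * h - e * g)"
    using same_prime_norm[OF q n] by blast
  have d: "int p dvd r\<^sup>2 - d0" using r by (simp add: cong_iff_dvd_diff)
  have U: "Legendre (g + h * r) (int p) = 1" by (rule Legendre_unit[OF d0 gh(1) p r])
  from gh(2) show ?thesis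
  proof
    assume ce: "c' = c * g + d0 * e * h \<and> e' = c * h + e * g"
    have "(c + e * r) * (g + h * r) - (c' + e' * r) = (r\<^sup>2 - d0) * (e * h)"
      unfolding conjunct1[OF ce] conjunct2[OF ce] by (simp add: power2_eq_square algebra_simps)
    hence "[(c + e * r) * (g + h * r) = c' + e' * r] (mod int p)" using d by (simp add: cong_iff_dvd_diff)
    thus ?thesis using Legendre_cong Legendre_mult[OF p(1) p2] U by (metis mult.right_neutral)
  next
    assume ce: "c' = c * g - d0 * e * h \<and> e' = c * h - e * g"
    have "(c + e * (- r)) * (g + h * r) - (c' + e' * r) = (r\<^sup>2 - d0) * (- e * h)"
      unfolding conjunct1[OF ce] conjunct2[OF ce] by (simp add: power2_eq_square algebra_simps)
    hence "[(c + e * (- r)) * (g + h * r) = c' + e' * r] (mod int p)" using d by (simp add: cong_iff_dvd_diff)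
    thus ?thesis using Legendre_cong Legendre_mult[OF p(1) p2] U by (metis mult.right_neutral)
  qed
qed

lemma Legendre_norm:
  assumes p: "prime p" "p > 2" and r: "[r\<^sup>2 = d0] (mod int p)" and n: "c\<^sup>2 - d0 * e\<^sup>2 = int q"
  shows "Legendre (c + e * r) (int p) * Legendre (c + e * (- r)) (int p) = Legendre (int q) (int p)"
proof -
  have "(c + e * r) * (c + e * (- r)) - int q = (r\<^sup>2 - d0) * (- e\<^sup>2)" unfolding n[symmetric] by (simp add: power2_eq_square algebra_simps)
  moreover have "int p dvd r\<^sup>2 - d0" using r by (simp add: cong_iff_dvd_diff)
  ultimately have "[(c + e * r) * (c + e * (- r)) = int q] (mod int p)" unfolding cong_iff_dvd_diff by (metis dvd_mult2)
  thus ?thesis using Legendre_cong Legendre_mult[OF p] by metis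
qed

text \<open>When $q$ is a square modulo $p$, the symbol depends only on $p$ and $q$: the coefficient
  $\kappa_p$ collects the contribution of \<open>w\<close>.\<close>

lemma eps_symbol_eq:
  fixes d0 :: int
  assumes d0: "d0 = -1 \<or> d0 = 2" and p: "prime p" "[p = 1] (mod 8)" and w0: "quad_norm d0 w0 = int p"
  obtains r \<kappa> :: int where "[r\<^sup>2 = d0] (mod int p)" "\<kappa> = 1 \<or> \<kappa> = -1"
    "\<And>q w z c e. prime q \<Longrightarrow> quad_norm d0 w = int p \<Longrightarrow> quad_norm d0 z = int q \<Longrightarrow> c\<^sup>2 - d0 * e\<^sup>2 = int q \<Longrightarrow>
       Legendre (int q) (int p) = 1 \<Longrightarrow> eps_symbol d0 w z = \<kappa> * Legendre (c + e * r) (int p)"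
proof -
  have p2: "p > 2" by (rule prime_1_mod_8_gt_2[OF p])
  have pr: "prime (int p)" using p by simp
  obtain r where r: "int p dvd redu r w0" "[r\<^sup>2 = d0] (mod int p)" "\<not> int p dvd irr_part w0" using norm_prime_root[OF p(1) w0] by blast
  \<comment> \<open>The symbol of conj(w0) modulo (w0). It is nonzero: otherwise p would divide 2r
    times the second coefficient of w0.\<close>
  define \<kappa> where "\<kappa> = Legendre (redu r (quad_conj w0)) (int p)"
  have rd: "int p dvd r\<^sup>2 - d0" using r by (simp add: cong_iff_dvd_diff)
  have kp: "\<kappa> = 1 \<or> \<kappa> = -1"
  proof -
    have "\<not> int p dvd redu r (quad_conj w0)"
    proof
      assume "int p dvd redu r (quad_conj w0)"
      hence "int p dvd redu r w0 - redu r (quad_conj w0)" using r(1) by (rule dvd_diff[rotated])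
      hence "int p dvd 2 * (irr_part w0 * r)" by (simp add: redu_def quad_conj_def mult.commute)
      hence "int p dvd 2 \<or> int p dvd irr_part w0 \<or> int p dvd r" using pr by (metis prime_dvd_mult_iff)
      hence "int p dvd r" using r(3) p2 by (auto dest: zdvd_imp_le)
      hence "int p dvd r\<^sup>2" by (simp add: power2_eq_square)
      hence "int p dvd d0" using rd by (metis dvd_diff_right_iff diff_add_cancel dvd_add_right_iff)
      thus False using d0 p2 by (auto dest: zdvd_imp_le)
    qed
    thus ?thesis unfolding \<kappa>_def by (rule Legendre_pm1)
  qed
  show ?thesis
  proof (rule that[OF r(2) kp])
    fix q w z c e
    assume q: "prime q" and w: "quad_norm d0 w = int p" and z: "quad_norm d0 z = int q" and ce: "c\<^sup>2 - d0 * e\<^sup>2 = int q"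
      and J: "Legendre (int q) (int p) = 1"
    obtain s where s: "int p dvd redu s w" "[s\<^sup>2 = d0] (mod int p)" "\<not> int p dvd irr_part w" using norm_prime_root[OF p(1) w] by blast
    have sd: "int p dvd s\<^sup>2 - d0" using s by (simp add: cong_iff_dvd_diff)
    have "eps_symbol d0 w z = Legendre (redu s (quad_conj (w \<otimes>\<^bsub>zsqrt d0\<^esub> z))) (int p)"
      unfolding eps_symbol_def Let_def by (rule ideal_symbol_Legendre[OF p(1) w s(1,2)])
    also have "quad_conj (w \<otimes>\<^bsub>zsqrt d0\<^esub> z) = quad_conj w \<otimes>\<^bsub>zsqrt d0\<^esub> quad_conj z" by (simp add: quad_conj_def)
    also have "Legendre (redu s (quad_conj w \<otimes>\<^bsub>zsqrt d0\<^esub> quad_conj z)) (int p) = Legendre (redu s (quad_conj w)) (int p) * Legendre (redu s (quad_conj z)) (int p)"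
      using Legendre_cong[OF redu_mult[OF s(2)]] Legendre_mult[OF p(1) p2] by simp
    finally have eps: "eps_symbol d0 w z = Legendre (redu s (quad_conj w)) (int p) * Legendre (redu s (quad_conj z)) (int p)" .
    have srd: "int p dvd (s - r) * (s + r)"
    proof -
      have "(s - r) * (s + r) = (s\<^sup>2 - d0) - (r\<^sup>2 - d0)" by (simp add: power2_eq_square algebra_simps)
      thus ?thesis using sd rd by (metis dvd_diff)
    qed
    hence sr: "[s = r] (mod int p) \<or> [s = - r] (mod int p)" using pr by (simp add: prime_dvd_mult_iff cong_iff_dvd_diff)
    \<comment> \<open>Here it matters that q is a residue: both roots give the same symbol, so
      neither the choice between z and its conjugate nor the sign of the root has any
      effect.\<close>
    have Lpm: "Legendre (c + e * (- r)) (int p) = Legendre (c + e * r) (int p)"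
      using Legendre_norm[OF p(1) p2 r(2) ce] J Legendre_values[of "c + e * r" "int p"] Legendre_values[of "c + e * (- r)" "int p"] by auto
    have 2: "Legendre (redu t (quad_conj z)) (int p) = Legendre (c + e * r) (int p)" if t: "t = r \<or> t = - r" for t
    proof -
      have tt: "[t\<^sup>2 = d0] (mod int p)" using t r(2) by auto
      have "Legendre (redu t (quad_conj z)) (int p) = Legendre (c + e * t) (int p) \<or> Legendre (redu t (quad_conj z)) (int p) = Legendre (c + e * (- t)) (int p)"
        using Legendre_same_norm[OF d0 q ce _ p tt, of "rat_part z" "- irr_part z"] z
        by (simp add: redu_def quad_conj_def quad_norm_def)
      thus ?thesis using Lpm t by auto
    qed
    have redc: "Legendre (redu s x) (int p) = Legendre (redu t x) (int p)" if "[s = t] (mod int p)" for t x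
    proof (rule Legendre_cong)
      show "[redu s x = redu t x] (mod int p)" unfolding redu_def using that by (intro cong_add cong_mult) auto
    qed
    obtain t where t: "t = r \<or> t = - r" "[s = t] (mod int p)" using sr by blast
    have tt: "[t\<^sup>2 = d0] (mod int p)" using t r(2) by auto
    have 3: "Legendre (redu s (quad_conj z)) (int p) = Legendre (c + e * r) (int p)" using redc[OF t(2)] 2[OF t(1)] by simp
    have tw: "int p dvd redu t w"
    proof -
      have "[redu s w = redu t w] (mod int p)" unfolding redu_def using t(2) by (intro cong_add cong_mult) auto
      thus ?thesis using s(1) by (simp add: cong_dvd_iff)
    qed
    have 4: "Legendre (redu s (quad_conj w)) (int p) = \<kappa>"
    proof -
      \<comment> \<open>Of w0 and its conjugate, the one that reduces to 0 at the same root t as w.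
        The alternative in \<open>Legendre_same_norm\<close> with the opposite root is excluded,
        since it would make a nonzero symbol vanish.\<close>
      define v where "v = (if t = r then w0 else quad_conj w0)"
      have v: "quad_norm d0 v = int p" "int p dvd redu t v" "Legendre (redu t (quad_conj v)) (int p) = \<kappa>"
        using w0 r(1) t(1) by (auto simp: v_def \<kappa>_def redu_conj)
      have nw: "(rat_part w)\<^sup>2 - d0 * (irr_part w)\<^sup>2 = int p" "(rat_part v)\<^sup>2 - d0 * (irr_part v)\<^sup>2 = int p"
        using w v(1) by (auto simp: quad_norm_def)
      have "Legendre (rat_part w + irr_part w * (- t)) (int p) = Legendre (rat_part v + irr_part v * (- t)) (int p) \<or>
        Legendre (rat_part w + irr_part w * (- t)) (int p) = Legendre (rat_part v + irr_part v * (- (- t))) (int p)"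
        by (rule Legendre_same_norm[OF d0 p(1) nw(2,1) p]) (use tt in simp)
      moreover have "Legendre (rat_part v + irr_part v * (- (- t))) (int p) = 0" using v(2) by (simp add: Legendre_eq_0_iff redu_def)
      moreover have "Legendre (rat_part w + irr_part w * (- t)) (int p) \<noteq> 0"
      proof
        assume "Legendre (rat_part w + irr_part w * (- t)) (int p) = 0"
        hence "int p dvd rat_part w + irr_part w * (- t)" by (simp add: Legendre_eq_0_iff)
        hence "int p dvd (rat_part w + irr_part w * t) - (rat_part w + irr_part w * (- t))" using tw by (intro dvd_diff) (auto simp: redu_def)
        hence "int p dvd 2 * (irr_part w * t)" by (simp add: algebra_simps)
        hence "int p dvd 2 \<or> int p dvd irr_part w \<or> int p dvd t" using pr by (metis prime_dvd_mult_iff)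
        hence "int p dvd t" using s(3) p2 by (auto dest: zdvd_imp_le)
        hence "int p dvd t\<^sup>2" by (simp add: power2_eq_square)
        moreover have "int p dvd t\<^sup>2 - d0" using tt by (simp add: cong_iff_dvd_diff)
        ultimately have "int p dvd d0" by (metis dvd_diff_right_iff diff_add_cancel dvd_add_right_iff)
        thus False using d0 p2 by (auto dest: zdvd_imp_le)
      qed
      ultimately have "Legendre (redu (- t) w) (int p) = Legendre (redu (- t) v) (int p)" by (simp add: redu_def)
      moreover have "Legendre (redu s (quad_conj w)) (int p) = Legendre (redu t (quad_conj w)) (int p)" by (rule redc[OF t(2)])
      ultimately show ?thesis using v(3) redu_conj[of t w] redu_conj[of t v] by simp
    qed
    show "eps_symbol d0 w z = \<kappa> * Legendre (c + e * r) (int p)" using eps 3 4 by simp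
  qed
qed

section \<open>Bilinear sums of Legendre symbols\<close>

lemma sum_affine_residues:
  fixes f :: "int \<Rightarrow> int" and m a g :: int
  assumes m: "m > 0" and co: "coprime a m" and f: "\<And>x. f (x mod m) = f x"
  shows "(\<Sum>v\<in>{0..<m}. f (a * v + g)) = (\<Sum>x\<in>{0..<m}. f x)"
proof -
  define \<phi> where "\<phi> = (\<lambda>v. (a * v + g) mod m)"
  have inj: "inj_on \<phi> {0..<m}"
  proof (rule inj_onI)
    fix v v' assume v: "v \<in> {0..<m}" "v' \<in> {0..<m}" and "\<phi> v = \<phi> v'"
    hence "m dvd (a * v + g) - (a * v' + g)" by (simp add: \<phi>_def mod_eq_dvd_iff)
    hence "m dvd a * (v - v')" by (simp add: algebra_simps)
    hence "m dvd v - v'" using co by (simp add: coprime_commute coprime_dvd_mult_right_iff)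
    moreover have "\<bar>v - v'\<bar> < m" using v by auto
    ultimately show "v = v'" using zdvd_not_zless[of "\<bar>v - v'\<bar>" m] by (cases "v = v'") auto
  qed
  have "\<phi> ` {0..<m} \<subseteq> {0..<m}" using m by (auto simp: \<phi>_def)
  hence im: "\<phi> ` {0..<m} = {0..<m}" using inj by (intro endo_inj_surj) auto
  have "(\<Sum>x\<in>{0..<m}. f x) = (\<Sum>x\<in>\<phi> ` {0..<m}. f x)" by (simp only: im)
  also have "... = (\<Sum>v\<in>{0..<m}. f (\<phi> v))" by (subst sum.reindex[OF inj]) simp
  also have "... = (\<Sum>v\<in>{0..<m}. f (a * v + g))" by (simp add: \<phi>_def f)
  finally show ?thesis ..
qed

lemma Legendre_mod: "Legendre (x mod int p) (int p) = Legendre x (int p)"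
  by (rule Legendre_cong) (simp add: cong_mod_def)

text \<open>Squaring identifies 1 and p - 1, hence it is not injective and so not surjective on the
  nonzero residues.\<close>

lemma ex_nonresidue:
  assumes p: "prime p" "p > 2"
  shows "\<exists>m. Legendre m (int p) = -1"
proof (rule ccontr)
  assume no: "\<nexists>m. Legendre m (int p) = -1"
  define A where "A = {1..<int p}"
  define \<psi> where "\<psi> = (\<lambda>y::int. y\<^sup>2 mod int p)"
  have "A \<subseteq> \<psi> ` A"
  proof
    fix m assume m: "m \<in> A"
    have nd: "\<not> int p dvd m" using m zdvd_not_zless[of m "int p"] by (auto simp: A_def)
    have "Legendre m (int p) = 1" using no Legendre_pm1[OF nd] by blast
    hence "QuadRes (int p) m" by (simp add: Legendre_eq_if split: if_splits)
    then obtain y where y: "[y\<^sup>2 = m] (mod int p)" by (auto simp: QuadRes_def)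
    hence "y\<^sup>2 mod int p = m mod int p" by (simp add: cong_mod_def)
    hence e: "(y mod int p)\<^sup>2 mod int p = m" using m by (simp add: power_mod A_def)
    have "y mod int p \<noteq> 0"
    proof
      assume "y mod int p = 0"
      hence "m = 0" using e by simp
      thus False using m by (simp add: A_def)
    qed
    moreover have "y mod int p \<ge> 0" "y mod int p < int p" using p by auto
    ultimately have "y mod int p \<in> A" by (simp add: A_def)
    thus "m \<in> \<psi> ` A" using e by (intro image_eqI[of _ _ "y mod int p"]) (simp_all add: \<psi>_def)
  qed
  hence "inj_on \<psi> A" by (intro finite_surj_inj) (auto simp: A_def)
  moreover have "\<psi> 1 = \<psi> (int p - 1)"
  proof -
    have "(int p - 1)\<^sup>2 = 1 + int p * (int p - 2)" by (simp add: power2_eq_square algebra_simps)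
    thus ?thesis by (simp only: \<psi>_def) simp
  qed
  moreover have "1 \<in> A" "int p - 1 \<in> A" using p by (auto simp: A_def)
  ultimately have "1 = int p - 1" by (rule inj_onD)
  thus False using p by simp
qed

lemma sum_Legendre:
  assumes p: "prime p" "p > 2"
  shows "(\<Sum>x\<in>{0..<int p}. Legendre x (int p)) = 0"
proof -
  obtain m where m: "Legendre m (int p) = -1" using ex_nonresidue[OF p] by blast
  hence "\<not> int p dvd m" using Legendre_eq_0_iff[of m p] by simp
  hence "coprime (int p) m" using p by (intro prime_imp_coprime) auto
  hence co: "coprime m (int p)" using coprime_commute by blast
  have "(\<Sum>x\<in>{0..<int p}. Legendre (m * x + 0) (int p)) = (\<Sum>x\<in>{0..<int p}. Legendre x (int p))"
    using p by (intro sum_affine_residues co Legendre_mod) auto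
  moreover have "(\<Sum>x\<in>{0..<int p}. Legendre (m * x + 0) (int p)) = - (\<Sum>x\<in>{0..<int p}. Legendre x (int p))"
    by (simp add: Legendre_mult[OF p] m sum_negf)
  ultimately show ?thesis by linarith
qed

text \<open>Full periods cancel, and what remains is shorter than one period.\<close>

lemma sum_periodic_bound:
  fixes h :: "nat \<Rightarrow> int"
  assumes P: "P > 0" and per: "\<And>x. h (x + P) = h x" and b: "\<And>x. \<bar>h x\<bar> \<le> 1" and z: "(\<Sum>x<P. h x) = 0"
  shows "\<bar>\<Sum>x<n. h x\<bar> \<le> int P"
proof (induction n rule: less_induct)
  case (less n)
  show ?case
  proof (cases "n < P")
    case True
    have "\<bar>\<Sum>x<n. h x\<bar> \<le> (\<Sum>x<n. \<bar>h x\<bar>)" by (rule sum_abs)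
    also have "... \<le> (\<Sum>x<n. 1)" by (intro sum_mono b)
    also have "... \<le> int P" using True by simp
    finally show ?thesis .
  next
    case False
    have "(\<Sum>x<n. h x) = (\<Sum>x<P. h x) + (\<Sum>x=P..<n. h x)"
      using False sum.atLeastLessThan_concat[of 0 P n h] by (simp add: atLeast0LessThan)
    also have "(\<Sum>x=P..<n. h x) = (\<Sum>x<n - P. h (x + P))"
      using sum.shift_bounds_nat_ivl[of h 0 P "n - P"] False by (simp add: atLeast0LessThan)
    finally have "(\<Sum>x<n. h x) = (\<Sum>x<n - P. h x)" by (simp add: z per)
    thus ?thesis using less.IH[of "n - P"] False P by simp
  qed
qed

text \<open>Over a full period write c = u + pv: the first symbol depends on u alone, while the
  second runs through all residues modulo p' as v varies, so the sum vanishes.\<close>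

lemma sum_two_Legendre:
  fixes p p' :: nat and \<alpha> \<beta> :: int
  assumes p: "prime p" "p > 2" and p': "prime p'" "p' > 2" and ne: "p \<noteq> p'"
  shows "\<bar>\<Sum>c<n. Legendre (int c + \<alpha>) (int p) * Legendre (int c + \<beta>) (int p')\<bar> \<le> int (p * p')"
proof (rule sum_periodic_bound)
  show "p * p' > 0" using p p' by auto
  fix x
  have "Legendre (int (x + p * p') + \<alpha>) (int p) = Legendre (int x + \<alpha>) (int p)"
    by (rule Legendre_cong) (simp add: cong_mod_def mod_add_cong mod_eq_dvd_iff)
  moreover have "Legendre (int (x + p * p') + \<beta>) (int p') = Legendre (int x + \<beta>) (int p')"
    by (rule Legendre_cong) (simp add: cong_mod_def mod_add_cong mod_eq_dvd_iff)
  ultimately show "Legendre (int (x + p * p') + \<alpha>) (int p) * Legendre (int (x + p * p') + \<beta>) (int p') = Legendre (int x + \<alpha>) (int p) * Legendre (int x + \<beta>) (int p')"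
    by simp
  have "\<bar>Legendre a b\<bar> \<le> 1" for a b using Legendre_values[of a b] by auto
  thus "\<bar>Legendre (int x + \<alpha>) (int p) * Legendre (int x + \<beta>) (int p')\<bar> \<le> 1"
    unfolding abs_mult by (intro mult_le_one) auto
next
  let ?f = "\<lambda>c. Legendre (int c + \<alpha>) (int p) * Legendre (int c + \<beta>) (int p')"
  let ?g = "\<lambda>u v. Legendre (int u + \<alpha>) (int p) * Legendre (int (u + p * v) + \<beta>) (int p')"
  have co: "coprime (int p) (int p')" using p p' ne by (simp add: primes_coprime)
  have inner: "(\<Sum>v<p'. Legendre (int (u + p * v) + \<beta>) (int p')) = 0" for u
  proof -
    have "(\<Sum>v<p'. Legendre (int (u + p * v) + \<beta>) (int p')) = (\<Sum>v\<in>int ` {..<p'}. Legendre (int p * v + (int u + \<beta>)) (int p'))"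
      by (subst sum.reindex) (auto simp: algebra_simps intro!: inj_onI)
    also have "int ` {..<p'} = {0..<int p'}" by (auto simp: image_iff) (metis lessThan_iff nat_less_iff nat_0_le)
    also have "(\<Sum>v\<in>{0..<int p'}. Legendre (int p * v + (int u + \<beta>)) (int p')) = (\<Sum>x\<in>{0..<int p'}. Legendre x (int p'))"
      using p' by (intro sum_affine_residues co Legendre_mod) auto
    also have "... = 0" by (rule sum_Legendre[OF p'])
    finally show ?thesis .
  qed
  have "(\<Sum>c<p * p'. ?f c) = (\<Sum>c<p' * p. ?f c)"
    by (simp only: mult.commute)
  also have "... = (\<Sum>v<p'. \<Sum>c\<in>{v * p ..< v * p + p}. ?f c)"
    by (rule sum.nat_group[symmetric])
  also have "... = (\<Sum>v<p'. \<Sum>u<p. ?g u v)"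
  proof (rule sum.cong[OF refl])
    fix v
    have "(\<Sum>c\<in>{v * p ..< v * p + p}. ?f c)
       = (\<Sum>u\<in>{0..<p}. Legendre (int (u + v * p) + \<alpha>) (int p) * Legendre (int (u + v * p) + \<beta>) (int p'))"
      using sum.shift_bounds_nat_ivl[of "\<lambda>c. ?f c" 0 "v * p" p] by (simp add: add.commute)
    also have "... = (\<Sum>u<p. ?g u v)"
    proof (intro sum.cong)
      fix u
      have "Legendre (int (u + v * p) + \<alpha>) (int p) = Legendre (int u + \<alpha>) (int p)"
        by (rule Legendre_cong) (simp add: cong_mod_def mod_eq_dvd_iff)
      thus "Legendre (int (u + v * p) + \<alpha>) (int p) * Legendre (int (u + v * p) + \<beta>) (int p') = ?g u v"
        by (simp only: mult.commute[of v p])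
    qed auto
    finally show "(\<Sum>c\<in>{v * p ..< v * p + p}. ?f c) = (\<Sum>u<p. ?g u v)" .
  qed
  also have "... = (\<Sum>u<p. \<Sum>v<p'. ?g u v)" by (rule sum.swap)
  also have "... = (\<Sum>u<p. Legendre (int u + \<alpha>) (int p) * (\<Sum>v<p'. Legendre (int (u + p * v) + \<beta>) (int p')))" by (simp only: sum_distrib_left)
  also have "... = 0" by (simp only: inner) simp
  finally show "(\<Sum>c<p * p'. ?f c) = 0" .
qed

text \<open>Cauchy--Schwarz over the sparse set Q, enlargement to the whole index set I by
  positivity, and expansion of the square. The range B p depends on p, so the off-diagonal sums run
  over intersections.\<close>

lemma bilinear_cauchy_schwarz:
  fixes F :: "'p \<Rightarrow> 'i \<Rightarrow> real" and \<iota> :: "'q \<Rightarrow> 'i"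
  assumes fin: "finite P" "finite Q" "finite I" and inj: "inj_on \<iota> Q" "\<iota> ` Q \<subseteq> I"
    and A: "\<And>p. p \<in> P \<Longrightarrow> A p \<subseteq> Q" and B: "\<And>p. p \<in> P \<Longrightarrow> B p \<subseteq> I"
    and AB: "\<And>p q. p \<in> P \<Longrightarrow> q \<in> Q \<Longrightarrow> \<iota> q \<in> B p \<longleftrightarrow> q \<in> A p"
    and D: "\<And>p. p \<in> P \<Longrightarrow> (\<Sum>i\<in>B p. F p i * F p i) \<le> D p"
    and O: "\<And>p p'. p \<in> P \<Longrightarrow> p' \<in> P \<Longrightarrow> p \<noteq> p' \<Longrightarrow> (\<Sum>i\<in>B p \<inter> B p'. F p i * F p' i) \<le> O'" and O0: "O' \<ge> 0"
  shows "(\<Sum>p\<in>P. \<Sum>q\<in>A p. F p (\<iota> q))\<^sup>2 \<le> real (card Q) * ((\<Sum>p\<in>P. D p) + (real (card P))\<^sup>2 * O')"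
proof -
  define H where "H = (\<lambda>i. \<Sum>p\<in>P. if i \<in> B p then F p i else 0)"
  have "(\<Sum>p\<in>P. \<Sum>q\<in>A p. F p (\<iota> q)) = (\<Sum>p\<in>P. \<Sum>q\<in>Q. if \<iota> q \<in> B p then F p (\<iota> q) else 0)"
  proof (rule sum.cong[OF refl])
    fix p assume p: "p \<in> P"
    have "A p = {q \<in> Q. \<iota> q \<in> B p}" using A[OF p] AB[OF p] by auto
    thus "(\<Sum>q\<in>A p. F p (\<iota> q)) = (\<Sum>q\<in>Q. if \<iota> q \<in> B p then F p (\<iota> q) else 0)"
      by (simp add: sum.inter_filter[OF fin(2)])
  qed
  also have "... = (\<Sum>q\<in>Q. H (\<iota> q))" unfolding H_def by (rule sum.swap)
  finally have T: "(\<Sum>p\<in>P. \<Sum>q\<in>A p. F p (\<iota> q)) = (\<Sum>q\<in>Q. 1 * H (\<iota> q))" by simp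
  have "(\<Sum>q\<in>Q. 1 * H (\<iota> q))\<^sup>2 \<le> (\<Sum>q\<in>Q. 1\<^sup>2) * (\<Sum>q\<in>Q. (H (\<iota> q))\<^sup>2)" by (rule Cauchy_Schwarz_ineq_sum)
  also have "(\<Sum>q\<in>Q. (H (\<iota> q))\<^sup>2) = (\<Sum>i\<in>\<iota> ` Q. (H i)\<^sup>2)" by (subst sum.reindex[OF inj(1)]) simp
  also have "(\<Sum>q\<in>Q. 1\<^sup>2) * (\<Sum>i\<in>\<iota> ` Q. (H i)\<^sup>2) \<le> real (card Q) * (\<Sum>i\<in>I. (H i)\<^sup>2)"
    using fin inj(2) by (intro mult_mono sum_mono2) (auto intro!: sum_nonneg)
  also have "(\<Sum>i\<in>I. (H i)\<^sup>2) = (\<Sum>i\<in>I. \<Sum>p\<in>P. \<Sum>p'\<in>P. (if i \<in> B p then F p i else 0) * (if i \<in> B p' then F p' i else 0))"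
    unfolding H_def power2_eq_square sum_product ..
  also have "... = (\<Sum>p\<in>P. \<Sum>i\<in>I. \<Sum>p'\<in>P. (if i \<in> B p then F p i else 0) * (if i \<in> B p' then F p' i else 0))" by (rule sum.swap)
  also have "... = (\<Sum>p\<in>P. \<Sum>p'\<in>P. \<Sum>i\<in>I. (if i \<in> B p then F p i else 0) * (if i \<in> B p' then F p' i else 0))"
    by (intro sum.cong refl sum.swap)
  also have "... = (\<Sum>p\<in>P. \<Sum>p'\<in>P. \<Sum>i\<in>B p \<inter> B p'. F p i * F p' i)"
  proof (rule sum.cong[OF refl], rule sum.cong[OF refl])
    fix p p' assume p: "p \<in> P" "p' \<in> P"
    have e: "B p \<inter> B p' = {i \<in> I. i \<in> B p \<and> i \<in> B p'}" using B[OF p(1)] by auto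
    show "(\<Sum>i\<in>I. (if i \<in> B p then F p i else 0) * (if i \<in> B p' then F p' i else 0)) = (\<Sum>i\<in>B p \<inter> B p'. F p i * F p' i)"
      unfolding e sum.inter_filter[OF fin(3)] by (intro sum.cong refl) auto
  qed
  also have "... \<le> (\<Sum>p\<in>P. \<Sum>p'\<in>P. (if p' = p then D p else 0) + O')"
  proof (intro sum_mono)
    fix p p' assume p: "p \<in> P" "p' \<in> P"
    show "(\<Sum>i\<in>B p \<inter> B p'. F p i * F p' i) \<le> (if p' = p then D p else 0) + O'"
      using D[OF p(1)] O[OF p] O0 by (cases "p' = p") auto
  qed
  also have "... = (\<Sum>p\<in>P. D p) + (real (card P))\<^sup>2 * O'"
    using fin(1) by (simp add: sum.distrib power2_eq_square)
  finally show ?thesis unfolding T by (simp add: mult_left_mono)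
qed

section \<open>Partial summation\<close>

text \<open>For decreasing u summation by parts has nonnegative weights, so the sum is dominated by
  the one for the sequence that is C at 0 and \<epsilon> afterwards, whose partial sums are the
  assumed bounds.\<close>

lemma abel_sum_compare:
  fixes a u :: "nat \<Rightarrow> real"
  assumes u: "\<And>n. u n \<ge> 0" "\<And>n. u (Suc n) \<le> u n" and A: "\<And>n. \<bar>\<Sum>k\<le>n. a k\<bar> \<le> C + \<epsilon> * real n"
  shows "\<bar>\<Sum>n\<le>N. a n * u n\<bar> \<le> C * u 0 + \<epsilon> * (\<Sum>n=1..N. u n)"
proof -
  define b where "b = (\<lambda>n::nat. if n = 0 then C else \<epsilon>)"
  have sb: "(\<Sum>k\<le>n. b k) = C + \<epsilon> * real n" for n
    by (induction n) (auto simp: b_def algebra_simps)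
  have e1: "(\<Sum>n\<le>N. a n * u n) = (\<Sum>k\<le>N. a k) * u (Suc N) + (\<Sum>n\<le>N. (\<Sum>k\<le>n. a k) * (u n - u (Suc n)))" by (rule abel_sum_nat)
  have e2: "(\<Sum>n\<le>N. b n * u n) = (\<Sum>k\<le>N. b k) * u (Suc N) + (\<Sum>n\<le>N. (\<Sum>k\<le>n. b k) * (u n - u (Suc n)))" by (rule abel_sum_nat)
  have "\<bar>\<Sum>n\<le>N. a n * u n\<bar> \<le> \<bar>(\<Sum>k\<le>N. a k) * u (Suc N)\<bar> + (\<Sum>n\<le>N. \<bar>(\<Sum>k\<le>n. a k) * (u n - u (Suc n))\<bar>)"
    unfolding e1 using sum_abs[of "\<lambda>n. (\<Sum>k\<le>n. a k) * (u n - u (Suc n))" "{..N}"] by linarith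
  also have "... \<le> (\<Sum>k\<le>N. b k) * u (Suc N) + (\<Sum>n\<le>N. (\<Sum>k\<le>n. b k) * (u n - u (Suc n)))"
    unfolding sb abs_mult using u A by (intro add_mono sum_mono mult_mono) (auto intro: order_trans[OF abs_ge_zero])
  also have "... = (\<Sum>n\<le>N. b n * u n)" by (rule e2[symmetric])
  also have "... = C * u 0 + \<epsilon> * (\<Sum>n=1..N. u n)"
  proof -
    have "{..N} = insert 0 {1..N}" by auto
    thus ?thesis by (simp add: b_def sum_distrib_left)
  qed
  finally show ?thesis .
qed

text \<open>The weight 1/(n ln n), with n replaced by 2 at 0 and 1 so that it is positive and
  decreasing from 0 on.\<close>

definition invnlog :: "nat \<Rightarrow> real" where
  "invnlog n = 1 / (real (max n 2) * ln (real (max n 2)))"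

lemma invnlog_nonneg: "invnlog n \<ge> 0"
  by (auto simp: invnlog_def intro!: divide_nonneg_nonneg mult_nonneg_nonneg)

lemma invnlog_decreasing: "invnlog (Suc n) \<le> invnlog n"
  unfolding invnlog_def
  by (intro divide_left_mono mult_mono mult_pos_pos) auto

lemma lnln_diff:
  fixes x :: real
  assumes "x > 1"
  shows "1 / ((x + 1) * ln (x + 1)) \<le> ln (ln (x + 1)) - ln (ln x)" "ln (ln (x + 1)) - ln (ln x) \<le> 1 / (x * ln x)"
proof -
  have "\<exists>z. x < z \<and> z < x + 1 \<and> (\<lambda>t. ln (ln t)) (x + 1) - (\<lambda>t. ln (ln t)) x = (x + 1 - x) * (\<lambda>z. 1 / (z * ln z)) z"
  proof (rule MVT2)
    fix z :: real assume "x \<le> z" "z \<le> x + 1"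
    hence "z > 1" using assms by simp
    thus "((\<lambda>t. ln (ln t)) has_real_derivative 1 / (z * ln z)) (at z)"
      by (auto intro!: derivative_eq_intros simp: field_simps)
  qed simp
  then obtain z where z: "z > x" "z < x + 1" "ln (ln (x + 1)) - ln (ln x) = 1 / (z * ln z)" by auto
  have "x * ln x \<le> z * ln z" "z * ln z \<le> (x + 1) * ln (x + 1)"
    using z assms by (auto intro!: mult_mono)
  moreover have "x * ln x > 0" using assms by simp
  ultimately show "1 / ((x + 1) * ln (x + 1)) \<le> ln (ln (x + 1)) - ln (ln x)" "ln (ln (x + 1)) - ln (ln x) \<le> 1 / (x * ln x)"
    unfolding z(3) by (intro frac_le; linarith)+
qed

lemma sum_invnlog_bounds:
  assumes "N \<ge> 2"
  shows "(\<Sum>n=1..N. invnlog n) \<le> ln (ln (real N)) - ln (ln 2) + 2 * invnlog 2"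
    and "ln (ln (real N)) - ln (ln 2) \<le> (\<Sum>n=1..N. invnlog n)"
proof -
  \<comment> \<open>The lower bound is strengthened by the last term, which pays for the next
    increment of ln ln.\<close>
  have "(\<Sum>n=1..N. invnlog n) \<le> ln (ln (real N)) - ln (ln 2) + 2 * invnlog 2 \<and> ln (ln (real N)) - ln (ln 2) + invnlog N \<le> (\<Sum>n=1..N. invnlog n)"
    using assms
  proof (induction N rule: dec_induct)
    case base
    have "invnlog 1 = invnlog 2" by (simp add: invnlog_def)
    thus ?case using invnlog_nonneg[of 2] by (simp add: numeral_2_eq_2)
  next
    case (step N)
    have i: "invnlog (Suc N) = 1 / ((real N + 1) * ln (real N + 1))" "invnlog N = 1 / (real N * ln (real N))"
      using step by (auto simp: invnlog_def max_def add.commute)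
    have "real N > 1" using step by simp
    note d = lnln_diff[OF this, folded i]
    have "(\<Sum>n=1..Suc N. invnlog n) = (\<Sum>n=1..N. invnlog n) + invnlog (Suc N)" using step by simp
    moreover have "real (Suc N) = real N + 1" by simp
    ultimately show ?case using step.IH d by (simp only:) linarith
  qed
  thus "(\<Sum>n=1..N. invnlog n) \<le> ln (ln (real N)) - ln (ln 2) + 2 * invnlog 2"
    "ln (ln (real N)) - ln (ln 2) \<le> (\<Sum>n=1..N. invnlog n)" using invnlog_nonneg[of N] by auto
qed

definition thA :: "nat set \<Rightarrow> real \<Rightarrow> real" where "thA A x = (\<Sum>q\<in>{q\<in>A. real q \<le> x}. ln (real q))"
definition piA :: "nat set \<Rightarrow> real \<Rightarrow> real" where "piA A x = real (card {q\<in>A. real q \<le> x})"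
definition rsA :: "nat set \<Rightarrow> real \<Rightarrow> real" where "rsA A x = (\<Sum>q\<in>{q\<in>A. real q \<le> x}. 1 / real q)"

lemma finite_le_real: "finite {q::nat. q \<in> A \<and> real q \<le> x}"
  by (rule finite_subset[of _ "{..nat \<lfloor>x\<rfloor>}"]) (auto simp: le_nat_floor)

lemma real_le_floor_iff: "x \<ge> 0 \<Longrightarrow> real q \<le> x \<longleftrightarrow> q \<le> nat \<lfloor>x\<rfloor>"
  by (metis le_nat_floor of_nat_floor of_nat_le_iff order_trans)

context
  fixes A :: "nat set" and c :: real
  assumes A2: "\<And>q. q \<in> A \<Longrightarrow> q \<ge> 2"
    and th: "(\<lambda>N. (\<Sum>q\<in>{q\<in>A. q \<le> N}. ln (real q)) / real N) \<longlonglongrightarrow> c"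
begin

lemma floor_seq: "filterlim (\<lambda>x::real. nat \<lfloor>x\<rfloor>) sequentially at_top"
  by (intro filterlim_compose[OF filterlim_nat_sequentially filterlim_floor_sequentially])

lemma thA_limit: "((\<lambda>x. thA A x / x) \<longlongrightarrow> c) at_top"
proof -
  have "((\<lambda>x::real. (\<Sum>q\<in>{q\<in>A. q \<le> nat \<lfloor>x\<rfloor>}. ln (real q)) / real (nat \<lfloor>x\<rfloor>) * (of_int \<lfloor>x\<rfloor> / x)) \<longlongrightarrow> c * 1) at_top"
    by (intro tendsto_mult filterlim_compose[OF th floor_seq]) real_asymp
  moreover have "\<forall>\<^sub>F x::real in at_top. (\<Sum>q\<in>{q\<in>A. q \<le> nat \<lfloor>x\<rfloor>}. ln (real q)) / real (nat \<lfloor>x\<rfloor>) * (of_int \<lfloor>x\<rfloor> / x) = thA A x / x"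
    using eventually_ge_at_top[of 1]
  proof eventually_elim
    case (elim x)
    have "1 \<le> nat \<lfloor>x\<rfloor>" using elim by (intro le_nat_floor) simp
    hence "of_int \<lfloor>x\<rfloor> = real (nat \<lfloor>x\<rfloor>)" "real (nat \<lfloor>x\<rfloor>) \<noteq> 0" by linarith+
    thus ?case using elim by (simp add: thA_def real_le_floor_iff)
  qed
  ultimately show ?thesis by (simp add: Lim_transform_eventually)
qed

text \<open>The lower bound is ln q <= ln x. For the upper one, elements above z = x/(ln x)^2 have
  ln q >= ln z, asymptotic to ln x, and those up to z number at most z + 1, which is of smaller
  order than x/ln x.\<close>

lemma piA_limit: "((\<lambda>x. piA A x * ln x / x) \<longlongrightarrow> c) at_top"
proof (rule tendsto_sandwich)
  show "((\<lambda>x. thA A x / x) \<longlongrightarrow> c) at_top" by (rule thA_limit)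
  show "\<forall>\<^sub>F x in at_top. thA A x / x \<le> piA A x * ln x / x"
    using eventually_ge_at_top[of 1]
  proof eventually_elim
    case (elim x)
    have "thA A x \<le> (\<Sum>q\<in>{q\<in>A. real q \<le> x}. ln x)" unfolding thA_def
      using A2 by (intro sum_mono) (fastforce intro!: ln_mono)
    also have "... = piA A x * ln x" by (simp add: piA_def)
    finally show ?case using elim by (intro divide_right_mono) auto
  qed
  have "((\<lambda>x::real. (1 / (ln x)^2 + 1 / x) * ln x + (thA A x / x) * (ln x / ln (x / (ln x)^2))) \<longlongrightarrow> 0 + c * 1) at_top"
    by (intro tendsto_add tendsto_mult thA_limit) real_asymp+
  thus "((\<lambda>x::real. (1 / (ln x)^2 + 1 / x) * ln x + (thA A x / x) * (ln x / ln (x / (ln x)^2))) \<longlongrightarrow> c) at_top" by simp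
  have "\<forall>\<^sub>F x::real in at_top. x / (ln x)^2 > 1" by real_asymp
  thus "\<forall>\<^sub>F x in at_top. piA A x * ln x / x \<le> (1 / (ln x)^2 + 1 / x) * ln x + (thA A x / x) * (ln x / ln (x / (ln x)^2))"
    using eventually_gt_at_top[of 1]
  proof eventually_elim
    case (elim x)
    define z where "z = x / (ln x)^2"
    have z: "z > 1" "ln z > 0" using elim by (auto simp: z_def)
    have "{q\<in>A. real q \<le> x} \<subseteq> {q\<in>A. real q \<le> z} \<union> {q\<in>A. real q \<le> x \<and> z < real q}" by auto
    hence "card {q\<in>A. real q \<le> x} \<le> card ({q\<in>A. real q \<le> z} \<union> {q\<in>A. real q \<le> x \<and> z < real q})"
      by (intro card_mono finite_UnI finite_le_real finite_subset[OF _ finite_le_real[of A x]]) auto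
    also have "... \<le> card {q\<in>A. real q \<le> z} + card {q\<in>A. real q \<le> x \<and> z < real q}" by (rule card_Un_le)
    finally have c1: "piA A x \<le> real (card {q\<in>A. real q \<le> z}) + real (card {q\<in>A. real q \<le> x \<and> z < real q})"
      unfolding piA_def by linarith
    have "card {q\<in>A. real q \<le> z} \<le> card {..nat \<lfloor>z\<rfloor>}" by (intro card_mono) (auto simp: le_nat_floor)
    hence c2: "real (card {q\<in>A. real q \<le> z}) \<le> z + 1" using z by (simp add: of_nat_floor) linarith
    have "ln z * real (card {q\<in>A. real q \<le> x \<and> z < real q}) = (\<Sum>q\<in>{q\<in>A. real q \<le> x \<and> z < real q}. ln z)" by simp
    also have "... \<le> (\<Sum>q\<in>{q\<in>A. real q \<le> x \<and> z < real q}. ln (real q))" using z by (intro sum_mono) (auto intro!: ln_mono)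
    also have "... \<le> thA A x" unfolding thA_def using A2
      by (intro sum_mono2 finite_le_real) (auto intro!: ln_ge_zero, fastforce)
    finally have "real (card {q\<in>A. real q \<le> x \<and> z < real q}) \<le> thA A x / ln z" using z by (simp add: field_simps)
    hence "piA A x \<le> z + 1 + thA A x / ln z" using c1 c2 by linarith
    hence "piA A x * ln x / x \<le> (z + 1 + thA A x / ln z) * ln x / x"
      using elim by (intro divide_right_mono mult_right_mono) auto
    also have "... = (z / x + 1 / x) * ln x + (thA A x / x) * (ln x / ln z)" by (simp add: add_divide_distrib distrib_right distrib_left)
    also have "z / x = 1 / (ln x)^2" using elim by (simp add: z_def)
    finally show ?case by (simp add: z_def)
  qed
qed

text \<open>A sum of Mertens type: the sequence ln n on A minus the constant c has partial sums
  o(n), and Abel summation against 1/(n ln n) leaves c ln ln N with a smaller error.\<close>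

lemma sum_reciprocals_seq: "(\<lambda>N. (\<Sum>q\<in>{q\<in>A. q \<le> N}. 1 / real q) / ln (ln (real N))) \<longlonglongrightarrow> c"
proof -
  define a where "a = (\<lambda>n::nat. (if n \<in> A then ln (real n) else 0) - (if n = 0 then 0 else c))"
  define V where "V = (\<lambda>N. \<Sum>n=1..N. invnlog n)"
  have filt: "(\<Sum>k\<le>N. if k \<in> A then f k else 0) = (\<Sum>q\<in>{q\<in>A. q \<le> N}. f q)" for N :: nat and f :: "nat \<Rightarrow> real"
    by (subst sum.inter_filter[symmetric]) (auto intro!: sum.cong)
  have c0: "(\<Sum>k\<le>n. (if k = 0 then 0 else c) * f k) = c * (\<Sum>k=1..n. f k)" for n :: nat and f :: "nat \<Rightarrow> real"
  proof -
    have "{..n} = insert 0 {1..n}" by auto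
    thus ?thesis by (simp add: sum_distrib_left)
  qed
  have sa: "(\<Sum>k\<le>n. a k) = (\<Sum>q\<in>{q\<in>A. q \<le> n}. ln (real q)) - c * real n" for n
    using c0[where n = n and f = "\<lambda>_. 1"] unfolding a_def sum_subtractf filt by simp
  have sau: "(\<Sum>n\<le>N. a n * invnlog n) = (\<Sum>q\<in>{q\<in>A. q \<le> N}. 1 / real q) - c * V N" for N
  proof -
    have "(\<Sum>n\<le>N. a n * invnlog n) = (\<Sum>n\<le>N. (if n \<in> A then 1 / real n else 0) - (if n = 0 then 0 else c) * invnlog n)"
    proof (intro sum.cong refl)
      fix n
      have "ln (real n) * invnlog n = 1 / real n" if "n \<in> A" using A2[OF that] by (simp add: invnlog_def max_def)
      thus "a n * invnlog n = (if n \<in> A then 1 / real n else 0) - (if n = 0 then 0 else c) * invnlog n"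
        by (simp add: a_def left_diff_distrib)
    qed
    thus ?thesis unfolding sum_subtractf filt c0 V_def .
  qed
  have VL: "(\<lambda>N. V N / ln (ln (real N))) \<longlonglongrightarrow> 1"
  proof (rule tendsto_sandwich)
    show "(\<lambda>N::nat. (ln (ln (real N)) - ln (ln 2)) / ln (ln (real N))) \<longlonglongrightarrow> 1" by real_asymp
    show "(\<lambda>N::nat. (ln (ln (real N)) - ln (ln 2) + 2 * invnlog 2) / ln (ln (real N))) \<longlonglongrightarrow> 1" by real_asymp
    have ev: "\<forall>\<^sub>F N in sequentially. ln (ln (real N)) > 0" by real_asymp
    show "\<forall>\<^sub>F N in sequentially. (ln (ln (real N)) - ln (ln 2)) / ln (ln (real N)) \<le> V N / ln (ln (real N))"
      using ev eventually_ge_at_top[of 2] by eventually_elim (unfold V_def, intro divide_right_mono sum_invnlog_bounds(2), auto)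
    show "\<forall>\<^sub>F N in sequentially. V N / ln (ln (real N)) \<le> (ln (ln (real N)) - ln (ln 2) + 2 * invnlog 2) / ln (ln (real N))"
      using ev eventually_ge_at_top[of 2] by eventually_elim (unfold V_def, intro divide_right_mono sum_invnlog_bounds(1), auto)
  qed
  have small: "(\<lambda>N. (\<Sum>n\<le>N. a n * invnlog n) / ln (ln (real N))) \<longlonglongrightarrow> 0"
  proof (rule LIMSEQ_I)
    fix \<epsilon> :: real assume e: "\<epsilon> > 0"
    have "(\<lambda>n. (\<Sum>q\<in>{q\<in>A. q \<le> n}. ln (real q)) / real n - c) \<longlonglongrightarrow> 0" using th by (simp add: LIM_zero)
    then obtain n0 where n0: "\<And>n. n \<ge> n0 \<Longrightarrow> \<bar>(\<Sum>q\<in>{q\<in>A. q \<le> n}. ln (real q)) / real n - c\<bar> < \<epsilon> / 4"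
      using e LIMSEQ_D[of _ 0 "\<epsilon> / 4"] by fastforce
    \<comment> \<open>Absorbs the finitely many partial sums for which the asymptotic bound is not
      yet available.\<close>
    define C where "C = (\<Sum>n\<le>n0. \<bar>\<Sum>k\<le>n. a k\<bar>)"
    have C0: "C \<ge> 0" unfolding C_def by (intro sum_nonneg) auto
    have bd: "\<bar>\<Sum>k\<le>n. a k\<bar> \<le> C + \<epsilon> / 4 * real n" for n
    proof (cases "n \<le> n0")
      case True
      have "\<bar>\<Sum>k\<le>n. a k\<bar> \<le> C" unfolding C_def using True by (intro member_le_sum[where f = "\<lambda>n. \<bar>\<Sum>k\<le>n. a k\<bar>"]) auto
      thus ?thesis using e by (smt (verit) mult_nonneg_nonneg of_nat_0_le_iff divide_nonneg_pos)
    next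
      case False
      hence n: "real n > 0" by simp
      have "\<bar>\<Sum>k\<le>n. a k\<bar> = \<bar>(\<Sum>q\<in>{q\<in>A. q \<le> n}. ln (real q)) / real n - c\<bar> * real n"
      proof -
        have "(\<Sum>k\<le>n. a k) = ((\<Sum>q\<in>{q\<in>A. q \<le> n}. ln (real q)) / real n - c) * real n"
          unfolding sa using n by (simp add: left_diff_distrib)
        hence "\<bar>\<Sum>k\<le>n. a k\<bar> = \<bar>((\<Sum>q\<in>{q\<in>A. q \<le> n}. ln (real q)) / real n - c) * real n\<bar>" by simp
        also have "... = \<bar>(\<Sum>q\<in>{q\<in>A. q \<le> n}. ln (real q)) / real n - c\<bar> * \<bar>real n\<bar>" by (rule abs_mult)
        finally show ?thesis by simp
      qed
      also have "... \<le> \<epsilon> / 4 * real n" using n0[of n] False n by (intro mult_right_mono) auto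
      finally show ?thesis using C0 by linarith
    qed
    have b2: "\<bar>\<Sum>n\<le>N. a n * invnlog n\<bar> \<le> C * invnlog 0 + \<epsilon> / 4 * V N" for N
      unfolding V_def by (rule abel_sum_compare[where u = invnlog and a = a and C = C and \<epsilon> = "\<epsilon> / 4", OF invnlog_nonneg invnlog_decreasing bd])
    have "(\<lambda>N. C * invnlog 0 / ln (ln (real N)) + \<epsilon> / 4 * (V N / ln (ln (real N)))) \<longlonglongrightarrow> 0 + \<epsilon> / 4 * 1"
      by (intro tendsto_add tendsto_mult VL tendsto_const) real_asymp
    hence "\<forall>\<^sub>F N in sequentially. C * invnlog 0 / ln (ln (real N)) + \<epsilon> / 4 * (V N / ln (ln (real N))) < \<epsilon> / 2"
      by (rule order_tendstoD(2)) (use e in simp)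
    moreover have "\<forall>\<^sub>F N in sequentially. ln (ln (real N)) > 0" by real_asymp
    ultimately have "\<forall>\<^sub>F N in sequentially. norm ((\<Sum>n\<le>N. a n * invnlog n) / ln (ln (real N)) - 0) < \<epsilon>"
    proof eventually_elim
      case (elim N)
      have "norm ((\<Sum>n\<le>N. a n * invnlog n) / ln (ln (real N)) - 0) = \<bar>\<Sum>n\<le>N. a n * invnlog n\<bar> / ln (ln (real N))" using elim(2) by simp
      also have "... \<le> (C * invnlog 0 + \<epsilon> / 4 * V N) / ln (ln (real N))" using elim(2) by (intro divide_right_mono b2) auto
      also have "... < \<epsilon> / 2" using elim(1) by (simp add: add_divide_distrib)
      finally show ?case using e by linarith
    qed
    thus "\<exists>no. \<forall>n\<ge>no. norm ((\<Sum>k\<le>n. a k * invnlog k) / ln (ln (real n)) - 0) < \<epsilon>" by (simp add: eventually_sequentially)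
  qed
  have "(\<lambda>N. (\<Sum>n\<le>N. a n * invnlog n) / ln (ln (real N)) + c * (V N / ln (ln (real N)))) \<longlonglongrightarrow> 0 + c * 1"
    by (intro tendsto_add tendsto_mult small VL tendsto_const)
  moreover have "(\<Sum>n\<le>N. a n * invnlog n) / ln (ln (real N)) + c * (V N / ln (ln (real N))) = (\<Sum>q\<in>{q\<in>A. q \<le> N}. 1 / real q) / ln (ln (real N))" for N
    unfolding sau by (simp add: diff_divide_distrib)
  ultimately show ?thesis by simp
qed

lemma rsA_limit: "((\<lambda>x. rsA A x / ln (ln x)) \<longlongrightarrow> c) at_top"
proof -
  have "((\<lambda>x::real. (\<Sum>q\<in>{q\<in>A. q \<le> nat \<lfloor>x\<rfloor>}. 1 / real q) / ln (ln (real (nat \<lfloor>x\<rfloor>))) * (ln (ln (of_int \<lfloor>x\<rfloor>)) / ln (ln x))) \<longlongrightarrow> c * 1) at_top"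
    by (intro tendsto_mult filterlim_compose[OF sum_reciprocals_seq floor_seq]) real_asymp
  moreover have "filterlim (\<lambda>x::real. ln (ln (of_int \<lfloor>x\<rfloor>)) :: real) at_top at_top" by real_asymp
  hence "\<forall>\<^sub>F x::real in at_top. ln (ln (of_int \<lfloor>x\<rfloor>)) > (0::real)" by (simp add: filterlim_at_top_dense)
  hence "\<forall>\<^sub>F x::real in at_top. (\<Sum>q\<in>{q\<in>A. q \<le> nat \<lfloor>x\<rfloor>}. 1 / real q) / ln (ln (real (nat \<lfloor>x\<rfloor>))) * (ln (ln (of_int \<lfloor>x\<rfloor>)) / ln (ln x)) = rsA A x / ln (ln x)"
    using eventually_ge_at_top[of 1]
  proof eventually_elim
    case (elim x)
    hence "of_int \<lfloor>x\<rfloor> = real (nat \<lfloor>x\<rfloor>)" by auto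
    thus ?case using elim by (simp add: rsA_def real_le_floor_iff)
  qed
  ultimately show ?thesis by (simp add: Lim_transform_eventually)
qed

end

section \<open>Ray classes and residue conditions\<close>

text \<open>With r = z^2 the prime q divides (r + i)(r - i) but neither factor, so it is not prime
  in Z[i]. In a proper factorization both factors have norm q, and a unit makes one of them
  primary.\<close>

lemma prime_1_mod_8_primary:
  assumes q: "prime q" "[q = 1] (mod 8)"
  obtains x where "primary x" "gnorm x = q"
proof -
  obtain z :: int where z: "[z ^ 4 = -1] (mod int q)" using prime_1_mod_8_root[OF q] by blast
  define r where "r = z\<^sup>2"
  have "int q dvd r\<^sup>2 + 1"
    using z by (simp add: r_def cong_iff_dvd_diff flip: power_mult)
  then obtain k where k: "r\<^sup>2 + 1 = int q * k" by (elim dvdE)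
  have q2: "q \<ge> 2" using q prime_ge_2_nat by blast
  have nd: "\<not> (of_nat q :: gint) dvd GInt r s" if s: "s = 1 \<or> s = -1" for s
  proof
    assume "(of_nat q :: gint) dvd GInt r s"
    then obtain k where "GInt r s = of_nat q * k" by (elim dvdE)
    hence "s = int q * gim k" by (simp add: gint_eq_iff)
    hence "int q dvd 1" using s by (metis dvd_triv_left dvd_minus_iff)
    thus False using q2 by simp
  qed
  have "\<not> prime_elem (of_nat q :: gint)"
  proof
    assume pe: "prime_elem (of_nat q :: gint)"
    have "GInt r 1 * GInt r (-1) = of_nat q * of_int k"
    proof -
      have "gre (of_int k :: gint) = k \<and> gim (of_int k :: gint) = 0" by (cases k) auto
      thus ?thesis using k by (simp add: gint_eq_iff power2_eq_square)
    qed
    hence "of_nat q dvd GInt r 1 * GInt r (-1)" by simp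
    hence "of_nat q dvd GInt r 1 \<or> of_nat q dvd GInt r (-1)" using pe by (simp add: prime_elem_dvd_mult_iff)
    thus False using nd by blast
  qed
  moreover have gq: "gnorm (of_nat q) = q\<^sup>2" by (simp add: gnorm_def flip: of_nat_power)
  hence "(of_nat q :: gint) \<noteq> 0" "\<not> (of_nat q :: gint) dvd 1" using q2 by (auto simp: gint_unit_iff simp flip: gnorm_0_iff)
  ultimately obtain a b :: gint where ab: "of_nat q = a * b" "\<not> a dvd 1" "\<not> b dvd 1"
    using gint_prime_elemI[of "of_nat q"] by blast
  have g: "gnorm a * gnorm b = q\<^sup>2" using gq gnorm_mult[of a b] ab(1) by simp
  have "gnorm a dvd q ^ 2" using g by (metis dvd_triv_left)
  then obtain i where i: "i \<le> 2" "gnorm a = q ^ i" using q(1) by (auto simp: divides_primepow_nat)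
  have "i \<noteq> 0" using i ab(2) by (auto simp: gint_unit_iff)
  moreover have "i \<noteq> 2"
  proof
    assume "i = 2"
    hence "gnorm b = 1" using g i q2 by simp
    thus False using ab(3) by (simp add: gint_unit_iff)
  qed
  ultimately have "i = 1" using i by linarith
  hence ga: "gnorm a = q" using i by simp
  have "q mod 8 = 1" using q(2) by (simp add: cong_mod_def)
  hence "odd q" by presburger
  hence "odd (gnorm a)" using ga by simp
  then obtain u where u: "gnorm u = 1" "primary (u * a)" by (rule odd_primary_assoc)
  show thesis by (rule that[OF u(2)]) (simp add: gnorm_mult u(1) ga)
qed

text \<open>The norm of 1 + 2m + 4n + 2mi is 1 + 4m modulo 8, and for m = 2h it is 1 + 8(h + n)
  modulo 16.\<close>

lemma primary_norm_mod:
  assumes x: "primary x"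
  shows "[gnorm x = 1] (mod 8) \<longleftrightarrow> even (pm x)"
    and "even (pm x) \<Longrightarrow> [gnorm x = (if even (pm x div 2 + pn x) then 1 else 9)] (mod 16)"
proof -
  define m n where "m = pm x" and "n = pn x"
  have "int (gnorm x) = (1 + 2 * m + 4 * n)\<^sup>2 + 4 * m\<^sup>2" unfolding m_def n_def
    by (subst primary_eq_mkp[OF x]) (rule gnorm_mkp)
  hence N: "int (gnorm x) = 1 + 8 * (m\<^sup>2 + 2 * m * n + 2 * n\<^sup>2 + n) + 4 * m" by (simp add: power2_eq_square algebra_simps)
  have i8: "[gnorm x = 1] (mod 8) \<longleftrightarrow> int (gnorm x) mod 8 = 1"
  proof -
    have "(g mod 8 = 1 mod 8) = (int g mod 8 = 1)" for g :: nat
    proof -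
      have "int (g mod 8) = int g mod 8" by (simp add: zmod_int)
      moreover have "1 mod 8 = (1::nat)" by simp
      ultimately show ?thesis by linarith
    qed
    thus ?thesis unfolding cong_mod_def .
  qed
  have "int (gnorm x) mod 8 = 1 \<longleftrightarrow> even m" unfolding N by presburger
  thus "[gnorm x = 1] (mod 8) \<longleftrightarrow> even (pm x)" using i8 by (simp add: m_def)
  assume "even (pm x)"
  then obtain h where h: "m = 2 * h" by (auto simp: m_def elim: evenE)
  define v :: nat where "v = (if even (h + n) then 1 else 9)"
  have N2: "int (gnorm x) = 1 + 8 * (h + n) + 16 * (2 * h\<^sup>2 + 2 * h * n + n\<^sup>2)" unfolding N h by (simp add: power2_eq_square algebra_simps)
  have "int (gnorm x) mod 16 = int v"
  proof -
    have "int (gnorm x) mod 16 = (1 + 8 * (h + n)) mod 16" unfolding N2 by (simp only: mod_mult_self2)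
    also have "... = int v" 
    proof (cases "even (h + n)")
      case True
      then obtain k where "h + n = 2 * k" by (elim evenE)
      hence "1 + 8 * (h + n) = 1 + k * 16" by simp
      thus ?thesis using True by (simp only: mod_mult_self1) (simp add: v_def)
    next
      case False
      then obtain k where "h + n = 2 * k + 1" by (elim oddE)
      hence "1 + 8 * (h + n) = 9 + k * 16" by simp
      thus ?thesis using False by (simp only: mod_mult_self1) (simp add: v_def)
    qed
    finally show ?thesis .
  qed
  hence "gnorm x mod 16 = v" by (metis of_nat_eq_iff of_nat_mod of_nat_numeral)
  moreover have "v mod 16 = v" by (simp add: v_def)
  moreover have "pm x div 2 = h" using h by (simp add: m_def)
  ultimately show "[gnorm x = (if even (pm x div 2 + pn x) then 1 else 9)] (mod 16)"
    by (simp add: cong_mod_def v_def n_def)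
qed

text \<open>For x = a + bi the difference a - b is 1 + 4n, so the symbol of 1 + i is (-1)^n. For d =
  8 the additional factor (-1)^{h+n} from q modulo 16, with m = 2h, leaves (-1)^h.\<close>

lemma chi2_primary:
  assumes x: "primary x" "gnorm x = q" and q: "prime q" "even (pm x)" and d: "d = -4 \<or> d = 8"
    and w: "quad_norm (d div 4) w = int q"
  shows "chi2 d q = (if d = -4 then (if even (pn x) then 1 else -1) else (if even (pm x div 2) then 1 else -1))"
proof -
  have q8: "[q = 1] (mod 8)" using primary_norm_mod(1)[OF x(1)] x q by simp
  define a b where "a = gre x" and "b = gim x"
  have x': "x = mkp (pm x) (pn x)" by (rule primary_eq_mkp[OF x(1)])
  have ab: "int q = a\<^sup>2 + b\<^sup>2" using int_gnorm[of x] x by (simp add: a_def b_def)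
  have "a = 1 + 2 * pm x + 4 * pn x" "b = 2 * pm x" unfolding a_def b_def by (subst x', simp add: mkp_def)+
  hence eb: "even b" and "a - b = 1 + 4 * pn x" by auto
  moreover have "(1 + 4 * k) mod 8 = (if even k then 1 else 5)" for k :: int by presburger
  ultimately have t8: "two8 (a - b) = (if even (pn x) then 1 else -1)" by (simp add: two8_def)
  obtain r where r: "[r\<^sup>2 = d div 4] (mod int q)" "chi2 d q = Legendre (redu r (t_elem d)) (int q)"
    by (rule chi2_Legendre[OF q(1) w])
  show ?thesis
  proof (cases "d = -4")
    case True
    hence "chi2 d q = Legendre (1 + r) (int q)" using r(2) by (simp add: redu_def t_elem_def)
    also have "... = two8 (a - b)" by (rule Legendre_one_plus_i[OF q(1) q8 ab eb]) (use r True in simp)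
    finally show ?thesis using t8 True by simp
  next
    case False
    hence d8: "d = 8" using d by simp
    obtain z :: int where "[z ^ 4 = -1] (mod int q)" using prime_1_mod_8_root[OF q(1) q8] by blast
    hence r0: "[(z\<^sup>2)\<^sup>2 = -1] (mod int q)" by (simp flip: power_mult)
    have "chi2 d q = Legendre r (int q)" using r(2) d8 by (simp add: redu_def t_elem_def)
    also have "... = (if [q = 1] (mod 16) then 1 else -1) * Legendre (1 + z\<^sup>2) (int q)"
      by (rule Legendre_sqrt2[OF q(1) q8 _ r0 ab eb]) (use r d8 in simp)
    also have "Legendre (1 + z\<^sup>2) (int q) = two8 (a - b)" by (rule Legendre_one_plus_i[OF q(1) q8 ab eb r0])
    also have "[q = 1] (mod 16) \<longleftrightarrow> even (pm x div 2 + pn x)"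
      using primary_norm_mod(2)[OF x(1) q(2)] x(2) by (auto simp: cong_mod_def split: if_splits)
    finally show ?thesis unfolding t8 using d8 by auto
  qed
qed

text \<open>With m = 2h, the residue r fixes the parity of h + n, while s fixes that of n for d = -4
  and that of h for d = 8. Hence each pair (r, s) is exactly one of the four classes with even m; n0
  and m0 solve these parity conditions.\<close>

lemma prime_class_eq_QC:
  assumes d: "d = -4 \<or> d = 8" and r: "r = 1 \<or> r = (9::nat)" and s: "s = 1 \<or> s = (-1::int)"
    and w: "\<And>q. prime q \<Longrightarrow> [q = 1] (mod 8) \<Longrightarrow> \<exists>w. quad_norm (d div 4) w = int q"
  obtains m0 n0 where "even m0" "{q. prime q \<and> [q = r] (mod 16) \<and> chi2 d q = s} = QC m0 n0"
proof -
  define n0 :: int where "n0 = (if d = -4 then (if s = 1 then 0 else 1) else (if (r = 1) = (s = 1) then 0 else 1))"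
  define m0 :: int where "m0 = (if (r = 1) = (n0 = 0) then 0 else 2)"
  have key: "[q = r] (mod 16) \<and> chi2 d q = s \<longleftrightarrow> cls m0 n0 x" if x: "primary x" "gnorm x = q" "prime q" "even (pm x)" for x q
  proof -
    obtain h where h: "pm x = 2 * h" using x(4) by (elim evenE)
    have "[q = 1] (mod 8)" using primary_norm_mod(1)[OF x(1)] x by simp
    then obtain w' where w': "quad_norm (d div 4) w' = int q" using w x(3) by blast
    have c: "chi2 d q = (if d = -4 then (if even (pn x) then 1 else -1) else (if even h then 1 else -1))"
      using chi2_primary[OF x(1,2,3,4) d w'] h by simp
    define v :: nat where "v = (if even (h + pn x) then 1 else 9)"
    have "[q = v] (mod 16)" using primary_norm_mod(2)[OF x(1,4)] x(2) h by (simp add: v_def)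
    hence "q mod 16 = v mod 16" unfolding cong_mod_def .
    also have "... = v" by (simp add: v_def)
    finally have qv: "q mod 16 = v" .
    have "r mod 16 = r" using r by auto
    hence "[q = r] (mod 16) \<longleftrightarrow> v = r" unfolding cong_mod_def qv by simp
    moreover have "v = r \<longleftrightarrow> (r = 1 \<longleftrightarrow> even (h + pn x))" using r by (cases "even (h + pn x)") (auto simp: v_def)
    ultimately have e: "[q = r] (mod 16) \<longleftrightarrow> (r = 1 \<longleftrightarrow> even (h + pn x))" by (simp only:)
    have mz: "m0 = 0 \<longleftrightarrow> (r = 1 \<longleftrightarrow> n0 = 0)" by (simp add: m0_def)
    have nz: "n0 = 0 \<longleftrightarrow> (if d = -4 then s = 1 else (r = 1 \<longleftrightarrow> s = 1))" by (simp add: n0_def)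
    have "m0 = 0 \<or> m0 = 2" by (simp add: m0_def)
    hence c1: "4 dvd (pm x - m0) \<longleftrightarrow> (even h \<longleftrightarrow> m0 = 0)" unfolding h by (elim disjE) (hypsubst, presburger)+
    have "n0 = 0 \<or> n0 = 1" by (simp add: n0_def)
    hence c2: "even (pn x - n0) \<longleftrightarrow> (even (pn x) \<longleftrightarrow> n0 = 0)" by (elim disjE) simp_all
    have cs: "chi2 d q = s \<longleftrightarrow> ((if d = -4 then even (pn x) else even h) \<longleftrightarrow> s = 1)" unfolding c using s by auto
    have "(R = (a = b) \<and> (if D then b else a) = S) = (a = (R = (if D then S else R = S)) \<and> b = (if D then S else R = S))"
      for R a b D S :: bool by (cases R; cases a; cases b; cases D; cases S; simp)
    thus ?thesis unfolding cs e cls_def c1 c2 mz nz even_add .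
  qed
  have ev: "even (pm x)" if "primary x" "gnorm x = q" "[q = r] (mod 16)" for x q
  proof -
    have "q mod 16 = r" using that(3) r by (auto simp: cong_mod_def)
    moreover have "q mod 8 = (q mod 16) mod 8" by (simp add: mod_mod_cancel)
    ultimately have "q mod 8 = 1" using r by auto
    thus ?thesis using primary_norm_mod(1)[OF that(1)] that(2) by (simp add: cong_mod_def)
  qed
  show thesis
  proof (rule that)
    show em: "even m0" by (simp add: m0_def)
    show "{q. prime q \<and> [q = r] (mod 16) \<and> chi2 d q = s} = QC m0 n0"
    proof (intro equalityI subsetI)
      fix q assume "q \<in> {q. prime q \<and> [q = r] (mod 16) \<and> chi2 d q = s}"
      hence q: "prime q" "[q = r] (mod 16)" "chi2 d q = s" by auto
      have "q mod 16 = r" using q(2) r by (auto simp: cong_mod_def)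
      moreover have "q mod 8 = (q mod 16) mod 8" by (simp add: mod_mod_cancel)
      ultimately have "q mod 8 = 1" using r by auto
      hence "[q = 1] (mod 8)" by (simp add: cong_mod_def)
      then obtain x where x: "primary x" "gnorm x = q" using prime_1_mod_8_primary[OF q(1)] by blast
      thus "q \<in> QC m0 n0" using key[OF x q(1) ev[OF x q(2)]] q by (auto simp: QC_def)
    next
      fix q assume "q \<in> QC m0 n0"
      then obtain x where x: "primary x" "gnorm x = q" "prime q" "cls m0 n0 x" by (auto simp: QC_def)
      have "even (pm x)" using x(4) em unfolding cls_def by presburger
      thus "q \<in> {q. prime q \<and> [q = r] (mod 16) \<and> chi2 d q = s}" using key[OF x(1,2,3)] x by auto
    qed
  qed
qed

section \<open>Bilinear sums over pairs of primes\<close>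

abbreviation btw :: "nat set \<Rightarrow> real \<Rightarrow> real \<Rightarrow> nat set" where
  "btw A a b \<equiv> {p\<in>A. a < real p \<and> real p \<le> b}"

text \<open>The cutoff q > y makes p < q automatic for p up to y.\<close>

abbreviation cofactors :: "nat set \<Rightarrow> real \<Rightarrow> real \<Rightarrow> nat \<Rightarrow> nat set" where
  "cofactors B y X p \<equiv> {q\<in>B. y < real q \<and> real (p * q) \<le> X}"

lemma sum_inverse_nat_le: "N \<ge> 1 \<Longrightarrow> (\<Sum>n=1..N. 1 / real n) \<le> 1 + ln (real N)"
proof (induction N rule: dec_induct)
  case (step N)
  have N: "real N > 0" using step by simp
  have "ln (real N / real (Suc N)) \<le> real N / real (Suc N) - 1" by (rule ln_le_minus_one) (use N in simp)
  also have "real N / real (Suc N) - 1 = - (1 / real (Suc N))" by (simp add: field_simps)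
  finally have "1 / real (Suc N) \<le> ln (real (Suc N)) - ln (real N)" using N by (simp add: ln_div)
  thus ?case using step by simp
qed simp

lemma card_pos_le:
  assumes "x \<ge> 0" "\<And>q. q \<in> S \<Longrightarrow> 1 \<le> q \<and> real q \<le> x"
  shows "real (card (S :: nat set)) \<le> x"
proof -
  have "card S \<le> card {1..nat \<lfloor>x\<rfloor>}" using assms by (intro card_mono) (auto simp: le_nat_floor)
  hence "real (card S) \<le> real (nat \<lfloor>x\<rfloor>)" by simp
  also have "... \<le> x" using assms(1) by (rule of_nat_floor)
  finally show ?thesis .
qed

text \<open>V Y stands for all candidates of size up to Y: for fixed e the second coordinate fills
  an initial segment, to which \<open>sum_two_Legendre\<close> applies. Two instances occur, the
  norm form and the plain integers with e = 0. The factor y^4 comes from at most y^2 pairs (p, p'),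
  each with pp' <= y^2.\<close>

lemma bilinear_Legendre:
  fixes A B :: "nat set" and V :: "real \<Rightarrow> (int \<times> nat) set" and E :: "real \<Rightarrow> int set" and N :: "real \<Rightarrow> int \<Rightarrow> nat"
    and \<kappa> \<rho> :: "nat \<Rightarrow> int" and \<iota> :: "nat \<Rightarrow> int \<times> nat"
  assumes V: "\<And>Y. Y \<ge> 1 \<Longrightarrow> V Y = Sigma (E Y) (\<lambda>e. {..<N Y e})" and Vm: "\<And>Y Y'. Y \<le> Y' \<Longrightarrow> V Y \<subseteq> V Y'"
    and E: "\<And>Y. finite (E Y)" "\<And>Y. Y \<ge> 1 \<Longrightarrow> real (card (E Y)) \<le> 3 * sqrt Y"
    and cV: "\<And>Y. Y \<ge> 1 \<Longrightarrow> real (card (V Y)) \<le> 9 * Y"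
    and \<iota>: "inj_on \<iota> B" "\<And>q Y. q \<in> B \<Longrightarrow> \<iota> q \<in> V Y \<longleftrightarrow> real q \<le> Y"
    and A: "\<And>p. p \<in> A \<Longrightarrow> prime p \<and> p > 2" and \<kappa>: "\<And>p. p \<in> A \<Longrightarrow> \<kappa> p = 1 \<or> \<kappa> p = -1"
    and L: "L \<ge> 1" and y: "1 \<le> y" "y \<le> X"
  shows "(\<Sum>p\<in>btw A L y. \<Sum>q\<in>cofactors B y X p.
      real_of_int (\<kappa> p * Legendre (int (snd (\<iota> q)) + fst (\<iota> q) * \<rho> p) (int p)))\<^sup>2
    \<le> (X / L) * (9 * X * (1 + ln y) + 3 * sqrt X * y ^ 4)"
proof -
  define P where "P = btw A L y"
  define Q where "Q = btw B y (X / L)"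
  define F where "F = (\<lambda>p (i::int \<times> nat). real_of_int (\<kappa> p * Legendre (int (snd i) + fst i * \<rho> p) (int p)))"
  have fP: "finite P" unfolding P_def by (rule finite_subset[OF _ finite_le_real[of UNIV y]]) auto
  have fQ: "finite Q" unfolding Q_def by (rule finite_subset[OF _ finite_le_real[of UNIV "X / L"]]) auto
  have X1: "X \<ge> 1" using y by simp
  have Y1: "X / real p \<ge> 1" "X / real p \<le> X" "X / real p \<le> X / L" "real p > 0" if "p \<in> P" for p
  proof -
    have p: "L < real p" "real p \<le> y" using that by (auto simp: P_def)
    hence p0: "real p > 0" "real p \<ge> 1" using L by auto
    show "real p > 0" by (rule p0)
    show "X / real p \<ge> 1" using p y p0 by (simp add: field_simps)
    show "X / real p \<le> X" using p0 X1 by (simp add: divide_le_eq mult_le_cancel_left1)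
    show "X / real p \<le> X / L" using p L X1 by (intro divide_left_mono) auto
  qed
  have fV: "finite (V Y)" if "Y \<ge> 1" for Y unfolding V[OF that] by (intro finite_SigmaI E) auto
  have F1: "F p i * F p i \<le> 1" if "p \<in> P" for p i
  proof -
    have "\<kappa> p = 1 \<or> \<kappa> p = -1" using that \<kappa> by (auto simp: P_def)
    moreover have "Legendre (int (snd i) + fst i * \<rho> p) (int p) \<in> {-1,0,1}" by (rule Legendre_values)
    ultimately show ?thesis by (auto simp: F_def)
  qed
  have D: "(\<Sum>i\<in>V (X / real p). F p i * F p i) \<le> 9 * (X / real p)" if p: "p \<in> P" for p
  proof -
    have "(\<Sum>i\<in>V (X / real p). F p i * F p i) \<le> (\<Sum>i\<in>V (X / real p). 1)" by (intro sum_mono F1 p)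
    also have "... = real (card (V (X / real p)))" by simp
    also have "... \<le> 9 * (X / real p)" by (intro cV Y1 p)
    finally show ?thesis .
  qed
  have Off: "(\<Sum>i\<in>V (X / real p) \<inter> V (X / real p'). F p i * F p' i) \<le> 3 * sqrt X * y\<^sup>2"
    if p: "p \<in> P" "p' \<in> P" "p \<noteq> p'" for p p'
  proof -
    \<comment> \<open>The sets V are nested, so an intersection is again one of them and its fibres
      are still initial segments.\<close>
    define Y where "Y = min (X / real p) (X / real p')"
    have Y: "Y \<ge> 1" "Y \<le> X" using Y1[OF p(1)] Y1[OF p(2)] by (auto simp: Y_def)
    have "V (X / real p) \<inter> V (X / real p') = V Y" unfolding Y_def
      using Vm[of "X / real p" "X / real p'"] Vm[of "X / real p'" "X / real p"] by (cases "X / real p \<le> X / real p'") (auto simp: min_def)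
    hence "(\<Sum>i\<in>V (X / real p) \<inter> V (X / real p'). F p i * F p' i) = (\<Sum>e\<in>E Y. \<Sum>c<N Y e. F p (e, c) * F p' (e, c))"
      unfolding V[OF Y(1)] by (simp add: sum.Sigma E)
    also have "... \<le> (\<Sum>e\<in>E Y. y\<^sup>2)"
    proof (rule sum_mono)
      fix e assume "e \<in> E Y"
      define S where "S = (\<Sum>c<N Y e. Legendre (int c + e * \<rho> p) (int p) * Legendre (int c + e * \<rho> p') (int p'))"
      have "\<bar>S\<bar> \<le> int (p * p')" unfolding S_def using p A by (intro sum_two_Legendre) (auto simp: P_def)
      moreover have "\<bar>\<kappa> p * \<kappa> p'\<bar> = 1" using \<kappa>[of p] \<kappa>[of p'] p by (auto simp: P_def)
      ultimately have "\<bar>\<kappa> p * \<kappa> p' * S\<bar> \<le> int (p * p')" by (simp add: abs_mult)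
      hence "real_of_int (\<kappa> p * \<kappa> p' * S) \<le> real (p * p')" by linarith
      also have "... \<le> y * y" unfolding of_nat_mult using p y by (intro mult_mono) (auto simp: P_def)
      also have "real_of_int (\<kappa> p * \<kappa> p' * S) = (\<Sum>c<N Y e. F p (e, c) * F p' (e, c))"
        unfolding F_def S_def sum_distrib_left of_int_sum by (intro sum.cong refl) simp
      finally show "(\<Sum>c<N Y e. F p (e, c) * F p' (e, c)) \<le> y\<^sup>2" by (simp add: power2_eq_square)
    qed
    also have "... = real (card (E Y)) * y\<^sup>2" by simp
    also have "... \<le> (3 * sqrt X) * y\<^sup>2"
    proof (rule mult_right_mono)
      have "real (card (E Y)) \<le> 3 * sqrt Y" by (rule E(2)[OF Y(1)])
      also have "... \<le> 3 * sqrt X" using Y by simp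
      finally show "real (card (E Y)) \<le> 3 * sqrt X" .
    qed simp
    finally show ?thesis .
  qed
  have "(\<Sum>p\<in>P. \<Sum>q\<in>cofactors B y X p. F p (\<iota> q))\<^sup>2
     \<le> real (card Q) * ((\<Sum>p\<in>P. 9 * (X / real p)) + (real (card P))\<^sup>2 * (3 * sqrt X * y\<^sup>2))"
  proof (cases "P = {}")
    case True thus ?thesis by simp
  next
    case False
    then obtain p0 where "p0 \<in> P" by blast
    hence XL: "X / L \<ge> 1" using Y1[of p0] by linarith
    show ?thesis
    proof (rule bilinear_cauchy_schwarz[where I = "V (X / L)" and B = "\<lambda>p. V (X / real p)"])
      show "finite P" "finite Q" "finite (V (X / L))" by (fact fP fQ fV[OF XL])+
      show "inj_on \<iota> Q" using \<iota>(1) by (rule inj_on_subset) (auto simp: Q_def)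
      show "\<iota> ` Q \<subseteq> V (X / L)" using \<iota>(2) by (auto simp: Q_def)
    next
      fix p assume p: "p \<in> P"
      have iff: "real (p * q) \<le> X \<longleftrightarrow> real q \<le> X / real p" for q using Y1(4)[OF p] by (simp add: field_simps)
      show "cofactors B y X p \<subseteq> Q" using Y1(3)[OF p] unfolding iff by (auto simp: Q_def)
      show "V (X / real p) \<subseteq> V (X / L)" by (rule Vm[OF Y1(3)[OF p]])
      show "\<iota> q \<in> V (X / real p) \<longleftrightarrow> q \<in> cofactors B y X p" if "q \<in> Q" for q
        using that \<iota>(2)[of q "X / real p"] unfolding iff by (auto simp: Q_def)
      show "(\<Sum>i\<in>V (X / real p). F p i * F p i) \<le> 9 * (X / real p)" by (rule D[OF p])
    next
      show "0 \<le> 3 * sqrt X * y\<^sup>2" using X1 by simp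
    qed (rule Off)
  qed
  also have "... \<le> (X / L) * (9 * X * (1 + ln y) + 3 * sqrt X * y ^ 4)"
  proof -
    have q: "real (card Q) \<le> X / L" using X1 L y by (intro card_pos_le) (auto simp: Q_def)
    have "(\<Sum>p\<in>P. 9 * (X / real p)) = 9 * X * (\<Sum>p\<in>P. 1 / real p)" by (simp add: sum_distrib_left)
    also have "(\<Sum>p\<in>P. 1 / real p) \<le> (\<Sum>n=1..nat \<lfloor>y\<rfloor>. 1 / real n)"
      using L by (intro sum_mono2) (auto simp: P_def le_nat_floor)
    also have "... \<le> 1 + ln (real (nat \<lfloor>y\<rfloor>))" using y by (intro sum_inverse_nat_le) (simp add: le_nat_floor)
    also have "ln (real (nat \<lfloor>y\<rfloor>)) \<le> ln y"
    proof -
      have "1 \<le> nat \<lfloor>y\<rfloor>" using y by (simp add: le_nat_floor)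
      thus ?thesis using y by (intro ln_mono of_nat_floor) auto
    qed
    finally have s1: "(\<Sum>p\<in>P. 9 * (X / real p)) \<le> 9 * X * (1 + ln y)" using X1 by simp
    have "real (card P) \<le> y" using y L by (intro card_pos_le) (auto simp: P_def)
    hence "(real (card P))\<^sup>2 * (3 * sqrt X * y\<^sup>2) \<le> y\<^sup>2 * (3 * sqrt X * y\<^sup>2)" using X1 by (intro mult_right_mono power_mono) auto
    also have "... = 3 * sqrt X * y ^ 4" by (simp add: power2_eq_square power4_eq_xxxx)
    finally have s2: "(real (card P))\<^sup>2 * (3 * sqrt X * y\<^sup>2) \<le> 3 * sqrt X * y ^ 4" .
    have z1: "0 \<le> X / L" using X1 L by simp
    have z2: "0 \<le> (\<Sum>p\<in>P. 9 * (X / real p)) + (real (card P))\<^sup>2 * (3 * sqrt X * y\<^sup>2)"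
      using X1 by (intro add_nonneg_nonneg sum_nonneg mult_nonneg_nonneg) auto
    show ?thesis by (rule mult_mono[OF q add_mono[OF s1 s2] z1 z2])
  qed
  finally show ?thesis unfolding P_def F_def .
qed

text \<open>The form is indefinite for d0 = 2, where a bound on the norm alone admits infinitely
  many points; the bound on e^2 is the one that reduced representatives of q <= Y satisfy.\<close>

definition Vq :: "int \<Rightarrow> real \<Rightarrow> (int \<times> nat) set" where
  "Vq d0 Y = {(e, c). real_of_int (e\<^sup>2) \<le> Y \<and> real_of_int ((int c)\<^sup>2 - d0 * e\<^sup>2) \<le> Y}"

lemma Vq_mono: "Y \<le> Y' \<Longrightarrow> Vq d0 Y \<subseteq> Vq d0 Y'"
  by (auto simp: Vq_def)

lemma card_squares_int:
  assumes "Y \<ge> 1"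
  shows "finite {e::int. real_of_int (e\<^sup>2) \<le> Y}" "real (card {e::int. real_of_int (e\<^sup>2) \<le> Y}) \<le> 3 * sqrt Y"
proof -
  define k where "k = \<lfloor>sqrt Y\<rfloor>"
  have k1: "k \<ge> 1" using assms by (simp add: k_def le_floor_iff)
  have sub: "{e::int. real_of_int (e\<^sup>2) \<le> Y} \<subseteq> {-k..k}"
  proof
    fix e :: int assume "e \<in> {e::int. real_of_int (e\<^sup>2) \<le> Y}"
    hence "sqrt ((real_of_int e)\<^sup>2) \<le> sqrt Y" by (intro real_sqrt_le_mono) simp
    hence "\<bar>real_of_int e\<bar> \<le> sqrt Y" by simp
    hence "\<bar>e\<bar> \<le> k" unfolding k_def le_floor_iff by simp
    thus "e \<in> {-k..k}" by auto
  qed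
  thus "finite {e::int. real_of_int (e\<^sup>2) \<le> Y}" by (rule finite_subset) simp
  have "card {e::int. real_of_int (e\<^sup>2) \<le> Y} \<le> card {-k..k}" by (intro card_mono sub) simp
  hence "real (card {e::int. real_of_int (e\<^sup>2) \<le> Y}) \<le> 2 * real_of_int k + 1" using k1 by simp
  also have "... \<le> 3 * real_of_int k" using k1 by linarith
  also have "real_of_int k \<le> sqrt Y" by (simp add: k_def)
  finally show "real (card {e::int. real_of_int (e\<^sup>2) \<le> Y}) \<le> 3 * sqrt Y" by simp
qed

lemma squares_nat_interval:
  assumes "Z \<ge> 0"
  shows "{c::nat. (real c)\<^sup>2 \<le> Z} = {..<nat \<lfloor>sqrt Z\<rfloor> + 1}"
proof -
  have k: "(real c)\<^sup>2 \<le> Z \<longleftrightarrow> c \<le> nat \<lfloor>sqrt Z\<rfloor>" for c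
  proof -
    have "(real c)\<^sup>2 \<le> Z \<longleftrightarrow> sqrt ((real c)\<^sup>2) \<le> sqrt Z" by (simp only: real_sqrt_le_iff)
    also have "... \<longleftrightarrow> real c \<le> sqrt Z" by simp
    also have "... \<longleftrightarrow> int c \<le> \<lfloor>sqrt Z\<rfloor>" by (simp add: le_floor_iff)
    also have "... \<longleftrightarrow> c \<le> nat \<lfloor>sqrt Z\<rfloor>" using assms by (simp add: le_nat_iff)
    finally show ?thesis .
  qed
  have "(c \<le> n) = (c < n + 1)" for c n :: nat by auto
  thus ?thesis unfolding k lessThan_def by simp
qed

lemma Vq_Sigma:
  assumes d0: "d0 = -1 \<or> d0 = 2" and Y: "Y \<ge> 1"
  shows "Vq d0 Y = Sigma {e. real_of_int (e\<^sup>2) \<le> Y} (\<lambda>e. {..<nat \<lfloor>sqrt (Y + real_of_int (d0 * e\<^sup>2))\<rfloor> + 1})"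
    and "real (card (Vq d0 Y)) \<le> 9 * Y"
proof -
  have nn: "Y + real_of_int (d0 * e\<^sup>2) \<ge> 0" "Y + real_of_int (d0 * e\<^sup>2) \<le> 3 * Y" if "real_of_int (e\<^sup>2) \<le> Y" for e
  proof -
    define u where "u = real_of_int (e\<^sup>2)"
    have u: "0 \<le> u" "u \<le> Y" using that by (auto simp: u_def)
    have e: "real_of_int (d0 * e\<^sup>2) = real_of_int d0 * u" by (simp add: u_def)
    show "Y + real_of_int (d0 * e\<^sup>2) \<ge> 0" "Y + real_of_int (d0 * e\<^sup>2) \<le> 3 * Y" unfolding e using d0 u Y by auto
  qed
  have "Vq d0 Y = Sigma {e. real_of_int (e\<^sup>2) \<le> Y} (\<lambda>e. {c. (real c)\<^sup>2 \<le> Y + real_of_int (d0 * e\<^sup>2)})"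
    by (auto simp: Vq_def algebra_simps)
  also have "... = Sigma {e. real_of_int (e\<^sup>2) \<le> Y} (\<lambda>e. {..<nat \<lfloor>sqrt (Y + real_of_int (d0 * e\<^sup>2))\<rfloor> + 1})"
    using nn by (intro Sigma_cong refl squares_nat_interval) auto
  finally show S: "Vq d0 Y = Sigma {e. real_of_int (e\<^sup>2) \<le> Y} (\<lambda>e. {..<nat \<lfloor>sqrt (Y + real_of_int (d0 * e\<^sup>2))\<rfloor> + 1})" .
  have "real (card (Vq d0 Y)) = (\<Sum>e\<in>{e. real_of_int (e\<^sup>2) \<le> Y}. real (nat \<lfloor>sqrt (Y + real_of_int (d0 * e\<^sup>2))\<rfloor> + 1))"
    unfolding S using card_squares_int(1)[OF Y] by (subst card_SigmaI) auto
  also have "... \<le> (\<Sum>e\<in>{e::int. real_of_int (e\<^sup>2) \<le> Y}. 3 * sqrt Y)"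
  proof (rule sum_mono)
    fix e :: int assume "e \<in> {e. real_of_int (e\<^sup>2) \<le> Y}"
    note n = nn[of e, OF this[THEN CollectD]]
    have "real (nat \<lfloor>sqrt (Y + real_of_int (d0 * e\<^sup>2))\<rfloor> + 1) \<le> sqrt (Y + real_of_int (d0 * e\<^sup>2)) + 1"
      using n by (simp add: of_nat_floor)
    also have "sqrt (Y + real_of_int (d0 * e\<^sup>2)) \<le> sqrt (4 * Y)" using n Y by (intro real_sqrt_le_mono) linarith
    also have "sqrt (4 * Y) = 2 * sqrt Y" by (simp add: real_sqrt_mult)
    also have "2 * sqrt Y + 1 \<le> 3 * sqrt Y" using Y by simp
    finally show "real (nat \<lfloor>sqrt (Y + real_of_int (d0 * e\<^sup>2))\<rfloor> + 1) \<le> 3 * sqrt Y" by simp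
  qed
  also have "... = real (card {e::int. real_of_int (e\<^sup>2) \<le> Y}) * (3 * sqrt Y)" by simp
  also have "... \<le> (3 * sqrt Y) * (3 * sqrt Y)" using Y by (intro mult_right_mono card_squares_int) auto
  also have "... = 9 * Y" using Y by simp
  finally show "real (card (Vq d0 Y)) \<le> 9 * Y" .
qed

text \<open>Let J be the symbol of q and E1, E2 those of c + er and c - er. Checking signs with E1
  E2 = J gives 4 [G] - 1 = J + \<kappa> E1 + \<kappa> E2; the factor 3 stands for these three sums,
  each controlled by \<open>bilinear_Legendre\<close>.\<close>

lemma symbol_sum_bound:
  fixes A B :: "nat set" and \<kappa> r :: "nat \<Rightarrow> int" and c e :: "nat \<Rightarrow> int" and G :: "nat \<Rightarrow> nat \<Rightarrow> bool"
  assumes d0: "d0 = -1 \<or> d0 = 2"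
    and A: "\<And>p. p \<in> A \<Longrightarrow> prime p \<and> p > 2" and B: "\<And>q. q \<in> B \<Longrightarrow> prime q"
    and \<kappa>: "\<And>p. p \<in> A \<Longrightarrow> \<kappa> p = 1 \<or> \<kappa> p = -1" and r: "\<And>p. p \<in> A \<Longrightarrow> [(r p)\<^sup>2 = d0] (mod int p)"
    and ce: "\<And>q. q \<in> B \<Longrightarrow> (c q)\<^sup>2 - d0 * (e q)\<^sup>2 = int q \<and> c q \<ge> 0 \<and> (e q)\<^sup>2 \<le> int q"
    and G: "\<And>p q. p \<in> A \<Longrightarrow> q \<in> B \<Longrightarrow> p \<noteq> q \<Longrightarrow>
       G p q \<longleftrightarrow> Legendre (int q) (int p) = 1 \<and> \<kappa> p * Legendre (c q + e q * r p) (int p) = 1"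
    and L: "L \<ge> 1" and y: "1 \<le> y" "y \<le> X"
  shows "\<bar>\<Sum>p\<in>btw A L y. \<Sum>q\<in>cofactors B y X p. 4 * of_bool (G p q) - 1\<bar>
     \<le> 3 * sqrt ((X / L) * (9 * X * (1 + ln y) + 3 * sqrt X * y ^ 4))"
proof -
  define P where "P = btw A L y"
  define AA where "AA = (\<lambda>p. cofactors B y X p)"
  define W where "W = (X / L) * (9 * X * (1 + ln y) + 3 * sqrt X * y ^ 4)"
  define TJ where "TJ = (\<Sum>p\<in>P. \<Sum>q\<in>AA p. real_of_int (Legendre (int q) (int p)))"
  define TE where "TE = (\<lambda>s. \<Sum>p\<in>P. \<Sum>q\<in>AA p. real_of_int (\<kappa> p * Legendre (c q + e q * (s * r p)) (int p)))"
  have TE: "\<bar>TE s\<bar> \<le> sqrt W" for s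
  proof -
    define \<iota> where "\<iota> = (\<lambda>q. (e q, nat (c q)))"
    have norm_inj: "q = q'" if "q \<in> B" "q' \<in> B" "\<iota> q = \<iota> q'" for q q'
    proof -
      have "e q = e q'" "nat (c q) = nat (c q')" using that by (auto simp: \<iota>_def)
      moreover have cq: "c q \<ge> 0" "c q' \<ge> 0" using ce[OF that(1)] ce[OF that(2)] by blast+
      ultimately have eqs: "e q = e q'" "c q = c q'" by linarith+
      have a: "int q = (c q)\<^sup>2 - d0 * (e q)\<^sup>2" using ce[OF that(1)] by (elim conjE) (rule sym)
      have b: "int q' = (c q')\<^sup>2 - d0 * (e q')\<^sup>2" using ce[OF that(2)] by (elim conjE) (rule sym)
      have "int q = int q'" by (simp only: a b eqs)
      thus ?thesis by (simp only: of_nat_eq_iff)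
    qed
    have in_iff: "\<iota> q \<in> Vq d0 Y \<longleftrightarrow> real q \<le> Y" if q: "q \<in> B" for q Y
    proof -
      have "real_of_int ((c q)\<^sup>2 - d0 * (e q)\<^sup>2) = real q" "real_of_int ((e q)\<^sup>2) \<le> real q" "int (nat (c q)) = c q"
        using ce[OF q] by (simp_all del: of_int_power)
      thus ?thesis unfolding Vq_def \<iota>_def by (auto simp del: of_int_power of_int_diff of_int_mult)
    qed
    have "(\<Sum>p\<in>btw A L y. \<Sum>q\<in>cofactors B y X p.
      real_of_int (\<kappa> p * Legendre (int (snd (\<iota> q)) + fst (\<iota> q) * (\<lambda>p. s * r p) p) (int p)))\<^sup>2 \<le> W"
      unfolding W_def
    proof (rule bilinear_Legendre[OF Vq_Sigma(1)[OF d0] Vq_mono _ card_squares_int(2) Vq_Sigma(2)[OF d0] _ in_iff A \<kappa> L y])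
      show "inj_on \<iota> B" using norm_inj by (intro inj_onI) auto
      show "finite {e::int. real_of_int (e\<^sup>2) \<le> Y}" for Y
        by (rule finite_subset[OF _ card_squares_int(1)[of "max 1 Y"]]) auto
    qed auto
    also have "(\<Sum>p\<in>btw A L y. \<Sum>q\<in>cofactors B y X p.
      real_of_int (\<kappa> p * Legendre (int (snd (\<iota> q)) + fst (\<iota> q) * (\<lambda>p. s * r p) p) (int p))) = TE s"
      unfolding TE_def P_def AA_def using ce by (intro sum.cong refl) (simp add: \<iota>_def)
    finally have "sqrt ((TE s)\<^sup>2) \<le> sqrt W" by (rule real_sqrt_le_mono)
    thus ?thesis by simp
  qed
  have TJ: "\<bar>TJ\<bar> \<le> sqrt W"
  proof -
    \<comment> \<open>The degenerate lattice e = 0, in which q indexes itself, handles the plain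
      symbol of q modulo p.\<close>
    define V where "V = (\<lambda>Y::real. {(e::int, n::nat). e = 0 \<and> real n \<le> Y})"
    have "(\<Sum>p\<in>btw A L y. \<Sum>q\<in>cofactors B y X p.
      real_of_int ((\<lambda>_. 1) p * Legendre (int (snd ((\<lambda>q. (0::int, q)) q)) + fst ((\<lambda>q. (0::int, q)) q) * (\<lambda>p. 0) p) (int p)))\<^sup>2 \<le> W"
      unfolding W_def
    proof (rule bilinear_Legendre[where V = V and E = "\<lambda>_. {0}" and N = "\<lambda>Y _. nat \<lfloor>Y\<rfloor> + 1"
        and \<kappa> = "\<lambda>_. 1" and \<rho> = "\<lambda>_. 0" and \<iota> = "\<lambda>q. (0, q)", OF _ _ _ _ _ _ _ A _ L y])
      fix Y :: real assume Y: "Y \<ge> 1"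
      show VS: "V Y = Sigma {0} (\<lambda>_. {..<nat \<lfloor>Y\<rfloor> + 1})"
        using Y by (auto simp: V_def le_nat_floor less_Suc_eq_le) (metis of_nat_floor of_nat_le_iff order_trans zero_le_one)
      have "1 \<le> sqrt Y" using Y by simp
      moreover have "real (card {0::int}) = 1" by simp
      ultimately show "real (card {0::int}) \<le> 3 * sqrt Y" by linarith
      have "card (V Y) = nat \<lfloor>Y\<rfloor> + 1" unfolding VS by (simp add: card_SigmaI)
      hence "real (card (V Y)) = real (nat \<lfloor>Y\<rfloor>) + 1" by (simp only: of_nat_add of_nat_1)
      moreover have "real (nat \<lfloor>Y\<rfloor>) \<le> Y" using Y by (intro of_nat_floor) simp
      ultimately show "real (card (V Y)) \<le> 9 * Y" using Y by linarith
    qed (auto simp: V_def inj_on_def)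
    hence "TJ\<^sup>2 \<le> W" by (simp add: TJ_def P_def AA_def)
    hence "sqrt (TJ\<^sup>2) \<le> sqrt W" by (rule real_sqrt_le_mono)
    thus ?thesis by simp
  qed
  have "(\<Sum>p\<in>P. \<Sum>q\<in>AA p. 4 * of_bool (G p q) - 1) = (\<Sum>p\<in>P. \<Sum>q\<in>AA p. real_of_int (Legendre (int q) (int p))
     + real_of_int (\<kappa> p * Legendre (c q + e q * (1 * r p)) (int p)) + real_of_int (\<kappa> p * Legendre (c q + e q * (-1 * r p)) (int p)))"
  proof (intro sum.cong refl)
    fix p q assume pq: "p \<in> P" "q \<in> AA p"
    hence pA: "p \<in> A" and qB: "q \<in> B" and ne: "p \<noteq> q" by (auto simp: P_def AA_def)
    define J where "J = Legendre (int q) (int p)"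
    define E1 where "E1 = Legendre (c q + e q * r p) (int p)"
    define E2 where "E2 = Legendre (c q + e q * (- r p)) (int p)"
    have "\<not> int p dvd int q" using A[OF pA] B[OF qB] ne by (simp add: primes_dvd_imp_eq) (metis primes_dvd_imp_eq)
    hence J: "J = 1 \<or> J = -1" unfolding J_def by (rule Legendre_pm1)
    have "E1 * E2 = J" unfolding E1_def E2_def J_def
      by (rule Legendre_norm[OF _ _ r[OF pA]]) (use A[OF pA] ce[OF qB] in auto)
    moreover have "E1 \<in> {-1,0,1}" "E2 \<in> {-1,0,1}" unfolding E1_def E2_def by (rule Legendre_values)+
    moreover have "G p q \<longleftrightarrow> J = 1 \<and> \<kappa> p * E1 = 1" using G[OF pA qB ne] by (simp add: J_def E1_def)
    ultimately have "4 * of_bool (G p q) - 1 = real_of_int J + real_of_int (\<kappa> p * E1) + real_of_int (\<kappa> p * E2)"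
      using J \<kappa>[OF pA] by auto
    thus "4 * of_bool (G p q) - 1 = real_of_int (Legendre (int q) (int p))
     + real_of_int (\<kappa> p * Legendre (c q + e q * (1 * r p)) (int p)) + real_of_int (\<kappa> p * Legendre (c q + e q * (-1 * r p)) (int p))"
      by (simp add: J_def E1_def E2_def)
  qed
  also have "... = TJ + TE 1 + TE (-1)" unfolding TJ_def TE_def by (simp only: sum.distrib)
  finally have "\<bar>\<Sum>p\<in>P. \<Sum>q\<in>AA p. 4 * of_bool (G p q) - 1\<bar> \<le> 3 * sqrt W" using TJ TE[of 1] TE[of "-1"] by linarith
  thus ?thesis unfolding P_def AA_def W_def .
qed

section \<open>Counting pairs\<close>

lemma rsA_diff:
  assumes "L \<le> y"
  shows "(\<Sum>p\<in>btw A L y. 1 / real p) = rsA A y - rsA A L"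
proof -
  have "{p\<in>A. real p \<le> y} = {p\<in>A. real p \<le> L} \<union> btw A L y" using assms by auto
  hence "rsA A y = (\<Sum>p\<in>{p\<in>A. real p \<le> L} \<union> btw A L y. 1 / real p)" by (simp add: rsA_def)
  also have "... = rsA A L + (\<Sum>p\<in>btw A L y. 1 / real p)"
    unfolding rsA_def by (intro sum.union_disjoint finite_le_real finite_subset[OF _ finite_le_real[of A y]]) auto
  finally show ?thesis by simp
qed

text \<open>Only pairs with L < p <= y < q use the symbol bound. Dropping q <= y from the main count
  costs at most y for each of at most y values of p. The other pairs have p <= L, or y < p <= sqrt
  X, or both entries at most y, and are counted without the condition G.\<close>

lemma pair_count_bounds:
  fixes A B :: "nat set" and G :: "nat \<Rightarrow> nat \<Rightarrow> bool" and X L y :: real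
  assumes A2: "\<And>q. q \<in> A \<Longrightarrow> q \<ge> 2" and B2: "\<And>q. q \<in> B \<Longrightarrow> q \<ge> 2"
    and L: "1 \<le> L" "L \<le> y" and y: "y\<^sup>2 \<le> X"
    and T: "\<bar>\<Sum>p\<in>btw A L y. \<Sum>q\<in>cofactors B y X p. 4 * of_bool (G p q) - 1\<bar> \<le> \<tau>"
  defines "M \<equiv> (\<Sum>p\<in>btw A L y. piA B (X / real p))"
    and "R \<equiv> (\<Sum>p\<in>{p\<in>A. real p \<le> L}. piA B (X / real p)) + (\<Sum>p\<in>btw A y (sqrt X). piA B (X / real p))"
    and "S \<equiv> {(p, q). p \<in> A \<and> q \<in> B \<and> p < q \<and> real (p * q) \<le> X \<and> G p q}"
  shows "M - \<tau> - y\<^sup>2 \<le> 4 * real (card S)" "4 * real (card S) \<le> M + \<tau> + 4 * R + 4 * y\<^sup>2"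
proof -
  define P where "P = btw A L y"
  define P1 where "P1 = {p\<in>A. real p \<le> L}"
  define P2 where "P2 = btw A y (sqrt X)"
  define AA where "AA = (\<lambda>p. cofactors B y X p)"
  define BB where "BB = (\<lambda>p. {q\<in>B. real (p * q) \<le> X})"
  define Mid where "Mid = Sigma P (\<lambda>p. {q \<in> AA p. G p q})"
  define R3 where "R3 = {p\<in>A. real p \<le> y} \<times> {q\<in>B. real q \<le> y}"
  have y1: "y \<ge> 1" using L by linarith
  have fP: "finite P" "finite P1" "finite P2" unfolding P_def P1_def P2_def
    by (rule finite_subset[OF _ finite_le_real[of A y]], auto)
      (rule finite_le_real, rule finite_subset[OF _ finite_le_real[of A "sqrt X"]], auto)
  have pos: "real p > 0" if "p \<in> A" for p using A2[OF that] by simp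
  have BBe: "BB p = {q\<in>B. real q \<le> X / real p}" if "p \<in> A" for p
    using pos[OF that] by (auto simp: BB_def field_simps)
  have fBB: "finite (BB p)" if "p \<in> A" for p unfolding BBe[OF that] by (rule finite_le_real)
  have cBB: "real (card (BB p)) = piA B (X / real p)" if "p \<in> A" for p unfolding BBe[OF that] piA_def ..
  have AAB: "AA p \<subseteq> BB p" for p by (auto simp: AA_def BB_def)
  have fAA: "finite (AA p)" if "p \<in> A" for p using finite_subset[OF AAB fBB[OF that]] .
  have PA: "p \<in> A" if "p \<in> P" for p using that by (simp add: P_def)
  have PA1: "p \<in> A" if "p \<in> P1" for p using that by (simp add: P1_def)
  have PA2: "p \<in> A" if "p \<in> P2" for p using that by (simp add: P2_def)
  have cAA: "piA B (X / real p) - y \<le> real (card (AA p))" "real (card (AA p)) \<le> piA B (X / real p)" if p: "p \<in> P" for p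
  proof -
    have "card (AA p) \<le> card (BB p)" by (intro card_mono fBB AAB PA p)
    thus "real (card (AA p)) \<le> piA B (X / real p)" using cBB[OF PA[OF p]] by linarith
    have "BB p \<subseteq> AA p \<union> {q\<in>B. real q \<le> y}" by (auto simp: AA_def BB_def)
    hence "card (BB p) \<le> card (AA p \<union> {q\<in>B. real q \<le> y})" by (intro card_mono finite_UnI fAA PA p finite_le_real)
    also have "... \<le> card (AA p) + card {q\<in>B. real q \<le> y}" by (rule card_Un_le)
    finally have "real (card (BB p)) \<le> real (card (AA p)) + real (card {q\<in>B. real q \<le> y})" by linarith
    moreover have "real (card {q\<in>B. real q \<le> y}) \<le> y" using y1 B2 by (intro card_pos_le) (auto dest: B2 intro: order_trans[OF _ B2])
    ultimately show "piA B (X / real p) - y \<le> real (card (AA p))" using cBB[OF PA[OF p]] by linarith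
  qed
  have cP: "real (card P) \<le> y" using y1 L by (intro card_pos_le) (auto simp: P_def)
  have mid: "4 * real (card Mid) = (\<Sum>p\<in>P. \<Sum>q\<in>AA p. 4 * of_bool (G p q) - 1) + (\<Sum>p\<in>P. real (card (AA p)))"
  proof -
    have "real (card Mid) = (\<Sum>p\<in>P. real (card {q \<in> AA p. G p q}))"
      unfolding Mid_def using fP fAA PA by (subst card_SigmaI) auto
    also have "... = (\<Sum>p\<in>P. \<Sum>q\<in>AA p. of_bool (G p q))"
    proof (rule sum.cong[OF refl])
      fix p assume "p \<in> P"
      hence "finite (AA p)" using fAA PA by blast
      thus "real (card {q \<in> AA p. G p q}) = (\<Sum>q\<in>AA p. of_bool (G p q))" by (simp add: Int_def)
    qed
    finally show ?thesis by (simp add: sum_subtractf sum_distrib_left)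
  qed
  have T': "\<bar>\<Sum>p\<in>P. \<Sum>q\<in>AA p. 4 * of_bool (G p q) - 1 :: real\<bar> \<le> \<tau>" using T unfolding P_def AA_def .
  have "(\<Sum>p\<in>P. real (card (AA p))) \<le> M" unfolding M_def P_def[symmetric] by (intro sum_mono cAA)
  moreover have "M - y\<^sup>2 \<le> (\<Sum>p\<in>P. real (card (AA p)))"
  proof -
    have "M - real (card P) * y = (\<Sum>p\<in>P. piA B (X / real p) - y)" unfolding M_def P_def[symmetric] by (simp add: sum_subtractf)
    also have "... \<le> (\<Sum>p\<in>P. real (card (AA p)))" by (intro sum_mono cAA)
    finally have "M - real (card P) * y \<le> (\<Sum>p\<in>P. real (card (AA p)))" .
    moreover have "real (card P) * y \<le> y * y" using cP y1 by (intro mult_right_mono) auto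
    ultimately show ?thesis by (simp add: power2_eq_square)
  qed
  ultimately have m1: "4 * real (card Mid) \<le> M + \<tau>" and m2: "M - \<tau> - y\<^sup>2 \<le> 4 * real (card Mid)" using mid T' by linarith+
  have finU: "finite (Mid \<union> (Sigma P1 BB \<union> (Sigma P2 BB \<union> R3)))"
    unfolding Mid_def R3_def using fP fAA fBB PA PA1 PA2
    by (intro finite_UnI finite_SigmaI finite_cartesian_product finite_le_real) (auto intro: finite_subset)
  have sub: "S \<subseteq> Mid \<union> (Sigma P1 BB \<union> (Sigma P2 BB \<union> R3))"
  proof
    fix a assume "a \<in> S"
    then obtain p q where a: "a = (p, q)" "p \<in> A" "q \<in> B" "p < q" "real (p * q) \<le> X" "G p q" by (auto simp: S_def)
    have "real (p * p) \<le> real (p * q)" using a(4) by (intro of_nat_mono mult_left_mono) auto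
    hence "(real p)\<^sup>2 \<le> X" using a(5) by (simp add: power2_eq_square)
    hence "real p \<le> sqrt X" by (rule real_le_rsqrt)
    thus "a \<in> Mid \<union> (Sigma P1 BB \<union> (Sigma P2 BB \<union> R3))"
      using a unfolding Mid_def P_def P1_def P2_def AA_def BB_def R3_def by (auto simp: not_le)
  qed
  have MS: "Mid \<subseteq> S"
    unfolding Mid_def S_def P_def AA_def by auto
  have "card Mid \<le> card S" by (rule card_mono[OF finite_subset[OF sub finU] MS])
  thus "M - \<tau> - y\<^sup>2 \<le> 4 * real (card S)" using m2 by linarith
  have "card S \<le> card (Mid \<union> (Sigma P1 BB \<union> (Sigma P2 BB \<union> R3)))" by (rule card_mono[OF finU sub])
  also have "... \<le> card Mid + (card (Sigma P1 BB) + (card (Sigma P2 BB) + card R3))"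
    by (meson card_Un_le add_left_mono order_trans)
  finally have k0: "real (card S) \<le> real (card Mid) + (real (card (Sigma P1 BB)) + (real (card (Sigma P2 BB)) + real (card R3)))" by linarith
  have k1: "real (card (Sigma P1 BB)) = (\<Sum>p\<in>P1. piA B (X / real p))"
    using fP fBB PA1 by (subst card_SigmaI) (auto simp: cBB)
  have k2: "real (card (Sigma P2 BB)) = (\<Sum>p\<in>P2. piA B (X / real p))"
    using fP fBB PA2 by (subst card_SigmaI) (auto simp: cBB)
  have k3: "real (card R3) \<le> y\<^sup>2"
  proof -
    have "real (card {p\<in>A. real p \<le> y}) \<le> y" "real (card {q\<in>B. real q \<le> y}) \<le> y"
      using y1 by (intro card_pos_le; force dest: A2 B2)+
    thus ?thesis unfolding R3_def card_cartesian_product of_nat_mult power2_eq_square using y1 by (intro mult_mono) auto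
  qed
  have "4 * cs \<le> m + 4 * (r1 + r2) + 4 * v" if "cs \<le> cm + (x1 + (x2 + x3))" "x1 = r1" "x2 = r2" "x3 \<le> v" "4 * cm \<le> m"
    for cs cm x1 x2 x3 r1 r2 v m :: real
  proof -
    have "4 * cs \<le> 4 * (cm + (r1 + (r2 + x3)))" using that by simp
    also have "... = 4 * cm + 4 * (r1 + r2) + 4 * x3" by (simp add: algebra_simps)
    also have "... \<le> m + 4 * (r1 + r2) + 4 * v" using that by (intro add_mono) auto
    finally show ?thesis .
  qed
  from this[OF k0 k1 k2 k3 m1] show "4 * real (card S) \<le> M + \<tau> + 4 * R + 4 * y\<^sup>2" unfolding R_def P1_def P2_def .
qed

text \<open>In the main range ln p is o(ln X), so each p contributes c2 X / (p ln X) uniformly, and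
  the reciprocals of p sum to c1 ln ln X to first order; the factor 1/4 is the mean of G.\<close>

theorem pair_count_asymp:
  fixes A B :: "nat set" and G :: "nat \<Rightarrow> nat \<Rightarrow> bool" and c1 c2 :: real
  assumes A2: "\<And>q. q \<in> A \<Longrightarrow> q \<ge> 2" and B2: "\<And>q. q \<in> B \<Longrightarrow> q \<ge> 2" and c: "c1 > 0" "c2 > 0"
    and thA: "(\<lambda>N. (\<Sum>q\<in>{q\<in>A. q \<le> N}. ln (real q)) / real N) \<longlonglongrightarrow> c1"
    and thB: "(\<lambda>N. (\<Sum>q\<in>{q\<in>B. q \<le> N}. ln (real q)) / real N) \<longlonglongrightarrow> c2"
    and T: "\<And>X L y :: real. 1 \<le> L \<Longrightarrow> 1 \<le> y \<Longrightarrow> y \<le> X \<Longrightarrow>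
      \<bar>\<Sum>p\<in>btw A L y. \<Sum>q\<in>cofactors B y X p. 4 * of_bool (G p q) - 1\<bar>
      \<le> 3 * sqrt ((X / L) * (9 * X * (1 + ln y) + 3 * sqrt X * y ^ 4))"
  shows "((\<lambda>X::real. real (card {(p, q). p \<in> A \<and> q \<in> B \<and> p < q \<and> real (p * q) \<le> X \<and> G p q}) / (X * ln (ln X) / ln X)) \<longlongrightarrow> c1 * c2 / 4) at_top"
proof -
  define f where "f = (\<lambda>X::real. X * ln (ln X) / ln X)"
  \<comment> \<open>The fourth power makes the diagonal part of \<tau>, at most of order X sqrt (ln
    X / L), negligible against X ln ln X / ln X.\<close>
  define L where "L = (\<lambda>X::real. (ln X) ^ 4)"
  \<comment> \<open>This exceeds every power of ln X, with ln ln y asymptotic to ln ln X, yet stays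
    below every positive power of X.\<close>
  define y where "y = (\<lambda>X::real. exp (ln X / ln (ln X)))"
  define \<tau> where "\<tau> = (\<lambda>X::real. 3 * sqrt ((X / L X) * (9 * X * (1 + ln (y X)) + 3 * sqrt X * y X ^ 4)))"
  define s where "s = (\<lambda>X. (rsA A (y X) - rsA A (L X)) / ln (ln X))"
  define M where "M = (\<lambda>X. \<Sum>p\<in>btw A (L X) (y X). piA B (X / real p))"
  define R where "R = (\<lambda>X. (\<Sum>p\<in>{p\<in>A. real p \<le> L X}. piA B (X / real p)) + (\<Sum>p\<in>btw A (y X) (sqrt X). piA B (X / real p)))"
  define S where "S = (\<lambda>X::real. {(p, q). p \<in> A \<and> q \<in> B \<and> p < q \<and> real (p * q) \<le> X \<and> G p q})"
  have ev0: "\<forall>\<^sub>F X in at_top. X > 1 \<and> ln X > 0 \<and> ln (ln X) > 0 \<and> f X > 0 \<and> 1 \<le> L X \<and> L X \<le> y X \<and> y X \<le> sqrt X \<and> ln X - ln X / ln (ln X) > 0"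
  proof -
    have "\<forall>\<^sub>F X::real in at_top. X > 1" "\<forall>\<^sub>F X::real in at_top. ln X > 0" "\<forall>\<^sub>F X::real in at_top. ln (ln X) > 0"
      "\<forall>\<^sub>F X::real in at_top. X * ln (ln X) / ln X > 0" "\<forall>\<^sub>F X::real in at_top. 1 \<le> (ln X) ^ 4"
      "\<forall>\<^sub>F X::real in at_top. (ln X) ^ 4 \<le> exp (ln X / ln (ln X))" "\<forall>\<^sub>F X::real in at_top. exp (ln X / ln (ln X)) \<le> sqrt X"
      "\<forall>\<^sub>F X::real in at_top. ln X - ln X / ln (ln X) > 0"
      by real_asymp+
    thus ?thesis unfolding f_def L_def y_def by eventually_elim auto
  qed
  have t1: "((\<lambda>X. \<tau> X / f X) \<longlongrightarrow> 0) at_top"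
    unfolding \<tau>_def f_def L_def y_def ln_exp by real_asymp
  have t2: "((\<lambda>X. (y X)\<^sup>2 / f X) \<longlongrightarrow> 0) at_top"
    unfolding f_def y_def by real_asymp
  have yl: "filterlim y at_top at_top" unfolding y_def by real_asymp
  have Ll: "filterlim L at_top at_top" unfolding L_def by real_asymp
  have sl: "filterlim (\<lambda>X::real. sqrt X) at_top at_top" by real_asymp
  note rl = rsA_limit[OF A2 thA]
  have quot: "((\<lambda>X. rsA A (g X) / ln (ln X)) \<longlongrightarrow> c1 * k) at_top"
    if g: "filterlim g at_top at_top" "((\<lambda>X::real. ln (ln (g X)) / ln (ln X)) \<longlongrightarrow> k) at_top" for g :: "real \<Rightarrow> real" and k
  proof -
    have "((\<lambda>X. rsA A (g X) / ln (ln (g X)) * (ln (ln (g X)) / ln (ln X))) \<longlongrightarrow> c1 * k) at_top"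
      by (intro tendsto_mult filterlim_compose[OF rl g(1)] g(2))
    moreover have "filterlim (\<lambda>x::real. ln (ln x)) at_top at_top" by real_asymp
    from filterlim_compose[OF this g(1)] have "\<forall>\<^sub>F X in at_top. ln (ln (g X)) > 0" by (simp add: filterlim_at_top_dense)
    hence "\<forall>\<^sub>F X in at_top. rsA A (g X) / ln (ln (g X)) * (ln (ln (g X)) / ln (ln X)) = rsA A (g X) / ln (ln X)"
      by eventually_elim simp
    ultimately show ?thesis by (rule Lim_transform_eventually)
  qed
  have qy: "((\<lambda>X. rsA A (y X) / ln (ln X)) \<longlongrightarrow> c1 * 1) at_top"
    by (rule quot[OF yl]) (unfold y_def ln_exp, real_asymp)
  have qL: "((\<lambda>X. rsA A (L X) / ln (ln X)) \<longlongrightarrow> c1 * 0) at_top"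
    by (rule quot[OF Ll]) (unfold L_def, real_asymp)
  have qs: "((\<lambda>X. rsA A (sqrt X) / ln (ln X)) \<longlongrightarrow> c1 * 1) at_top"
    by (rule quot[OF sl]) real_asymp
  have s_lim: "(s \<longlongrightarrow> c1) at_top"
    using tendsto_diff[OF qy qL] unfolding s_def by (simp add: diff_divide_distrib)
  note pl = piA_limit[OF B2 thB]
  have unif: "\<exists>z0>1. \<forall>z\<ge>z0. \<bar>piA B z * ln z / z - c2\<bar> \<le> \<epsilon>" if "\<epsilon> > 0" for \<epsilon>
  proof -
    have "\<forall>\<^sub>F z in at_top. dist (piA B z * ln z / z) c2 < \<epsilon>" by (rule tendstoD[OF pl that])
    then obtain z1 where z1: "\<And>z. z \<ge> z1 \<Longrightarrow> dist (piA B z * ln z / z) c2 < \<epsilon>" by (auto simp: eventually_at_top_linorder)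
    show ?thesis by (rule exI[of _ "max z1 2"]) (use z1 in \<open>auto simp: dist_real_def intro: less_imp_le\<close>)
  qed
  have pib: "(c2 - \<epsilon>) * (z / ln z) \<le> piA B z \<and> piA B z \<le> (c2 + \<epsilon>) * (z / ln z)"
    if "\<bar>piA B z * ln z / z - c2\<bar> \<le> \<epsilon>" "z > 1" for z \<epsilon>
  proof -
    define w where "w = ln z / z"
    have w: "w > 0" "z / ln z = 1 / w" using that(2) by (auto simp: w_def)
    have "piA B z * ln z / z = piA B z * w" by (simp add: w_def)
    hence "c2 - \<epsilon> \<le> piA B z * w" "piA B z * w \<le> c2 + \<epsilon>" using that(1) by linarith+
    thus ?thesis unfolding w(2) using w(1) by (simp add: pos_divide_le_eq pos_le_divide_eq)
  qed
  have lnXp: "ln (X / real p) \<le> ln X \<and> ln X - ln u \<le> ln (X / real p)"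
    if "p \<in> A" "real p \<le> u" "X > 1" for p u X
  proof -
    have p: "real p \<ge> 1" using A2[OF that(1)] by simp
    have "ln (X / real p) = ln X - ln (real p)" using p that by (simp add: ln_div)
    moreover have "0 \<le> ln (real p)" "ln (real p) \<le> ln u" using p that by (auto intro!: ln_ge_zero ln_mono)
    ultimately show ?thesis by linarith
  qed
  \<comment> \<open>The reciprocal sums up to L, y and sqrt X are 0, c1 and c1 times ln ln X to
    first order, so both leftover ranges contribute o(ln ln X).\<close>
  have R_lim: "((\<lambda>X. R X / f X) \<longlongrightarrow> 0) at_top"
  proof (rule tendsto_sandwich[OF _ _ tendsto_const])
    let ?B = "\<lambda>X. 2 * (c2 + 1) * (rsA A (L X) / ln (ln X) + (rsA A (sqrt X) / ln (ln X) - rsA A (y X) / ln (ln X)))"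
    show "\<forall>\<^sub>F X in at_top. 0 \<le> R X / f X" using ev0
      by eventually_elim (auto simp: R_def piA_def intro!: divide_nonneg_pos add_nonneg_nonneg sum_nonneg)
    have "((\<lambda>X. ?B X) \<longlongrightarrow> 2 * (c2 + 1) * (c1 * 0 + (c1 * 1 - c1 * 1))) at_top"
      by (intro tendsto_mult tendsto_add tendsto_diff tendsto_const qL qs qy)
    thus "((\<lambda>X. ?B X) \<longlongrightarrow> 0) at_top" by simp
    obtain z0 where z0: "z0 > 1" "\<And>z. z \<ge> z0 \<Longrightarrow> \<bar>piA B z * ln z / z - c2\<bar> \<le> 1" using unif[of 1] by auto
    have "\<forall>\<^sub>F X::real in at_top. sqrt X \<ge> z0" using sl by (simp add: filterlim_at_top)
    thus "\<forall>\<^sub>F X in at_top. R X / f X \<le> ?B X"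
      using ev0
    proof eventually_elim
      case (elim X)
      \<comment> \<open>For p <= sqrt X the logarithm of X/p is at least half of ln X, whence the
        factor 2.\<close>
      have pt: "piA B (X / real p) \<le> 2 * (c2 + 1) * X / ln X * (1 / real p)" if p: "p \<in> A" "real p \<le> sqrt X" for p
      proof -
        have p0: "real p > 0" using A2[OF p(1)] by simp
        have "X / sqrt X \<le> X / real p" using p p0 elim by (intro divide_left_mono) auto
        moreover have "X / sqrt X = sqrt X" using elim by (simp add: real_div_sqrt)
        ultimately have z: "X / real p \<ge> z0" using elim by linarith
        have "piA B (X / real p) \<le> (c2 + 1) * (X / real p / ln (X / real p))" using pib[OF z0(2)[OF z]] z z0(1) by auto
        also have "... \<le> (c2 + 1) * (X / real p / (ln X / 2))"
        proof (intro mult_left_mono divide_left_mono)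
          show "ln X / 2 \<le> ln (X / real p)" using lnXp[OF p, of X] elim by (simp add: ln_sqrt)
          thus "0 < ln (X / real p) * (ln X / 2)" using elim by (intro mult_pos_pos) linarith+
        qed (use c elim p0 in auto)
        also have "... = 2 * (c2 + 1) * X / ln X * (1 / real p)" using p0 elim by (simp add: field_simps)
        finally show ?thesis .
      qed
      have "(\<Sum>p\<in>{p\<in>A. real p \<le> L X}. piA B (X / real p)) \<le> (\<Sum>p\<in>{p\<in>A. real p \<le> L X}. 2 * (c2 + 1) * X / ln X * (1 / real p))"
        by (intro sum_mono pt) (use elim in auto)
      also have "... = 2 * (c2 + 1) * X / ln X * rsA A (L X)" unfolding rsA_def sum_distrib_left ..
      finally have b1: "(\<Sum>p\<in>{p\<in>A. real p \<le> L X}. piA B (X / real p)) \<le> 2 * (c2 + 1) * X / ln X * rsA A (L X)" .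
      have "(\<Sum>p\<in>btw A (y X) (sqrt X). piA B (X / real p)) \<le> (\<Sum>p\<in>btw A (y X) (sqrt X). 2 * (c2 + 1) * X / ln X * (1 / real p))"
        by (intro sum_mono pt) auto
      also have "... = 2 * (c2 + 1) * X / ln X * (rsA A (sqrt X) - rsA A (y X))"
        unfolding sum_distrib_left[symmetric] by (subst rsA_diff) (use elim in auto)
      finally have "R X \<le> 2 * (c2 + 1) * X / ln X * rsA A (L X) + 2 * (c2 + 1) * X / ln X * (rsA A (sqrt X) - rsA A (y X))"
        using b1 unfolding R_def by linarith
      also have "... = ?B X * f X"
        
      proof -
        have "k * X / m * a + k * X / m * (b - d) = k * (a / l + (b / l - d / l)) * (X * l / m)" if "l > 0" for k m a b d l :: real
        proof -
          have "a / l + (b / l - d / l) = (a + (b - d)) / l" by (simp add: add_divide_distrib diff_divide_distrib)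
          thus ?thesis using that by (simp add: algebra_simps add_divide_distrib diff_divide_distrib)
        qed
        thus ?thesis unfolding f_def using elim by blast
      qed
      finally show ?case using elim by (simp add: pos_divide_le_eq)
    qed
  qed
  have Mb: "\<forall>\<^sub>F X in at_top. (c2 - \<epsilon>) * s X \<le> M X / f X \<and> M X / f X \<le> (c2 + \<epsilon>) * s X * (ln X / (ln X - ln X / ln (ln X)))"
    if e: "\<epsilon> > 0" "\<epsilon> < c2" for \<epsilon>
  proof -
    obtain z0 where z0: "z0 > 1" "\<And>z. z \<ge> z0 \<Longrightarrow> \<bar>piA B z * ln z / z - c2\<bar> \<le> \<epsilon>" using unif[OF e(1)] by auto
    have "\<forall>\<^sub>F X::real in at_top. sqrt X \<ge> z0" using sl by (simp add: filterlim_at_top)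
    thus ?thesis using ev0
    proof eventually_elim
      case (elim X)
      define P where "P = btw A (L X) (y X)"
      \<comment> \<open>A lower bound for ln (X/p) over the range, namely ln X - ln y.\<close>
      define K where "K = ln X - ln X / ln (ln X)"
      have K: "K > 0" using elim by (simp add: K_def)
      have rs: "(\<Sum>p\<in>P. 1 / real p) = s X * ln (ln X)" unfolding P_def s_def using elim by (subst rsA_diff) auto
      have pt: "(c2 - \<epsilon>) * X / ln X * (1 / real p) \<le> piA B (X / real p) \<and> piA B (X / real p) \<le> (c2 + \<epsilon>) * X / K * (1 / real p)" if "p \<in> P" for p
      proof -
        have p: "p \<in> A" "real p \<le> y X" using that by (auto simp: P_def)
        have p0: "real p > 0" using A2[OF p(1)] by simp
        have "X / sqrt X \<le> X / real p" using p p0 elim by (intro divide_left_mono) auto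
        moreover have "X / sqrt X = sqrt X" using elim by (simp add: real_div_sqrt)
        ultimately have z: "X / real p \<ge> z0" using elim by linarith
        have z1: "X / real p > 1" using z z0(1) by linarith
        have l: "ln (X / real p) \<le> ln X" "K \<le> ln (X / real p)" "0 < ln (X / real p)"
          using lnXp[OF p, of X] elim z1 by (auto simp: y_def K_def)
        note b = pib[OF z0(2)[OF z] z1]
        have "(c2 - \<epsilon>) * X / ln X * (1 / real p) = (c2 - \<epsilon>) * (X / real p / ln X)" by simp
        also have "... \<le> (c2 - \<epsilon>) * (X / real p / ln (X / real p))"
          using l e elim p0 by (intro mult_left_mono divide_left_mono mult_pos_pos) auto
        finally have 1: "(c2 - \<epsilon>) * X / ln X * (1 / real p) \<le> piA B (X / real p)" using b by linarith
        have "(c2 + \<epsilon>) * (X / real p / ln (X / real p)) \<le> (c2 + \<epsilon>) * (X / real p / K)"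
          using l e elim p0 K c by (intro mult_left_mono divide_left_mono mult_pos_pos) auto
        also have "... = (c2 + \<epsilon>) * X / K * (1 / real p)" by simp
        finally show ?thesis using 1 b by linarith
      qed
      have f0: "f X > 0" using elim by blast
      have a: "(c2 - \<epsilon>) * X / ln X * (s X * ln (ln X)) \<le> M X"
        unfolding M_def P_def[symmetric] rs[symmetric] sum_distrib_left using pt by (intro sum_mono) blast
      have b: "M X \<le> (c2 + \<epsilon>) * X / K * (s X * ln (ln X))"
        unfolding M_def P_def[symmetric] rs[symmetric] sum_distrib_left using pt by (intro sum_mono) blast
      have e1: "(c2 - \<epsilon>) * X / ln X * (s X * ln (ln X)) = (c2 - \<epsilon>) * s X * f X" by (simp add: f_def)
      have e2: "(c2 + \<epsilon>) * X / K * (s X * ln (ln X)) = (c2 + \<epsilon>) * s X * (ln X / K) * f X" using elim by (simp add: f_def)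
      show ?case unfolding pos_le_divide_eq[OF f0] pos_divide_le_eq[OF f0] K_def[symmetric]
        using a b unfolding e1 e2 by (rule conjI)
    qed
  qed
  have M_lim: "((\<lambda>X. M X / f X) \<longlongrightarrow> c1 * c2) at_top"
  proof (rule order_tendstoI)
    fix a assume a: "a < c1 * c2"
    define t where "t = a / c1"
    define \<epsilon> where "\<epsilon> = min (c2 / 2) ((c2 - t) / 2)"
    have "t < c2" using a c by (simp add: t_def divide_less_eq mult.commute)
    hence "\<epsilon> > 0" using c by (simp add: \<epsilon>_def)
    moreover have "\<epsilon> \<le> c2 / 2" "\<epsilon> \<le> (c2 - t) / 2" unfolding \<epsilon>_def by (rule min.cobounded1 min.cobounded2)+
    moreover have "x < u - v" if "v > 0" "v \<le> (u - x) / 2" for u v x :: real using that by (simp add: field_simps)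
    ultimately have e: "\<epsilon> > 0" "\<epsilon> < c2" "t < c2 - \<epsilon>" using c by (blast, linarith, blast)
    have "a / c1 < c2 - \<epsilon>" using e(3) by (simp only: t_def)
    hence "a < (c2 - \<epsilon>) * c1" using c by (simp add: divide_less_eq)
    moreover have "((\<lambda>X. (c2 - \<epsilon>) * s X) \<longlongrightarrow> (c2 - \<epsilon>) * c1) at_top" by (intro tendsto_mult tendsto_const s_lim)
    ultimately have "\<forall>\<^sub>F X in at_top. a < (c2 - \<epsilon>) * s X" by (intro order_tendstoD(1))
    thus "\<forall>\<^sub>F X in at_top. a < M X / f X" using Mb[OF e(1,2)] by eventually_elim linarith
  next
    fix a assume a: "a > c1 * c2"
    define t where "t = a / c1"
    define \<epsilon> where "\<epsilon> = min (c2 / 2) ((t - c2) / 2)"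
    have "t > c2" using a c by (simp add: t_def less_divide_eq mult.commute)
    hence "\<epsilon> > 0" using c by (simp add: \<epsilon>_def)
    moreover have "\<epsilon> \<le> c2 / 2" "\<epsilon> \<le> (t - c2) / 2" unfolding \<epsilon>_def by (rule min.cobounded1 min.cobounded2)+
    moreover have "u + v < x" if "v > 0" "v \<le> (x - u) / 2" for u v x :: real using that by (simp add: field_simps)
    ultimately have e: "\<epsilon> > 0" "\<epsilon> < c2" "c2 + \<epsilon> < t" using c by (blast, linarith, blast)
    have "c2 + \<epsilon> < a / c1" using e(3) by (simp only: t_def)
    hence "a > (c2 + \<epsilon>) * c1 * 1" using c by (simp add: less_divide_eq)
    moreover have "((\<lambda>X::real. ln X / (ln X - ln X / ln (ln X))) \<longlongrightarrow> 1) at_top" by real_asymp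
    hence "((\<lambda>X. (c2 + \<epsilon>) * s X * (ln X / (ln X - ln X / ln (ln X)))) \<longlongrightarrow> (c2 + \<epsilon>) * c1 * 1) at_top" by (intro tendsto_mult tendsto_const s_lim)
    ultimately have "\<forall>\<^sub>F X in at_top. a > (c2 + \<epsilon>) * s X * (ln X / (ln X - ln X / ln (ln X)))" by (intro order_tendstoD(2))
    thus "\<forall>\<^sub>F X in at_top. a > M X / f X" using Mb[OF e(1,2)] by eventually_elim linarith
  qed
  have bounds: "\<forall>\<^sub>F X in at_top. (M X / f X - \<tau> X / f X - (y X)\<^sup>2 / f X) / 4 \<le> real (card (S X)) / f X
     \<and> real (card (S X)) / f X \<le> (M X / f X + \<tau> X / f X + 4 * (R X / f X) + 4 * ((y X)\<^sup>2 / f X)) / 4"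
    using ev0
  proof eventually_elim
    case (elim X)
    have y1: "1 \<le> y X" using elim by linarith
    have "(y X)\<^sup>2 \<le> (sqrt X)\<^sup>2" using elim y1 by (intro power_mono) auto
    hence y2: "(y X)\<^sup>2 \<le> X" using elim by simp
    have "sqrt X \<le> X" using elim by (simp add: real_sqrt_le_iff power2_eq_square real_le_lsqrt)
    hence yX: "y X \<le> X" using elim by linarith
    have L1: "1 \<le> L X" "L X \<le> y X" using elim by auto
    have "\<bar>\<Sum>p\<in>btw A (L X) (y X). \<Sum>q\<in>cofactors B (y X) X p. 4 * of_bool (G p q) - 1\<bar> \<le> \<tau> X"
      unfolding \<tau>_def by (rule T[OF L1(1) y1 yX])
    note b = pair_count_bounds[OF A2 B2 L1 y2 this]
    have b1: "M X - \<tau> X - (y X)\<^sup>2 \<le> 4 * real (card (S X))" unfolding M_def S_def by (rule b(1))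
    have b2: "4 * real (card (S X)) \<le> M X + \<tau> X + 4 * R X + 4 * (y X)\<^sup>2" unfolding M_def S_def R_def by (rule b(2))
    have f0: "0 \<le> f X" using elim by linarith
    have "(M X - \<tau> X - (y X)\<^sup>2) / f X \<le> 4 * real (card (S X)) / f X" "4 * real (card (S X)) / f X \<le> (M X + \<tau> X + 4 * R X + 4 * (y X)\<^sup>2) / f X"
      by (rule divide_right_mono[OF b1 f0], rule divide_right_mono[OF b2 f0])
    thus ?case by (simp add: diff_divide_distrib add_divide_distrib)
  qed
  have "((\<lambda>X. real (card (S X)) / f X) \<longlongrightarrow> c1 * c2 / 4) at_top"
  proof (rule tendsto_sandwich)
    have "((\<lambda>X. (M X / f X - \<tau> X / f X - (y X)\<^sup>2 / f X) / 4) \<longlongrightarrow> (c1 * c2 - 0 - 0) / 4) at_top"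
      by (intro tendsto_divide tendsto_diff M_lim t1 t2 tendsto_const) simp
    thus "((\<lambda>X. (M X / f X - \<tau> X / f X - (y X)\<^sup>2 / f X) / 4) \<longlongrightarrow> c1 * c2 / 4) at_top" by simp
    have "((\<lambda>X. (M X / f X + \<tau> X / f X + 4 * (R X / f X) + 4 * ((y X)\<^sup>2 / f X)) / 4) \<longlongrightarrow> (c1 * c2 + 0 + 4 * 0 + 4 * 0) / 4) at_top"
      by (intro tendsto_divide tendsto_add tendsto_mult M_lim R_lim t1 t2 tendsto_const) simp
    thus "((\<lambda>X. (M X / f X + \<tau> X / f X + 4 * (R X / f X) + 4 * ((y X)\<^sup>2 / f X)) / 4) \<longlongrightarrow> c1 * c2 / 4) at_top" by simp
  qed (use bounds in \<open>auto elim: eventually_mono\<close>)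
  thus ?thesis unfolding S_def f_def .
qed

text \<open>For d0 = -1 the form is definite and any representation will do; for d0 = 2 one is
  supplied by \<open>sqrt2_reduction\<close>.\<close>

lemma reduced_norm_form:
  assumes d0: "d0 = -1 \<or> d0 = 2" and n: "quad_norm d0 w = int q" and q: "q > 0"
  shows "\<exists>c e. c\<^sup>2 - d0 * e\<^sup>2 = int q \<and> c \<ge> 0 \<and> e\<^sup>2 \<le> int q"
proof (cases "d0 = -1")
  case True
  hence "(rat_part w)\<^sup>2 + (irr_part w)\<^sup>2 = int q" using n by (simp add: quad_norm_def)
  moreover from this have "(irr_part w)\<^sup>2 \<le> int q" using zero_le_power2[of "rat_part w"] by linarith
  ultimately have "(irr_part w)\<^sup>2 \<le> int q" "\<bar>rat_part w\<bar>\<^sup>2 - d0 * (irr_part w)\<^sup>2 = int q" using True by simp_all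
  thus ?thesis by (intro exI[of _ "\<bar>rat_part w\<bar>"] exI[of _ "irr_part w"]) simp
next
  case False
  hence d2: "d0 = 2" using d0 by simp
  have "(rat_part w)\<^sup>2 - 2 * (irr_part w)\<^sup>2 = int q" using n d2 by (simp add: quad_norm_def)
  moreover have "int q > 0" using q by simp
  ultimately obtain c e where ce: "c\<^sup>2 - 2 * e\<^sup>2 = int q" "2 * e\<^sup>2 \<le> int q" using sqrt2_reduction by blast
  have "0 \<le> e\<^sup>2" by simp
  hence "e\<^sup>2 \<le> int q" using ce(2) by linarith
  thus ?thesis using ce d2 by (intro exI[of _ "\<bar>c\<bar>"] exI[of _ e]) simp
qed

theorem theorem3p1:
  fixes d d0 s1 s2 :: int and r1 r2 :: nat
    and w z :: "nat \<Rightarrow> nat \<Rightarrow> quad_int"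
  assumes "d \<in> {- 4, 8}" and "d0 = d div 4"
    and "r1 \<in> {1, 9}" and "r2 \<in> {1, 9}"
    and "d = 8 \<Longrightarrow> [r1 * r2 = 1] (mod 16)"
    and "s1 \<in> {1, - 1}" and "s2 \<in> {1, - 1}" and "s1 * s2 = 1"
    and "\<And>p q. \<lbrakk>prime p; prime q; [p = 1] (mod 8); [q = 1] (mod 8)\<rbrakk> \<Longrightarrow>
           primary_prime_elem d0 p (w p q) \<and> primary_prime_elem d0 q (z p q)"
  shows "(\<lambda>X::real. real (card {(p, q). prime p \<and> prime q \<and> p < q \<and> real (p * q) \<le> X \<and>
             [p = r1] (mod 16) \<and> [q = r2] (mod 16) \<and>
             chi2 d p = s1 \<and> chi2 d q = s2 \<and>
             QuadRes (int q) (int p) \<and>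
             eps_symbol d0 (w p q) (z p q) = 1}))
         \<sim>[at_top] (\<lambda>X. 1 / 1024 * (X * ln (ln X) / ln X))"
proof -
  have d: "d = -4 \<or> d = 8" using assms(1) by auto
  hence d0: "d0 = -1 \<or> d0 = 2" using assms(2) by auto
  define A where "A = {p. prime p \<and> [p = r1] (mod 16) \<and> chi2 d p = s1}"
  define B where "B = {q. prime q \<and> [q = r2] (mod 16) \<and> chi2 d q = s2}"
  define G where "G = (\<lambda>p q. QuadRes (int q) (int p) \<and> eps_symbol d0 (w p q) (z p q) = 1)"
  have nw: "quad_norm d0 (w p q) = int p" "quad_norm d0 (z p q) = int q"
    if "prime p" "prime q" "[p = 1] (mod 8)" "[q = 1] (mod 8)" for p q
    using assms(9)[OF that] by (auto simp: primary_prime_elem_def)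
  have ex: "\<exists>w. quad_norm (d div 4) w = int q" if "prime q" "[q = 1] (mod 8)" for q
    using nw(1)[OF that(1) that(1) that(2) that(2)] assms(2) by blast
  have mod8: "[q = 1] (mod 8)" if "[q = r] (mod 16)" "r \<in> {1, 9}" for q r :: nat
  proof -
    have "q mod 16 = r mod 16" using that(1) unfolding cong_mod_def .
    also have "... = r" using that(2) by auto
    finally have "q mod 16 = r" .
    moreover have "q mod 8 = (q mod 16) mod 8" by (simp add: mod_mod_cancel)
    ultimately show ?thesis using that(2) by (auto simp: cong_mod_def)
  qed
  have A: "prime p" "[p = 1] (mod 8)" "p > 2" if "p \<in> A" for p
    using that mod8[of p r1] assms(3) prime_1_mod_8_gt_2[of p] by (auto simp: A_def)
  have B: "prime q" "[q = 1] (mod 8)" "q > 2" if "q \<in> B" for q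
    using that mod8[of q r2] assms(4) prime_1_mod_8_gt_2[of q] by (auto simp: B_def)
  have thA: "(\<lambda>N. (\<Sum>q\<in>{q\<in>A. q \<le> N}. ln (real q)) / real N) \<longlonglongrightarrow> 1 / 16"
  proof -
    obtain m0 n0 where "even m0" "A = QC m0 n0"
      using prime_class_eq_QC[of d r1 s1] d assms(3,6) ex unfolding A_def by auto
    thus ?thesis using theta_QC by simp
  qed
  have thB: "(\<lambda>N. (\<Sum>q\<in>{q\<in>B. q \<le> N}. ln (real q)) / real N) \<longlonglongrightarrow> 1 / 16"
  proof -
    obtain m0 n0 where "even m0" "B = QC m0 n0"
      using prime_class_eq_QC[of d r2 s2] d assms(4,7) ex unfolding B_def by auto
    thus ?thesis using theta_QC by simp
  qed
  \<comment> \<open>Stated as an implication from p \<in> A, so that r and \<kappa> can be chosen as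
    total functions of p.\<close>
  define Pr where "Pr = (\<lambda>p r \<kappa>. p \<in> A \<longrightarrow> [r\<^sup>2 = d0] (mod int p) \<and> (\<kappa> = 1 \<or> \<kappa> = -1) \<and>
    (\<forall>q w z c e. prime q \<longrightarrow> quad_norm d0 w = int p \<longrightarrow> quad_norm d0 z = int q \<longrightarrow> c\<^sup>2 - d0 * e\<^sup>2 = int q \<longrightarrow>
       Legendre (int q) (int p) = 1 \<longrightarrow> eps_symbol d0 w z = \<kappa> * Legendre (c + e * r) (int p)))"
  have "\<exists>r \<kappa>. Pr p r \<kappa>" for p
  proof (cases "p \<in> A")
    case True
    note p = A[OF True]
    show ?thesis
      by (rule eps_symbol_eq[OF d0 p(1,2) nw(1)[OF p(1) p(1) p(2) p(2)]]) (unfold Pr_def, blast)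
  qed (auto simp: Pr_def)
  then obtain r \<kappa> where Pr: "\<And>p. Pr p (r p) (\<kappa> p)" by metis
  have "\<exists>c e. q \<in> B \<longrightarrow> c\<^sup>2 - d0 * e\<^sup>2 = int q \<and> c \<ge> 0 \<and> e\<^sup>2 \<le> int q" for q
  proof (cases "q \<in> B")
    case True
    note q = B[OF True]
    show ?thesis using reduced_norm_form[OF d0 nw(1)[OF q(1) q(1) q(2) q(2)]] q(3) by auto
  qed auto
  then obtain c e where ce: "\<And>q. q \<in> B \<longrightarrow> (c q)\<^sup>2 - d0 * (e q)\<^sup>2 = int q \<and> c q \<ge> 0 \<and> (e q)\<^sup>2 \<le> int q" by metis
  have G: "G p q \<longleftrightarrow> Legendre (int q) (int p) = 1 \<and> \<kappa> p * Legendre (c q + e q * r p) (int p) = 1"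
    if pq: "p \<in> A" "q \<in> B" "p \<noteq> q" for p q
  proof -
    note p = A[OF pq(1)] and q = B[OF pq(2)]
    have "\<not> int q dvd int p" using p(1) q(1) pq(3) by (simp add: primes_dvd_imp_eq) (metis primes_dvd_imp_eq)
    hence "QuadRes (int q) (int p) \<longleftrightarrow> Legendre (int p) (int q) = 1"
      by (simp add: Legendre_eq_if cong_0_iff)
    \<comment> \<open>Reciprocity, without a sign as p = 1 modulo 8, moves the residue condition to
      the modulus p shared by the other symbols.\<close>
    also have "Legendre (int p) (int q) = Legendre (int q) (int p)"
      using Legendre_recip[OF p(1,2) q(1,3)] pq(3) by simp
    finally have Q: "QuadRes (int q) (int p) \<longleftrightarrow> Legendre (int q) (int p) = 1" .
    have "eps_symbol d0 (w p q) (z p q) = \<kappa> p * Legendre (c q + e q * r p) (int p)" if L: "Legendre (int q) (int p) = 1"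
      using Pr[of p] pq ce[of q] nw[OF p(1) q(1) p(2) q(2)] q(1) L unfolding Pr_def by blast
    thus ?thesis unfolding G_def Q by auto
  qed
  have T: "\<bar>\<Sum>p\<in>btw A L y. \<Sum>q\<in>cofactors B y X p. 4 * of_bool (G p q) - 1\<bar>
      \<le> 3 * sqrt ((X / L) * (9 * X * (1 + ln y) + 3 * sqrt X * y ^ 4))" if "1 \<le> L" "1 \<le> y" "y \<le> X" for X L y :: real
  proof (rule symbol_sum_bound[OF d0, where \<kappa> = \<kappa> and r = r and c = c and e = e])
    show "\<kappa> p = 1 \<or> \<kappa> p = -1" "[(r p)\<^sup>2 = d0] (mod int p)" if "p \<in> A" for p
      using Pr[of p] that unfolding Pr_def by blast+
    show "(c q)\<^sup>2 - d0 * (e q)\<^sup>2 = int q \<and> c q \<ge> 0 \<and> (e q)\<^sup>2 \<le> int q" if "q \<in> B" for q using ce that by blast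
  qed (use A B G that in auto)
  have "((\<lambda>X::real. real (card {(p, q). p \<in> A \<and> q \<in> B \<and> p < q \<and> real (p * q) \<le> X \<and> G p q}) / (X * ln (ln X) / ln X)) \<longlongrightarrow> (1 / 16) * (1 / 16) / 4) at_top"
    by (rule pair_count_asymp[OF _ _ _ _ thA thB T]) (use A B in \<open>force+\<close>)
  hence lim: "((\<lambda>X::real. 1024 * (real (card {(p, q). p \<in> A \<and> q \<in> B \<and> p < q \<and> real (p * q) \<le> X \<and> G p q}) / (X * ln (ln X) / ln X))) \<longlongrightarrow> 1024 * ((1 / 16) * (1 / 16) / 4)) at_top"
    by (intro tendsto_mult tendsto_const)
  have seteq: "{(p, q). p \<in> A \<and> q \<in> B \<and> p < q \<and> real (p * q) \<le> X \<and> G p q} = {(p, q). prime p \<and> prime q \<and> p < q \<and> real (p * q) \<le> X \<and>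
             [p = r1] (mod 16) \<and> [q = r2] (mod 16) \<and>
             chi2 d p = s1 \<and> chi2 d q = s2 \<and>
             QuadRes (int q) (int p) \<and>
             eps_symbol d0 (w p q) (z p q) = 1}" for X :: real
    unfolding A_def B_def G_def by blast
  have "1024 * (u / v) = u / (1 / 1024 * v)" for u v :: real by simp
  moreover have "1024 * ((1 / 16) * (1 / 16) / 4) = (1 :: real)" by simp
  ultimately show ?thesis using lim unfolding seteq by (intro asymp_equivI') (simp only:)
qed

end
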